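(* Let $R$ be a ring which is free as a $\mathbb{Z}$-module and let $I$ be a $\mathbb{Z}$-basis of $R$. Then the elements $e_r(U)$, for $r\in\mathbb{Z}_{>0}$ and $U\in I$, generate the ring $\mathcal{G}_\infty^{\mathbb{Z}}(R)$.
   Context: Rings are associative with unit. $\mathcal{G}_\infty^{\mathbb{Q}}(R)=\bigotimes_{i\ge 1}U(\mathbb{Q}\otimes_{\mathbb{Z}}R_i)$, where each $R_i$ is a copy of $R$, $\mathbb{Q}\otimes R$ is viewed as a Lie algebra via the commutator, $U(-)$ is the universal enveloping algebra, and the infinite tensor product is spanned by pure tensors with all but finitely many factors equal to $1$. For $r\in\mathbb{Q}\otimes R$, $T_i(r)$ is the image of $r$ under the canonical map $\mathbb{Q}\otimes R\to U(\mathbb{Q}\otimes R_i)\subset\mathcal{G}_\infty^{\mathbb{Q}}(R)$. $\Lambda$ is the ring of symmetric functions over $\mathbb{Z}$, with power sums $p_n$ and Schur functions $s_\lambda$. For each $U\in I$, $\Lambda^{(U)}$ is a copy of $\Lambda$ with variable set $\mathbf{x}_U$, and $f^{(U)}=f(\mathbf{x}_U)$. $\mathcal{P}$ is the set of partitions; $\mathcal{P}^I$ is the set of functions $\vec\lambda:I\to\mathcal{P}$ with $\sum_{U}|\vec\lambda(U)|<\infty$. For a $\mathbb{Q}$-algebra $A$ one works with (possibly infinite) formal sums $\sum_{\vec\mu\in\mathcal{P}^I}\left(\prod_U p_{\vec\mu(U)}^{(U)}\right)a_{\vec\mu}$, $a_{\vec\mu}\in A$ (the completed tensor product of $\bigotimes_U\Lambda_{\mathbb{Q}}^{(U)}$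 with $A$), and $T_l$ is applied coefficientwise to such series with coefficients in $\mathbb{Q}\otimes R$. The elements $Z_{\vec\lambda}\in\mathcal{G}_\infty^{\mathbb{Q}}(R)$ are defined by $$\sum_{\vec\lambda\in\mathcal{P}^I}\Big(\prod_{U\in I}s_{\vec\lambda(U)}^{(U)}\Big)\otimes Z_{\vec\lambda}=\prod_{l=1}^\infty\exp\Big(T_l\Big(\log\Big(1+\sum_{U\in I}p_l^{(U)}U\Big)\Big)\Big),$$ and $\mathcal{G}_\infty^{\mathbb{Z}}(R)$ is the $\mathbb{Z}$-span of the $Z_{\vec\lambda}$; it is a subring of $\mathcal{G}_\infty^{\mathbb{Q}}(R)$. For $U\in I$, $e_r(U)=Z_{\vec\lambda}$ where $\vec\lambda(U)=(1^r)$ and $\vec\lambda(V)=\emptyset$ for $V\ne U$. *)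

theory Defs
  imports Complex_Main "HOL-Library.Poly_Mapping" "HOL-Library.Multiset" "HOL-Library.FuncSet"
begin

section \<open>Subrings, ideals, and integer combinations\<close>

text \<open>
  Rings are associative with unit and may be zero; they are rendered by the sort
  \<open>{ring, monoid_mult}\<close>, which is \<open>ring_1\<close> without the axiom \<open>0 \<noteq> 1\<close>.
\<close>

definition is_subring :: "'a::{ring, monoid_mult} set \<Rightarrow> bool" where
  "is_subring S \<longleftrightarrow> 1 \<in> S \<and> (\<forall>x\<in>S. \<forall>y\<in>S. x - y \<in> S \<and> x * y \<in> S)"

definition is_ideal :: "'a::{ring, monoid_mult} set \<Rightarrow> bool" where
  "is_ideal J \<longleftrightarrow> 0 \<in> J \<and> (\<forall>x\<in>J. \<forall>y\<in>J. x + y \<in> J) \<and> (\<forall>x\<in>J. \<forall>a b. a * x * b \<in> J)"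

definition ideal_cong :: "'a::{ring, monoid_mult} set \<Rightarrow> 'a \<Rightarrow> 'a \<Rightarrow> bool" where
  "ideal_cong S x y \<longleftrightarrow> x - y \<in> is_ideal hull S"

lemma is_ideal_hull: "is_ideal (is_ideal hull S)"
  by (rule hull_in) (auto simp: is_ideal_def)

lemma ideal_hull_0: "0 \<in> is_ideal hull S"
  and ideal_hull_add: "x \<in> is_ideal hull S \<Longrightarrow> y \<in> is_ideal hull S \<Longrightarrow> x + y \<in> is_ideal hull S"
  and ideal_hull_mult: "x \<in> is_ideal hull S \<Longrightarrow> a * x * b \<in> is_ideal hull S"
  using is_ideal_hull[of S] unfolding is_ideal_def by blast+

lemma ideal_hull_lmult: "x \<in> is_ideal hull S \<Longrightarrow> a * x \<in> is_ideal hull S"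
  and ideal_hull_rmult: "x \<in> is_ideal hull S \<Longrightarrow> x * b \<in> is_ideal hull S"
  and ideal_hull_uminus: "x \<in> is_ideal hull S \<Longrightarrow> - x \<in> is_ideal hull S"
  using ideal_hull_mult[of x S a 1] ideal_hull_mult[of x S 1 b] ideal_hull_mult[of x S "- 1" 1]
  by simp_all

lemma ideal_cong_base: "x - y \<in> S \<Longrightarrow> ideal_cong S x y"
  by (simp add: ideal_cong_def hull_inc)

lemma ideal_cong_refl: "ideal_cong S x x"
  by (simp add: ideal_cong_def ideal_hull_0)

lemma ideal_cong_sym: "ideal_cong S x y \<Longrightarrow> ideal_cong S y x"
  using ideal_hull_uminus[of "x - y" S] by (simp add: ideal_cong_def)

lemma ideal_cong_trans: "ideal_cong S x y \<Longrightarrow> ideal_cong S y z \<Longrightarrow> ideal_cong S x z"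
  using ideal_hull_add[of "x - y" S "y - z"] by (simp add: ideal_cong_def)

lemma equivp_ideal_cong: "equivp (ideal_cong S)"
proof (rule equivpI)
  show "reflp (ideal_cong S)" by (rule reflpI) (rule ideal_cong_refl)
  show "symp (ideal_cong S)" by (rule sympI) (rule ideal_cong_sym)
  show "transp (ideal_cong S)" by (rule transpI) (rule ideal_cong_trans)
qed

lemma ideal_cong_add: "ideal_cong S x y \<Longrightarrow> ideal_cong S u v \<Longrightarrow> ideal_cong S (x + u) (y + v)"
  using ideal_hull_add[of "x - y" S "u - v"] by (simp add: ideal_cong_def algebra_simps)

lemma ideal_cong_uminus: "ideal_cong S x y \<Longrightarrow> ideal_cong S (- x) (- y)"
  using ideal_hull_uminus[of "x - y" S] by (simp add: ideal_cong_def algebra_simps)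

lemma ideal_cong_diff: "ideal_cong S x y \<Longrightarrow> ideal_cong S u v \<Longrightarrow> ideal_cong S (x - u) (y - v)"
  using ideal_cong_add[OF _ ideal_cong_uminus] by fastforce

lemma ideal_cong_mult:
  assumes "ideal_cong S x y" "ideal_cong S u v" shows "ideal_cong S (x * u) (y * v)"
proof -
  have "(x - y) * u + y * (u - v) \<in> is_ideal hull S"
    using assms unfolding ideal_cong_def
    by (intro ideal_hull_add ideal_hull_lmult ideal_hull_rmult)
  then show ?thesis by (simp add: ideal_cong_def algebra_simps)
qed

text \<open>The action of the integers on an abelian group.\<close>

definition zscale :: "int \<Rightarrow> 'a::ab_group_add \<Rightarrow> 'a" where
  "zscale n x = (if 0 \<le> n then ((+) x ^^ nat n) 0 else - (((+) x ^^ nat (- n)) 0))"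

lemma zscale_0: "zscale 0 x = 0"
  by (simp add: zscale_def)

lemma zscale_add1: "zscale (n + 1) x = x + zscale n x"
proof (cases "0 \<le> n")
  case True
  then have "nat (n + 1) = Suc (nat n)" by simp
  with True show ?thesis by (simp add: zscale_def)
next
  case False
  then have Suc: "nat (- n) = Suc (nat (- (n + 1)))" by simp
  have "zscale (n + 1) x = - (((+) x ^^ nat (- (n + 1))) 0)"
    using False by (cases "n + 1 = 0") (simp_all add: zscale_def)
  moreover have "zscale n x = - (x + ((+) x ^^ nat (- (n + 1))) 0)"
    using False unfolding zscale_def Suc by simp
  ultimately show ?thesis by simp
qed

lemma zscale_diff1: "zscale (n - 1) x = zscale n x - x"
  using zscale_add1[of "n - 1" x] by (simp add: algebra_simps)

lemma zscale_distrib_left: "zscale (m + n) x = zscale m x + zscale n x"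
proof (induction m rule: int_induct[where k = 0])
  case (step1 m)
  have "m + 1 + n = (m + n) + 1" by simp
  then have "zscale (m + 1 + n) x = x + zscale (m + n) x" by (simp only: zscale_add1)
  then show ?case by (simp add: zscale_add1 step1.IH add.assoc)
next
  case (step2 m)
  have "m - 1 + n = (m + n) - 1" by simp
  then have "zscale (m - 1 + n) x = zscale (m + n) x - x" by (simp only: zscale_diff1)
  then show ?case by (simp add: zscale_diff1 step2.IH)
qed (simp add: zscale_0)

lemma zscale_distrib_right: "zscale m (x + y) = zscale m x + zscale m y"
  by (induction m rule: int_induct[where k = 0])
    (simp_all add: zscale_0 zscale_add1 zscale_diff1)

lemma zscale_zscale: "zscale m (zscale n x) = zscale (m * n) x"
proof (induction m rule: int_induct[where k = 0])
  case (step1 m)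
  have "(m + 1) * n = n + m * n" by (simp add: algebra_simps)
  then have "zscale ((m + 1) * n) x = zscale n x + zscale (m * n) x"
    by (simp only: zscale_distrib_left)
  then show ?case by (simp only: zscale_add1 step1.IH)
next
  case (step2 m)
  have "(m - 1) * n + n = m * n" by (simp add: algebra_simps)
  then have "zscale ((m - 1) * n) x + zscale n x = zscale (m * n) x"
    by (simp only: zscale_distrib_left[symmetric])
  then show ?case by (simp add: zscale_diff1 step2.IH algebra_simps)
qed (simp add: zscale_0)

interpretation zmod: module "zscale :: int \<Rightarrow> 'a::ab_group_add \<Rightarrow> 'a"
proof
  show "zscale 1 x = x" for x :: 'a
    using zscale_add1[of 0 x] by (simp add: zscale_0)
qed (rule zscale_distrib_right zscale_distrib_left zscale_zscale)+

definition is_Z_basis :: "'a::ab_group_add set \<Rightarrow> bool" where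
  "is_Z_basis B \<longleftrightarrow> \<not> zmod.dependent B \<and> zmod.span B = UNIV"


section \<open>Rational algebras\<close>

class rat_algebra = ring + monoid_mult +
  fixes qscale :: "rat \<Rightarrow> 'a \<Rightarrow> 'a"  (infixr \<open>*\<^sub>Q\<close> 75)
  assumes qscale_add_right: "q *\<^sub>Q (x + y) = q *\<^sub>Q x + q *\<^sub>Q y"
    and qscale_add_left: "(p + q) *\<^sub>Q x = p *\<^sub>Q x + q *\<^sub>Q x"
    and qscale_qscale: "p *\<^sub>Q (q *\<^sub>Q x) = (p * q) *\<^sub>Q x"
    and qscale_one: "1 *\<^sub>Q x = x"
    and qscale_mult_left: "(q *\<^sub>Q x) * y = q *\<^sub>Q (x * y)"
    and qscale_mult_right: "x * (q *\<^sub>Q y) = q *\<^sub>Q (x * y)"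

text \<open>
  Monoid algebras \<open>\<rat>[M]\<close> (and \<open>\<int>[M]\<close>) are the types \<open>M \<Rightarrow>\<^sub>0 rat\<close> of finitely supported
  functions with the convolution product, where \<open>M\<close> is a monoid written additively.
  The monoids used below therefore carry their product under the name \<open>+\<close>.
\<close>

lemma single_central:
  fixes x :: "'m::monoid_add \<Rightarrow>\<^sub>0 'c::comm_ring_1"
  assumes "\<And>m. z + m = m + z"
  shows "Poly_Mapping.single z c * x = x * Poly_Mapping.single z c"
proof (induction x rule: update_induct)
  case (update f k v)
  then have "Poly_Mapping.update k v f = f + Poly_Mapping.single k v"
    by (intro poly_mapping_eqI)
      (auto simp: lookup_update lookup_add lookup_single when_def in_keys_iff)
  with update show ?case by (simp add: algebra_simps mult_single assms)
qed simp

lemma single0_central: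
  fixes x :: "'m::monoid_add \<Rightarrow>\<^sub>0 'c::comm_ring_1"
  shows "Poly_Mapping.single 0 c * x = x * Poly_Mapping.single 0 c"
  by (rule single_central) simp


section \<open>The rational algebra \<open>\<rat> \<otimes>\<^sub>\<int> R\<close>\<close>

text \<open>Pairs, with componentwise product.\<close>

datatype 'r qpair = QPair rat 'r

instantiation qpair :: (monoid_mult) monoid_add
begin
definition zero_qpair :: "'a qpair" where "zero_qpair = QPair 1 1"
fun plus_qpair :: "'a qpair \<Rightarrow> 'a qpair \<Rightarrow> 'a qpair" where
  "plus_qpair (QPair p r) (QPair q s) = QPair (p * q) (r * s)"
instance
proof
  fix a b c :: "'a qpair"
  show "a + b + c = a + (b + c)" by (cases a; cases b; cases c) (simp add: mult.assoc)
  show "0 + a = a" "a + 0 = a" by (cases a; simp add: zero_qpair_def)+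
qed
end

abbreviation qsym :: "rat \<Rightarrow> 'r \<Rightarrow> 'r qpair \<Rightarrow>\<^sub>0 int" where
  "qsym q r \<equiv> Poly_Mapping.single (QPair q r) 1"

definition qtensor_rels :: "('r::{ring, monoid_mult} qpair \<Rightarrow>\<^sub>0 int) set" where
  "qtensor_rels =
     {qsym (p + q) r - qsym p r - qsym q r | p q r. True} \<union>
     {qsym q (r + s) - qsym q r - qsym q s | q r s. True}"

quotient_type (overloaded) 'r qtensor = "'r::{ring, monoid_mult} qpair \<Rightarrow>\<^sub>0 int"
  / "ideal_cong qtensor_rels"
  by (rule equivp_ideal_cong)

instantiation qtensor :: ("{ring, monoid_mult}") rat_algebra
begin

lift_definition zero_qtensor :: "'a qtensor" is 0 .
lift_definition one_qtensor :: "'a qtensor" is 1 .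
lift_definition plus_qtensor :: "'a qtensor \<Rightarrow> 'a qtensor \<Rightarrow> 'a qtensor" is "(+)"
  by (rule ideal_cong_add)
lift_definition minus_qtensor :: "'a qtensor \<Rightarrow> 'a qtensor \<Rightarrow> 'a qtensor" is "(-)"
  by (rule ideal_cong_diff)
lift_definition uminus_qtensor :: "'a qtensor \<Rightarrow> 'a qtensor" is uminus
  by (rule ideal_cong_uminus)
lift_definition times_qtensor :: "'a qtensor \<Rightarrow> 'a qtensor \<Rightarrow> 'a qtensor" is "(*)"
  by (rule ideal_cong_mult)
lift_definition qscale_qtensor :: "rat \<Rightarrow> 'a qtensor \<Rightarrow> 'a qtensor" is "\<lambda>q x. qsym q 1 * x"
  by (intro ideal_cong_mult ideal_cong_refl)

instance
proof
  fix x y z :: "'a qtensor" and p q :: rat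
  show "x + y + z = x + (y + z)" by transfer (simp add: ideal_cong_refl add.assoc)
  show "x + y = y + x" by transfer (simp add: ideal_cong_refl add.commute)
  show "0 + x = x" by transfer (simp add: ideal_cong_refl)
  show "- x + x = 0" by transfer (simp add: ideal_cong_refl)
  show "x - y = x + - y" by transfer (simp add: ideal_cong_refl)
  show "x * y * z = x * (y * z)" by transfer (simp add: ideal_cong_refl mult.assoc)
  show "(x + y) * z = x * z + y * z" by transfer (simp add: ideal_cong_refl distrib_right)
  show "x * (y + z) = x * y + x * z" by transfer (simp add: ideal_cong_refl distrib_left)
  show "1 * x = x" by transfer (simp add: ideal_cong_refl)
  show "x * 1 = x" by transfer (simp add: ideal_cong_refl)
  show "q *\<^sub>Q (x + y) = q *\<^sub>Q x + q *\<^sub>Q y"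
    by transfer (simp add: ideal_cong_refl distrib_left)
  show "(p + q) *\<^sub>Q x = p *\<^sub>Q x + q *\<^sub>Q x"
  proof transfer
    fix p q and x :: "'a qpair \<Rightarrow>\<^sub>0 int"
    have "ideal_cong qtensor_rels (qsym (p + q) 1) (qsym p (1::'a) + qsym q 1)"
      by (rule ideal_cong_base) (auto simp: qtensor_rels_def diff_diff_eq)
    then show "ideal_cong qtensor_rels (qsym (p + q) 1 * x) (qsym p 1 * x + qsym q 1 * x)"
      using ideal_cong_mult[OF _ ideal_cong_refl] by (fastforce simp: distrib_right[symmetric])
  qed
  show "p *\<^sub>Q (q *\<^sub>Q x) = (p * q) *\<^sub>Q x"
    by transfer (simp add: ideal_cong_refl mult.assoc[symmetric] mult_single)
  show "1 *\<^sub>Q x = x"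
    by transfer (simp add: ideal_cong_refl zero_qpair_def[symmetric])
  show "(q *\<^sub>Q x) * y = q *\<^sub>Q (x * y)"
    by transfer (simp add: ideal_cong_refl mult.assoc)
  show "x * (q *\<^sub>Q y) = q *\<^sub>Q (x * y)"
  proof transfer
    fix x y :: "'a qpair \<Rightarrow>\<^sub>0 int" and q
    have "QPair q 1 + m = m + QPair q 1" for m :: "'a qpair"
      by (cases m) (simp add: mult.commute)
    then have "qsym q 1 * x = x * qsym q 1" by (rule single_central)
    then have "x * (qsym q 1 * y) = qsym q 1 * (x * y)" by (simp flip: mult.assoc)
    then show "ideal_cong qtensor_rels (x * (qsym q 1 * y)) (qsym q 1 * (x * y))"
      by (simp add: ideal_cong_refl)
  qed
qed

end

lift_definition qtens :: "rat \<Rightarrow> 'r::{ring, monoid_mult} \<Rightarrow> 'r qtensor"  (infixl \<open>\<otimes>\<^sub>Q\<close> 70)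
  is qsym .


section \<open>Universal enveloping algebras\<close>

text \<open>
  The free monoid on \<open>'a\<close>; its monoid algebra over \<open>\<rat>\<close> is the free associative algebra.
  The first two families of relations below turn the free algebra on the set \<open>A\<close> into the tensor
  algebra of the vector space \<open>A\<close>; the last one imposes \<open>[x, y] = x \<otimes> y - y \<otimes> x\<close>, where
  \<open>A\<close> is a Lie algebra via the commutator.
\<close>

datatype 'a fword = FWord "'a list"

instantiation fword :: (type) monoid_add
begin
definition zero_fword :: "'a fword" where "zero_fword = FWord []"
fun plus_fword :: "'a fword \<Rightarrow> 'a fword \<Rightarrow> 'a fword" where
  "plus_fword (FWord u) (FWord v) = FWord (u @ v)"
instance
proof
  fix a b c :: "'a fword"
  show "a + b + c = a + (b + c)" by (cases a; cases b; cases c) simp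
  show "0 + a = a" "a + 0 = a" by (cases a; simp add: zero_fword_def)+
qed
end

abbreviation letter :: "'a \<Rightarrow> 'a fword \<Rightarrow>\<^sub>0 rat" where
  "letter x \<equiv> Poly_Mapping.single (FWord [x]) 1"

definition lie_bracket :: "'a::ring \<Rightarrow> 'a \<Rightarrow> 'a" where
  "lie_bracket x y = x * y - y * x"

definition uenv_rels :: "('a::rat_algebra fword \<Rightarrow>\<^sub>0 rat) set" where
  "uenv_rels =
     {letter (x + y) - letter x - letter y | x y. True} \<union>
     {letter (q *\<^sub>Q x) - Poly_Mapping.single 0 q * letter x | q x. True} \<union>
     {letter (lie_bracket x y) - lie_bracket (letter x) (letter y) | x y. True}"

quotient_type (overloaded) 'a uenv = "'a::rat_algebra fword \<Rightarrow>\<^sub>0 rat" / "ideal_cong uenv_rels"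
  by (rule equivp_ideal_cong)

instantiation uenv :: (rat_algebra) rat_algebra
begin

lift_definition zero_uenv :: "'a uenv" is 0 .
lift_definition one_uenv :: "'a uenv" is 1 .
lift_definition plus_uenv :: "'a uenv \<Rightarrow> 'a uenv \<Rightarrow> 'a uenv" is "(+)"
  by (rule ideal_cong_add)
lift_definition minus_uenv :: "'a uenv \<Rightarrow> 'a uenv \<Rightarrow> 'a uenv" is "(-)"
  by (rule ideal_cong_diff)
lift_definition uminus_uenv :: "'a uenv \<Rightarrow> 'a uenv" is uminus
  by (rule ideal_cong_uminus)
lift_definition times_uenv :: "'a uenv \<Rightarrow> 'a uenv \<Rightarrow> 'a uenv" is "(*)"
  by (rule ideal_cong_mult)
lift_definition qscale_uenv :: "rat \<Rightarrow> 'a uenv \<Rightarrow> 'a uenv" is "\<lambda>q x. Poly_Mapping.single 0 q * x"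
  by (intro ideal_cong_mult ideal_cong_refl)

instance
proof
  fix x y z :: "'a uenv" and p q :: rat
  show "x + y + z = x + (y + z)" by transfer (simp add: ideal_cong_refl add.assoc)
  show "x + y = y + x" by transfer (simp add: ideal_cong_refl add.commute)
  show "0 + x = x" by transfer (simp add: ideal_cong_refl)
  show "- x + x = 0" by transfer (simp add: ideal_cong_refl)
  show "x - y = x + - y" by transfer (simp add: ideal_cong_refl)
  show "x * y * z = x * (y * z)" by transfer (simp add: ideal_cong_refl mult.assoc)
  show "(x + y) * z = x * z + y * z" by transfer (simp add: ideal_cong_refl distrib_right)
  show "x * (y + z) = x * y + x * z" by transfer (simp add: ideal_cong_refl distrib_left)
  show "1 * x = x" by transfer (simp add: ideal_cong_refl)
  show "x * 1 = x" by transfer (simp add: ideal_cong_refl)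
  show "q *\<^sub>Q (x + y) = q *\<^sub>Q x + q *\<^sub>Q y"
    by transfer (simp add: ideal_cong_refl distrib_left)
  show "(p + q) *\<^sub>Q x = p *\<^sub>Q x + q *\<^sub>Q x"
    by transfer (simp add: ideal_cong_refl distrib_right single_add)
  show "p *\<^sub>Q (q *\<^sub>Q x) = (p * q) *\<^sub>Q x"
    by transfer (simp add: ideal_cong_refl mult.assoc[symmetric] mult_single)
  show "1 *\<^sub>Q x = x" by transfer (simp add: ideal_cong_refl)
  show "(q *\<^sub>Q x) * y = q *\<^sub>Q (x * y)" by transfer (simp add: ideal_cong_refl mult.assoc)
  show "x * (q *\<^sub>Q y) = q *\<^sub>Q (x * y)"
    by transfer (simp add: ideal_cong_refl single0_central[symmetric] flip: mult.assoc)
qed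

end

lift_definition uenv_incl :: "'a::rat_algebra \<Rightarrow> 'a uenv" is letter .


section \<open>Infinite tensor powers\<close>

text \<open>
  Pure tensors \<open>\<Otimes>\<^bsub>i\<ge>1\<^esub> f i\<close> with all but finitely many factors equal to \<open>1\<close>, multiplied
  factorwise. The factors are numbered from \<open>1\<close>, so the unused entry \<open>f 0\<close> is fixed to be \<open>1\<close>.
  Modulo multilinearity these span the infinite tensor power; the multilinearity
  relations are stable under multiplication by pure tensors, so the ideal they generate is their
  linear span.
\<close>

typedef (overloaded) 'a ptensor =
    "{f :: nat \<Rightarrow> 'a::monoid_mult. f 0 = 1 \<and> finite {i. f i \<noteq> 1}}"
  by (rule exI[of _ "\<lambda>_. 1"]) simp

setup_lifting type_definition_ptensor

instantiation ptensor :: (monoid_mult) monoid_add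
begin
lift_definition zero_ptensor :: "'a ptensor" is "\<lambda>_. 1" by simp
lift_definition plus_ptensor :: "'a ptensor \<Rightarrow> 'a ptensor \<Rightarrow> 'a ptensor" is "\<lambda>f g i. f i * g i"
proof -
  fix f g :: "nat \<Rightarrow> 'a"
  assume f: "f 0 = 1 \<and> finite {i. f i \<noteq> 1}" and g: "g 0 = 1 \<and> finite {i. g i \<noteq> 1}"
  have "{i. f i * g i \<noteq> 1} \<subseteq> {i. f i \<noteq> 1} \<union> {i. g i \<noteq> 1}" by auto
  with f g show "f 0 * g 0 = 1 \<and> finite {i. f i * g i \<noteq> 1}"
    by (auto intro: finite_subset)
qed
instance
  by intro_classes (transfer; simp add: mult.assoc)+
end

text \<open>Replacing the \<open>i\<close>-th factor of a pure tensor, for \<open>i \<ge> 1\<close>.\<close>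

lift_definition ptensor_upd :: "'a::monoid_mult ptensor \<Rightarrow> nat \<Rightarrow> 'a \<Rightarrow> 'a ptensor"
  is "\<lambda>f i a. if i = 0 then f else f(i := a)"
proof -
  fix f :: "nat \<Rightarrow> 'a" and i a
  assume f: "f 0 = 1 \<and> finite {i. f i \<noteq> 1}"
  have "{j. (f(i := a)) j \<noteq> 1} \<subseteq> insert i {i. f i \<noteq> 1}" by auto
  then have "finite {j. (f(i := a)) j \<noteq> 1}" by (rule finite_subset) (use f in simp)
  with f show "(if i = 0 then f else f(i := a)) 0 = 1
      \<and> finite {j. (if i = 0 then f else f(i := a)) j \<noteq> 1}"
    by (cases "i = 0") simp_all
qed

abbreviation pten :: "'a ptensor \<Rightarrow> 'a::monoid_mult ptensor \<Rightarrow>\<^sub>0 rat" where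
  "pten f \<equiv> Poly_Mapping.single f 1"

definition inftensor_rels :: "('a::rat_algebra ptensor \<Rightarrow>\<^sub>0 rat) set" where
  "inftensor_rels =
     {pten (ptensor_upd f i (a + b)) - pten (ptensor_upd f i a) - pten (ptensor_upd f i b)
       | f i a b. 1 \<le> i} \<union>
     {pten (ptensor_upd f i (q *\<^sub>Q a)) - Poly_Mapping.single 0 q * pten (ptensor_upd f i a)
       | f i q a. 1 \<le> i}"

quotient_type (overloaded) 'a inftensor = "'a::rat_algebra ptensor \<Rightarrow>\<^sub>0 rat"
  / "ideal_cong inftensor_rels"
  by (rule equivp_ideal_cong)

instantiation inftensor :: (rat_algebra) rat_algebra
begin

lift_definition zero_inftensor :: "'a inftensor" is 0 .
lift_definition one_inftensor :: "'a inftensor" is 1 .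
lift_definition plus_inftensor :: "'a inftensor \<Rightarrow> 'a inftensor \<Rightarrow> 'a inftensor" is "(+)"
  by (rule ideal_cong_add)
lift_definition minus_inftensor :: "'a inftensor \<Rightarrow> 'a inftensor \<Rightarrow> 'a inftensor" is "(-)"
  by (rule ideal_cong_diff)
lift_definition uminus_inftensor :: "'a inftensor \<Rightarrow> 'a inftensor" is uminus
  by (rule ideal_cong_uminus)
lift_definition times_inftensor :: "'a inftensor \<Rightarrow> 'a inftensor \<Rightarrow> 'a inftensor" is "(*)"
  by (rule ideal_cong_mult)
lift_definition qscale_inftensor :: "rat \<Rightarrow> 'a inftensor \<Rightarrow> 'a inftensor"
  is "\<lambda>q x. Poly_Mapping.single 0 q * x"
  by (intro ideal_cong_mult ideal_cong_refl)

instance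
proof
  fix x y z :: "'a inftensor" and p q :: rat
  show "x + y + z = x + (y + z)" by transfer (simp add: ideal_cong_refl add.assoc)
  show "x + y = y + x" by transfer (simp add: ideal_cong_refl add.commute)
  show "0 + x = x" by transfer (simp add: ideal_cong_refl)
  show "- x + x = 0" by transfer (simp add: ideal_cong_refl)
  show "x - y = x + - y" by transfer (simp add: ideal_cong_refl)
  show "x * y * z = x * (y * z)" by transfer (simp add: ideal_cong_refl mult.assoc)
  show "(x + y) * z = x * z + y * z" by transfer (simp add: ideal_cong_refl distrib_right)
  show "x * (y + z) = x * y + x * z" by transfer (simp add: ideal_cong_refl distrib_left)
  show "1 * x = x" by transfer (simp add: ideal_cong_refl)
  show "x * 1 = x" by transfer (simp add: ideal_cong_refl)
  show "q *\<^sub>Q (x + y) = q *\<^sub>Q x + q *\<^sub>Q y"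
    by transfer (simp add: ideal_cong_refl distrib_left)
  show "(p + q) *\<^sub>Q x = p *\<^sub>Q x + q *\<^sub>Q x"
    by transfer (simp add: ideal_cong_refl distrib_right single_add)
  show "p *\<^sub>Q (q *\<^sub>Q x) = (p * q) *\<^sub>Q x"
    by transfer (simp add: ideal_cong_refl mult.assoc[symmetric] mult_single)
  show "1 *\<^sub>Q x = x" by transfer (simp add: ideal_cong_refl)
  show "(q *\<^sub>Q x) * y = q *\<^sub>Q (x * y)" by transfer (simp add: ideal_cong_refl mult.assoc)
  show "x * (q *\<^sub>Q y) = q *\<^sub>Q (x * y)"
    by transfer (simp add: ideal_cong_refl single0_central[symmetric] flip: mult.assoc)
qed

end

lift_definition inftensor_incl :: "nat \<Rightarrow> 'a::rat_algebra \<Rightarrow> 'a inftensor"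
  is "\<lambda>i a. pten (ptensor_upd 0 i a)" .

type_synonym 'r G_inf_Q = "'r qtensor uenv inftensor"

definition T :: "nat \<Rightarrow> 'r::{ring, monoid_mult} qtensor \<Rightarrow> 'r G_inf_Q" where
  "T i r = inftensor_incl i (uenv_incl r)"


section \<open>Symmetric functions\<close>

text \<open>
  A partition is the multiset of its (positive) parts. A symmetric function is represented by the
  sequence of its images in the polynomial rings \<open>\<rat>[x\<^sub>0, \<dots>, x\<^bsub>N-1\<^esub>]\<close>, that is, \<open>\<Lambda>\<close> is
  the inverse limit (in each degree) of the rings of symmetric polynomials.
\<close>

type_synonym partition = "nat multiset"
type_synonym polynomial = "(nat \<Rightarrow>\<^sub>0 nat) \<Rightarrow>\<^sub>0 rat"

definition is_partition :: "partition \<Rightarrow> bool" where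
  "is_partition \<mu> \<longleftrightarrow> 0 \<notin># \<mu>"

definition indet :: "nat \<Rightarrow> polynomial" where
  "indet i = Poly_Mapping.single (Poly_Mapping.single i 1) 1"

definition power_sum :: "partition \<Rightarrow> nat \<Rightarrow> polynomial" where
  "power_sum \<mu> N = (\<Prod>n\<in>#\<mu>. \<Sum>i<N. indet i ^ n)"

definition diagram :: "partition \<Rightarrow> (nat \<times> nat) set" where
  "diagram \<mu> = {(i, j). i < size \<mu> \<and> j < rev (sorted_list_of_multiset \<mu>) ! i}"

definition ssyt :: "partition \<Rightarrow> nat \<Rightarrow> (nat \<times> nat \<Rightarrow> nat) set" where
  "ssyt \<mu> N = {t \<in> diagram \<mu> \<rightarrow>\<^sub>E {..<N}.
     (\<forall>i j. (i, Suc j) \<in> diagram \<mu> \<longrightarrow> t (i, j) \<le> t (i, Suc j)) \<and>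
     (\<forall>i j. (Suc i, j) \<in> diagram \<mu> \<longrightarrow> t (i, j) < t (Suc i, j))}"

definition schur :: "partition \<Rightarrow> nat \<Rightarrow> polynomial" where
  "schur \<mu> N = (\<Sum>t\<in>ssyt \<mu> N. \<Prod>c\<in>diagram \<mu>. indet (t c))"

text \<open>
  The power sums \<open>p\<^sub>\<mu>\<close> form a basis of \<open>\<Lambda>\<^sub>\<rat>\<close>; \<open>schur_expansion \<nu>\<close> is the coefficient vector
  of \<open>s\<^sub>\<nu>\<close> in this basis.
\<close>

definition schur_expansion :: "partition \<Rightarrow> partition \<Rightarrow>\<^sub>0 rat" where
  "schur_expansion \<nu> = (THE c.
     (\<forall>\<mu>\<in>Poly_Mapping.keys c. is_partition \<mu>) \<and>
     (\<forall>N. schur \<nu> N =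
       (\<Sum>\<mu>\<in>Poly_Mapping.keys c. Poly_Mapping.single 0 (Poly_Mapping.lookup c \<mu>) * power_sum \<mu> N)))"


section \<open>Formal sums over families of partitions\<close>

text \<open>
  Families of multisets with finite support are indexed by the elements of the ring. Since every
  nonempty partition has positive size, \<open>\<Sum>\<^bsub>U\<^esub> |\<nu>(U)| < \<infinity>\<close> amounts to finiteness of the support.
\<close>

type_synonym 'r family = "'r \<Rightarrow>\<^sub>0 partition"

definition partition_families :: "'r set \<Rightarrow> 'r family set" where
  "partition_families I =
     {\<nu>. Poly_Mapping.keys \<nu> \<subseteq> I \<and> (\<forall>U\<in>I. is_partition (Poly_Mapping.lookup \<nu> U))}"

text \<open>
  A formal sum \<open>\<Sum>\<^bsub>\<mu>\<^esub> (\<Prod>\<^bsub>U\<^esub> p\<^bsub>\<mu>(U)\<^esub>\<^sup>(\<^sup>U\<^sup>)) a\<^bsub>\<mu>\<^esub>\<close> is the function sending \<open>\<mu>\<close> to \<open>a\<^bsub>\<mu>\<^esub>\<close>.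
  As \<open>p\<^bsub>\<alpha>\<^esub> p\<^bsub>\<beta>\<^esub> = p\<^bsub>\<alpha> \<union> \<beta>\<^esub>\<close>, the product is convolution with respect to union of families,
  and every family is such a union in only finitely many ways.
\<close>

type_synonym ('r, 'a) formal_sum = "'r family \<Rightarrow> 'a"

definition fs_one :: "('r, 'a::{ring, monoid_mult}) formal_sum" where
  "fs_one \<mu> = (if \<mu> = 0 then 1 else 0)"

definition fs_mult :: "('r, 'a::{ring, monoid_mult}) formal_sum \<Rightarrow> ('r, 'a) formal_sum
    \<Rightarrow> ('r, 'a) formal_sum" where
  "fs_mult f g \<mu> = (\<Sum>(\<alpha>, \<beta>)\<in>{(\<alpha>, \<beta>). \<alpha> + \<beta> = \<mu>}. f \<alpha> * g \<beta>)"

primrec fs_power :: "('r, 'a::{ring, monoid_mult}) formal_sum \<Rightarrow> nat \<Rightarrow> ('r, 'a) formal_sum" where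
  "fs_power f 0 = fs_one"
| "fs_power f (Suc k) = fs_mult f (fs_power f k)"

text \<open>
  For \<open>f\<close> without constant term, each coefficient of the series \<open>exp f\<close> and \<open>log (1 + f)\<close> is a
  sum over \<open>k\<close> with finitely many nonzero terms.
\<close>

definition fs_exp :: "('r, 'a::rat_algebra) formal_sum \<Rightarrow> ('r, 'a) formal_sum" where
  "fs_exp f \<mu> = Sum_any (\<lambda>k. (1 / fact k) *\<^sub>Q fs_power f k \<mu>)"

definition fs_log1p :: "('r, 'a::rat_algebra) formal_sum \<Rightarrow> ('r, 'a) formal_sum" where
  "fs_log1p f \<mu> =
     Sum_any (\<lambda>k. ((- 1) ^ k / of_nat (Suc k)) *\<^sub>Q fs_power f (Suc k) \<mu>)"

text \<open>The coefficientwise limit of \<open>F 1 \<cdot> F 2 \<cdots> F n\<close>, all coefficients becoming stationary.\<close>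

primrec fs_partial_prod :: "(nat \<Rightarrow> ('r, 'a::{ring, monoid_mult}) formal_sum) \<Rightarrow> nat
    \<Rightarrow> ('r, 'a) formal_sum" where
  "fs_partial_prod F 0 = fs_one"
| "fs_partial_prod F (Suc n) = fs_mult (fs_partial_prod F n) (F (Suc n))"

definition fs_infprod :: "(nat \<Rightarrow> ('r, 'a::{ring, monoid_mult}) formal_sum)
    \<Rightarrow> ('r, 'a) formal_sum" where
  "fs_infprod F \<mu> = (THE a. \<forall>\<^sub>F n in sequentially. fs_partial_prod F n \<mu> = a)"


section \<open>The ring \<open>\<G>\<^sub>\<infinity>\<^sup>\<int>(R)\<close>\<close>

text \<open>\<open>\<Sum>\<^bsub>U\<in>I\<^esub> p\<^sub>l\<^sup>(\<^sup>U\<^sup>) U\<close>; at most one summand contributes to each coefficient.\<close>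

definition linear_sum :: "'r::{ring, monoid_mult} set \<Rightarrow> nat \<Rightarrow> ('r, 'r qtensor) formal_sum" where
  "linear_sum I l \<mu> = (\<Sum>U | U \<in> I \<and> \<mu> = Poly_Mapping.single U {#l#}. 1 \<otimes>\<^sub>Q U)"

definition generating_product ::
    "'r::{ring, monoid_mult} set \<Rightarrow> ('r, 'r G_inf_Q) formal_sum" where
  "generating_product I = fs_infprod (\<lambda>l. fs_exp (T l \<circ> fs_log1p (linear_sum I l)))"

text \<open>
  The coefficient of \<open>\<Prod>\<^bsub>U\<^esub> p\<^bsub>\<mu>(U)\<^esub>\<^sup>(\<^sup>U\<^sup>)\<close> in \<open>\<Prod>\<^bsub>U\<^esub> s\<^bsub>\<nu>(U)\<^esub>\<^sup>(\<^sup>U\<^sup>)\<close>. The remaining factors are the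
  coefficient of \<open>p\<^sub>\<emptyset> = 1\<close> in \<open>s\<^sub>\<emptyset> = 1\<close>.
\<close>

definition schur_coeff :: "'r family \<Rightarrow> 'r family \<Rightarrow> rat" where
  "schur_coeff \<nu> \<mu> = (\<Prod>U\<in>Poly_Mapping.keys \<nu> \<union> Poly_Mapping.keys \<mu>.
     Poly_Mapping.lookup (schur_expansion (Poly_Mapping.lookup \<nu> U)) (Poly_Mapping.lookup \<mu> U))"

text \<open>
  The family of the \<open>Z\<^bsub>\<nu>\<^esub>\<close>, extended by zero to indices outside \<open>\<P>\<^sup>I\<close>. Its defining identity of
  formal sums is compared coefficientwise in the power sum basis; only the finitely many \<open>\<nu>\<close> with
  \<open>|\<nu>(U)| = |\<mu>(U)|\<close> for all \<open>U\<close> contribute to the coefficient at \<open>\<mu>\<close>.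
\<close>

definition Z_elt :: "'r::{ring, monoid_mult} set \<Rightarrow> 'r family \<Rightarrow> 'r G_inf_Q" where
  "Z_elt I = (THE Z.
     (\<forall>\<nu>. \<nu> \<notin> partition_families I \<longrightarrow> Z \<nu> = 0) \<and>
     (\<forall>\<mu>\<in>partition_families I.
       (\<Sum>\<nu> | \<nu> \<in> partition_families I \<and> schur_coeff \<nu> \<mu> \<noteq> 0. schur_coeff \<nu> \<mu> *\<^sub>Q Z \<nu>)
         = generating_product I \<mu>))"

definition G_inf_Z :: "'r::{ring, monoid_mult} set \<Rightarrow> 'r G_inf_Q set" where
  "G_inf_Z I = zmod.span (Z_elt I ` partition_families I)"

definition e_elt :: "'r::{ring, monoid_mult} set \<Rightarrow> nat \<Rightarrow> 'r \<Rightarrow> 'r G_inf_Q" where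
  "e_elt I r U = Z_elt I (Poly_Mapping.single U (replicate_mset r 1))"

end

theory Submission
  imports Defs "HOL-Computational_Algebra.Formal_Power_Series" "HOL-Combinatorics.Transposition"
begin

text \<open>
  The product \<open>\<Omega>\<close> defining the \<open>Z\<^bsub>\<nu>\<^esub>\<close> is evaluated at alphabets, that is, its power sums
  \<open>p\<^sub>n\<^sup>(\<^sup>U\<^sup>)\<close> are replaced by \<open>\<Sum> c y\<^sup>n\<close> for finitely many letters \<open>y\<close> with multiplicities
  \<open>c \<in> \<int>\<close>. By integrality of Schur functions at such virtual alphabets, all coefficients of
  \<open>\<Omega>\<close> at an alphabet lie in the integer span of the \<open>Z\<^bsub>\<nu>\<^esub>\<close>. The element \<open>e\<^sub>r(U)\<close> is the
  coefficient of \<open>x\<^sup>r\<close> at the alphabet of \<open>U\<close> with the single letter \<open>-x\<close> of multiplicity \<open>-1\<close>.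

  Since \<open>exp (T(log (1 + a))) exp (T(log (1 + b))) = exp (T(log ((1 + a) (1 + b))))\<close>, a product
  of values of \<open>\<Omega>\<close> is again a value of \<open>\<Omega>\<close>: multiplying out and expanding the products of basis
  elements in the basis \<open>I\<close> only adds letters of higher degree, with integer multiplicities.
  So products of the \<open>e\<^sub>r(U)\<close> lie in the span of the \<open>Z\<^bsub>\<nu>\<^esub>\<close>, and modulo terms of lower weight
  they are the coefficients of \<open>\<Omega>\<close> at the union of the alphabets of the factors. The latter
  coefficients span, up to the involution \<open>p\<^sub>n \<mapsto> (- 1)\<^bsup>n-1\<^esup> p\<^sub>n\<close>, the same group as the \<open>Z\<^bsub>\<nu>\<^esub>\<close>,
  by unitriangularity of the Kostka numbers, and induction on the weight concludes.
\<close>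

section \<open>Power series indexed by a graded monoid\<close>

text \<open>The obstacle is that T_l respects commutators but not products. The product rule
  therefore comes from a derivation D: the logarithmic derivative (D exp X) exp (-X) equals ((exp
  (ad X) - 1) / ad X) (D X), which is built from brackets only and so is carried along by T_l. If
  every term of a contains a variable that b lacks, let D count this variable: both sides of the
  product rule then solve the same linear equation. Hence each factor e_r(U) gets a variable of its
  own, even when factors repeat. Letters make multiplying out possible: x^l y^l = (x y)^l, so one
  product letter serves all l at once. Multiplicities may be negative, where there are no tableaux
  to count; there integrality holds because s_\<nu> at k copies of a letter is polynomial in k and
  integral for k \<ge> 0. The involution is crossed without computing its effect on Schur functions:
  the twisted coefficients have their own elements Z', the Kostka matrix puts these into the
  generated ring first, and twisting a second time recovers the Z of the same weight.\<close>

class graded_cmonoid = comm_monoid_add +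
  fixes deg :: "'a \<Rightarrow> nat"
  assumes deg_add: "deg (a + b) = deg a + deg b"
    and deg_eq_0: "deg a = 0 \<Longrightarrow> a = 0"
    and finite_decomp_aux: "finite {(a, b). a + b = c}"
begin

definition decomp :: "'a \<Rightarrow> ('a \<times> 'a) set" where
  "decomp c = {(a, b). a + b = c}"

lemma finite_decomp [simp]: "finite (decomp c)"
  using finite_decomp_aux by (simp add: decomp_def)

lemma in_decomp_iff: "(a, b) \<in> decomp c \<longleftrightarrow> a + b = c"
  by (simp add: decomp_def)

lemma deg_zero [simp]: "deg 0 = 0"
  using deg_add[of 0 0] by simp

lemma add_eq_0_left: "a + b = 0 \<Longrightarrow> a = 0"
  using deg_add[of a b] deg_eq_0[of a] by simp

lemma decomp_0: "decomp 0 = {(0, 0)}"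
proof -
  have "a = 0 \<and> b = 0" if "a + b = 0" for a b
    using add_eq_0_left[OF that] that by simp
  then have "a + b = 0 \<longleftrightarrow> a = 0 \<and> b = 0" for a b by (metis add_0)
  then show ?thesis by (simp add: decomp_def set_eq_iff)
qed

end

instantiation nat :: graded_cmonoid
begin
definition deg_nat :: "nat \<Rightarrow> nat" where "deg_nat n = n"
instance
proof
  fix c :: nat
  have "{(a, b). a + b = c} \<subseteq> {..c} \<times> {..c}" by auto
  then show "finite {(a, b). a + b = c}" by (rule finite_subset) simp
qed (simp_all add: deg_nat_def)
end

text \<open>The degree is the number of elements, not their sum: 0 may be an element of a multiset
  of naturals, and a degree must vanish only at the neutral element.\<close>

instantiation multiset :: (type) graded_cmonoid
begin
definition deg_multiset :: "'a multiset \<Rightarrow> nat" where "deg_multiset m = size m"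
instance
proof
  fix c :: "'a multiset"
  show "finite {(a, b). a + b = c}"
  proof (induction c)
    case empty
    have "{(a, b). a + b = ({#} :: 'a multiset)} \<subseteq> {({#}, {#})}" by auto
    then show ?case by (rule finite_subset) simp
  next
    case (add x c)
    let ?S = "{(a, b). a + b = c}"
    have "{(a, b). a + b = add_mset x c}
        \<subseteq> (\<lambda>(a, b). (add_mset x a, b)) ` ?S \<union> (\<lambda>(a, b). (a, add_mset x b)) ` ?S"
    proof safe
      fix a b
      assume ab: "a + b = add_mset x c"
        and nb: "(a, b) \<notin> (\<lambda>(a, b). (a, add_mset x b)) ` ?S"
      then have "x \<in># a \<or> x \<in># b" by (metis union_iff union_single_eq_member)
      then show "(a, b) \<in> (\<lambda>(a, b). (add_mset x a, b)) ` ?S"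
      proof
        assume "x \<in># a"
        then obtain a' where a': "a = add_mset x a'" by (metis multi_member_split)
        with ab have "(a', b) \<in> ?S" by simp
        with a' show ?thesis by (auto intro!: image_eqI)
      next
        assume "x \<in># b"
        then obtain b' where b': "b = add_mset x b'" by (metis multi_member_split)
        with ab have "(a, b') \<in> ?S" by simp
        with b' have "(a, b) \<in> (\<lambda>(a, b). (a, add_mset x b)) ` ?S" by (auto intro!: image_eqI)
        with nb show ?thesis by contradiction
      qed
    qed
    then show ?case by (rule finite_subset) (use add.IH in simp)
  qed
qed (simp_all add: deg_multiset_def)
end

instantiation poly_mapping :: (type, graded_cmonoid) graded_cmonoid
begin

definition deg_poly_mapping :: "('a \<Rightarrow>\<^sub>0 'b) \<Rightarrow> nat" where
  "deg_poly_mapping f = (\<Sum>k\<in>Poly_Mapping.keys f. deg (Poly_Mapping.lookup f k))"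

lemma deg_poly_mapping_superset:
  assumes "finite S" "Poly_Mapping.keys f \<subseteq> S"
  shows "deg (f :: 'a \<Rightarrow>\<^sub>0 'b) = (\<Sum>k\<in>S. deg (Poly_Mapping.lookup f k))"
  unfolding deg_poly_mapping_def using assms
  by (intro sum.mono_neutral_left) (auto simp: in_keys_iff)

instance
proof
  fix a b c :: "'a \<Rightarrow>\<^sub>0 'b"
  let ?S = "Poly_Mapping.keys a \<union> Poly_Mapping.keys b"
  show "deg (a + b) = deg a + deg b"
    using keys_add[of a b]
    by (simp add: deg_poly_mapping_superset[of ?S] lookup_add deg_add sum.distrib)
  show "deg a = 0 \<Longrightarrow> a = 0"
    by (rule poly_mapping_eqI) (auto simp: deg_poly_mapping_def in_keys_iff dest: deg_eq_0)
  let ?K = "Poly_Mapping.keys c"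
  let ?P = "PiE ?K (\<lambda>k. decomp (Poly_Mapping.lookup c k))"
  let ?h = "\<lambda>(f, g). \<lambda>k\<in>?K. (Poly_Mapping.lookup f k, Poly_Mapping.lookup g k)"
  have fin: "finite ?P" by (intro finite_PiE) auto
  \<comment> \<open>A sum in a graded monoid is 0 only if both summands are, so f and g vanish off
    the keys of c, and the pair is determined by its values on this finite set.\<close>
  have 0: "Poly_Mapping.lookup f k = 0" "Poly_Mapping.lookup g k = 0"
    if "f + g = c" "k \<notin> ?K" for f g k
  proof -
    have "Poly_Mapping.lookup f k + Poly_Mapping.lookup g k = 0"
      using that by (metis lookup_add in_keys_iff)
    then show "Poly_Mapping.lookup f k = 0" "Poly_Mapping.lookup g k = 0"
      using add_eq_0_left by (metis add.commute)+
  qed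
  have "inj_on ?h {(f, g). f + g = c}"
  proof (rule inj_onI, clarify)
    fix f g f' g' assume c: "f' + g' = f + g" "c = f + g"
      and eq: "(\<lambda>k\<in>Poly_Mapping.keys (f + g). (Poly_Mapping.lookup f k, Poly_Mapping.lookup g k)) =
        (\<lambda>k\<in>Poly_Mapping.keys (f + g). (Poly_Mapping.lookup f' k, Poly_Mapping.lookup g' k))"
    have "Poly_Mapping.lookup f k = Poly_Mapping.lookup f' k
        \<and> Poly_Mapping.lookup g k = Poly_Mapping.lookup g' k" for k
    proof (cases "k \<in> Poly_Mapping.keys (f + g)")
      case True
      with fun_cong[OF eq, of k] show ?thesis by simp
    next
      case False
      with c show ?thesis using 0[of f g k] 0[of f' g' k] by simp
    qed
    then show "f = f' \<and> g = g'" by (auto intro: poly_mapping_eqI)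
  qed
  moreover have "?h ` {(f, g). f + g = c} \<subseteq> ?P"
    by (auto simp: decomp_def lookup_add)
  ultimately show "finite {(f, g). f + g = c}"
    using fin by (meson inj_on_finite)
qed

end

lemma deg_single: "deg (Poly_Mapping.single k m) = deg m"
  by (cases "m = 0") (simp_all add: deg_poly_mapping_def)

lemma qscale_vector_space: "vector_space (qscale :: rat \<Rightarrow> 'a::rat_algebra \<Rightarrow> 'a)"
  by unfold_locales (simp_all add: qscale_add_right qscale_add_left qscale_qscale qscale_one)

interpretation qs: vector_space "qscale :: rat \<Rightarrow> 'a::rat_algebra \<Rightarrow> 'a"
  by (rule qscale_vector_space)

text \<open>Scalars count as a \<open>rat_algebra\<close>, so that results on values in such an
  algebra also cover numerical linear systems and series over the rationals.\<close>

instantiation rat :: rat_algebra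
begin
definition qscale_rat :: "rat \<Rightarrow> rat \<Rightarrow> rat" where "qscale_rat p q = p * q"
instance by standard (simp_all add: qscale_rat_def algebra_simps)
end

text \<open>The same functions as the formal sums of the definitions, but as a type of their own, so
  that convolution can be the multiplication and the ring classes apply. Besides families, monomials
  occur as indices.\<close>

typedef ('m, 'a) mseries = "UNIV :: ('m \<Rightarrow> 'a) set"
  morphisms mcoef MSeries ..

setup_lifting type_definition_mseries

lemma mcoef_MSeries [simp]: "mcoef (MSeries f) = f"
  by (simp add: MSeries_inverse)

lemma mseries_eqI: "(\<And>m. mcoef f m = mcoef g m) \<Longrightarrow> f = g"
  by (simp add: mcoef_inject[symmetric] fun_eq_iff)

instantiation mseries :: (type, ab_group_add) ab_group_add
begin
lift_definition zero_mseries :: "('a, 'b) mseries" is "\<lambda>_. 0" .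
lift_definition plus_mseries :: "('a, 'b) mseries \<Rightarrow> ('a, 'b) mseries \<Rightarrow> ('a, 'b) mseries"
  is "\<lambda>f g m. f m + g m" .
lift_definition minus_mseries :: "('a, 'b) mseries \<Rightarrow> ('a, 'b) mseries \<Rightarrow> ('a, 'b) mseries"
  is "\<lambda>f g m. f m - g m" .
lift_definition uminus_mseries :: "('a, 'b) mseries \<Rightarrow> ('a, 'b) mseries"
  is "\<lambda>f m. - f m" .
instance
  by standard (transfer; simp add: algebra_simps fun_eq_iff)+
end

lemma mcoef_simps [simp]:
  "mcoef 0 m = 0" "mcoef (f + g) m = mcoef f m + mcoef g m"
  "mcoef (f - g) m = mcoef f m - mcoef g m" "mcoef (- f) m = - mcoef f m"
  by (transfer, simp)+

lemma mcoef_sum [simp]: "mcoef (sum f A) m = (\<Sum>x\<in>A. mcoef (f x) m)"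
  by (induction A rule: infinite_finite_induct) auto

instantiation mseries :: (graded_cmonoid, ring) ring
begin

lift_definition times_mseries :: "('a, 'b) mseries \<Rightarrow> ('a, 'b) mseries \<Rightarrow> ('a, 'b) mseries"
  is "\<lambda>f g m. \<Sum>(a, b)\<in>decomp m. f a * g b" .

lemma mcoef_times: "mcoef (f * g) m = (\<Sum>(a, b)\<in>decomp m. mcoef f a * mcoef g b)"
  by (simp add: times_mseries.rep_eq)

instance
proof
  fix f g h :: "('a, 'b) mseries"
  show "f * g * h = f * (g * h)"
  proof (rule mseries_eqI)
    fix m
    have "mcoef (f * g * h) m
        = (\<Sum>((a, b), (c, d))\<in>(SIGMA x:decomp m. decomp (fst x)). mcoef f c * mcoef g d * mcoef h b)"
      by (simp add: mcoef_times sum.Sigma split_def sum_distrib_right)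
    also have "\<dots> = (\<Sum>((a, b), (c, d))\<in>(SIGMA x:decomp m. decomp (snd x)).
        mcoef f a * mcoef g c * mcoef h d)"
      by (rule sum.reindex_bij_witness[where i = "\<lambda>((a, b), (c, d)). ((a + c, d), (a, c))"
            and j = "\<lambda>((a, b), (c, d)). ((c, d + b), (d, b))"])
        (auto simp: decomp_def add.assoc)
    also have "\<dots> = mcoef (f * (g * h)) m"
      by (simp add: mcoef_times sum.Sigma split_def sum_distrib_left mult.assoc)
    finally show "mcoef (f * g * h) m = mcoef (f * (g * h)) m" .
  qed
  show "(f + g) * h = f * h + g * h"
    by (rule mseries_eqI) (simp add: mcoef_times split_def distrib_right sum.distrib)
  show "f * (g + h) = f * g + f * h"
    by (rule mseries_eqI) (simp add: mcoef_times split_def distrib_left sum.distrib)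
qed

end

instantiation mseries :: (graded_cmonoid, "{ring, monoid_mult}") monoid_mult
begin

lift_definition one_mseries :: "('a, 'b) mseries" is "\<lambda>m. if m = 0 then 1 else 0" .

lemma mcoef_one: "mcoef (1 :: ('a, 'b) mseries) m = (if m = 0 then 1 else 0)"
  by (simp add: one_mseries.rep_eq)

instance
proof
  fix f :: "('a, 'b) mseries"
  show "1 * f = f"
  proof (rule mseries_eqI)
    fix m
    have "mcoef (1 * f) m = (\<Sum>(a, b)\<in>{(0, m)}. mcoef 1 a * mcoef f b)"
      unfolding mcoef_times
      proof (rule sum.mono_neutral_right)
      show "{(0, m)} \<subseteq> decomp m" by (simp add: decomp_def)
    qed (auto simp: mcoef_one in_decomp_iff split: if_splits)
    then show "mcoef (1 * f) m = mcoef f m" by (simp add: mcoef_one)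
  qed
  show "f * 1 = f"
  proof (rule mseries_eqI)
    fix m
    have "mcoef (f * 1) m = (\<Sum>(a, b)\<in>{(m, 0)}. mcoef f a * mcoef 1 b)"
      unfolding mcoef_times
      proof (rule sum.mono_neutral_right)
      show "{(m, 0)} \<subseteq> decomp m" by (simp add: decomp_def)
    qed (auto simp: mcoef_one in_decomp_iff split: if_splits)
    then show "mcoef (f * 1) m = mcoef f m" by (simp add: mcoef_one)
  qed
qed

end

instantiation mseries :: (graded_cmonoid, rat_algebra) rat_algebra
begin

lift_definition qscale_mseries :: "rat \<Rightarrow> ('a, 'b) mseries \<Rightarrow> ('a, 'b) mseries"
  is "\<lambda>q f m. q *\<^sub>Q f m" .

lemma mcoef_qscale [simp]: "mcoef (q *\<^sub>Q (f :: ('a, 'b) mseries)) m = q *\<^sub>Q mcoef f m"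
  by (simp add: qscale_mseries.rep_eq)

instance
  by standard (rule mseries_eqI; simp add: mcoef_times qs.scale_sum_right split_def
      qscale_mult_left qscale_mult_right qscale_add_right qscale_add_left qscale_qscale qscale_one)+

end

instance mseries :: (graded_cmonoid, comm_ring) comm_ring
proof
  fix f g :: "('a, 'b) mseries"
  show "f * g = g * f"
  proof (rule mseries_eqI)
    fix m
    show "mcoef (f * g) m = mcoef (g * f) m"
      unfolding mcoef_times
      by (rule sum.reindex_bij_witness[where i = "\<lambda>(a, b). (b, a)" and j = "\<lambda>(a, b). (b, a)"])
        (auto simp: decomp_def add.commute mult.commute)
  qed
qed (simp_all add: distrib_right)

instance mseries :: (graded_cmonoid, "{comm_ring, comm_monoid_mult}") comm_monoid_mult
  by standard simp

instance mseries :: (graded_cmonoid, comm_ring_1) comm_ring_1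
proof
  have "mcoef (0 :: ('a, 'b) mseries) 0 \<noteq> mcoef 1 0" by (simp add: mcoef_one)
  then show "(0 :: ('a, 'b) mseries) \<noteq> 1" by metis
qed

definition mmono :: "'m \<Rightarrow> 'a::zero \<Rightarrow> ('m, 'a) mseries" where
  "mmono m c = MSeries (\<lambda>n. if n = m then c else 0)"

lemma mcoef_mono: "mcoef (mmono m c) n = (if n = m then c else 0)"
  by (simp add: mmono_def)

lemma mono_0_1: "mmono 0 1 = 1"
  by (rule mseries_eqI) (simp add: mcoef_mono mcoef_one)

lemma mono_mult: "mmono m (c::'a::ring) * mmono n d = mmono (m + n) (c * d)"
proof (rule mseries_eqI)
  fix k
  have "mcoef (mmono m c * mmono n d) k = (\<Sum>(a, b)\<in>decomp k \<inter> {(m, n)}. c * d)"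
    unfolding mcoef_times by (rule sum.mono_neutral_cong_right) (auto simp: mcoef_mono split: if_splits)
  also have "\<dots> = mcoef (mmono (m + n) (c * d)) k"
    by (auto simp: mcoef_mono decomp_def)
  finally show "mcoef (mmono m c * mmono n d) k = mcoef (mmono (m + n) (c * d)) k" .
qed

section \<open>The order filtration of a ring of series\<close>

definition ord_ge :: "nat \<Rightarrow> ('m::graded_cmonoid, 'a::zero) mseries \<Rightarrow> bool" where
  "ord_ge k f \<longleftrightarrow> (\<forall>m. deg m < k \<longrightarrow> mcoef f m = 0)"

lemma ord_ge_mult:
  fixes f g :: "('m::graded_cmonoid, 'a::ring) mseries"
  assumes "ord_ge j f" "ord_ge k g"
  shows "ord_ge (j + k) (f * g)"
  unfolding ord_ge_def
proof safe
  fix m :: 'm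
  assume m: "deg m < j + k"
  have "mcoef f a * mcoef g b = 0" if "(a, b) \<in> decomp m" for a b
  proof -
    have "deg a < j \<or> deg b < k" using that m by (auto simp: decomp_def deg_add)
    then show ?thesis using assms by (auto simp: ord_ge_def)
  qed
  then show "mcoef (f * g) m = 0" by (auto simp: mcoef_times intro!: sum.neutral)
qed

lemma ord_ge_0 [simp]: "ord_ge 0 f"
  by (simp add: ord_ge_def)

definition no_const :: "('m::graded_cmonoid, 'a::zero) mseries \<Rightarrow> bool" where
  "no_const f \<longleftrightarrow> mcoef f 0 = 0"

lemma no_const_iff_ord_ge: "no_const f \<longleftrightarrow> ord_ge 1 f"
  by (auto simp: ord_ge_def no_const_def dest: deg_eq_0)

lemma ord_ge_power: "no_const f \<Longrightarrow> ord_ge k (f ^ k)"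
  for f :: "('m::graded_cmonoid, 'a::{ring, monoid_mult}) mseries"
proof (induction k)
  case (Suc k)
  then show ?case using ord_ge_mult[of 1 f k "f ^ k"] by (simp add: no_const_iff_ord_ge)
qed simp

lemma ord_ge_mono: "ord_ge k f \<Longrightarrow> j \<le> k \<Longrightarrow> ord_ge j f"
  by (auto simp: ord_ge_def)

lemma ord_ge_lin:
  fixes f g :: "('m::graded_cmonoid, 'a::ab_group_add) mseries"
  assumes "ord_ge k f" "ord_ge k g"
  shows "ord_ge k (f + g)" "ord_ge k (f - g)" "ord_ge k (- f)"
  using assms by (auto simp: ord_ge_def)

lemma ord_ge_qscale: "ord_ge k f \<Longrightarrow> ord_ge k (q *\<^sub>Q f)"
  for f :: "('m::graded_cmonoid, 'a::rat_algebra) mseries"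
  by (auto simp: ord_ge_def)


subsection \<open>Locally finite sums and substitution into power series in one variable\<close>

text \<open>If the k-th summand has order at least k, the terms beyond the degree of m vanish at m,
  and this is the full sum. Cutting in the definition makes additive identities hold without
  conditions on orders.\<close>

definition lfsum :: "(nat \<Rightarrow> ('m::graded_cmonoid, 'a::ab_group_add) mseries) \<Rightarrow> ('m, 'a) mseries" where
  "lfsum u = MSeries (\<lambda>m. \<Sum>k\<le>deg m. mcoef (u k) m)"

lemma mcoef_lfsum:
  assumes "\<And>k. ord_ge k (u k)" "deg m \<le> N"
  shows "mcoef (lfsum u) m = (\<Sum>k\<le>N. mcoef (u k) m)"
  unfolding lfsum_def mcoef_MSeries
  by (rule sum.mono_neutral_left) (use assms in \<open>auto simp: ord_ge_def\<close>)

lemma lfsum_mult: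
  fixes u v :: "nat \<Rightarrow> ('m::graded_cmonoid, 'a::ring) mseries"
  assumes u: "\<And>k. ord_ge k (u k)" and v: "\<And>k. ord_ge k (v k)"
  shows "lfsum u * lfsum v = lfsum (\<lambda>n. \<Sum>i\<le>n. u i * v (n - i))"
proof (rule mseries_eqI)
  fix m :: 'm
  let ?N = "deg m"
  have "mcoef (lfsum u * lfsum v) m
      = (\<Sum>(a, b)\<in>decomp m. \<Sum>k\<le>?N. \<Sum>i\<le>k. mcoef (u i) a * mcoef (v (k - i)) b)"
    unfolding mcoef_times
  proof (rule sum.cong[OF refl], clarify)
    fix a b assume "(a, b) \<in> decomp m"
    then have ab: "deg a + deg b = ?N" by (auto simp: decomp_def deg_add)
    have "mcoef (lfsum u) a * mcoef (lfsum v) b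
        = (\<Sum>i\<le>?N. mcoef (u i) a) * (\<Sum>j\<le>?N. mcoef (v j) b)"
      using ab by (subst (1 2) mcoef_lfsum[where N = "?N"]) (use u v in auto)
    also have "\<dots> = (\<Sum>(i, j)\<in>{..?N} \<times> {..?N}. mcoef (u i) a * mcoef (v j) b)"
      by (simp add: sum_product sum.cartesian_product)
    \<comment> \<open>If i + j exceeds deg a + deg b, one of the two coefficients lies below the
      order of its series.\<close>
    also have "\<dots> = (\<Sum>(i, j)\<in>{(i, j). i + j \<le> ?N}. mcoef (u i) a * mcoef (v j) b)"
    proof (rule sum.mono_neutral_right)
      show "\<forall>x\<in>{..?N} \<times> {..?N} - {(i, j). i + j \<le> ?N}. (case x of (i, j) \<Rightarrow>
          mcoef (u i) a * mcoef (v j) b) = 0"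
      proof
        fix x assume x: "x \<in> {..?N} \<times> {..?N} - {(i, j). i + j \<le> ?N}"
        obtain i j where ij: "x = (i, j)" by (cases x)
        have "deg a < i \<or> deg b < j" using x ab by (auto simp: ij)
        then show "(case x of (i, j) \<Rightarrow> mcoef (u i) a * mcoef (v j) b) = 0"
          using u v by (auto simp: ord_ge_def ij)
      qed
    qed auto
    also have "\<dots> = (\<Sum>k\<le>?N. \<Sum>i\<le>k. mcoef (u i) a * mcoef (v (k - i)) b)"
      by (rule sum.triangle_reindex_eq[of "\<lambda>i j. mcoef (u i) a * mcoef (v j) b"])
    finally show "mcoef (lfsum u) a * mcoef (lfsum v) b
        = (\<Sum>k\<le>?N. \<Sum>i\<le>k. mcoef (u i) a * mcoef (v (k - i)) b)" .
  qed
  also have "\<dots> = (\<Sum>k\<le>?N. \<Sum>i\<le>k. \<Sum>(a, b)\<in>decomp m. mcoef (u i) a * mcoef (v (k - i)) b)"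
  proof -
    have "(\<Sum>x\<in>decomp m. \<Sum>k\<le>?N. \<Sum>i\<le>k. mcoef (u i) (fst x) * mcoef (v (k - i)) (snd x))
        = (\<Sum>k\<le>?N. \<Sum>x\<in>decomp m. \<Sum>i\<le>k. mcoef (u i) (fst x) * mcoef (v (k - i)) (snd x))"
      by (rule sum.swap)
    also have "\<dots> = (\<Sum>k\<le>?N. \<Sum>i\<le>k. \<Sum>x\<in>decomp m. mcoef (u i) (fst x) * mcoef (v (k - i)) (snd x))"
      by (intro sum.cong refl sum.swap)
    finally show ?thesis by (simp add: split_def)
  qed
  also have "\<dots> = mcoef (lfsum (\<lambda>n. \<Sum>i\<le>n. u i * v (n - i))) m"
    by (simp add: lfsum_def mcoef_times)
  finally show "mcoef (lfsum u * lfsum v) m = mcoef (lfsum (\<lambda>n. \<Sum>i\<le>n. u i * v (n - i))) m" .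
qed

lemma lfsum_shift:
  assumes "\<And>k. ord_ge k (u k)" "\<And>k. ord_ge k (u (Suc k))" "u 0 = 0"
  shows "lfsum u = lfsum (\<lambda>k. u (Suc k))"
proof (rule mseries_eqI)
  fix m
  have "mcoef (lfsum u) m = (\<Sum>k\<le>Suc (deg m). mcoef (u k) m)"
    by (rule mcoef_lfsum) (use assms in auto)
  then show "mcoef (lfsum u) m = mcoef (lfsum (\<lambda>k. u (Suc k))) m"
    by (simp add: sum.atMost_Suc_shift assms lfsum_def del: sum.atMost_Suc)
qed

text \<open>Only powers of a single f occur, so identities between power series in one commuting
  variable transfer to noncommutative coefficients.\<close>

definition fpsub :: "rat fps \<Rightarrow> ('m::graded_cmonoid, 'a::rat_algebra) mseries \<Rightarrow> ('m, 'a) mseries" where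
  "fpsub F f = lfsum (\<lambda>k. fps_nth F k *\<^sub>Q f ^ k)"

lemma mcoef_fpsub:
  fixes f :: "('m::graded_cmonoid, 'a::rat_algebra) mseries"
  assumes "no_const f" "deg m \<le> N"
  shows "mcoef (fpsub F f) m = (\<Sum>k\<le>N. fps_nth F k *\<^sub>Q mcoef (f ^ k) m)"
  unfolding fpsub_def
  by (subst mcoef_lfsum[where N = N]) (use assms in \<open>auto intro: ord_ge_qscale ord_ge_power\<close>)

lemma fpsub_mult:
  fixes f :: "('m::graded_cmonoid, 'a::rat_algebra) mseries"
  assumes "no_const f"
  shows "fpsub (F * G) f = fpsub F f * fpsub G f"
proof -
  have "fpsub F f * fpsub G f
      = lfsum (\<lambda>n. \<Sum>i\<le>n. (fps_nth F i *\<^sub>Q f ^ i) * (fps_nth G (n - i) *\<^sub>Q f ^ (n - i)))"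
    unfolding fpsub_def by (rule lfsum_mult) (use assms in \<open>auto intro: ord_ge_qscale ord_ge_power\<close>)
  also have "(\<lambda>n. \<Sum>i\<le>n. (fps_nth F i *\<^sub>Q f ^ i) * (fps_nth G (n - i) *\<^sub>Q f ^ (n - i)))
      = (\<lambda>n. fps_nth (F * G) n *\<^sub>Q f ^ n)"
    by (rule ext) (simp add: fps_mult_nth qs.scale_sum_left qscale_mult_left qscale_mult_right
        qscale_qscale mult.commute atLeast0AtMost flip: power_add)
  finally show ?thesis by (simp add: fpsub_def)
qed

lemma fpsub_1: "no_const f \<Longrightarrow> fpsub 1 f = 1"
  by (rule mseries_eqI) (simp add: mcoef_fpsub[OF _ order_refl] if_distrib[where f = "\<lambda>x. x *\<^sub>Q _"]
      qscale_one cong: if_cong)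

lemma fpsub_X: "no_const f \<Longrightarrow> fpsub fps_X f = f"
proof (rule mseries_eqI)
  fix m assume "no_const f"
  then have "mcoef (fpsub fps_X f) m = (\<Sum>k\<le>Suc (deg m). fps_nth fps_X k *\<^sub>Q mcoef (f ^ k) m)"
    by (intro mcoef_fpsub) auto
  also have "\<dots> = (\<Sum>k\<le>Suc (deg m). if k = 1 then mcoef (f ^ k) m else 0)"
    by (intro sum.cong) (auto simp: qscale_one)
  finally show "mcoef (fpsub fps_X f) m = mcoef f m" by simp
qed

lemma fpsub_add: "fpsub (F + G) f = fpsub F f + fpsub G f"
  by (rule mseries_eqI) (simp add: fpsub_def lfsum_def qscale_add_left sum.distrib)

lemma fpsub_power: "no_const f \<Longrightarrow> fpsub (F ^ n) f = fpsub F f ^ n"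
  by (induction n) (simp_all add: fpsub_1 fpsub_mult)

lemma no_const_fpsub:
  assumes "no_const f" "fps_nth F 0 = 0"
  shows "no_const (fpsub F f)"
  using assms(2) by (simp add: no_const_def mcoef_fpsub[OF assms(1), of 0 0])

lemma fpsub_compose:
  fixes f :: "('m::graded_cmonoid, 'a::rat_algebra) mseries"
  assumes f: "no_const f" and G: "fps_nth G 0 = 0"
  shows "fpsub (F oo G) f = fpsub F (fpsub G f)"
proof (rule mseries_eqI)
  fix m :: 'm
  let ?N = "deg m"
  have "mcoef (fpsub F (fpsub G f)) m
      = (\<Sum>k\<le>?N. \<Sum>n\<le>?N. (fps_nth F k * fps_nth (G ^ k) n) *\<^sub>Q mcoef (f ^ n) m)"
    by (simp add: mcoef_fpsub[OF no_const_fpsub[OF f G] order_refl] fpsub_power[OF f, symmetric]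
        mcoef_fpsub[OF f order_refl] qs.scale_sum_right qscale_qscale)
  also have "\<dots> = (\<Sum>n\<le>?N. \<Sum>k\<le>?N. (fps_nth F k * fps_nth (G ^ k) n) *\<^sub>Q mcoef (f ^ n) m)"
    by (rule sum.swap)
  \<comment> \<open>G^k starts in degree k, so the square of indices shrinks to the triangle k \<le>
    n.\<close>
  also have "\<dots> = (\<Sum>n\<le>?N. \<Sum>k\<le>n. (fps_nth F k * fps_nth (G ^ k) n) *\<^sub>Q mcoef (f ^ n) m)"
    by (intro sum.cong refl sum.mono_neutral_right) (auto simp: startsby_zero_power_prefix[OF G])
  also have "\<dots> = mcoef (fpsub (F oo G) f) m"
    by (simp add: mcoef_fpsub[OF f order_refl] fps_compose_nth qs.scale_sum_left atLeast0AtMost)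
  finally show "mcoef (fpsub (F oo G) f) m = mcoef (fpsub F (fpsub G f)) m" ..
qed

definition sexp :: "('m::graded_cmonoid, 'a::rat_algebra) mseries \<Rightarrow> ('m, 'a) mseries" where
  "sexp f = fpsub (fps_exp 1) f"

text \<open>\<open>fps_ln 1\<close> is the series log (1 + X): this is the logarithm of 1 + f, and
  \<open>sinv\<close> below is likewise the inverse of 1 + f.\<close>

definition slog :: "('m::graded_cmonoid, 'a::rat_algebra) mseries \<Rightarrow> ('m, 'a) mseries" where
  "slog f = fpsub (fps_ln 1) f"

definition sinv :: "('m::graded_cmonoid, 'a::rat_algebra) mseries \<Rightarrow> ('m, 'a) mseries" where
  "sinv f = fpsub (inverse (1 + fps_X)) f"

lemma no_const_slog: "no_const f \<Longrightarrow> no_const (slog f)"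
  unfolding slog_def by (rule no_const_fpsub) auto

lemma sexp_slog: "no_const f \<Longrightarrow> sexp (slog f) = 1 + f"
proof -
  assume f: "no_const f"
  have "(fps_exp (1::rat) - 1) oo fps_ln 1 = fps_X"
    unfolding fps_ln_fps_exp_inv[OF one_neq_zero] by (rule fps_inv_right) auto
  then have "fps_exp (1::rat) oo fps_ln 1 = 1 + fps_X"
    by (simp add: fps_compose_sub_distrib algebra_simps)
  then show ?thesis
    unfolding sexp_def slog_def
    using f by (simp add: fpsub_add fpsub_1 fpsub_X flip: fpsub_compose)
qed

lemma sinv_right: "no_const f \<Longrightarrow> (1 + f) * sinv f = 1"
  and sinv_left: "no_const f \<Longrightarrow> sinv f * (1 + f) = 1"
proof -
  assume f: "no_const f"
  have "1 + f = fpsub (1 + fps_X) f" using f by (simp add: fpsub_add fpsub_1 fpsub_X)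
  then show "(1 + f) * sinv f = 1" "sinv f * (1 + f) = 1"
    using f by (simp_all add: sinv_def inverse_mult_eq_1 inverse_mult_eq_1' fpsub_1
        flip: fpsub_mult)
qed

subsection \<open>Coefficientwise maps and derivations\<close>

definition map_mseries :: "('a \<Rightarrow> 'b) \<Rightarrow> ('m, 'a) mseries \<Rightarrow> ('m, 'b) mseries" where
  "map_mseries h f = MSeries (\<lambda>m. h (mcoef f m))"

lemma mcoef_map [simp]: "mcoef (map_mseries h f) m = h (mcoef f m)"
  by (simp add: map_mseries_def)

text \<open>The structure that the T_l respect: linear maps compatible with commutators, in general
  not multiplicative.\<close>

definition lie_map :: "('a::rat_algebra \<Rightarrow> 'b::rat_algebra) \<Rightarrow> bool" where
  "lie_map h \<longleftrightarrow> (\<forall>x y. h (x + y) = h x + h y) \<and> (\<forall>q x. h (q *\<^sub>Q x) = q *\<^sub>Q h x)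
     \<and> (\<forall>x y. h (lie_bracket x y) = lie_bracket (h x) (h y))"

lemma lie_map_simps:
  assumes "lie_map h"
  shows "h (x + y) = h x + h y" "h (q *\<^sub>Q x) = q *\<^sub>Q h x"
    "h (lie_bracket x y) = lie_bracket (h x) (h y)" "h 0 = 0" "h (x - y) = h x - h y"
    "h (sum f A) = (\<Sum>a\<in>A. h (f a))"
proof -
  show add: "h (x + y) = h x + h y" for x y using assms by (simp add: lie_map_def)
  show "h (q *\<^sub>Q x) = q *\<^sub>Q h x" "h (lie_bracket x y) = lie_bracket (h x) (h y)"
    using assms by (simp_all add: lie_map_def)
  show 0: "h 0 = 0" using add[of 0 0] by simp
  show "h (x - y) = h x - h y" using add[of "x - y" y] by (simp add: algebra_simps)
  show "h (sum f A) = (\<Sum>a\<in>A. h (f a))"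
    by (induction A rule: infinite_finite_induct) (auto simp: 0 add)
qed

text \<open>Indices commute, so the reversed product sums over the same decompositions of m with the
  two coefficients in reversed order.\<close>

lemma mcoef_lie_bracket:
  fixes f g :: "('m::graded_cmonoid, 'a::rat_algebra) mseries"
  shows "mcoef (lie_bracket f g) m = (\<Sum>(a, b)\<in>decomp m. lie_bracket (mcoef f a) (mcoef g b))"
proof -
  have "mcoef (g * f) m = (\<Sum>(a, b)\<in>decomp m. mcoef g b * mcoef f a)"
    unfolding mcoef_times
    by (rule sum.reindex_bij_witness[where i = "\<lambda>(a, b). (b, a)" and j = "\<lambda>(a, b). (b, a)"])
      (auto simp: decomp_def add.commute)
  then show ?thesis
    by (simp add: lie_bracket_def mcoef_times split_def sum_subtractf)
qed

lemma map_mseries_bracket: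
  "lie_map h \<Longrightarrow> map_mseries h (lie_bracket f g)
     = lie_bracket (map_mseries h f) (map_mseries h (g :: ('m::graded_cmonoid, 'a::rat_algebra) mseries))"
  by (rule mseries_eqI) (simp add: mcoef_lie_bracket lie_map_simps split_def)

lemma map_mseries_lin:
  assumes "lie_map h"
  shows "map_mseries h (f + g) = map_mseries h f + map_mseries h g"
    "map_mseries h (q *\<^sub>Q f) = q *\<^sub>Q map_mseries h f"
    "map_mseries h (0 :: ('m::graded_cmonoid, 'a::rat_algebra) mseries) = 0"
  by (rule mseries_eqI; simp add: lie_map_simps[OF assms])+

lemma map_mseries_lfsum:
  "lie_map h \<Longrightarrow> map_mseries h (lfsum u) = lfsum (\<lambda>k. map_mseries h (u k))"
  by (rule mseries_eqI) (simp add: lfsum_def lie_map_simps)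

lemma no_const_map: "lie_map h \<Longrightarrow> no_const f \<Longrightarrow> no_const (map_mseries h f)"
  by (simp add: no_const_def lie_map_simps)

text \<open>For additive \<chi> this is the Euler derivation, which multiplies every term by its
  exponent in the direction counted by \<chi>.\<close>

definition derv :: "('m::graded_cmonoid \<Rightarrow> nat) \<Rightarrow> ('m, 'a::rat_algebra) mseries \<Rightarrow> ('m, 'a) mseries" where
  "derv \<chi> f = MSeries (\<lambda>m. of_nat (\<chi> m) *\<^sub>Q mcoef f m)"

lemma mcoef_derv [simp]: "mcoef (derv \<chi> f) m = of_nat (\<chi> m) *\<^sub>Q mcoef f m"
  by (simp add: derv_def)

lemma derv_lin: "derv \<chi> (f + g) = derv \<chi> f + derv \<chi> g" "derv \<chi> (q *\<^sub>Q f) = q *\<^sub>Q derv \<chi> f"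
  by (rule mseries_eqI; simp add: qscale_add_right qscale_qscale mult.commute)+

lemma derv_lfsum: "derv \<chi> (lfsum u) = lfsum (\<lambda>k. derv \<chi> (u k))"
  by (rule mseries_eqI) (simp add: lfsum_def qs.scale_sum_right)

lemma derv_map: "lie_map h \<Longrightarrow> derv \<chi> (map_mseries h f) = map_mseries h (derv \<chi> f)"
  by (rule mseries_eqI) (simp add: lie_map_simps)

lemma ord_ge_derv: "ord_ge k f \<Longrightarrow> ord_ge k (derv \<chi> f)"
  by (simp add: ord_ge_def)

lemma derv_mult:
  assumes "\<And>a b. \<chi> (a + b) = \<chi> a + \<chi> b"
  shows "derv \<chi> (f * g) = derv \<chi> f * g + f * derv \<chi> g"
  by (rule mseries_eqI)
    (auto simp: mcoef_times qs.scale_sum_right decomp_def split_def assms qscale_mult_left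
      qscale_mult_right qscale_add_left simp flip: sum.distrib intro!: sum.cong)

lemma derv_1:
  assumes "\<And>a b. \<chi> (a + b) = \<chi> a + \<chi> b"
  shows "derv \<chi> 1 = 0"
proof -
  have "\<chi> 0 = 0" using assms[of 0 0] by simp
  then show ?thesis by (intro mseries_eqI) (simp add: mcoef_one)
qed

abbreviation ad_pow :: "nat \<Rightarrow> 'a::ring \<Rightarrow> 'a \<Rightarrow> 'a" where
  "ad_pow k X Y \<equiv> (lie_bracket X ^^ k) Y"

text \<open>The factors D X are moved to the left. Each passage across X costs a bracket, X Z =
  [X, Z] + Z X, and the resulting coefficients obey Pascal's rule.\<close>

lemma derv_power:
  fixes X :: "('m::graded_cmonoid, 'a::rat_algebra) mseries"
  assumes "\<And>a b. \<chi> (a + b) = \<chi> a + \<chi> b"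
  shows "derv \<chi> (X ^ Suc n)
    = (\<Sum>k\<le>n. of_nat (Suc n choose Suc k) *\<^sub>Q (ad_pow k X (derv \<chi> X) * X ^ (n - k)))"
proof (induction n)
  case 0
  then show ?case by (simp add: qscale_one)
next
  case (Suc n)
  let ?Z = "\<lambda>k. ad_pow k X (derv \<chi> X)"
  have comm: "X * ?Z k = ?Z (Suc k) + ?Z k * X" for k
    by (simp add: lie_bracket_def)
  have "X * derv \<chi> (X ^ Suc n)
      = (\<Sum>k\<le>n. of_nat (Suc n choose Suc k) *\<^sub>Q (?Z (Suc k) * X ^ (n - k)))
      + (\<Sum>k\<le>n. of_nat (Suc n choose Suc k) *\<^sub>Q (?Z k * X ^ (Suc n - k)))"
    unfolding Suc.IH sum_distrib_left sum.distrib[symmetric]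
  proof (rule sum.cong[OF refl])
    fix k assume k: "k \<in> {..n}"
    have "X * (?Z k * X ^ (n - k)) = ?Z (Suc k) * X ^ (n - k) + ?Z k * X ^ (Suc n - k)"
      using k by (simp only: mult.assoc[symmetric] comm distrib_right)
        (simp add: Suc_diff_le mult.assoc)
    then show "X * (of_nat (Suc n choose Suc k) *\<^sub>Q (?Z k * X ^ (n - k))) =
        of_nat (Suc n choose Suc k) *\<^sub>Q (?Z (Suc k) * X ^ (n - k)) +
        of_nat (Suc n choose Suc k) *\<^sub>Q (?Z k * X ^ (Suc n - k))"
      by (simp only: qscale_mult_right qscale_add_right)
  qed
  \<comment> \<open>The summand (D X) X^(n+1) of the product rule fills the slot k = 0 left open by
    shifting the first sum.\<close>
  also have "(\<Sum>k\<le>n. of_nat (Suc n choose Suc k) *\<^sub>Q (?Z (Suc k) * X ^ (n - k)))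
      + derv \<chi> X * X ^ Suc n = (\<Sum>k\<le>Suc n. of_nat (Suc n choose k) *\<^sub>Q (?Z k * X ^ (Suc n - k)))"
    by (simp add: sum.atMost_Suc_shift qscale_one algebra_simps del: sum.atMost_Suc funpow.simps)
  then have "(\<Sum>k\<le>n. of_nat (Suc n choose Suc k) *\<^sub>Q (?Z (Suc k) * X ^ (n - k)))
      = (\<Sum>k\<le>Suc n. of_nat (Suc n choose k) *\<^sub>Q (?Z k * X ^ (Suc n - k))) - derv \<chi> X * X ^ Suc n"
    by (simp only: eq_diff_eq)
  also have "(\<Sum>k\<le>n. of_nat (Suc n choose Suc k) *\<^sub>Q (?Z k * X ^ (Suc n - k)))
     = (\<Sum>k\<le>Suc n. of_nat (Suc n choose Suc k) *\<^sub>Q (?Z k * X ^ (Suc n - k)))"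
    by (simp add: binomial_eq_0)
  finally have "X * derv \<chi> (X ^ Suc n) + derv \<chi> X * X ^ Suc n
      = (\<Sum>k\<le>Suc n. of_nat (Suc n choose k) *\<^sub>Q (?Z k * X ^ (Suc n - k)))
      + (\<Sum>k\<le>Suc n. of_nat (Suc n choose Suc k) *\<^sub>Q (?Z k * X ^ (Suc n - k)))"
    by (simp only: algebra_simps)
  also have "\<dots> = (\<Sum>k\<le>Suc n. of_nat (Suc (Suc n) choose Suc k) *\<^sub>Q (?Z k * X ^ (Suc n - k)))"
    by (simp only: sum.distrib[symmetric] qscale_add_left[symmetric] of_nat_add[symmetric]
        binomial_Suc_Suc)
  finally show ?case
    by (simp only: power_Suc[of X "Suc n"] derv_mult[OF assms] add.commute)
qed

text \<open>This is ((exp (ad X) - 1) / ad X) applied to Z.\<close>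

definition exp_factor where
  "exp_factor X Z = lfsum (\<lambda>k. (1 / fact (Suc k)) *\<^sub>Q ad_pow k X (Z :: ('m::graded_cmonoid, 'a::rat_algebra) mseries))"

lemma ord_ge_ad_pow:
  fixes X :: "('m::graded_cmonoid, 'a::rat_algebra) mseries"
  assumes "no_const X"
  shows "ord_ge k (ad_pow k X Z)"
proof (induction k)
  case (Suc k)
  have X: "ord_ge 1 X" using assms by (simp add: no_const_iff_ord_ge)
  show ?case
    using ord_ge_mult[OF X Suc] ord_ge_mult[OF Suc X]
    by (auto simp: lie_bracket_def intro: ord_ge_lin)
qed simp

text \<open>Divided by n! and summed over n, the formula for D (X^n) becomes the Cauchy product of
  the series of iterated brackets with exp X. The left factor contains brackets only, which is what
  a Lie map can transport.\<close>

lemma derv_sexp: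
  fixes X :: "('m::graded_cmonoid, 'a::rat_algebra) mseries"
  assumes \<chi>: "\<And>a b. \<chi> (a + b) = \<chi> a + \<chi> b" and X: "no_const X"
  shows "derv \<chi> (sexp X) = exp_factor X (derv \<chi> X) * sexp X"
proof -
  let ?u = "\<lambda>n. (1 / fact n) *\<^sub>Q derv \<chi> (X ^ n)"
  have Z: "?u (Suc n) = (\<Sum>i\<le>n. ((1 / fact (Suc i)) *\<^sub>Q ad_pow i X (derv \<chi> X)) *
      ((1 / fact (n - i)) *\<^sub>Q X ^ (n - i)))" for n
  proof -
    have "(1 / fact (Suc n)) * of_nat (Suc n choose Suc i) = (1 / fact (Suc i)) * (1 / fact (n - i) :: rat)"
      if "i \<le> n" for i
      using binomial_fact[of "Suc i" "Suc n", where 'a = rat] that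
      by (simp add: field_simps del: fact_Suc binomial_Suc_Suc)
    then show ?thesis
      unfolding derv_power[OF \<chi>] qs.scale_sum_right
      by (intro sum.cong refl) (simp add: qscale_mult_left qscale_mult_right qscale_qscale mult.commute)
  qed
  have "exp_factor X (derv \<chi> X) * sexp X
      = lfsum (\<lambda>k. (1 / fact (Suc k)) *\<^sub>Q ad_pow k X (derv \<chi> X)) * lfsum (\<lambda>k. (1 / fact k) *\<^sub>Q X ^ k)"
    by (simp add: exp_factor_def sexp_def fpsub_def)
  also have "\<dots> = lfsum (\<lambda>n. ?u (Suc n))"
    unfolding Z
    by (rule lfsum_mult) (intro ord_ge_qscale ord_ge_ad_pow X ord_ge_power)+
  also have "\<dots> = lfsum ?u"
    by (rule lfsum_shift[symmetric])
      (auto intro!: ord_ge_qscale ord_ge_derv ord_ge_mono[OF ord_ge_power[OF X]]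
        simp: derv_1[OF \<chi>] simp del: power_Suc)
  also have "\<dots> = derv \<chi> (sexp X)"
    by (simp add: sexp_def fpsub_def derv_lfsum derv_lin)
  finally show ?thesis ..
qed

lemma map_exp_factor:
  assumes "lie_map h"
  shows "map_mseries h (exp_factor X Z) = exp_factor (map_mseries h X) (map_mseries h Z)"
proof -
  have "map_mseries h (ad_pow k X Z) = ad_pow k (map_mseries h X) (map_mseries h Z)" for k
    by (induction k) (simp_all add: map_mseries_bracket[OF assms])
  then show ?thesis
    by (simp add: exp_factor_def map_mseries_lfsum[OF assms] map_mseries_lin[OF assms])
qed


subsection \<open>The group-like series\<close>

definition gexp :: "('a::rat_algebra \<Rightarrow> 'b::rat_algebra) \<Rightarrow> ('m::graded_cmonoid, 'a) mseries \<Rightarrow> ('m, 'b) mseries" where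
  "gexp h c = sexp (map_mseries h (slog c))"

text \<open>The logarithmic derivative of 1 + c is a combination of brackets of log (1 + c) and its
  derivative. Hence h maps it to the logarithmic derivative of exp (h (log (1 + c))), although h
  need not be multiplicative.\<close>

lemma derv_gexp:
  assumes \<chi>: "\<And>a b. \<chi> (a + b) = \<chi> a + \<chi> b" and h: "lie_map h" and c: "no_const c"
  shows "derv \<chi> (gexp h c) = map_mseries h (derv \<chi> c * sinv c) * gexp h c"
proof -
  let ?X = "slog c"
  have X: "no_const ?X" using c by (rule no_const_slog)
  have "derv \<chi> c = derv \<chi> (1 + c)" by (simp add: derv_lin derv_1[OF \<chi>])
  also have "\<dots> = exp_factor ?X (derv \<chi> ?X) * (1 + c)"
    using derv_sexp[OF \<chi> X] by (simp add: sexp_slog[OF c])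
  finally have "derv \<chi> c * sinv c = exp_factor ?X (derv \<chi> ?X)"
    by (simp add: mult.assoc sinv_right[OF c])
  then show ?thesis
    unfolding gexp_def derv_sexp[OF \<chi> no_const_map[OF h X]]
    by (simp add: map_exp_factor[OF h] derv_map[OF h])
qed

text \<open>Since y has no terms with \<chi> = 0, the equation expresses a coefficient of F with
  \<chi> m > 0 through coefficients of F with smaller \<chi>; those with \<chi> = 0 are the initial
  condition.\<close>

lemma derv_equation_unique:
  fixes F G y :: "('m::graded_cmonoid, 'a::rat_algebra) mseries"
  assumes \<chi>: "\<And>a b. \<chi> (a + b) = \<chi> a + \<chi> b"
    and y: "\<And>m. \<chi> m = 0 \<Longrightarrow> mcoef y m = 0"
    and F: "derv \<chi> F = y * F" and G: "derv \<chi> G = y * G"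
    and eq: "\<And>m. \<chi> m = 0 \<Longrightarrow> mcoef F m = mcoef G m"
  shows "F = G"
proof (rule mseries_eqI)
  fix m
  show "mcoef F m = mcoef G m"
  proof (induction "\<chi> m" arbitrary: m rule: less_induct)
    case less
    show ?case
    proof (cases "\<chi> m = 0")
      case False
      have "mcoef (y * F) m = mcoef (y * G) m"
        unfolding mcoef_times
      proof (rule sum.cong[OF refl], clarify)
        fix a b assume "(a, b) \<in> decomp m"
        then have m: "\<chi> m = \<chi> a + \<chi> b" by (auto simp: decomp_def \<chi>)
        show "mcoef y a * mcoef F b = mcoef y a * mcoef G b"
          using y[of a] less[of b] m by (cases "\<chi> a = 0") auto
      qed
      then have "of_nat (\<chi> m) *\<^sub>Q mcoef F m = of_nat (\<chi> m) *\<^sub>Q mcoef G m"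
        by (metis F G mcoef_derv)
      then show ?thesis using False by simp
    qed (rule eq)
  qed
qed

section \<open>Restriction of series to faces of the index monoid\<close>

definition mrestrict :: "'m set \<Rightarrow> ('m, 'a::zero) mseries \<Rightarrow> ('m, 'a) mseries" where
  "mrestrict S f = MSeries (\<lambda>m. if m \<in> S then mcoef f m else 0)"

lemma mcoef_mrestrict: "mcoef (mrestrict S f) m = (if m \<in> S then mcoef f m else 0)"
  by (simp add: mrestrict_def)

text \<open>Summands of an element of S again lie in S, so terms outside S never contribute inside,
  and restriction is multiplicative. Typical faces consist of the indices in which a given variable
  does not occur.\<close>

definition face :: "'m::comm_monoid_add set \<Rightarrow> bool" where
  "face S \<longleftrightarrow> 0 \<in> S \<and> (\<forall>a b. a + b \<in> S \<longleftrightarrow> a \<in> S \<and> b \<in> S)"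

lemma mrestrict_mult: "face S \<Longrightarrow> mrestrict S (f * g) = mrestrict S f * mrestrict S (g :: ('m::graded_cmonoid, 'a::ring) mseries)"
  by (rule mseries_eqI)
    (auto simp: mcoef_mrestrict mcoef_times face_def decomp_def intro!: sum.cong sum.neutral)

lemma mrestrict_power: "face S \<Longrightarrow> mrestrict S (f ^ n) = mrestrict S f ^ n"
  for f :: "('m::graded_cmonoid, 'a::rat_algebra) mseries"
proof (induction n)
  case 0
  then show ?case by (intro mseries_eqI) (auto simp: mcoef_mrestrict mcoef_one face_def)
qed (simp add: mrestrict_mult)

lemma mrestrict_fpsub: "face S \<Longrightarrow> mrestrict S (fpsub F f) = fpsub F (mrestrict S f)"
  by (rule mseries_eqI)
    (auto simp: fpsub_def lfsum_def mcoef_mrestrict simp flip: mrestrict_power)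

lemma mrestrict_map: "lie_map h \<Longrightarrow> mrestrict S (map_mseries h f) = map_mseries h (mrestrict S f)"
  by (rule mseries_eqI) (simp add: mcoef_mrestrict lie_map_simps)

lemma mrestrict_gexp:
  "face S \<Longrightarrow> lie_map h \<Longrightarrow> mrestrict S (gexp h c) = gexp h (mrestrict S c)"
  by (simp add: gexp_def sexp_def slog_def mrestrict_fpsub mrestrict_map)

lemma gexp_0: "lie_map h \<Longrightarrow> gexp h (0 :: ('m::graded_cmonoid, 'a::rat_algebra) mseries) = 1"
proof -
  assume h: "lie_map h"
  have pow: "mcoef ((0::('n::graded_cmonoid, 'c::rat_algebra) mseries) ^ k) m = (if k = 0 \<and> m = 0 then 1 else 0)" for k m
    by (cases k) (simp_all add: mcoef_one)
  have "slog (0 :: ('m, 'a) mseries) = 0"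
    by (rule mseries_eqI) (auto simp: slog_def fpsub_def lfsum_def pow intro!: sum.neutral)
  then have "gexp h (0 :: ('m, 'a) mseries) = fpsub (fps_exp 1) 0"
    by (simp add: gexp_def sexp_def map_mseries_lin[OF h])
  also have "\<dots> = 1"
    by (rule mseries_eqI) (auto simp: mcoef_fpsub[OF _ order_refl] no_const_def pow mcoef_one qscale_one
        if_distrib[where f = "\<lambda>x. _ *\<^sub>Q x"] sum.delta cong: if_cong)
  finally show ?thesis .
qed

text \<open>Both sides solve the same linear differential equation in the direction counted by \<open>\<chi>\<close>.\<close>

lemma gexp_mult:
  fixes \<chi> :: "'m::graded_cmonoid \<Rightarrow> nat"
    and a b :: "('m, 'a::rat_algebra) mseries" and h :: "'a \<Rightarrow> 'b::rat_algebra"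
  assumes \<chi>: "\<And>a b. \<chi> (a + b) = \<chi> a + \<chi> b" and h: "lie_map h"
    and a: "\<And>m. \<chi> m = 0 \<Longrightarrow> mcoef a m = 0"
    and b: "\<And>m. \<chi> m \<noteq> 0 \<Longrightarrow> mcoef b m = 0" "no_const b"
  shows "gexp h a * gexp h b = gexp h (a + b + a * b)"
proof (rule derv_equation_unique[OF \<chi>])
  let ?c = "a + b + a * b" and ?y = "map_mseries h (derv \<chi> a * sinv a)"
  let ?S = "{m. \<chi> m = 0}"
  have \<chi>0: "\<chi> 0 = 0" using \<chi>[of 0 0] by simp
  have S: "face ?S" by (auto simp: face_def \<chi> \<chi>0)
  have a0: "no_const a" using a[OF \<chi>0] by (simp add: no_const_def)
  have c0: "no_const ?c" using a0 b(2) by (simp add: no_const_def mcoef_times decomp_0)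
  have c: "1 + ?c = (1 + a) * (1 + b)" by (simp add: algebra_simps)
  have db: "derv \<chi> b = 0" using b(1) by (intro mseries_eqI) auto
  show "mcoef ?y m = 0" if "\<chi> m = 0" for m
    using that by (auto simp: lie_map_simps[OF h] mcoef_times decomp_def \<chi> intro!: sum.neutral)
  show "derv \<chi> (gexp h a * gexp h b) = ?y * (gexp h a * gexp h b)"
    by (simp add: derv_mult[OF \<chi>] derv_gexp[OF \<chi> h] a0 b(2) db map_mseries_lin[OF h] mult.assoc)
  \<comment> \<open>As D b = 0, the derivative of c is (D a) (1 + b); with 1 + c = (1 + a) (1 + b)
    the factor 1 + b cancels, so c has the same logarithmic derivative as a.\<close>
  have "sinv ?c = sinv ?c * ((1 + a) * ((1 + b) * sinv b) * sinv a)"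
    by (simp add: sinv_right a0 b(2))
  also have "\<dots> = sinv ?c * (1 + ?c) * (sinv b * sinv a)" by (simp add: c mult.assoc)
  also have "\<dots> = sinv b * sinv a" by (simp add: sinv_left[OF c0])
  finally have "derv \<chi> ?c * sinv ?c = derv \<chi> a * ((1 + b) * sinv b) * sinv a"
    by (simp add: derv_lin derv_mult[OF \<chi>] db algebra_simps)
  also have "\<dots> = derv \<chi> a * sinv a" by (simp add: sinv_right b(2))
  finally show "derv \<chi> (gexp h ?c) = ?y * gexp h ?c"
    by (simp add: derv_gexp[OF \<chi> h c0])
  \<comment> \<open>The initial condition: on the face \<chi> = 0 the series a vanishes, and both
    sides restrict to the restriction of \<open>gexp h b\<close>.\<close>
  fix m assume m: "\<chi> m = 0"
  have ra: "mrestrict ?S a = 0" by (rule mseries_eqI) (simp add: mcoef_mrestrict a)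
  have "mrestrict ?S ?c = mrestrict ?S b"
  proof (rule mseries_eqI)
    fix m
    have "mcoef (mrestrict ?S (a * b)) m = 0" by (simp add: mrestrict_mult[OF S] ra)
    then show "mcoef (mrestrict ?S ?c) m = mcoef (mrestrict ?S b) m"
      by (auto simp: mcoef_mrestrict a split: if_splits)
  qed
  then have "mrestrict ?S (gexp h a * gexp h b) = mrestrict ?S (gexp h ?c)"
    by (simp add: mrestrict_mult[OF S] mrestrict_gexp[OF S h] ra gexp_0[OF h])
  then have "mcoef (mrestrict ?S (gexp h a * gexp h b)) m = mcoef (mrestrict ?S (gexp h ?c)) m"
    by simp
  with m show "mcoef (gexp h a * gexp h b) m = mcoef (gexp h ?c) m"
    by (simp add: mcoef_mrestrict)
qed


subsection \<open>Substitution of series for the elements of the index monoid\<close>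

text \<open>Finiteness makes each coefficient of a substituted series a finite sum.
  \<open>phi_deg\<close> preserves the absence of a constant term and lets one cutoff serve both
  sides when substitution meets a series of powers.\<close>

locale msubst =
  fixes \<phi> :: "'n::graded_cmonoid \<Rightarrow> ('m::graded_cmonoid, rat) mseries"
  assumes phi_0: "\<phi> 0 = 1" and phi_add: "\<phi> (\<mu> + \<nu>) = \<phi> \<mu> * \<phi> \<nu>"
    and finite_supp: "finite {\<mu>. mcoef (\<phi> \<mu>) m \<noteq> 0}"
    and phi_deg: "mcoef (\<phi> \<mu>) m \<noteq> 0 \<Longrightarrow> deg \<mu> \<le> deg m"
begin

definition supp where "supp m = {\<mu>. mcoef (\<phi> \<mu>) m \<noteq> 0}"

definition sub :: "('n, 'a::rat_algebra) mseries \<Rightarrow> ('m, 'a) mseries" where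
  "sub f = MSeries (\<lambda>m. \<Sum>\<mu>\<in>supp m. mcoef (\<phi> \<mu>) m *\<^sub>Q mcoef f \<mu>)"

lemma mcoef_sub: "finite S \<Longrightarrow> supp m \<subseteq> S \<Longrightarrow>
    mcoef (sub f) m = (\<Sum>\<mu>\<in>S. mcoef (\<phi> \<mu>) m *\<^sub>Q mcoef f \<mu>)"
  unfolding sub_def mcoef_MSeries
  by (rule sum.mono_neutral_left) (auto simp: supp_def)

lemma finite_supp' [simp]: "finite (supp m)"
  using finite_supp by (simp add: supp_def)

lemma sub_lin: "sub (f + g) = sub f + sub g" "sub (q *\<^sub>Q f) = q *\<^sub>Q sub f"
  by (rule mseries_eqI; simp add: sub_def qscale_add_right sum.distrib qscale_qscale
      qs.scale_sum_right mult.commute)+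

lemma sub_1: "sub 1 = 1"
proof (rule mseries_eqI)
  fix m
  have "mcoef (sub 1) m = (\<Sum>\<mu>\<in>insert 0 (supp m). mcoef (\<phi> \<mu>) m *\<^sub>Q mcoef 1 \<mu>)"
    by (rule mcoef_sub) auto
  also have "\<dots> = mcoef (\<phi> 0) m *\<^sub>Q 1"
    by (subst sum.remove[of _ 0]) (auto simp: mcoef_one intro!: sum.neutral)
  finally show "mcoef (sub 1) m = mcoef 1 m" by (cases "m = 0") (simp_all add: phi_0 mcoef_one qscale_one)
qed

lemma sub_mult: "sub (f * g) = sub f * sub g"
proof (rule mseries_eqI)
  fix m
  \<comment> \<open>All sums are moved to common finite sets: B holds every index visible in some
    factor of m, and Q also the splittings of the indices visible in m itself.\<close>
  define B where "B = (\<Union>(a, b)\<in>decomp m. supp a \<union> supp b)"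
  define Q where "Q = (\<Union>\<mu>\<in>supp m. decomp \<mu>) \<union> B \<times> B"
  have "finite B" unfolding B_def by (intro finite_UN_I finite_decomp) auto
  then have fin: "finite B" "finite Q" by (simp_all add: Q_def)
  let ?t = "\<lambda>(\<alpha>, \<beta>). \<Sum>(a, b)\<in>decomp m. (mcoef (\<phi> \<alpha>) a *\<^sub>Q mcoef f \<alpha>) * (mcoef (\<phi> \<beta>) b *\<^sub>Q mcoef g \<beta>)"
  have t: "?t (\<alpha>, \<beta>) = mcoef (\<phi> (\<alpha> + \<beta>)) m *\<^sub>Q (mcoef f \<alpha> * mcoef g \<beta>)" for \<alpha> \<beta>
    by (simp add: phi_add mcoef_times split_def qs.scale_sum_left qscale_mult_left qscale_mult_right
        qscale_qscale mult.commute)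
  have "mcoef (sub (f * g)) m
      = (\<Sum>\<mu>\<in>supp m. \<Sum>x\<in>decomp \<mu>. mcoef (\<phi> \<mu>) m *\<^sub>Q (mcoef f (fst x) * mcoef g (snd x)))"
    by (simp add: sub_def mcoef_times split_def qs.scale_sum_right)
  also have "\<dots> = (\<Sum>\<mu>\<in>supp m. \<Sum>x\<in>decomp \<mu>. ?t x)"
  proof (intro sum.cong refl)
    fix \<mu> :: 'n and x assume "x \<in> decomp \<mu>"
    moreover obtain \<alpha> \<beta> where "x = (\<alpha>, \<beta>)" by (cases x)
    ultimately show "mcoef (\<phi> \<mu>) m *\<^sub>Q (mcoef f (fst x) * mcoef g (snd x)) = ?t x"
      using t[of \<alpha> \<beta>] by (simp add: in_decomp_iff)
  qed
  also have "\<dots> = (\<Sum>x\<in>(\<Union>\<mu>\<in>supp m. decomp \<mu>). ?t x)"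
    by (rule sum.UNION_disjoint[symmetric]) (simp, simp, auto simp: decomp_def)
  also have "\<dots> = (\<Sum>x\<in>Q. ?t x)"
  proof (rule sum.mono_neutral_left[OF fin(2)])
    show "\<forall>x\<in>Q - (\<Union>\<mu>\<in>supp m. decomp \<mu>). ?t x = 0"
    proof
      fix x assume x: "x \<in> Q - (\<Union>\<mu>\<in>supp m. decomp \<mu>)"
      obtain \<alpha> \<beta> where [simp]: "x = (\<alpha>, \<beta>)" by (cases x)
      have "\<alpha> + \<beta> \<notin> supp m" using x by (auto simp: decomp_def)
      then show "?t x = 0" using t[of \<alpha> \<beta>] by (simp add: supp_def)
    qed
  qed (auto simp: Q_def)
  also have "\<dots> = (\<Sum>x\<in>B \<times> B. ?t x)"
  proof (rule sum.mono_neutral_right[OF fin(2)])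
    show "\<forall>x\<in>Q - B \<times> B. ?t x = 0"
    proof
      fix x assume x: "x \<in> Q - B \<times> B"
      obtain \<alpha> \<beta> where [simp]: "x = (\<alpha>, \<beta>)" by (cases x)
      have n: "\<not> (\<alpha> \<in> B \<and> \<beta> \<in> B)" using x by simp
      show "?t x = 0"
        unfolding \<open>x = (\<alpha>, \<beta>)\<close> split_conv
      proof (rule sum.neutral, clarify)
        fix a b assume ab: "(a, b) \<in> decomp m"
        have "\<alpha> \<notin> supp a \<or> \<beta> \<notin> supp b" using n ab by (auto simp: B_def)
        then show "(mcoef (\<phi> \<alpha>) a *\<^sub>Q mcoef f \<alpha>) * (mcoef (\<phi> \<beta>) b *\<^sub>Q mcoef g \<beta>) = 0"
          by (auto simp: supp_def)
      qed
    qed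
  qed (auto simp: Q_def)
  also have "\<dots> = (\<Sum>(a, b)\<in>decomp m. \<Sum>(\<alpha>, \<beta>)\<in>B \<times> B.
      (mcoef (\<phi> \<alpha>) a *\<^sub>Q mcoef f \<alpha>) * (mcoef (\<phi> \<beta>) b *\<^sub>Q mcoef g \<beta>))"
    unfolding split_def by (rule sum.swap)
  also have "\<dots> = (\<Sum>(a, b)\<in>decomp m. mcoef (sub f) a * mcoef (sub g) b)"
  proof (rule sum.cong[OF refl], clarify)
    fix a b assume ab: "(a, b) \<in> decomp m"
    have "supp a \<subseteq> B" "supp b \<subseteq> B" using ab by (auto simp: B_def)
    then show "(\<Sum>(\<alpha>, \<beta>)\<in>B \<times> B. (mcoef (\<phi> \<alpha>) a *\<^sub>Q mcoef f \<alpha>) * (mcoef (\<phi> \<beta>) b *\<^sub>Q mcoef g \<beta>))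
        = mcoef (sub f) a * mcoef (sub g) b"
      by (simp add: mcoef_sub[OF fin(1)] sum_product sum.cartesian_product)
  qed
  finally show "mcoef (sub (f * g)) m = mcoef (sub f * sub g) m" by (simp add: mcoef_times)
qed

lemma sub_power: "sub (f ^ n) = sub f ^ n"
  by (induction n) (simp_all add: sub_1 sub_mult)

lemma no_const_sub:
  assumes "no_const f" shows "no_const (sub f)"
proof -
  have "\<mu> = 0" if "\<mu> \<in> supp 0" for \<mu>
    using that phi_deg[of \<mu> 0] by (auto simp: supp_def intro: deg_eq_0)
  then have "mcoef (sub f) 0 = (\<Sum>\<mu>\<in>{0}. mcoef (\<phi> \<mu>) 0 *\<^sub>Q mcoef f \<mu>)"
    by (intro mcoef_sub) auto
  with assms show ?thesis by (simp add: no_const_def)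
qed

lemma sub_fpsub:
  assumes f: "no_const f" shows "sub (fpsub F f) = fpsub F (sub f)"
proof (rule mseries_eqI)
  fix m
  have "mcoef (sub (fpsub F f)) m
      = (\<Sum>\<mu>\<in>supp m. \<Sum>k\<le>deg m. mcoef (\<phi> \<mu>) m *\<^sub>Q fps_nth F k *\<^sub>Q mcoef (f ^ k) \<mu>)"
    unfolding sub_def mcoef_MSeries
  proof (rule sum.cong[OF refl])
    fix \<mu> assume "\<mu> \<in> supp m"
    then have "deg \<mu> \<le> deg m" using phi_deg by (simp add: supp_def)
    then show "mcoef (\<phi> \<mu>) m *\<^sub>Q mcoef (fpsub F f) \<mu>
        = (\<Sum>k\<le>deg m. mcoef (\<phi> \<mu>) m *\<^sub>Q fps_nth F k *\<^sub>Q mcoef (f ^ k) \<mu>)"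
      by (simp add: mcoef_fpsub[OF f] qs.scale_sum_right)
  qed
  also have "\<dots> = (\<Sum>k\<le>deg m. fps_nth F k *\<^sub>Q mcoef (sub (f ^ k)) m)"
    by (subst sum.swap) (simp add: sub_def qs.scale_sum_right qscale_qscale mult.commute)
  also have "\<dots> = mcoef (fpsub F (sub f)) m"
    by (simp add: mcoef_fpsub[OF no_const_sub[OF f] order_refl] sub_power)
  finally show "mcoef (sub (fpsub F f)) m = mcoef (fpsub F (sub f)) m" .
qed

lemma sub_map: "lie_map h \<Longrightarrow> sub (map_mseries h f) = map_mseries h (sub f)"
  by (rule mseries_eqI) (simp add: sub_def lie_map_simps)

lemma sub_gexp: "lie_map h \<Longrightarrow> no_const c \<Longrightarrow> sub (gexp h c) = gexp h (sub c)"
  by (simp add: gexp_def sexp_def sub_fpsub no_const_map no_const_slog sub_map slog_def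
      flip: slog_def) (simp add: slog_def sub_fpsub)

end

section \<open>The generating product as a product of group-like series\<close>

lemma uenv_incl_lie: "lie_map (uenv_incl :: 'a::rat_algebra \<Rightarrow> 'a uenv)"
proof -
  have "uenv_incl (x + y) = uenv_incl x + uenv_incl y" for x y :: 'a
    by transfer (rule ideal_cong_base, auto simp: uenv_rels_def diff_diff_eq)
  moreover have "uenv_incl (q *\<^sub>Q x) = q *\<^sub>Q uenv_incl x" for x :: 'a and q
    by transfer (rule ideal_cong_base, auto simp: uenv_rels_def)
  moreover have "uenv_incl (lie_bracket x y) = uenv_incl x * uenv_incl y - uenv_incl y * uenv_incl x" for x y :: 'a
    by transfer (rule ideal_cong_base, auto simp: uenv_rels_def lie_bracket_def)
  ultimately show ?thesis by (simp add: lie_map_def lie_bracket_def[of "uenv_incl _"])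
qed

lemma ptensor_upd_mult: "ptensor_upd 0 i (a * b) = ptensor_upd 0 i a + ptensor_upd 0 i (b::'a::monoid_mult)"
  by transfer (auto simp: fun_eq_iff)

lemma ptensor_upd_commute: "i \<noteq> j \<Longrightarrow>
    ptensor_upd 0 i a + ptensor_upd 0 j b = ptensor_upd 0 j b + ptensor_upd 0 i (a::'a::monoid_mult)"
  by transfer (auto simp: fun_eq_iff)

lemma inftensor_incl_add:
  "1 \<le> i \<Longrightarrow> inftensor_incl i (a + b) = inftensor_incl i a + inftensor_incl i (b::'a::rat_algebra)"
  by transfer (rule ideal_cong_base, simp only: inftensor_rels_def diff_diff_eq[symmetric], blast)

lemma inftensor_incl_scale:
  "1 \<le> i \<Longrightarrow> inftensor_incl i (q *\<^sub>Q a) = q *\<^sub>Q inftensor_incl i (a::'a::rat_algebra)"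
  by transfer (rule ideal_cong_base, simp only: inftensor_rels_def, blast)

lemma inftensor_incl_mult:
  "inftensor_incl i (a * b) = inftensor_incl i a * inftensor_incl i (b::'a::rat_algebra)"
  by transfer (simp add: ptensor_upd_mult mult_single ideal_cong_refl)

lemma inftensor_incl_commute:
  "i \<noteq> j \<Longrightarrow> inftensor_incl i a * inftensor_incl j b = inftensor_incl j b * inftensor_incl i (a::'a::rat_algebra)"
  by transfer (simp add: ptensor_upd_commute mult_single ideal_cong_refl)

text \<open>The positions of a pure tensor start at 1 and \<open>ptensor_upd\<close> ignores
  position 0, so \<open>T 0\<close> is constantly 1; linearity needs l \<ge> 1.\<close>

lemma lie_map_T: "1 \<le> l \<Longrightarrow> lie_map (T l)"
proof -
  assume l: "1 \<le> l"
  have "inftensor_incl l (x - y) = inftensor_incl l x - inftensor_incl l y" for x y :: "'a qtensor uenv"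
    using inftensor_incl_add[OF l, of "x - y" y] by (simp add: algebra_simps)
  then show ?thesis
    using l by (simp add: lie_map_def T_def lie_map_simps[OF uenv_incl_lie] inftensor_incl_add
        inftensor_incl_scale lie_bracket_def[of "uenv_incl _"] lie_bracket_def[of "inftensor_incl _ _"]
        inftensor_incl_mult)
qed

lemma T_commute: "l \<noteq> k \<Longrightarrow> T l x * T k y = T k y * T l x"
  by (simp add: T_def inftensor_incl_commute)

lemma qtens_add_right: "q \<otimes>\<^sub>Q (r + s) = q \<otimes>\<^sub>Q r + q \<otimes>\<^sub>Q s"
  by transfer (rule ideal_cong_base, simp only: qtensor_rels_def diff_diff_eq[symmetric], blast)

lemma qtens_mult: "(p \<otimes>\<^sub>Q r) * (q \<otimes>\<^sub>Q s) = (p * q) \<otimes>\<^sub>Q (r * s)"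
  by transfer (simp add: mult_single ideal_cong_refl)

lemma qtens_zscale: "1 \<otimes>\<^sub>Q zscale n r = of_int n *\<^sub>Q (1 \<otimes>\<^sub>Q r)"
proof -
  have 0: "(1::rat) \<otimes>\<^sub>Q (0::'a) = 0" using qtens_add_right[of 1 "0::'a" 0] by simp
  have diff: "(1::rat) \<otimes>\<^sub>Q (x - y :: 'a) = 1 \<otimes>\<^sub>Q x - 1 \<otimes>\<^sub>Q y" for x y
    using qtens_add_right[of 1 "x - y" y] by (simp add: algebra_simps)
  show ?thesis
    by (induction n rule: int_induct[where k = 0])
      (simp_all add: 0 zscale_0 zscale_add1 zscale_diff1 qtens_add_right diff qscale_add_left
        qs.scale_left_diff_distrib qscale_one)
qed


subsection \<open>Commuting series\<close>

lemma lfsum_commute: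
  fixes u v :: "nat \<Rightarrow> ('m::graded_cmonoid, 'a::ring) mseries"
  assumes u: "\<And>k. ord_ge k (u k)" and v: "\<And>k. ord_ge k (v k)"
    and comm: "\<And>i j. u i * v j = v j * u i"
  shows "lfsum u * lfsum v = lfsum v * lfsum u"
proof -
  have "(\<Sum>i\<le>n. u i * v (n - i)) = (\<Sum>i\<le>n. v i * u (n - i))" for n
    unfolding comm
    by (rule sum.reindex_bij_witness[where i = "\<lambda>i. n - i" and j = "\<lambda>i. n - i"]) auto
  then show ?thesis using u v by (simp add: lfsum_mult)
qed

lemma fpsub_commute:
  fixes f g :: "('m::graded_cmonoid, 'a::rat_algebra) mseries"
  assumes f: "no_const f" and g: "no_const g" and fg: "f * g = g * f"
  shows "fpsub F f * fpsub G g = fpsub G g * fpsub F f"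
proof -
  have 1: "f ^ i * g = g * f ^ i" for i
    by (induction i) (simp_all add: mult.assoc, simp add: fg flip: mult.assoc)
  have 2: "f ^ i * g ^ j = g ^ j * f ^ i" for i j
    by (induction j) (simp_all, metis 1 mult.assoc)
  show ?thesis
    unfolding fpsub_def
    by (rule lfsum_commute)
      (auto intro!: ord_ge_qscale ord_ge_power f g simp: qscale_mult_left qscale_mult_right qscale_qscale 2
        mult.commute[of "fps_nth F _"])
qed

lemma map_mseries_commute:
  fixes f :: "('m::graded_cmonoid, 'a) mseries"
  assumes "\<And>x y. h x * k y = k y * (h x :: 'b::ring)"
  shows "map_mseries h f * map_mseries k g = map_mseries k g * map_mseries h f"
proof (rule mseries_eqI)
  fix m
  show "mcoef (map_mseries h f * map_mseries k g) m = mcoef (map_mseries k g * map_mseries h f) m"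
    unfolding mcoef_times
    by (rule sum.reindex_bij_witness[where i = "\<lambda>(a, b). (b, a)" and j = "\<lambda>(a, b). (b, a)"])
      (auto simp: decomp_def add.commute assms)
qed

lemma gexp_commute:
  assumes "lie_map h" "lie_map k" "\<And>x y. h x * k y = k y * h x" "no_const f" "no_const g"
  shows "gexp h f * gexp k g = gexp k g * gexp h f"
  unfolding gexp_def sexp_def
  by (intro fpsub_commute no_const_map no_const_slog map_mseries_commute assms)

text \<open>Arbitrary series replace the linear sums of the generating product, so that its values
  at alphabets are covered as well.\<close>

primrec gprod :: "(nat \<Rightarrow> ('m::graded_cmonoid, 'r::{ring, monoid_mult} qtensor) mseries) \<Rightarrow> nat
    \<Rightarrow> ('m, 'r G_inf_Q) mseries" where
  "gprod c 0 = 1"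
| "gprod c (Suc n) = gprod c n * gexp (T (Suc n)) (c (Suc n))"

lemma gprod_commute:
  assumes "\<And>l. 1 \<le> l \<Longrightarrow> no_const (c l)" "no_const b" "n < l"
  shows "gprod c n * gexp (T l) b = gexp (T l) b * gprod c n"
  using assms(3)
proof (induction n)
  case (Suc n)
  have "gexp (T (Suc n)) (c (Suc n)) * gexp (T l) b = gexp (T l) b * gexp (T (Suc n)) (c (Suc n))"
    by (intro gexp_commute lie_map_T T_commute assms) (use Suc in auto)
  with Suc show ?case by (simp add: mult.assoc) (simp flip: mult.assoc)
qed simp

text \<open>Factors of different index l live in different tensor positions and commute, so the
  product can be formed for every l separately.\<close>

lemma gprod_mult:
  assumes a: "\<And>l. 1 \<le> l \<Longrightarrow> no_const (a l)" and b: "\<And>l. 1 \<le> l \<Longrightarrow> no_const (b l)"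
    and eq: "\<And>l. 1 \<le> l \<Longrightarrow> gexp (T l) (a l) * gexp (T l) (b l) = gexp (T l) (c l)"
  shows "gprod a n * gprod b n = gprod c n"
proof (induction n)
  case (Suc n)
  have comm: "gprod b n * gexp (T (Suc n)) (a (Suc n)) = gexp (T (Suc n)) (a (Suc n)) * gprod b n"
    by (rule gprod_commute) (simp_all add: a b)
  have "gprod a (Suc n) * gprod b (Suc n)
      = gprod a n * (gexp (T (Suc n)) (a (Suc n)) * gprod b n) * gexp (T (Suc n)) (b (Suc n))"
    by (simp add: mult.assoc)
  also have "\<dots> = (gprod a n * gprod b n) * (gexp (T (Suc n)) (a (Suc n)) * gexp (T (Suc n)) (b (Suc n)))"
    by (simp only: comm[symmetric] mult.assoc)
  finally show ?case by (simp add: Suc eq)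
qed simp


subsection \<open>Formal sums as series\<close>

lemma fs_mult_eq: "fs_mult (mcoef f) (mcoef g) = mcoef (f * g)"
  by (rule ext) (simp add: fs_mult_def mcoef_times decomp_def)

lemma fs_one_eq: "fs_one = mcoef 1"
  by (rule ext) (simp add: fs_one_def mcoef_one)

lemma fs_power_eq: "fs_power (mcoef f) k = mcoef (f ^ k)"
  by (induction k) (simp_all add: fs_one_eq fs_mult_eq)

lemma fs_exp_eq: "no_const f \<Longrightarrow> fs_exp (mcoef f) = mcoef (sexp f)"
proof
  fix \<mu> assume f: "no_const f"
  have "fs_exp (mcoef f) \<mu> = (\<Sum>k\<le>deg \<mu>. (1 / fact k) *\<^sub>Q mcoef (f ^ k) \<mu>)"
    unfolding fs_exp_def fs_power_eq
    by (rule Sum_any.expand_superset) (use ord_ge_power[OF f] in \<open>auto simp: ord_ge_def not_le[symmetric]\<close>)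
  then show "fs_exp (mcoef f) \<mu> = mcoef (sexp f) \<mu>"
    by (simp add: sexp_def mcoef_fpsub[OF f order_refl])
qed

lemma fs_log1p_eq: "no_const f \<Longrightarrow> fs_log1p (mcoef f) = mcoef (slog f)"
proof
  fix \<mu> assume f: "no_const f"
  have 0: "mcoef (f ^ Suc k) \<mu> = 0" if "deg \<mu> < k" for k
    using ord_ge_power[OF f, of "Suc k"] that by (simp add: ord_ge_def)
  have "fs_log1p (mcoef f) \<mu> = (\<Sum>k\<le>deg \<mu>. ((- 1) ^ k / of_nat (Suc k)) *\<^sub>Q mcoef (f ^ Suc k) \<mu>)"
    unfolding fs_log1p_def fs_power_eq
  proof (rule Sum_any.expand_superset)
    show "{k. ((- 1) ^ k / of_nat (Suc k)) *\<^sub>Q mcoef (f ^ Suc k) \<mu> \<noteq> 0} \<subseteq> {..deg \<mu>}"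
    proof
      fix k assume "k \<in> {k. ((- 1) ^ k / of_nat (Suc k)) *\<^sub>Q mcoef (f ^ Suc k) \<mu> \<noteq> 0}"
      then have "mcoef (f ^ Suc k) \<mu> \<noteq> 0" by (metis (mono_tags, lifting) mem_Collect_eq qs.scale_zero_right)
      then show "k \<in> {..deg \<mu>}" using 0[of k] by (meson atMost_iff not_le)
    qed
  qed simp
  \<comment> \<open>The series \<open>fps_ln 1\<close> has no constant term, so summing over the
    powers \<open>Suc k\<close> is summing over all powers.\<close>
  also have "\<dots> = (\<Sum>k\<le>Suc (deg \<mu>). fps_nth (fps_ln 1) k *\<^sub>Q mcoef (f ^ k) \<mu>)"
    by (simp add: sum.atMost_Suc_shift fps_ln_nth del: sum.atMost_Suc power_Suc)
  also have "\<dots> = mcoef (slog f) \<mu>"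
    unfolding slog_def by (rule mcoef_fpsub[OF f, symmetric]) simp
  finally show "fs_log1p (mcoef f) \<mu> = mcoef (slog f) \<mu>" .
qed

definition lin :: "'r::{ring, monoid_mult} set \<Rightarrow> nat \<Rightarrow> ('r family, 'r qtensor) mseries" where
  "lin I l = MSeries (linear_sum I l)"

lemma no_const_lin: "no_const (lin I l)"
proof -
  have "{U. U \<in> I \<and> 0 = Poly_Mapping.single U {#l#}} = {}"
  proof safe
    fix U assume "0 = Poly_Mapping.single U {#l#}"
    then have "Poly_Mapping.lookup (Poly_Mapping.single U {#l#}) U = {#}" by (metis lookup_zero)
    then show "U \<in> {}" by simp
  qed
  then show ?thesis by (simp only: lin_def no_const_def mcoef_MSeries linear_sum_def sum.empty)
qed

lemma fs_partial_prod_eq: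
  "fs_partial_prod (\<lambda>l. fs_exp (T l \<circ> fs_log1p (linear_sum I l))) n = mcoef (gprod (lin I) n)"
proof (induction n)
  case (Suc n)
  have E: "T l \<circ> fs_log1p (linear_sum I l) = mcoef (map_mseries (T l) (slog (lin I l)))" for l
    using fs_log1p_eq[OF no_const_lin, of I l] by (auto simp: lin_def)
  have "no_const (map_mseries (T (Suc n)) (slog (lin I (Suc n))))"
    by (intro no_const_map lie_map_T no_const_slog no_const_lin) simp
  then show ?case
    unfolding fs_partial_prod.simps Suc.IH gprod.simps gexp_def
    by (simp only: E fs_exp_eq fs_mult_eq)
qed (simp add: fs_one_eq)

text \<open>The degree of the symmetric function indexed by \<mu>; \<open>deg\<close> counts parts
  instead, since it has to see parts equal to 0 too.\<close>

definition weight :: "'r family \<Rightarrow> nat" where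
  "weight \<mu> = (\<Sum>U\<in>Poly_Mapping.keys \<mu>. \<Sum>\<^sub># (Poly_Mapping.lookup \<mu> U))"

lemma weight_superset:
  assumes "finite S" "Poly_Mapping.keys \<mu> \<subseteq> S"
  shows "weight \<mu> = (\<Sum>U\<in>S. \<Sum>\<^sub># (Poly_Mapping.lookup \<mu> U))"
  unfolding weight_def using assms
  by (intro sum.mono_neutral_left) (auto simp: in_keys_iff)

lemma weight_add: "weight (\<mu> + \<nu>) = weight \<mu> + weight \<nu>"
  using keys_add[of \<mu> \<nu>]
  by (simp add: weight_superset[of "Poly_Mapping.keys \<mu> \<union> Poly_Mapping.keys \<nu>"] lookup_add sum.distrib)

lemma part_le_weight: "n \<in># Poly_Mapping.lookup \<mu> U \<Longrightarrow> n \<le> weight \<mu>"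
proof -
  assume n: "n \<in># Poly_Mapping.lookup \<mu> U"
  then have U: "U \<in> Poly_Mapping.keys \<mu>" by (auto simp: in_keys_iff)
  have "n \<le> \<Sum>\<^sub># (Poly_Mapping.lookup \<mu> U)"
    using n by (metis sum_mset.remove le_add1)
  also have "\<dots> \<le> weight \<mu>"
    unfolding weight_def using U by (intro member_le_sum) auto
  finally show ?thesis .
qed

text \<open>The factor of index l is 1 on the face of families without a part l, and a family of
  weight at most n has no part n + 1.\<close>

lemma gprod_stable:
  assumes "weight \<mu> \<le> n"
  shows "mcoef (gprod (lin I) (Suc n)) \<mu> = mcoef (gprod (lin I) n) \<mu>"
proof -
  let ?l = "Suc n"
  let ?S = "{\<mu> :: 'a family. \<forall>U. ?l \<notin># Poly_Mapping.lookup \<mu> U}"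
  have S: "face ?S" by (auto simp: face_def lookup_add)
  have "mrestrict ?S (lin I ?l) = 0"
  proof (rule mseries_eqI)
    fix \<mu> :: "'a family"
    have "{U. U \<in> I \<and> \<mu> = Poly_Mapping.single U {#?l#}} = {}" if "\<mu> \<in> ?S"
    proof safe
      fix U assume "\<mu> = Poly_Mapping.single U {#?l#}"
      then have "?l \<in># Poly_Mapping.lookup \<mu> U" by simp
      with that show "U \<in> {}" by blast
    qed
    then show "mcoef (mrestrict ?S (lin I ?l)) \<mu> = mcoef 0 \<mu>"
      by (cases "\<mu> \<in> ?S")
        (simp_all only: mcoef_mrestrict lin_def linear_sum_def mcoef_MSeries sum.empty mcoef_simps if_True if_False)
  qed
  then have "mrestrict ?S (gexp (T ?l) (lin I ?l)) = 1"
    by (simp add: mrestrict_gexp[OF S lie_map_T] gexp_0 lie_map_T)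
  then have "mcoef (mrestrict ?S (gexp (T ?l) (lin I ?l))) \<beta> = mcoef 1 \<beta>" for \<beta> by simp
  then have 1: "mcoef (gexp (T ?l) (lin I ?l)) \<beta> = mcoef 1 \<beta>" if "\<beta> \<in> ?S" for \<beta>
    using that unfolding mcoef_mrestrict by presburger
  have "mcoef (gprod (lin I) ?l) \<mu> = mcoef (gprod (lin I) n * 1) \<mu>"
    unfolding mcoef_times gprod.simps
  proof (rule sum.cong[OF refl], clarify)
    fix \<alpha> \<beta> assume "(\<alpha>, \<beta>) \<in> decomp \<mu>"
    then have "weight \<beta> \<le> n" using assms by (auto simp: decomp_def weight_add)
    then have "\<beta> \<in> ?S" using part_le_weight[of ?l \<beta>] by auto
    then show "mcoef (gprod (lin I) n) \<alpha> * mcoef (gexp (T ?l) (lin I ?l)) \<beta> =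
        mcoef (gprod (lin I) n) \<alpha> * mcoef 1 \<beta>" by (simp add: 1)
  qed
  then show ?thesis by simp
qed

lemma generating_product_eq:
  assumes "weight \<mu> \<le> n"
  shows "generating_product I \<mu> = mcoef (gprod (lin I) n) \<mu>"
proof -
  have st: "mcoef (gprod (lin I) n') \<mu> = mcoef (gprod (lin I) n) \<mu>" if "n \<le> n'" for n'
    using that by (induction n' rule: dec_induct) (use assms in \<open>simp_all add: gprod_stable del: gprod.simps\<close>)
  have "(THE a. \<forall>\<^sub>F k in sequentially. mcoef (gprod (lin I) k) \<mu> = a) = mcoef (gprod (lin I) n) \<mu>"
  proof (rule the_equality)
    show ev: "\<forall>\<^sub>F k in sequentially. mcoef (gprod (lin I) k) \<mu> = mcoef (gprod (lin I) n) \<mu>"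
      unfolding eventually_sequentially by (intro exI[of _ n] allI impI st)
    fix a assume "\<forall>\<^sub>F k in sequentially. mcoef (gprod (lin I) k) \<mu> = a"
    with ev have "\<forall>\<^sub>F k::nat in sequentially. a = mcoef (gprod (lin I) n) \<mu>"
      by eventually_elim simp
    then show "a = mcoef (gprod (lin I) n) \<mu>" by simp
  qed
  then show ?thesis by (simp add: generating_product_def fs_infprod_def fs_partial_prod_eq)
qed

section \<open>Semistandard tableaux\<close>

definition dg :: "(nat \<Rightarrow> nat) \<Rightarrow> (nat \<times> nat) set" where
  "dg f = {(i, j). j < f i}"

text \<open>With row lengths padded by zeros, inclusion and interlacing of shapes become
  inequalities at every index.\<close>

definition shape :: "(nat \<Rightarrow> nat) \<Rightarrow> bool" where
  "shape f \<longleftrightarrow> (\<forall>i. f (Suc i) \<le> f i) \<and> finite {i. f i \<noteq> 0}"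

definition tabs :: "(nat \<Rightarrow> nat) \<Rightarrow> nat \<Rightarrow> (nat \<times> nat \<Rightarrow> nat) set" where
  "tabs f N = {t \<in> dg f \<rightarrow>\<^sub>E {..<N}.
     (\<forall>i j. Suc j < f i \<longrightarrow> t (i, j) \<le> t (i, Suc j)) \<and>
     (\<forall>i j. j < f (Suc i) \<longrightarrow> t (i, j) < t (Suc i, j))}"

lemma dg_iff [simp]: "(i, j) \<in> dg f \<longleftrightarrow> j < f i"
  by (simp add: dg_def)

lemma dg_Sigma: "dg f = Sigma {i. f i \<noteq> 0} (\<lambda>i. {..<f i})"
  by (auto simp: dg_def)

lemma shape_antimono: "shape f \<Longrightarrow> i \<le> j \<Longrightarrow> f j \<le> f i"
  by (rule lift_Suc_antimono_le[of f]) (auto simp: shape_def)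

lemma shapeE:
  assumes "shape f"
  obtains K where "\<And>i. K \<le> i \<Longrightarrow> f i = 0"
proof -
  have "finite {i. f i \<noteq> 0}" using assms by (simp add: shape_def)
  then obtain K where "\<And>i. i \<in> {i. f i \<noteq> 0} \<Longrightarrow> i < K"
    by (metis finite_nat_set_iff_bounded)
  then show thesis by (intro that[of K]) (meson leD mem_Collect_eq)
qed

lemma finite_dg: "shape f \<Longrightarrow> finite (dg f)"
  unfolding dg_Sigma by (intro finite_SigmaI) (auto simp: shape_def)

lemma finite_tabs: "shape f \<Longrightarrow> finite (tabs f N)"
  by (rule finite_subset[of _ "dg f \<rightarrow>\<^sub>E {..<N}"]) (auto simp: tabs_def intro!: finite_PiE finite_dg)

lemma sum_dg:
  assumes "\<And>i. K \<le> i \<Longrightarrow> f i = 0"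
  shows "(\<Sum>c\<in>dg f. h (fst c)) = (\<Sum>i<K. of_nat (f i) * (h i :: 'a::comm_semiring_1))"
proof -
  have "dg f = Sigma {..<K} (\<lambda>i. {..<f i})"
    using assms by (auto simp: dg_def intro: ccontr simp: not_less)
  moreover have "(\<Sum>i<K. \<Sum>j<f i. h i) = (\<Sum>(i, j)\<in>Sigma {..<K} (\<lambda>i. {..<f i}). h i)"
    by (rule sum.Sigma) auto
  ultimately show ?thesis by (simp add: split_def)
qed

lemma card_dg:
  assumes "\<And>i. K \<le> i \<Longrightarrow> f i = 0"
  shows "card (dg f) = (\<Sum>i<K. f i)"
  using sum_dg[of K f "\<lambda>_. 1::nat"] assms by simp

text \<open>Interlacing says that f / g has at most one box in each column, that is, f / g is a
  horizontal strip.\<close>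

definition hstrips :: "(nat \<Rightarrow> nat) \<Rightarrow> (nat \<Rightarrow> nat) set" where
  "hstrips f = {g. \<forall>i. f (Suc i) \<le> g i \<and> g i \<le> f i}"

lemma shape_hstrip: "shape f \<Longrightarrow> g \<in> hstrips f \<Longrightarrow> shape g"
proof -
  assume f: "shape f" and g: "g \<in> hstrips f"
  have "{i. g i \<noteq> 0} \<subseteq> {i. f i \<noteq> 0}" using g by (auto simp: hstrips_def) (metis order.strict_trans2)
  then have "finite {i. g i \<noteq> 0}" by (rule finite_subset) (use f in \<open>simp add: shape_def\<close>)
  moreover have "g (Suc i) \<le> g i" for i
  proof -
    have "g (Suc i) \<le> f (Suc i)" "f (Suc i) \<le> g i" using g by (auto simp: hstrips_def)
    then show ?thesis by linarith
  qed
  ultimately show ?thesis by (simp add: shape_def)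
qed

lemma finite_le_fun: "shape f \<Longrightarrow> finite {g. \<forall>i. g i \<le> f i}"
proof -
  assume f: "shape f"
  obtain K where K: "\<And>i. K \<le> i \<Longrightarrow> f i = 0" using shapeE[OF f] by blast
  let ?r = "\<lambda>g. \<lambda>i\<in>{..<K}. g i"
  have "inj_on ?r {g. \<forall>i. g i \<le> f i}"
  proof (rule inj_onI, rule ext)
    fix g h i assume g: "g \<in> {g. \<forall>i. g i \<le> f i}" and h: "h \<in> {g. \<forall>i. g i \<le> f i}" and "?r g = ?r h"
    then have "?r g i = ?r h i" by simp
    moreover have "K \<le> i \<Longrightarrow> g i = h i" using g h K[of i] by (metis le_zero_eq mem_Collect_eq)
    ultimately show "g i = h i" by (cases "i < K") auto
  qed
  moreover have "?r ` {g. \<forall>i. g i \<le> f i} \<subseteq> PiE {..<K} (\<lambda>i. {..f i})"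
    by (auto simp: PiE_iff extensional_def split: if_splits)
  moreover have "finite (PiE {..<K} (\<lambda>i. {..f i}))" by (intro finite_PiE) auto
  ultimately show ?thesis by (meson inj_on_finite)
qed

lemma finite_hstrips: "shape f \<Longrightarrow> finite (hstrips f)"
  by (rule finite_subset[OF _ finite_le_fun]) (auto simp: hstrips_def)

lemma dg_hstrip: "g \<in> hstrips f \<Longrightarrow> dg g \<subseteq> dg f"
proof clarify
  fix i j assume "g \<in> hstrips f" "(i, j) \<in> dg g"
  then have "g i \<le> f i" "j < g i" by (auto simp: hstrips_def)
  then show "(i, j) \<in> dg f" by simp
qed

lemma down_closed_nat:
  assumes "finite S" "\<And>i j. i \<le> j \<Longrightarrow> j \<in> S \<Longrightarrow> (i::nat) \<in> S"
  shows "S = {..<card S}"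
proof (cases "S = {}")
  case False
  have "S = {..Max S}"
    using assms False by (auto intro: Max_ge Max_in)
  then show ?thesis by (metis card_atMost lessThan_Suc_atMost)
qed simp

lemma tabs_row_mono:
  assumes "t \<in> tabs f N" "j \<le> k" "k < f i"
  shows "t (i, j) \<le> t (i, k)"
  using assms(2,3)
proof (induction k rule: dec_induct)
  case (step k)
  have "t (i, k) \<le> t (i, Suc k)" using assms(1) step by (simp add: tabs_def)
  with step show ?case by simp
qed simp

definition tab_gf :: "(nat \<Rightarrow> nat) \<Rightarrow> (nat \<Rightarrow> 'c::comm_ring_1) \<Rightarrow> nat \<Rightarrow> 'c" where
  "tab_gf f y N = (\<Sum>t\<in>tabs f N. \<Prod>c\<in>dg f. y (t c))"

text \<open>Sorting tableaux by the region occupied by the entries smaller than the maximal one.\<close>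

lemma tab_gf_Suc:
  assumes f: "shape f"
  shows "tab_gf f y (Suc N) = (\<Sum>g\<in>hstrips f. tab_gf g y N * y N ^ (card (dg f) - card (dg g)))"
proof -
  \<comment> \<open>Rows increase weakly, so the entries below N fill an initial segment of each
    row; G records its length.\<close>
  define G where "G t = (\<lambda>i. card {j. j < f i \<and> t (i, j) < N})" for t :: "nat \<times> nat \<Rightarrow> nat"
  have region: "t (i, j) < N \<longleftrightarrow> j < G t i" if t: "t \<in> tabs f (Suc N)" and j: "j < f i" for t i j
  proof -
    have "{j. j < f i \<and> t (i, j) < N} = {..<card {j. j < f i \<and> t (i, j) < N}}"
      by (rule down_closed_nat) (auto dest: tabs_row_mono[OF t] intro: le_less_trans)
    then show ?thesis using j unfolding G_def by blast
  qed
  have lessN: "t (i, j) < Suc N" if "t \<in> tabs f (Suc N)" "j < f i" for t i j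
    using that by (auto simp: tabs_def PiE_iff)
  have Gf: "G t i \<le> f i" for t i
  proof -
    have "card {j. j < f i \<and> t (i, j) < N} \<le> card {..<f i}" by (rule card_mono) auto
    then show ?thesis by (simp add: G_def)
  qed
  have GH: "G t \<in> hstrips f" if t: "t \<in> tabs f (Suc N)" for t
  proof -
    \<comment> \<open>Otherwise the first entry N of row i would have a box below it, whose entry
      would have to exceed N.\<close>
    have "f (Suc i) \<le> G t i" for i
    proof (rule ccontr)
      assume "\<not> f (Suc i) \<le> G t i"
      then have j: "G t i < f (Suc i)" by simp
      then have j': "G t i < f i" using shape_antimono[OF f, of i "Suc i"] by simp
      have "t (i, G t i) < t (Suc i, G t i)" using t j by (auto simp: tabs_def)
      moreover have "t (Suc i, G t i) < Suc N" using lessN[OF t j] .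
      ultimately have "t (i, G t i) < N" by simp
      then show False using region[OF t j'] by simp
    qed
    then show ?thesis using Gf by (simp add: hstrips_def)
  qed
  have fiber: "(\<Sum>t | t \<in> tabs f (Suc N) \<and> G t = g. \<Prod>c\<in>dg f. y (t c))
      = tab_gf g y N * y N ^ (card (dg f) - card (dg g))" if g: "g \<in> hstrips f" for g
  proof -
    have gf: "dg g \<subseteq> dg f" using g by (rule dg_hstrip)
    have g': "f (Suc i) \<le> g i" "g i \<le> f i" for i using g by (auto simp: hstrips_def)
    \<comment> \<open>The inverse of restricting to the small entries: the strip is filled with N,
      and off the diagram stands the value \<open>undefined\<close> that extensional functions
      require.\<close>
    let ?ext = "\<lambda>s c. if c \<in> dg g then s c else if c \<in> dg f then N else undefined"
    let ?A = "{t \<in> tabs f (Suc N). G t = g}"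
    have reg: "t (i, j) < N \<longleftrightarrow> j < g i" if "t \<in> ?A" "j < f i" for t i j
      using region[of t j i] that by auto
    have big: "t (i, j) = N" if "t \<in> ?A" "j < f i" "\<not> j < g i" for t i j
      using reg[of t j i] lessN[of t j i] that by auto
    have val: "(\<Prod>c\<in>dg f. y (?ext s c)) = (\<Prod>c\<in>dg g. y (s c)) * y N ^ (card (dg f) - card (dg g))" for s
    proof -
      have "(\<Prod>c\<in>dg f. y (?ext s c)) = (\<Prod>c\<in>dg f - dg g. y (?ext s c)) * (\<Prod>c\<in>dg g. y (?ext s c))"
        by (rule prod.subset_diff[OF gf finite_dg[OF f]])
      moreover have "(\<Prod>c\<in>dg f - dg g. y (?ext s c)) = y N ^ card (dg f - dg g)" by simp
      ultimately show ?thesis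
        using card_Diff_subset[OF finite_subset[OF gf finite_dg[OF f]] gf] by (simp add: mult.commute)
    qed
    have "(\<Sum>t\<in>?A. \<Prod>c\<in>dg f. y (t c)) = (\<Sum>s\<in>tabs g N. \<Prod>c\<in>dg f. y (?ext s c))"
    proof (rule sum.reindex_bij_witness[where j = "\<lambda>t. restrict t (dg g)" and i = ?ext])
      fix t assume t: "t \<in> ?A"
      then have te: "t \<in> dg f \<rightarrow>\<^sub>E {..<Suc N}" by (simp add: tabs_def)
      show eq: "?ext (restrict t (dg g)) = t"
      proof
        fix c :: "nat \<times> nat"
        obtain i j where c: "c = (i, j)" by (cases c)
        show "?ext (restrict t (dg g)) c = t c"
          using te big[OF t, of j i] by (auto simp: c PiE_iff extensional_def)
      qed
      show "(\<Prod>c\<in>dg f. y (?ext (restrict t (dg g)) c)) = (\<Prod>c\<in>dg f. y (t c))"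
      proof (rule prod.cong[OF refl])
        fix c show "y (?ext (restrict t (dg g)) c) = y (t c)"
          by (rule arg_cong[OF fun_cong[OF eq, of c]])
      qed
      have "restrict t (dg g) \<in> dg g \<rightarrow>\<^sub>E {..<N}"
      proof (rule restrict_PiE_iff[THEN iffD2], rule ballI)
        fix c assume c: "c \<in> dg g"
        obtain i j where "c = (i, j)" by (cases c)
        then show "t c \<in> {..<N}" using c reg[OF t, of j i] g'(2)[of i] by auto
      qed
      moreover have "t (i, j) \<le> t (i, Suc j)" if "Suc j < g i" for i j
        using t that g'(2)[of i] by (auto simp: tabs_def)
      moreover have "t (i, j) < t (Suc i, j)" "j < g i" if "j < g (Suc i)" for i j
      proof -
        have "j < f (Suc i)" using that g'(2)[of "Suc i"] by simp
        then show "t (i, j) < t (Suc i, j)" "j < g i" using t g'(1)[of i] by (auto simp: tabs_def)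
      qed
      ultimately show "restrict t (dg g) \<in> tabs g N" by (simp add: tabs_def)
    next
      fix s assume s: "s \<in> tabs g N"
      then have se: "s \<in> dg g \<rightarrow>\<^sub>E {..<N}" by (simp add: tabs_def)
      then have sN: "s (i, j) < N" if "j < g i" for i j using that by (auto simp: PiE_iff)
      show "restrict (?ext s) (dg g) = s"
        using se by (auto simp: restrict_def PiE_iff extensional_def fun_eq_iff)
      have "?ext s \<in> dg f \<rightarrow>\<^sub>E {..<Suc N}"
        using sN less_le_trans[OF _ g'(2)] by (auto simp: PiE_iff extensional_def less_Suc_eq)
      moreover have "?ext s (i, j) \<le> ?ext s (i, Suc j)" if "Suc j < f i" for i j
        using that s sN[of j i] by (auto simp: tabs_def)
      moreover have "?ext s (i, j) < ?ext s (Suc i, j)" if "j < f (Suc i)" for i j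
        using that s sN[of j i] g'(1)[of i] g'(2)[of "Suc i"] by (auto simp: tabs_def)
      ultimately have T: "?ext s \<in> tabs f (Suc N)" by (simp add: tabs_def)
      have "G (?ext s) i = g i" for i
      proof -
        have "{j. j < f i \<and> ?ext s (i, j) < N} = {..<g i}"
          using sN[of _ i] g'(2)[of i] by auto
        then show ?thesis by (simp add: G_def)
      qed
      with T show "?ext s \<in> ?A" by auto
    qed
    also have "\<dots> = tab_gf g y N * y N ^ (card (dg f) - card (dg g))"
      by (simp add: val tab_gf_def sum_distrib_right)
    finally show ?thesis .
  qed
  have "tab_gf f y (Suc N) = (\<Sum>g\<in>hstrips f. \<Sum>t | t \<in> tabs f (Suc N) \<and> G t = g. \<Prod>c\<in>dg f. y (t c))"
    unfolding tab_gf_def using GH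
    by (intro sum.group[symmetric] finite_tabs finite_hstrips f) auto
  then show ?thesis by (simp add: fiber)
qed

lemma tab_gf_cong: "(\<And>i. i < N \<Longrightarrow> y i = z i) \<Longrightarrow> tab_gf f y N = tab_gf f z N"
  unfolding tab_gf_def
  by (intro sum.cong prod.cong refl) (auto simp: tabs_def PiE_iff)

text \<open>The Bender--Knuth involution: given \<open>h \<subseteq> g \<subseteq> f\<close> with both steps horizontal strips, each row
  length of \<open>g\<close> ranges over an interval independently of the other rows, and is reflected there.\<close>

lemma hstrip_reflection:
  assumes f: "shape f" and h: "shape h"
  obtains r where "\<And>g. g \<in> hstrips f \<Longrightarrow> h \<in> hstrips g \<Longrightarrow>
      r g \<in> hstrips f \<and> h \<in> hstrips (r g) \<and> r (r g) = g \<and>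
      card (dg (r g)) + card (dg g) = card (dg f) + card (dg h)"
proof -
  \<comment> \<open>Both strip conditions together confine g i to an interval depending on f and h
    only; row 0 has no row of h above it.\<close>
  define lo where "lo i = max (f (Suc i)) (h i)" for i
  define hi where "hi i = (if i = 0 then f 0 else min (f i) (h (i - 1)))" for i
  define r where "r g i = lo i + hi i - g i" for g i
  have iff: "g \<in> hstrips f \<and> h \<in> hstrips g \<longleftrightarrow> (\<forall>i. lo i \<le> g i \<and> g i \<le> hi i)" for g
  proof
    assume gh: "g \<in> hstrips f \<and> h \<in> hstrips g"
    show "\<forall>i. lo i \<le> g i \<and> g i \<le> hi i"
    proof
      fix i
      show "lo i \<le> g i \<and> g i \<le> hi i"
        using gh by (cases i) (auto simp: hstrips_def lo_def hi_def)
    qed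
  next
    assume b: "\<forall>i. lo i \<le> g i \<and> g i \<le> hi i"
    have "f (Suc i) \<le> g i \<and> g i \<le> f i \<and> g (Suc i) \<le> h i \<and> h i \<le> g i" for i
      using b[rule_format, of i] b[rule_format, of "Suc i"]
      by (auto simp: lo_def hi_def split: if_splits)
    then show "g \<in> hstrips f \<and> h \<in> hstrips g" by (simp add: hstrips_def)
  qed
  obtain K where K: "\<And>i. K \<le> i \<Longrightarrow> f i = 0" using shapeE[OF f] by blast
  obtain K' where K': "\<And>i. K' \<le> i \<Longrightarrow> h i = 0" using shapeE[OF h] by blast
  define L where "L = max K K'"
  have L: "f i = 0" "h i = 0" if "L \<le> i" for i using that K[of i] K'[of i] by (auto simp: L_def)
  show thesis
  proof (rule that[of r])
    fix g assume g: "g \<in> hstrips f" "h \<in> hstrips g"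
    then have b: "lo i \<le> g i" "g i \<le> hi i" for i using iff by blast+
    have b': "lo i \<le> r g i \<and> r g i \<le> hi i" for i using b[of i] by (auto simp: r_def)
    then have rg: "r g \<in> hstrips f \<and> h \<in> hstrips (r g)" using iff by blast
    have rr: "r (r g) = g"
    proof
      fix i show "r (r g) i = g i" using b[of i] by (simp add: r_def)
    qed
    have z: "g i = 0" "r g i = 0" if "L \<le> i" for i
      using g(1) conjunct1[OF rg] L(1)[OF that] by (auto simp: hstrips_def) (metis le_zero_eq)+
    have "card (dg (r g)) + card (dg g) = (\<Sum>i<Suc L. lo i + hi i)"
    proof -
      have "r g i + g i = lo i + hi i" for i using b[of i] by (simp add: r_def)
      then have "(\<Sum>i<Suc L. r g i) + (\<Sum>i<Suc L. g i) = (\<Sum>i<Suc L. lo i + hi i)"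
        by (simp only: sum.distrib[symmetric])
      then show ?thesis using z by (simp add: card_dg[of "Suc L"])
    qed
    also have "\<dots> = (\<Sum>i<Suc L. lo i) + (hi 0 + (\<Sum>i<L. hi (Suc i)))"
      by (simp only: sum.distrib sum.lessThan_Suc_shift)
    \<comment> \<open>Here lo i is paired with hi (i + 1): they are the maximum and the minimum of
      the same numbers f (i + 1) and h i, so their sum is the sum of these.\<close>
    also have "\<dots> = f 0 + (\<Sum>i<L. lo i + hi (Suc i))"
      using L by (simp add: lo_def hi_def sum.distrib)
    also have "(\<Sum>i<L. lo i + hi (Suc i)) = (\<Sum>i<L. f (Suc i) + h i)"
      by (rule sum.cong) (auto simp: lo_def hi_def)
    also have "f 0 + \<dots> = (\<Sum>i<Suc L. f i) + (\<Sum>i<L. h i)"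
      by (simp only: sum.distrib sum.lessThan_Suc_shift)
    also have "\<dots> = card (dg f) + card (dg h)"
      using L by (simp add: card_dg[of "Suc L"] card_dg[of L])
    finally show "r g \<in> hstrips f \<and> h \<in> hstrips (r g) \<and> r (r g) = g \<and>
        card (dg (r g)) + card (dg g) = card (dg f) + card (dg h)"
      using rg rr by blast
  qed
qed

lemma card_dg_hstrip: "shape f \<Longrightarrow> g \<in> hstrips f \<Longrightarrow> card (dg g) \<le> card (dg f)"
  by (intro card_mono finite_dg dg_hstrip)

text \<open>If the largest letter is not moved, induct along the branching rule. Otherwise the two
  largest letters are exchanged: apply that rule twice and sort by the innermost shape h; reflecting
  the intermediate shape exchanges the exponents of the two letters.\<close>

lemma tab_gf_swap:
  assumes "shape f" "Suc k < N"
  shows "tab_gf f (y \<circ> transpose k (Suc k)) N = tab_gf f y N"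
  using assms
proof (induction N arbitrary: f)
  case (Suc N)
  let ?\<tau> = "transpose k (Suc k)"
  show ?case
  proof (cases "Suc k < N")
    case True
    then have "?\<tau> N = N" by simp
    with True show ?thesis using Suc by (simp add: tab_gf_Suc shape_hstrip)
  next
    case False
    with Suc have N: "N = Suc k" by simp
    define H where "H = (\<Union>g\<in>hstrips f. hstrips g)"
    define B where "B h = {g \<in> hstrips f. h \<in> hstrips g}" for h
    have finH: "finite H"
      unfolding H_def
      by (rule finite_UN_I[OF finite_hstrips[OF Suc.prems(1)]])
        (rule finite_hstrips[OF shape_hstrip[OF Suc.prems(1)]])
    have finB: "finite (B h)" for h using finite_hstrips[OF Suc.prems(1)] by (simp add: B_def)
    have expand: "tab_gf f z (Suc (Suc k)) = (\<Sum>h\<in>H. tab_gf h z k * (\<Sum>g\<in>B h.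
        z k ^ (card (dg g) - card (dg h)) * z (Suc k) ^ (card (dg f) - card (dg g))))"
      for z :: "nat \<Rightarrow> 'a"
    proof -
      have "tab_gf f z (Suc (Suc k)) = (\<Sum>g\<in>hstrips f. \<Sum>h\<in>hstrips g. tab_gf h z k *
          (z k ^ (card (dg g) - card (dg h)) * z (Suc k) ^ (card (dg f) - card (dg g))))"
        using Suc.prems(1) by (simp add: tab_gf_Suc shape_hstrip sum_distrib_right mult.assoc)
      also have "\<dots> = (\<Sum>g\<in>hstrips f. \<Sum>h | h \<in> H \<and> h \<in> hstrips g. tab_gf h z k *
          (z k ^ (card (dg g) - card (dg h)) * z (Suc k) ^ (card (dg f) - card (dg g))))"
        by (intro sum.cong refl) (auto simp: H_def)
      also have "\<dots> = (\<Sum>h\<in>H. \<Sum>g | g \<in> hstrips f \<and> h \<in> hstrips g. tab_gf h z k *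
          (z k ^ (card (dg g) - card (dg h)) * z (Suc k) ^ (card (dg f) - card (dg g))))"
        by (rule sum.swap_restrict) (use finite_hstrips[OF Suc.prems(1)] finH in auto)
      finally show ?thesis by (simp add: sum_distrib_left B_def)
    qed
    show ?thesis
      unfolding N expand
    proof (rule sum.cong[OF refl])
      fix h assume h: "h \<in> H"
      then have sh: "shape h" using shape_hstrip[OF shape_hstrip[OF Suc.prems(1)]] by (auto simp: H_def)
      obtain r where r: "\<And>g. g \<in> hstrips f \<Longrightarrow> h \<in> hstrips g \<Longrightarrow>
          r g \<in> hstrips f \<and> h \<in> hstrips (r g) \<and> r (r g) = g \<and>
          card (dg (r g)) + card (dg g) = card (dg f) + card (dg h)"
        using hstrip_reflection[OF Suc.prems(1) sh] by blast
      have "(\<Sum>g\<in>B h. y (Suc k) ^ (card (dg g) - card (dg h)) * y k ^ (card (dg f) - card (dg g)))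
          = (\<Sum>g\<in>B h. y k ^ (card (dg g) - card (dg h)) * y (Suc k) ^ (card (dg f) - card (dg g)))"
      proof (rule sum.reindex_bij_witness[of _ r r])
        fix g assume g: "g \<in> B h"
        have gs: "g \<in> hstrips f" "h \<in> hstrips g" using g by (simp_all add: B_def)
        note 1 = card_dg_hstrip[OF shape_hstrip[OF Suc.prems(1) gs(1)] gs(2)]
          card_dg_hstrip[OF Suc.prems(1) gs(1)]
        have 2: "card (dg (r g)) + card (dg g) = card (dg f) + card (dg h)"
          using g r by (simp add: B_def)
        then have "card (dg (r g)) - card (dg h) = card (dg f) - card (dg g)"
          "card (dg f) - card (dg (r g)) = card (dg g) - card (dg h)" using 1 by linarith+
        then show "y k ^ (card (dg (r g)) - card (dg h)) * y (Suc k) ^ (card (dg f) - card (dg (r g)))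
            = y (Suc k) ^ (card (dg g) - card (dg h)) * y k ^ (card (dg f) - card (dg g))"
          by (simp add: mult.commute)
      qed (use r in \<open>auto simp: B_def\<close>)
      moreover have "tab_gf h (y \<circ> ?\<tau>) k = tab_gf h y k"
        by (rule tab_gf_cong) simp
      ultimately show "tab_gf h (y \<circ> ?\<tau>) k * (\<Sum>g\<in>B h. (y \<circ> ?\<tau>) k ^ (card (dg g) - card (dg h)) *
          (y \<circ> ?\<tau>) (Suc k) ^ (card (dg f) - card (dg g))) = tab_gf h y k * (\<Sum>g\<in>B h.
          y k ^ (card (dg g) - card (dg h)) * y (Suc k) ^ (card (dg f) - card (dg g)))"
        by simp
    qed
  qed
qed simp

section \<open>Power sum expansions of Schur functions\<close>

subsection \<open>Triangular systems\<close>

text \<open>Forward substitution: the equation at \<alpha> involves X \<alpha> and unknowns of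
  smaller rank only. The sums run over nonzero entries because P may be infinite.\<close>

lemma triangular_unique:
  fixes X :: "'i \<Rightarrow> 'v::rat_algebra" and A :: "'i \<Rightarrow> 'i \<Rightarrow> rat" and rk :: "'i \<Rightarrow> nat"
  assumes fin: "\<And>\<alpha>. \<alpha> \<in> P \<Longrightarrow> finite {\<mu> \<in> P. A \<mu> \<alpha> \<noteq> 0}"
    and tri: "\<And>\<mu> \<alpha>. \<mu> \<in> P \<Longrightarrow> \<alpha> \<in> P \<Longrightarrow> A \<mu> \<alpha> \<noteq> 0 \<Longrightarrow> \<mu> = \<alpha> \<or> rk \<mu> < rk \<alpha>"
    and diag: "\<And>\<alpha>. \<alpha> \<in> P \<Longrightarrow> A \<alpha> \<alpha> \<noteq> 0"
    and eq: "\<And>\<alpha>. \<alpha> \<in> P \<Longrightarrow> (\<Sum>\<mu> | \<mu> \<in> P \<and> A \<mu> \<alpha> \<noteq> 0. A \<mu> \<alpha> *\<^sub>Q X \<mu>) = 0"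
    and "\<alpha> \<in> P"
  shows "X \<alpha> = 0"
  using \<open>\<alpha> \<in> P\<close>
proof (induction "rk \<alpha>" arbitrary: \<alpha> rule: less_induct)
  case less
  have "(\<Sum>\<mu> | \<mu> \<in> P \<and> A \<mu> \<alpha> \<noteq> 0. A \<mu> \<alpha> *\<^sub>Q X \<mu>)
      = A \<alpha> \<alpha> *\<^sub>Q X \<alpha> + (\<Sum>\<mu>\<in>{\<mu> \<in> P. A \<mu> \<alpha> \<noteq> 0} - {\<alpha>}. A \<mu> \<alpha> *\<^sub>Q X \<mu>)"
    using less diag by (intro sum.remove fin) auto
  also have "(\<Sum>\<mu>\<in>{\<mu> \<in> P. A \<mu> \<alpha> \<noteq> 0} - {\<alpha>}. A \<mu> \<alpha> *\<^sub>Q X \<mu>) = 0"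
  proof (rule sum.neutral, rule ballI)
    fix \<mu> assume \<mu>: "\<mu> \<in> {\<mu> \<in> P. A \<mu> \<alpha> \<noteq> 0} - {\<alpha>}"
    then have "X \<mu> = 0" using tri[of \<mu> \<alpha>] less by blast
    then show "A \<mu> \<alpha> *\<^sub>Q X \<mu> = 0" by simp
  qed
  finally show ?case using eq[OF less.prems] diag[OF less.prems] by simp
qed

lemma triangular_solve:
  fixes Y :: "'i \<Rightarrow> 'v::rat_algebra" and A :: "'i \<Rightarrow> 'i \<Rightarrow> rat" and rk :: "'i \<Rightarrow> nat"
  assumes fin: "\<And>\<alpha>. \<alpha> \<in> P \<Longrightarrow> finite {\<mu> \<in> P. A \<mu> \<alpha> \<noteq> 0}"
    and tri: "\<And>\<mu> \<alpha>. \<mu> \<in> P \<Longrightarrow> \<alpha> \<in> P \<Longrightarrow> A \<mu> \<alpha> \<noteq> 0 \<Longrightarrow> \<mu> = \<alpha> \<or> rk \<mu> < rk \<alpha>"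
    and diag: "\<And>\<alpha>. \<alpha> \<in> P \<Longrightarrow> A \<alpha> \<alpha> \<noteq> 0"
  shows "\<exists>X. \<forall>\<alpha>\<in>P. (\<Sum>\<mu> | \<mu> \<in> P \<and> A \<mu> \<alpha> \<noteq> 0. A \<mu> \<alpha> *\<^sub>Q X \<mu>) = Y \<alpha>"
proof -
  let ?N = "\<lambda>\<alpha>. {\<mu> \<in> P. A \<mu> \<alpha> \<noteq> 0} - {\<alpha>}"
  let ?rhs = "\<lambda>X \<alpha>. (1 / A \<alpha> \<alpha>) *\<^sub>Q (Y \<alpha> - (\<Sum>\<mu>\<in>?N \<alpha>. A \<mu> \<alpha> *\<^sub>Q X \<mu>))"
  have "\<exists>X. \<forall>\<alpha>. \<alpha> \<in> P \<longrightarrow> X \<alpha> = ?rhs X \<alpha>"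
  \<comment> \<open>The recursion is posed on all indices and made vacuous outside P; inside P only
    values of smaller rank enter.\<close>
  proof (rule dependent_wf_choice[of "measure rk" "\<lambda>X \<alpha> x. \<alpha> \<in> P \<longrightarrow> x = ?rhs X \<alpha>"])
    fix f g :: "'i \<Rightarrow> 'v" and \<alpha> and r
    assume fg: "\<And>\<mu>. (\<mu>, \<alpha>) \<in> measure rk \<Longrightarrow> f \<mu> = g \<mu>"
    have "(\<Sum>\<mu>\<in>?N \<alpha>. A \<mu> \<alpha> *\<^sub>Q f \<mu>) = (\<Sum>\<mu>\<in>?N \<alpha>. A \<mu> \<alpha> *\<^sub>Q g \<mu>)" if "\<alpha> \<in> P"
    proof (rule sum.cong[OF refl])
      fix \<mu> assume "\<mu> \<in> ?N \<alpha>"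
      then show "A \<mu> \<alpha> *\<^sub>Q f \<mu> = A \<mu> \<alpha> *\<^sub>Q g \<mu>" using tri[of \<mu> \<alpha>] that fg[of \<mu>] by auto
    qed
    then show "(\<alpha> \<in> P \<longrightarrow> r = ?rhs f \<alpha>) = (\<alpha> \<in> P \<longrightarrow> r = ?rhs g \<alpha>)" by auto
  qed auto
  then obtain X where X: "\<And>\<alpha>. \<alpha> \<in> P \<Longrightarrow> X \<alpha> = ?rhs X \<alpha>" by blast
  have "(\<Sum>\<mu> | \<mu> \<in> P \<and> A \<mu> \<alpha> \<noteq> 0. A \<mu> \<alpha> *\<^sub>Q X \<mu>) = Y \<alpha>" if \<alpha>: "\<alpha> \<in> P" for \<alpha>
  proof -
    have "(\<Sum>\<mu> | \<mu> \<in> P \<and> A \<mu> \<alpha> \<noteq> 0. A \<mu> \<alpha> *\<^sub>Q X \<mu>)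
        = A \<alpha> \<alpha> *\<^sub>Q X \<alpha> + (\<Sum>\<mu>\<in>?N \<alpha>. A \<mu> \<alpha> *\<^sub>Q X \<mu>)"
      using \<alpha> diag by (intro sum.remove fin) auto
    also have "A \<alpha> \<alpha> *\<^sub>Q X \<alpha> = Y \<alpha> - (\<Sum>\<mu>\<in>?N \<alpha>. A \<mu> \<alpha> *\<^sub>Q X \<mu>)"
      by (subst X[OF \<alpha>]) (simp add: qscale_qscale diag[OF \<alpha>])
    finally show ?thesis by simp
  qed
  then show ?thesis by blast
qed

definition zsubgroup :: "'v::ab_group_add set \<Rightarrow> bool" where
  "zsubgroup L \<longleftrightarrow> 0 \<in> L \<and> (\<forall>x\<in>L. \<forall>y\<in>L. x - y \<in> L)"

lemma zsubgroup_closed: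
  assumes "zsubgroup L"
  shows "0 \<in> L" "x \<in> L \<Longrightarrow> y \<in> L \<Longrightarrow> x - y \<in> L" "x \<in> L \<Longrightarrow> y \<in> L \<Longrightarrow> x + y \<in> L"
    "(\<And>a. a \<in> A \<Longrightarrow> f a \<in> L) \<Longrightarrow> sum f A \<in> L"
proof -
  show 0: "0 \<in> L" and diff: "x \<in> L \<Longrightarrow> y \<in> L \<Longrightarrow> x - y \<in> L" for x y
    using assms by (auto simp: zsubgroup_def)
  show add: "x \<in> L \<Longrightarrow> y \<in> L \<Longrightarrow> x + y \<in> L" for x y
    using diff[of x "0 - y"] diff[OF 0, of y] by simp
  show "(\<And>a. a \<in> A \<Longrightarrow> f a \<in> L) \<Longrightarrow> sum f A \<in> L"
    by (induction A rule: infinite_finite_induct) (auto intro: 0 add)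
qed

lemma zsubgroup_scale:
  fixes L :: "'v::rat_algebra set"
  assumes L: "zsubgroup L" and q: "q \<in> \<int>" and x: "x \<in> L"
  shows "q *\<^sub>Q x \<in> L"
proof -
  from q obtain n where n: "q = of_int n" by (elim Ints_cases)
  have "of_int n *\<^sub>Q x \<in> L"
    by (induction n rule: int_induct[where k = 0])
      (auto simp: qscale_add_left qs.scale_left_diff_distrib qscale_one zsubgroup_closed[OF L] x)
  with n show ?thesis by simp
qed

text \<open>With unit diagonal the substitution never divides, so a subgroup L suffices instead of a
  subspace.\<close>

lemma triangular_integral:
  fixes X :: "'i \<Rightarrow> 'v::rat_algebra" and A :: "'i \<Rightarrow> 'i \<Rightarrow> rat" and rk :: "'i \<Rightarrow> nat"
  assumes fin: "\<And>\<alpha>. \<alpha> \<in> P \<Longrightarrow> finite {\<mu> \<in> P. A \<mu> \<alpha> \<noteq> 0}"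
    and tri: "\<And>\<mu> \<alpha>. \<mu> \<in> P \<Longrightarrow> \<alpha> \<in> P \<Longrightarrow> A \<mu> \<alpha> \<noteq> 0 \<Longrightarrow> \<mu> = \<alpha> \<or> rk \<mu> < rk \<alpha>"
    and diag: "\<And>\<alpha>. \<alpha> \<in> P \<Longrightarrow> A \<alpha> \<alpha> = 1"
    and int: "\<And>\<mu> \<alpha>. \<mu> \<in> P \<Longrightarrow> \<alpha> \<in> P \<Longrightarrow> A \<mu> \<alpha> \<in> \<int>"
    and L: "zsubgroup L"
    and eq: "\<And>\<alpha>. \<alpha> \<in> P \<Longrightarrow> (\<Sum>\<mu> | \<mu> \<in> P \<and> A \<mu> \<alpha> \<noteq> 0. A \<mu> \<alpha> *\<^sub>Q X \<mu>) \<in> L"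
    and "\<alpha> \<in> P"
  shows "X \<alpha> \<in> L"
  using \<open>\<alpha> \<in> P\<close>
proof (induction "rk \<alpha>" arbitrary: \<alpha> rule: less_induct)
  case less
  let ?S = "\<Sum>\<mu>\<in>{\<mu> \<in> P. A \<mu> \<alpha> \<noteq> 0} - {\<alpha>}. A \<mu> \<alpha> *\<^sub>Q X \<mu>"
  have "(\<Sum>\<mu> | \<mu> \<in> P \<and> A \<mu> \<alpha> \<noteq> 0. A \<mu> \<alpha> *\<^sub>Q X \<mu>) = A \<alpha> \<alpha> *\<^sub>Q X \<alpha> + ?S"
    using less diag by (intro sum.remove fin) auto
  moreover have "?S \<in> L"
  proof (rule zsubgroup_closed(4)[OF L])
    fix \<mu> assume \<mu>: "\<mu> \<in> {\<mu> \<in> P. A \<mu> \<alpha> \<noteq> 0} - {\<alpha>}"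
    then have "X \<mu> \<in> L" using tri[of \<mu> \<alpha>] less by blast
    then show "A \<mu> \<alpha> *\<^sub>Q X \<mu> \<in> L" using \<mu> less.prems by (intro zsubgroup_scale[OF L] int) auto
  qed
  ultimately show ?case
    using zsubgroup_closed(2)[OF L eq[OF less.prems], of ?S] diag[OF less.prems]
    by (simp add: qscale_one)
qed


subsection \<open>Partitions as decreasing functions\<close>

definition rows :: "partition \<Rightarrow> nat \<Rightarrow> nat" where
  "rows \<nu> i = (if i < size \<nu> then rev (sorted_list_of_multiset \<nu>) ! i else 0)"

definition of_shape :: "(nat \<Rightarrow> nat) \<Rightarrow> partition" where
  "of_shape f = image_mset f (mset_set {i. f i \<noteq> 0})"

lemma length_sorted_list: "length (sorted_list_of_multiset \<nu>) = size \<nu>"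
  by (metis mset_sorted_list_of_multiset size_mset)

lemma rows_antimono: "i \<le> j \<Longrightarrow> rows \<nu> j \<le> rows \<nu> i"
proof (cases "j < size \<nu>")
  case True
  assume "i \<le> j"
  then have "sorted_list_of_multiset \<nu> ! (size \<nu> - Suc j) \<le> sorted_list_of_multiset \<nu> ! (size \<nu> - Suc i)"
    using True by (intro sorted_nth_mono) (auto simp: length_sorted_list)
  with True \<open>i \<le> j\<close> show ?thesis by (simp add: rows_def rev_nth length_sorted_list)
qed (simp add: rows_def)

lemma shape_rows: "shape (rows \<nu>)"
proof -
  have "{i. rows \<nu> i \<noteq> 0} \<subseteq> {..<size \<nu>}" by (auto simp: rows_def split: if_splits)
  then show ?thesis by (auto simp: shape_def rows_antimono intro: finite_subset)
qed

lemma rows_support: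
  assumes "is_partition \<nu>"
  shows "{i. rows \<nu> i \<noteq> 0} = {..<size \<nu>}"
proof -
  have "rows \<nu> i \<noteq> 0" if "i < size \<nu>" for i
  proof -
    have "rows \<nu> i \<in> set (rev (sorted_list_of_multiset \<nu>))"
      using that by (simp add: rows_def length_sorted_list del: set_rev)
    then show ?thesis using assms by (auto simp: is_partition_def intro: ccontr)
  qed
  then show ?thesis by (auto simp: rows_def)
qed

lemma image_rows: "image_mset (rows \<nu>) (mset_set {..<size \<nu>}) = \<nu>"
proof -
  have "map (rows \<nu>) [0..<size \<nu>] = rev (sorted_list_of_multiset \<nu>)"
    by (rule nth_equalityI) (auto simp: rows_def length_sorted_list)
  then have "mset (map (rows \<nu>) [0..<size \<nu>]) = \<nu>" by simp
  then show ?thesis by (simp add: atLeast0LessThan)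
qed

lemma of_shape_rows: "is_partition \<nu> \<Longrightarrow> of_shape (rows \<nu>) = \<nu>"
  by (simp only: of_shape_def rows_support image_rows)

lemma shape_support: "shape f \<Longrightarrow> {i. f i \<noteq> 0} = {..<card {i. f i \<noteq> 0}}"
proof (rule down_closed_nat)
  fix i j assume "shape f" "i \<le> j" "j \<in> {i. f i \<noteq> 0}"
  then show "i \<in> {i. f i \<noteq> 0}" using shape_antimono[of f i j] by auto
qed (simp add: shape_def)

lemma rows_of_shape:
  assumes "shape f"
  shows "rows (of_shape f) = f" "is_partition (of_shape f)" "size (of_shape f) = card {i. f i \<noteq> 0}"
proof -
  define n where "n = card {i. f i \<noteq> 0}"
  have S: "{i. f i \<noteq> 0} = {..<n}" using shape_support[OF assms] by (simp add: n_def)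
  show size: "size (of_shape f) = card {i. f i \<noteq> 0}" by (simp add: of_shape_def)
  show "is_partition (of_shape f)"
    using assms by (auto simp: is_partition_def of_shape_def shape_def)
  have "of_shape f = mset (map f [0..<n])"
    unfolding of_shape_def S by (simp add: atLeast0LessThan)
  moreover have "sort (map f [0..<n]) = rev (map f [0..<n])"
  proof (rule properties_for_sort)
    show "sorted (rev (map f [0..<n]))"
      by (auto simp: sorted_iff_nth_mono rev_nth intro!: shape_antimono[OF assms])
  qed simp
  ultimately have "rev (sorted_list_of_multiset (of_shape f)) = map f [0..<n]"
    by (simp only: sorted_list_of_multiset_mset rev_rev_ident)
  moreover have "size (of_shape f) = n" by (simp only: size n_def)
  moreover have "f i = 0" if "\<not> i < n" for i
  proof -
    have "i \<notin> {i. f i \<noteq> 0}" using that unfolding S by simp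
    then show ?thesis by simp
  qed
  ultimately show "rows (of_shape f) = f"
    by (intro ext) (simp only: rows_def, auto)
qed

lemma diagram_eq: "diagram \<nu> = dg (rows \<nu>)"
  by (auto simp: diagram_def dg_def rows_def split: if_splits)

lemma ssyt_eq: "ssyt \<nu> N = tabs (rows \<nu>) N"
  by (simp add: ssyt_def tabs_def diagram_eq)

lemma schur_eq: "schur \<nu> N = tab_gf (rows \<nu>) indet N"
  by (simp add: schur_def tab_gf_def ssyt_eq diagram_eq)

lemma card_diagram: "card (diagram \<nu>) = \<Sum>\<^sub># \<nu>"
proof -
  have "card (diagram \<nu>) = (\<Sum>i<size \<nu>. rows \<nu> i)"
    unfolding diagram_eq by (rule card_dg) (simp add: rows_def)
  also have "\<dots> = \<Sum>\<^sub># (image_mset (rows \<nu>) (mset_set {..<size \<nu>}))"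
    by (simp add: sum_unfold_sum_mset)
  finally show ?thesis by (simp add: image_rows)
qed

lemma finite_diagram [simp]: "finite (diagram \<nu>)"
  by (simp add: diagram_eq finite_dg shape_rows)

lemma finite_ssyt [simp]: "finite (ssyt \<nu> N)"
  by (simp add: ssyt_eq finite_tabs shape_rows)

lemma size_le_sum: "is_partition \<mu> \<Longrightarrow> size \<mu> \<le> \<Sum>\<^sub># \<mu>"
  unfolding is_partition_def by (induction \<mu>) auto

lemma finite_partitions: "finite {\<mu>. is_partition \<mu> \<and> \<Sum>\<^sub># \<mu> \<le> d}"
proof (rule finite_subset)
  show "{\<mu>. is_partition \<mu> \<and> \<Sum>\<^sub># \<mu> \<le> d} \<subseteq> mset ` {xs. set xs \<subseteq> {..d} \<and> length xs \<le> d}"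
  proof clarify
    fix \<mu> assume \<mu>: "is_partition \<mu>" "\<Sum>\<^sub># \<mu> \<le> d"
    have "x \<le> d" if "x \<in># \<mu>" for x
      using that \<mu>(2) by (metis sum_mset.remove le_add1 order_trans)
    then show "\<mu> \<in> mset ` {xs. set xs \<subseteq> {..d} \<and> length xs \<le> d}"
      using size_le_sum[OF \<mu>(1)] \<mu>(2)
      by (intro image_eqI[of _ _ "sorted_list_of_multiset \<mu>"]) (auto simp: length_sorted_list)
  qed
qed (simp add: finite_lists_length_le)


subsection \<open>Coefficients of Schur polynomials and power sums\<close>

text \<open>As series, polynomials share the convolution calculus of coefficients, and other series
  can be substituted for their variables.\<close>

definition pser :: "('m \<Rightarrow>\<^sub>0 'c::comm_ring_1) \<Rightarrow> ('m, 'c) mseries" where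
  "pser P = MSeries (Poly_Mapping.lookup P)"

lemma mcoef_pser [simp]: "mcoef (pser P) m = Poly_Mapping.lookup P m"
  by (simp add: pser_def)

lemma pser_add: "pser (P + Q) = pser P + pser Q"
  by (rule mseries_eqI) (simp add: lookup_add)

lemma pser_0: "pser 0 = 0"
  by (rule mseries_eqI) simp

lemma pser_single: "pser (Poly_Mapping.single m c) = mmono m c"
  by (rule mseries_eqI) (simp add: mcoef_mono lookup_single when_def)

lemma pser_1: "pser (1 :: 'm::graded_cmonoid \<Rightarrow>\<^sub>0 'c::comm_ring_1) = 1"
  using pser_single[of "0::'m" "1::'c"] by (simp add: mono_0_1)

lemma pser_mult: "pser (P * Q) = pser P * pser (Q :: 'm::graded_cmonoid \<Rightarrow>\<^sub>0 'c::comm_ring_1)"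
proof (induction P rule: update_induct)
  case const
  show ?case by (simp add: pser_0)
next
  case (update f k v)
  then have upd: "Poly_Mapping.update k v f = f + Poly_Mapping.single k v"
    by (intro poly_mapping_eqI)
      (auto simp: lookup_update lookup_add lookup_single when_def in_keys_iff)
  have "pser (Poly_Mapping.single k v * Q) = mmono k v * pser Q"
  proof (induction Q rule: update_induct)
    case const
    show ?case by (simp add: pser_0)
  next
    case (update g l w)
    then have "Poly_Mapping.update l w g = g + Poly_Mapping.single l w"
      by (intro poly_mapping_eqI)
        (auto simp: lookup_update lookup_add lookup_single when_def in_keys_iff)
    with update.IH show ?case
      by (simp add: distrib_left pser_add mult_single pser_single mono_mult)
  qed
  with update.IH show ?case by (simp add: upd distrib_right pser_add pser_single)
qed

lemma pser_sum: "pser (sum f A) = (\<Sum>x\<in>A. pser (f x))"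
  by (induction A rule: infinite_finite_induct) (auto simp: pser_0 pser_add)

lemma pser_prod:
  fixes f :: "'i \<Rightarrow> 'm::graded_cmonoid \<Rightarrow>\<^sub>0 'c::comm_ring_1"
  shows "pser (prod f A) = (\<Prod>x\<in>A. pser (f x))"
  by (induction A rule: infinite_finite_induct) (auto simp: pser_1 pser_mult)

lemma mcoef_mono_mult:
  fixes f :: "('m::{graded_cmonoid, cancel_comm_monoid_add}, 'a::ring) mseries"
  shows "mcoef (mmono b c * f) (b + m) = c * mcoef f m"
    and "(\<And>m. n \<noteq> b + m) \<Longrightarrow> mcoef (mmono b c * f) n = 0"
proof -
  have "mcoef (mmono b c * f) (b + m) = (\<Sum>(x, y)\<in>{(b, m)}. mcoef (mmono b c) x * mcoef f y)"
    unfolding mcoef_times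
    by (rule sum.mono_neutral_right) (auto simp: in_decomp_iff mcoef_mono split: if_splits)
  then show "mcoef (mmono b c * f) (b + m) = c * mcoef f m" by (simp add: mcoef_mono)
  show "mcoef (mmono b c * f) n = 0" if "\<And>m. n \<noteq> b + m"
    unfolding mcoef_times
  proof (rule sum.neutral, clarify)
    fix x y assume "(x, y) \<in> decomp n"
    then have "x \<noteq> b" using that[of y] by (auto simp: in_decomp_iff)
    then show "mcoef (mmono b c) x * mcoef f y = 0" by (simp add: mcoef_mono)
  qed
qed

lemma lookup_const_mult: "Poly_Mapping.lookup (Poly_Mapping.single 0 c * P) m = c * Poly_Mapping.lookup P m"
  for P :: polynomial
  using mcoef_mono_mult(1)[of 0 c "pser P" m] by (simp flip: mcoef_pser add: pser_mult pser_single)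

text \<open>The exponent vector of the monomial of a filling.\<close>

definition content :: "('i \<Rightarrow> nat) \<Rightarrow> 'i set \<Rightarrow> nat \<Rightarrow>\<^sub>0 nat" where
  "content t D = (\<Sum>c\<in>D. Poly_Mapping.single (t c) 1)"

lemma prod_indet: "(\<Prod>c\<in>D. indet (t c)) = Poly_Mapping.single (content t D) 1"
  by (induction D rule: infinite_finite_induct) (auto simp: content_def indet_def mult_single)

lemma lookup_tab_sum:
  assumes "finite A"
  shows "Poly_Mapping.lookup (\<Sum>t\<in>A. \<Prod>c\<in>D. indet (\<tau> (t c))) \<alpha>
    = of_nat (card {t \<in> A. content (\<tau> \<circ> t) D = \<alpha>})"
proof -
  have "Poly_Mapping.lookup (\<Sum>t\<in>A. \<Prod>c\<in>D. indet (\<tau> (t c))) \<alpha>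
      = (\<Sum>t\<in>A. if content (\<tau> \<circ> t) D = \<alpha> then 1 else 0)"
    using prod_indet[of "\<tau> \<circ> t" D for t]
    by (simp add: lookup_sum lookup_single when_def)
  also have "\<dots> = (\<Sum>t\<in>{t \<in> A. content (\<tau> \<circ> t) D = \<alpha>}. 1)"
    using assms by (intro sum.mono_neutral_cong_right) auto
  finally show ?thesis by simp
qed

section \<open>Symmetry under adjacent transpositions of exponents\<close>

definition swp :: "nat \<Rightarrow> (nat \<Rightarrow>\<^sub>0 nat) \<Rightarrow> nat \<Rightarrow>\<^sub>0 nat" where
  "swp k \<alpha> = Poly_Mapping.map_key (transpose k (Suc k)) \<alpha>"

lemma inj_transpose: "inj (transpose a b)"
  by (rule bij_is_inj) simp

lemma lookup_swp: "Poly_Mapping.lookup (swp k \<alpha>) i = Poly_Mapping.lookup \<alpha> (transpose k (Suc k) i)"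
  by (simp add: swp_def map_key.rep_eq inj_transpose)

lemma swp_swp: "swp k (swp k \<alpha>) = \<alpha>"
  by (rule poly_mapping_eqI) (simp add: lookup_swp)

lemma swp_add: "swp k (\<alpha> + \<beta>) = swp k \<alpha> + swp k \<beta>"
  by (rule poly_mapping_eqI) (simp add: lookup_swp lookup_add)

lemma swp_single: "swp k (Poly_Mapping.single i n) = Poly_Mapping.single (transpose k (Suc k) i) n"
  by (rule poly_mapping_eqI) (auto simp: lookup_swp lookup_single when_def)

lemma content_transpose: "content (transpose k (Suc k) \<circ> t) D = swp k (content t D)"
proof (induction D rule: infinite_finite_induct)
  case (infinite A)
  then show ?case by (intro poly_mapping_eqI) (simp add: content_def lookup_swp)
next
  case empty
  then show ?case by (intro poly_mapping_eqI) (simp add: content_def lookup_swp)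
qed (simp add: content_def swp_add swp_single)

lemma lookup_schur:
  "Poly_Mapping.lookup (schur \<nu> N) \<alpha> = of_nat (card {t \<in> ssyt \<nu> N. content t (diagram \<nu>) = \<alpha>})"
  using lookup_tab_sum[of "ssyt \<nu> N" id "diagram \<nu>" \<alpha>] by (simp add: schur_def)

text \<open>The coefficient counts tableaux of content \<alpha>. Exchanging two adjacent letters
  leaves the generating function unchanged and exchanges two exponents of each content.\<close>

lemma lookup_schur_swp:
  assumes "Suc k < N"
  shows "Poly_Mapping.lookup (schur \<nu> N) (swp k \<alpha>) = Poly_Mapping.lookup (schur \<nu> N) \<alpha>"
proof -
  let ?\<tau> = "transpose k (Suc k)"
  have "schur \<nu> N = (\<Sum>t\<in>ssyt \<nu> N. \<Prod>c\<in>diagram \<nu>. indet (?\<tau> (t c)))"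
    using tab_gf_swap[OF shape_rows assms, of \<nu> indet]
    by (simp add: schur_eq) (simp add: tab_gf_def ssyt_eq diagram_eq)
  then have "Poly_Mapping.lookup (schur \<nu> N) \<alpha>
      = of_nat (card {t \<in> ssyt \<nu> N. content (?\<tau> \<circ> t) (diagram \<nu>) = \<alpha>})"
    by (simp only: lookup_tab_sum[OF finite_ssyt])
  also have "{t \<in> ssyt \<nu> N. content (?\<tau> \<circ> t) (diagram \<nu>) = \<alpha>}
      = {t \<in> ssyt \<nu> N. content t (diagram \<nu>) = swp k \<alpha>}"
    by (auto simp: content_transpose swp_swp)
  finally show ?thesis by (simp add: lookup_schur)
qed

lemma lookup_content: "finite D \<Longrightarrow> Poly_Mapping.lookup (content t D) i = card {c \<in> D. t c = i}"
proof (induction D rule: finite_induct)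
  case (insert c D)
  have "{d \<in> insert c D. t d = i} = (if t c = i then insert c {d \<in> D. t d = i} else {d \<in> D. t d = i})"
    by auto
  then show ?case using insert by (simp add: content_def lookup_add lookup_single when_def)
qed (simp add: content_def)

lemma keys_content: "finite D \<Longrightarrow> Poly_Mapping.keys (content t D) = t ` D"
  by (auto simp: in_keys_iff lookup_content card_eq_0_iff)

lemma deg_content: "finite D \<Longrightarrow> deg (content t D) = card D"
  by (induction D rule: finite_induct) (auto simp: content_def deg_add deg_single deg_nat_def)

section \<open>Monomial coefficients of products of power sums\<close>

lemma lookup_power_sum_add:
  "Poly_Mapping.lookup (power_sum (add_mset n \<mu>) N) \<alpha>
    = (\<Sum>i<N. if n \<le> Poly_Mapping.lookup \<alpha> i
         then Poly_Mapping.lookup (power_sum \<mu> N) (\<alpha> - Poly_Mapping.single i n) else 0)"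
proof -
  have pow: "indet i ^ n = Poly_Mapping.single (Poly_Mapping.single i n) 1" for i
    by (induction n) (auto simp: indet_def mult_single simp flip: single_add)
  have "mcoef (mmono (Poly_Mapping.single i n) 1 * pser (power_sum \<mu> N)) \<alpha>
      = (if n \<le> Poly_Mapping.lookup \<alpha> i
         then Poly_Mapping.lookup (power_sum \<mu> N) (\<alpha> - Poly_Mapping.single i n) else 0)" for i
  proof (cases "n \<le> Poly_Mapping.lookup \<alpha> i")
    case True
    then have "\<alpha> = Poly_Mapping.single i n + (\<alpha> - Poly_Mapping.single i n)"
      by (intro poly_mapping_eqI) (auto simp: lookup_add lookup_minus lookup_single when_def)
    then show ?thesis
      using True mcoef_mono_mult(1)[of "Poly_Mapping.single i n" 1 "pser (power_sum \<mu> N)"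
          "\<alpha> - Poly_Mapping.single i n"] by simp
  next
    case False
    then have "\<alpha> \<noteq> Poly_Mapping.single i n + m" for m by (auto simp: lookup_add)
    then show ?thesis using False by (simp add: mcoef_mono_mult(2))
  qed
  moreover have "pser (power_sum (add_mset n \<mu>) N)
      = (\<Sum>i<N. mmono (Poly_Mapping.single i n) 1 * pser (power_sum \<mu> N))"
    by (simp add: power_sum_def pow pser_mult pser_sum pser_single sum_distrib_right)
  ultimately have "mcoef (pser (power_sum (add_mset n \<mu>) N)) \<alpha>
    = (\<Sum>i<N. if n \<le> Poly_Mapping.lookup \<alpha> i
         then Poly_Mapping.lookup (power_sum \<mu> N) (\<alpha> - Poly_Mapping.single i n) else 0)"
    by (simp only: mcoef_sum)
  then show ?thesis by (simp only: mcoef_pser)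
qed

lemma lookup_power_sum_empty: "Poly_Mapping.lookup (power_sum {#} N) \<alpha> = (if \<alpha> = 0 then 1 else 0)"
  by (auto simp: power_sum_def lookup_one when_def)

lemma lookup_power_sum_nonneg: "0 \<le> Poly_Mapping.lookup (power_sum \<mu> N) \<alpha>"
  by (induction \<mu> arbitrary: \<alpha>)
    (auto simp: lookup_power_sum_empty lookup_power_sum_add intro!: sum_nonneg)

lemma lookup_power_sum_nonzeroE:
  assumes "Poly_Mapping.lookup (power_sum (add_mset n \<mu>) N) \<alpha> \<noteq> 0"
  obtains i \<beta> where "i < N" "\<alpha> = \<beta> + Poly_Mapping.single i n"
    "Poly_Mapping.lookup (power_sum \<mu> N) \<beta> \<noteq> 0"
proof -
  obtain i where i: "i < N" "n \<le> Poly_Mapping.lookup \<alpha> i"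
    "Poly_Mapping.lookup (power_sum \<mu> N) (\<alpha> - Poly_Mapping.single i n) \<noteq> 0"
    using assms unfolding lookup_power_sum_add
    by (elim sum.not_neutral_contains_not_neutral) (auto split: if_splits)
  moreover have "\<alpha> = (\<alpha> - Poly_Mapping.single i n) + Poly_Mapping.single i n"
    using i(2) by (intro poly_mapping_eqI) (auto simp: lookup_add lookup_minus lookup_single when_def)
  ultimately show thesis using that by blast
qed

lemma power_sum_support:
  assumes "Poly_Mapping.lookup (power_sum \<mu> N) \<alpha> \<noteq> 0"
  shows "Poly_Mapping.keys \<alpha> \<subseteq> {..<N}" "deg \<alpha> = \<Sum>\<^sub># \<mu>"
  using assms
proof (induction \<mu> arbitrary: \<alpha>)
  case (add n \<mu>)
  { case 1
    then obtain i \<beta> where *: "i < N" "\<alpha> = \<beta> + Poly_Mapping.single i n"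
        "Poly_Mapping.lookup (power_sum \<mu> N) \<beta> \<noteq> 0" by (elim lookup_power_sum_nonzeroE)
    then show ?case
      using add.IH(1)[of \<beta>] keys_add[of \<beta> "Poly_Mapping.single i n"] by (auto split: if_splits) }
  { case 2
    then obtain i \<beta> where *: "i < N" "\<alpha> = \<beta> + Poly_Mapping.single i n"
        "Poly_Mapping.lookup (power_sum \<mu> N) \<beta> \<noteq> 0" by (elim lookup_power_sum_nonzeroE)
    then show ?case using add.IH(2)[of \<beta>] by (simp add: deg_add deg_single deg_nat_def) }
qed (auto simp: lookup_power_sum_empty split: if_splits)

lemma keys_diff_subset: "Poly_Mapping.keys (\<alpha> - \<beta>) \<subseteq> Poly_Mapping.keys (\<alpha> :: nat \<Rightarrow>\<^sub>0 nat)"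
proof
  fix x assume "x \<in> Poly_Mapping.keys (\<alpha> - \<beta>)"
  then have "Poly_Mapping.lookup \<alpha> x - Poly_Mapping.lookup \<beta> x \<noteq> 0"
    unfolding in_keys_iff lookup_minus .
  then show "x \<in> Poly_Mapping.keys \<alpha>" unfolding in_keys_iff by simp
qed

definition exponents :: "(nat \<Rightarrow>\<^sub>0 nat) \<Rightarrow> nat multiset" where
  "exponents \<alpha> = image_mset (Poly_Mapping.lookup \<alpha>) (mset_set (Poly_Mapping.keys \<alpha>))"

lemma exponents_add_single:
  assumes "i \<notin> Poly_Mapping.keys \<beta>" "n \<noteq> 0"
  shows "exponents (\<beta> + Poly_Mapping.single i n) = add_mset n (exponents \<beta>)"
proof -
  have i: "Poly_Mapping.lookup \<beta> i = 0" using assms(1) by (simp add: in_keys_iff)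
  have "Poly_Mapping.keys (\<beta> + Poly_Mapping.single i n) = insert i (Poly_Mapping.keys \<beta>)"
    using assms(2) by (auto simp: in_keys_iff lookup_add lookup_single when_def split: if_splits)
  moreover have "image_mset (Poly_Mapping.lookup (\<beta> + Poly_Mapping.single i n)) (mset_set (Poly_Mapping.keys \<beta>))
      = image_mset (Poly_Mapping.lookup \<beta>) (mset_set (Poly_Mapping.keys \<beta>))"
    using assms(1) by (intro image_mset_cong) (auto simp: lookup_add lookup_single when_def)
  ultimately show ?thesis using assms(1) i by (simp add: exponents_def lookup_add)
qed

text \<open>Expanding p_\<mu> puts each part on some variable. Parts on the same variable merge, so
  at most as many variables as parts occur, and if equally many occur, the exponents are the
  parts.\<close>

lemma power_sum_triangular:
  assumes "Poly_Mapping.lookup (power_sum \<mu> N) \<alpha> \<noteq> 0" "is_partition \<mu>"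
  shows "card (Poly_Mapping.keys \<alpha>) \<le> size \<mu> \<and> (card (Poly_Mapping.keys \<alpha>) = size \<mu> \<longrightarrow> exponents \<alpha> = \<mu>)"
  using assms
proof (induction \<mu> arbitrary: \<alpha>)
  case empty
  then show ?case by (auto simp: lookup_power_sum_empty exponents_def split: if_splits)
next
  case (add n \<mu>)
  then have n: "n \<noteq> 0" and \<mu>: "is_partition \<mu>" by (auto simp: is_partition_def)
  from add.prems(1) obtain i \<beta> where *: "i < N" "\<alpha> = \<beta> + Poly_Mapping.single i n"
      "Poly_Mapping.lookup (power_sum \<mu> N) \<beta> \<noteq> 0" by (elim lookup_power_sum_nonzeroE)
  have keys: "Poly_Mapping.keys \<alpha> = insert i (Poly_Mapping.keys \<beta>)"
    using n by (auto simp: * in_keys_iff lookup_add lookup_single when_def split: if_splits)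
  note IH = add.IH[OF *(3) \<mu>]
  show ?case
  proof (cases "i \<in> Poly_Mapping.keys \<beta>")
    case True
    then show ?thesis using IH by (auto simp: keys insert_absorb)
  next
    case False
    then show ?thesis using IH exponents_add_single[OF False n] by (auto simp: keys *(2)[symmetric])
  qed
qed

text \<open>The coefficients of p_\<mu> are nonnegative, so the one placement of the parts on
  distinct variables given by \<alpha> already makes this coefficient positive.\<close>

lemma power_sum_diagonal:
  assumes "exponents \<alpha> = \<mu>" "Poly_Mapping.keys \<alpha> \<subseteq> {..<N}"
  shows "0 < Poly_Mapping.lookup (power_sum \<mu> N) \<alpha>"
  using assms
proof (induction \<mu> arbitrary: \<alpha>)
  case empty
  then have "\<alpha> = 0" by (simp add: exponents_def mset_set_empty_iff)
  then show ?case by (simp add: lookup_power_sum_empty)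
next
  case (add n \<mu>)
  then have "n \<in># exponents \<alpha>" by simp
  then obtain i where i: "i \<in> Poly_Mapping.keys \<alpha>" "Poly_Mapping.lookup \<alpha> i = n"
    by (auto simp: exponents_def)
  define \<beta> where "\<beta> = \<alpha> - Poly_Mapping.single i n"
  have \<alpha>: "\<alpha> = \<beta> + Poly_Mapping.single i n"
    using i(2) by (intro poly_mapping_eqI) (auto simp: \<beta>_def lookup_add lookup_minus lookup_single when_def)
  have n: "n \<noteq> 0" using i by (auto simp: in_keys_iff)
  have "i \<notin> Poly_Mapping.keys \<beta>" using i by (simp add: \<beta>_def in_keys_iff lookup_minus)
  then have "exponents \<beta> = \<mu>" using exponents_add_single[of i \<beta> n] n add.prems(1) \<alpha> by simp
  moreover have "Poly_Mapping.keys \<beta> \<subseteq> {..<N}"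
    using add.prems(2) keys_diff_subset[of \<alpha> "Poly_Mapping.single i n"] by (auto simp: \<beta>_def)
  ultimately have pos: "0 < Poly_Mapping.lookup (power_sum \<mu> N) \<beta>" by (rule add.IH)
  have iN: "i < N" using i(1) add.prems(2) by auto
  let ?g = "\<lambda>i. if n \<le> Poly_Mapping.lookup \<alpha> i
      then Poly_Mapping.lookup (power_sum \<mu> N) (\<alpha> - Poly_Mapping.single i n) else 0"
  have "?g i \<le> (\<Sum>i<N. ?g i)"
    by (rule member_le_sum) (use iN in \<open>auto simp: lookup_power_sum_nonneg\<close>)
  then show ?case using pos i(2) by (simp add: lookup_power_sum_add \<beta>_def)
qed

lemma lookup_power_sum_swp:
  assumes "Suc k < N"
  shows "Poly_Mapping.lookup (power_sum \<mu> N) (swp k \<alpha>) = Poly_Mapping.lookup (power_sum \<mu> N) \<alpha>"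
proof (induction \<mu> arbitrary: \<alpha>)
  case empty
  have "swp k \<alpha> = 0 \<longleftrightarrow> \<alpha> = 0" by (metis swp_swp lookup_swp lookup_zero poly_mapping_eqI)
  then show ?case by (simp add: lookup_power_sum_empty)
next
  case (add n \<mu>)
  let ?\<tau> = "transpose k (Suc k)"
  have \<tau>: "?\<tau> i < N \<longleftrightarrow> i < N" for i using assms by (auto simp: transpose_def)
  have sub: "swp k \<alpha> - Poly_Mapping.single (?\<tau> i) n = swp k (\<alpha> - Poly_Mapping.single i n)" for i
    by (rule poly_mapping_eqI) (auto simp: lookup_swp lookup_minus lookup_single when_def)
  show ?case
    unfolding lookup_power_sum_add
  proof (rule sum.reindex_bij_witness[of _ ?\<tau> ?\<tau>])
    fix i
    have "swp k \<alpha> - Poly_Mapping.single i n = swp k (\<alpha> - Poly_Mapping.single (?\<tau> i) n)"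
      using sub[of "?\<tau> i"] by simp
    then show "(if n \<le> Poly_Mapping.lookup \<alpha> (?\<tau> i)
         then Poly_Mapping.lookup (power_sum \<mu> N) (\<alpha> - Poly_Mapping.single (?\<tau> i) n) else 0) =
        (if n \<le> Poly_Mapping.lookup (swp k \<alpha>) i
         then Poly_Mapping.lookup (power_sum \<mu> N) (swp k \<alpha> - Poly_Mapping.single i n) else 0)"
      by (simp add: lookup_swp add.IH)
  qed (auto simp: \<tau>)
qed

lemma power_sum_stable:
  assumes "Poly_Mapping.keys \<alpha> \<subseteq> {..<N}" "N \<le> N'" "is_partition \<mu>"
  shows "Poly_Mapping.lookup (power_sum \<mu> N') \<alpha> = Poly_Mapping.lookup (power_sum \<mu> N) \<alpha>"
  using assms(1,3)
proof (induction \<mu> arbitrary: \<alpha>)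
  case (add n \<mu>)
  then have n: "n \<noteq> 0" and \<mu>: "is_partition \<mu>" by (auto simp: is_partition_def)
  have "Poly_Mapping.lookup (power_sum (add_mset n \<mu>) N') \<alpha> = (\<Sum>i<N. if n \<le> Poly_Mapping.lookup \<alpha> i
         then Poly_Mapping.lookup (power_sum \<mu> N') (\<alpha> - Poly_Mapping.single i n) else 0)"
    unfolding lookup_power_sum_add
  proof (rule sum.mono_neutral_right)
    have "Poly_Mapping.lookup \<alpha> i = 0" if "N \<le> i" for i
    proof -
      have "i \<notin> Poly_Mapping.keys \<alpha>" using add.prems(1) that by auto
      then show ?thesis by (simp add: in_keys_iff)
    qed
    then show "\<forall>i\<in>{..<N'} - {..<N}. (if n \<le> Poly_Mapping.lookup \<alpha> i
         then Poly_Mapping.lookup (power_sum \<mu> N') (\<alpha> - Poly_Mapping.single i n) else 0) = 0"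
      using n by simp
  qed (use assms(2) in auto)
  also have "\<dots> = Poly_Mapping.lookup (power_sum (add_mset n \<mu>) N) \<alpha>"
    unfolding lookup_power_sum_add
  proof (intro sum.cong if_cong refl add.IH \<mu>)
    fix i show "Poly_Mapping.keys (\<alpha> - Poly_Mapping.single i n) \<subseteq> {..<N}"
      using add.prems(1) keys_diff_subset[of \<alpha> "Poly_Mapping.single i n"] by blast
  qed
  finally show ?case .
qed (simp add: lookup_power_sum_empty)

lemma schur_support:
  assumes "Poly_Mapping.lookup (schur \<nu> N) \<alpha> \<noteq> 0"
  shows "Poly_Mapping.keys \<alpha> \<subseteq> {..<N}" "deg \<alpha> = \<Sum>\<^sub># \<nu>"
proof -
  obtain t where t: "t \<in> ssyt \<nu> N" "content t (diagram \<nu>) = \<alpha>"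
    using assms unfolding lookup_schur by (metis (mono_tags, lifting) card.empty empty_Collect_eq of_nat_0)
  then show "Poly_Mapping.keys \<alpha> \<subseteq> {..<N}"
    by (auto simp: keys_content ssyt_def simp flip: t(2))
  show "deg \<alpha> = \<Sum>\<^sub># \<nu>" using deg_content[of "diagram \<nu>" t] t(2) by (simp add: card_diagram)
qed

lemma schur_stable:
  assumes "Poly_Mapping.keys \<alpha> \<subseteq> {..<N}" "N \<le> N'"
  shows "Poly_Mapping.lookup (schur \<nu> N') \<alpha> = Poly_Mapping.lookup (schur \<nu> N) \<alpha>"
proof -
  have "{t \<in> ssyt \<nu> N'. content t (diagram \<nu>) = \<alpha>} = {t \<in> ssyt \<nu> N. content t (diagram \<nu>) = \<alpha>}"
  proof (rule Collect_cong)
    fix t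
    have "t \<in> ssyt \<nu> N' \<longleftrightarrow> t \<in> ssyt \<nu> N" if "content t (diagram \<nu>) = \<alpha>"
    proof -
      have "t ` diagram \<nu> \<subseteq> {..<N}" using that assms(1) keys_content[of "diagram \<nu>" t] by simp
      then have "(t \<in> diagram \<nu> \<rightarrow>\<^sub>E {..<N'}) = (t \<in> diagram \<nu> \<rightarrow>\<^sub>E {..<N})"
        using assms(2) by (auto simp: PiE_iff)
      then show ?thesis by (simp add: ssyt_def)
    qed
    then show "(t \<in> ssyt \<nu> N' \<and> content t (diagram \<nu>) = \<alpha>) = (t \<in> ssyt \<nu> N \<and> content t (diagram \<nu>) = \<alpha>)"
      by blast
  qed
  then show ?thesis by (simp add: lookup_schur)
qed

subsection \<open>Existence and uniqueness of the expansion\<close>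

text \<open>The dominant exponent vector of \<kappa>. Its coefficient in a symmetric polynomial is
  that of the monomial symmetric function m_\<kappa>.\<close>

definition rowexp :: "partition \<Rightarrow> nat \<Rightarrow>\<^sub>0 nat" where
  "rowexp \<kappa> = Abs_poly_mapping (rows \<kappa>)"

lemma lookup_rowexp [simp]: "Poly_Mapping.lookup (rowexp \<kappa>) = rows \<kappa>"
  using shape_rows[of \<kappa>] by (simp add: rowexp_def shape_def)

lemma keys_rowexp: "is_partition \<kappa> \<Longrightarrow> Poly_Mapping.keys (rowexp \<kappa>) = {..<size \<kappa>}"
  using rows_support[of \<kappa>] by (auto simp: set_eq_iff in_keys_iff)

lemma exponents_rowexp: "is_partition \<kappa> \<Longrightarrow> exponents (rowexp \<kappa>) = \<kappa>"
  by (simp add: exponents_def keys_rowexp image_rows)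

lemma rowexp_inj: "is_partition \<kappa> \<Longrightarrow> is_partition \<mu> \<Longrightarrow> rowexp \<kappa> = rowexp \<mu> \<Longrightarrow> \<kappa> = \<mu>"
  by (metis exponents_rowexp)

lemma deg_rowexp: "is_partition \<kappa> \<Longrightarrow> deg (rowexp \<kappa>) = \<Sum>\<^sub># \<kappa>"
proof -
  assume \<kappa>: "is_partition \<kappa>"
  have "deg (rowexp \<kappa>) = (\<Sum>i<size \<kappa>. rows \<kappa> i)"
    by (simp add: deg_poly_mapping_def keys_rowexp[OF \<kappa>] deg_nat_def)
  also have "\<dots> = \<Sum>\<^sub># (image_mset (rows \<kappa>) (mset_set {..<size \<kappa>}))"
    by (simp add: sum_unfold_sum_mset)
  finally show ?thesis by (simp add: image_rows)
qed

text \<open>Adjacent exchanges sort any exponent vector into a dominant one, where the coefficient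
  vanishes by assumption. An exchange at an ascent lowers the sum of i times the exponent of
  variable i, which is the measure of the induction.\<close>

lemma swap_symmetric_eq_0:
  fixes P :: polynomial
  assumes sym: "\<And>k \<alpha>. Suc k < N \<Longrightarrow> Poly_Mapping.lookup P (swp k \<alpha>) = Poly_Mapping.lookup P \<alpha>"
    and van: "\<And>\<kappa>. is_partition \<kappa> \<Longrightarrow> size \<kappa> \<le> N \<Longrightarrow> Poly_Mapping.lookup P (rowexp \<kappa>) = 0"
    and supp: "\<And>\<alpha>. Poly_Mapping.lookup P \<alpha> \<noteq> 0 \<Longrightarrow> Poly_Mapping.keys \<alpha> \<subseteq> {..<N}"
  shows "P = 0"
proof (rule poly_mapping_eqI)
  fix \<alpha>
  show "Poly_Mapping.lookup P \<alpha> = Poly_Mapping.lookup 0 \<alpha>"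
  proof (induction "\<Sum>i<N. i * Poly_Mapping.lookup \<alpha> i" arbitrary: \<alpha> rule: less_induct)
    case less
    let ?a = "Poly_Mapping.lookup \<alpha>"
    show ?case
    proof (rule ccontr)
      assume nz: "\<not> ?case"
      then have keys: "Poly_Mapping.keys \<alpha> \<subseteq> {..<N}" by (intro supp) simp
      then have out: "?a i = 0" if "N \<le> i" for i
        using that by (metis in_keys_iff lessThan_iff linorder_not_less subsetD)
      show False
      proof (cases "\<exists>k. Suc k < N \<and> ?a k < ?a (Suc k)")
        case True
        then obtain k where k: "Suc k < N" "?a k < ?a (Suc k)" by blast
        let ?R = "{..<N} - {k, Suc k}"
        have split: "(\<Sum>i<N. i * f i) = k * f k + (Suc k * f (Suc k) + (\<Sum>i\<in>?R. i * f i))" for f :: "nat \<Rightarrow> nat"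
        proof -
          have "{..<N} = insert k (insert (Suc k) ?R)" using k by auto
          then have "(\<Sum>i<N. i * f i) = (\<Sum>i\<in>insert k (insert (Suc k) ?R). i * f i)" by simp
          then show ?thesis by (simp del: mult_Suc)
        qed
        have "(\<Sum>i\<in>?R. i * Poly_Mapping.lookup (swp k \<alpha>) i) = (\<Sum>i\<in>?R. i * ?a i)"
          by (rule sum.cong) (auto simp: lookup_swp transpose_def)
        then have "(\<Sum>i<N. i * Poly_Mapping.lookup (swp k \<alpha>) i) < (\<Sum>i<N. i * ?a i)"
          using k(2) by (simp add: split lookup_swp)
        then have "Poly_Mapping.lookup P (swp k \<alpha>) = 0" using less by simp
        then show False using nz sym[OF k(1)] by simp
      next
        case False
        have "?a (Suc i) \<le> ?a i" for i
        proof (cases "Suc i < N")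
          case True
          then show ?thesis using False by (meson not_less)
        qed (simp add: out)
        then have sh: "shape ?a" by (simp add: shape_def)
        have "Poly_Mapping.keys \<alpha> = {i. ?a i \<noteq> 0}" by (auto simp: in_keys_iff)
        then have "card {i. ?a i \<noteq> 0} \<le> N" using card_mono[OF _ keys] by simp
        then have "Poly_Mapping.lookup P (rowexp (of_shape ?a)) = 0"
          using rows_of_shape[OF sh] by (intro van) auto
        moreover have "rowexp (of_shape ?a) = \<alpha>"
          by (rule poly_mapping_eqI) (simp add: rows_of_shape[OF sh])
        ultimately show False using nz by simp
      qed
    qed
  qed
qed

text \<open>The coefficient of m_\<kappa> in p_\<mu> and, in the next definition, in s_\<nu>. As
  many variables as \<kappa> has parts suffice, by stability.\<close>

definition pcoeff :: "partition \<Rightarrow> partition \<Rightarrow> rat" where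
  "pcoeff \<mu> \<kappa> = Poly_Mapping.lookup (power_sum \<mu> (size \<kappa>)) (rowexp \<kappa>)"

definition kostka :: "partition \<Rightarrow> partition \<Rightarrow> rat" where
  "kostka \<nu> \<kappa> = Poly_Mapping.lookup (schur \<nu> (size \<kappa>)) (rowexp \<kappa>)"

lemma lookup_power_sum_rowexp:
  "is_partition \<mu> \<Longrightarrow> is_partition \<kappa> \<Longrightarrow> size \<kappa> \<le> N \<Longrightarrow>
    Poly_Mapping.lookup (power_sum \<mu> N) (rowexp \<kappa>) = pcoeff \<mu> \<kappa>"
  unfolding pcoeff_def by (rule power_sum_stable) (auto simp: keys_rowexp)

lemma lookup_schur_rowexp:
  "is_partition \<kappa> \<Longrightarrow> size \<kappa> \<le> N \<Longrightarrow>
    Poly_Mapping.lookup (schur \<nu> N) (rowexp \<kappa>) = kostka \<nu> \<kappa>"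
  unfolding kostka_def by (rule schur_stable) (auto simp: keys_rowexp)

lemma pcoeff_sum: "is_partition \<kappa> \<Longrightarrow> pcoeff \<mu> \<kappa> \<noteq> 0 \<Longrightarrow> \<Sum>\<^sub># \<mu> = \<Sum>\<^sub># \<kappa>"
  unfolding pcoeff_def by (metis power_sum_support(2) deg_rowexp)

lemma kostka_sum: "is_partition \<kappa> \<Longrightarrow> kostka \<nu> \<kappa> \<noteq> 0 \<Longrightarrow> \<Sum>\<^sub># \<nu> = \<Sum>\<^sub># \<kappa>"
  unfolding kostka_def by (metis schur_support(2) deg_rowexp)

lemma pcoeff_triangular:
  assumes "is_partition \<mu>" "is_partition \<kappa>" "pcoeff \<mu> \<kappa> \<noteq> 0"
  shows "size \<kappa> \<le> size \<mu> \<and> (size \<kappa> = size \<mu> \<longrightarrow> \<mu> = \<kappa>)"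
  using power_sum_triangular[OF assms(3)[unfolded pcoeff_def] assms(1)] assms(2)
  by (auto simp: keys_rowexp exponents_rowexp)

lemma pcoeff_diagonal: "is_partition \<kappa> \<Longrightarrow> pcoeff \<kappa> \<kappa> \<noteq> 0"
  using power_sum_diagonal[of "rowexp \<kappa>" \<kappa> "size \<kappa>"]
  by (simp add: pcoeff_def exponents_rowexp keys_rowexp)

text \<open>At a nonzero entry the sums agree and \<mu> has at least as many parts as \<kappa>, so
  sum minus number of parts can serve as rank.\<close>

lemma pcoeff_rank:
  assumes "is_partition \<mu>" "is_partition \<kappa>" "pcoeff \<mu> \<kappa> \<noteq> 0"
  shows "\<mu> = \<kappa> \<or> \<Sum>\<^sub># \<mu> - size \<mu> < \<Sum>\<^sub># \<kappa> - size \<kappa>"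
  using pcoeff_triangular[OF assms] pcoeff_sum[OF assms(2,3)] size_le_sum[OF assms(1)]
  by fastforce

lemma finite_pcoeff:
  assumes "is_partition \<kappa>"
  shows "finite {\<mu> \<in> Collect is_partition. pcoeff \<mu> \<kappa> \<noteq> 0}"
  by (rule finite_subset[OF _ finite_partitions[of "\<Sum>\<^sub># \<kappa>"]]) (use pcoeff_sum[OF assms] in auto)

definition is_expansion :: "partition \<Rightarrow> (partition \<Rightarrow>\<^sub>0 rat) \<Rightarrow> bool" where
  "is_expansion \<nu> c \<longleftrightarrow>
     (\<forall>\<mu>\<in>Poly_Mapping.keys c. is_partition \<mu>) \<and>
     (\<forall>N. schur \<nu> N =
       (\<Sum>\<mu>\<in>Poly_Mapping.keys c. Poly_Mapping.single 0 (Poly_Mapping.lookup c \<mu>) * power_sum \<mu> N))"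

text \<open>Both expansions give the same dominant coefficients, so their difference solves the
  homogeneous triangular system of \<open>pcoeff\<close>.\<close>

lemma expansion_unique:
  assumes "is_expansion \<nu> c" "is_expansion \<nu> c'"
  shows "c = c'"
proof -
  let ?S = "Poly_Mapping.keys c \<union> Poly_Mapping.keys c'"
  let ?X = "\<lambda>\<mu>. Poly_Mapping.lookup c \<mu> - Poly_Mapping.lookup c' \<mu>"
  have ext: "(\<Sum>\<mu>\<in>Poly_Mapping.keys d. Poly_Mapping.lookup d \<mu> * pcoeff \<mu> \<kappa>)
      = (\<Sum>\<mu>\<in>?S. Poly_Mapping.lookup d \<mu> * pcoeff \<mu> \<kappa>)" if "Poly_Mapping.keys d \<subseteq> ?S" for d \<kappa>
    by (rule sum.mono_neutral_left) (use that in \<open>auto simp: in_keys_iff\<close>)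
  have schur: "kostka \<nu> \<kappa> = (\<Sum>\<mu>\<in>Poly_Mapping.keys d. Poly_Mapping.lookup d \<mu> * pcoeff \<mu> \<kappa>)"
    if "is_expansion \<nu> d" for d \<kappa>
    using that by (simp add: is_expansion_def kostka_def pcoeff_def lookup_sum lookup_const_mult)
  have sum0: "(\<Sum>\<mu>\<in>?S. ?X \<mu> * pcoeff \<mu> \<kappa>) = 0" for \<kappa>
    using schur[OF assms(1), of \<kappa>] schur[OF assms(2), of \<kappa>] ext[of c \<kappa>] ext[of c' \<kappa>]
    by (simp add: left_diff_distrib sum_subtractf)
  have "?X \<mu> = 0" if "is_partition \<mu>" for \<mu>
  proof (rule triangular_unique[where P = "Collect is_partition" and A = pcoeff and rk = "\<lambda>\<mu>. \<Sum>\<^sub># \<mu> - size \<mu>"])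
    fix \<kappa> assume \<kappa>: "\<kappa> \<in> Collect is_partition"
    have "(\<Sum>\<mu> | \<mu> \<in> Collect is_partition \<and> pcoeff \<mu> \<kappa> \<noteq> 0. pcoeff \<mu> \<kappa> *\<^sub>Q ?X \<mu>)
       = (\<Sum>\<mu>\<in>?S. ?X \<mu> * pcoeff \<mu> \<kappa>)"
      unfolding qscale_rat_def
      by (rule sum.mono_neutral_cong)
        (use assms finite_pcoeff[of \<kappa>] \<kappa> in \<open>auto simp: is_expansion_def in_keys_iff\<close>)
    then show "(\<Sum>\<mu> | \<mu> \<in> Collect is_partition \<and> pcoeff \<mu> \<kappa> \<noteq> 0. pcoeff \<mu> \<kappa> *\<^sub>Q ?X \<mu>) = 0"
      using sum0 by simp
  qed (use finite_pcoeff pcoeff_rank pcoeff_diagonal that in auto)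
  moreover have "?X \<mu> = 0" if "\<not> is_partition \<mu>" for \<mu>
    using assms that unfolding is_expansion_def by (metis in_keys_iff diff_self)
  ultimately show ?thesis by (intro poly_mapping_eqI) (metis eq_iff_diff_eq_0)
qed

lemma expansion_exists: "\<exists>c. is_expansion \<nu> c \<and> (\<forall>\<mu>\<in>Poly_Mapping.keys c. \<Sum>\<^sub># \<mu> = \<Sum>\<^sub># \<nu>)"
proof -
  obtain X :: "partition \<Rightarrow> rat" where X: "\<And>\<kappa>. is_partition \<kappa> \<Longrightarrow>
      (\<Sum>\<mu> | is_partition \<mu> \<and> pcoeff \<mu> \<kappa> \<noteq> 0. pcoeff \<mu> \<kappa> *\<^sub>Q X \<mu>) = kostka \<nu> \<kappa>"
    using triangular_solve[of "Collect is_partition" pcoeff "\<lambda>\<mu>. \<Sum>\<^sub># \<mu> - size \<mu>" "kostka \<nu>"]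
      finite_pcoeff pcoeff_rank pcoeff_diagonal by auto
  let ?P = "{\<mu>. is_partition \<mu> \<and> \<Sum>\<^sub># \<mu> = \<Sum>\<^sub># \<nu>}"
  \<comment> \<open>Cutting the solution down to partitions with the same sum as \<nu> gives finite
    support; the equations of other degrees then read 0 = 0, since both matrices preserve
    sums.\<close>
  define c where "c = Abs_poly_mapping (\<lambda>\<mu>. if \<mu> \<in> ?P then X \<mu> else 0)"
  have finP: "finite ?P" by (rule finite_subset[OF _ finite_partitions[of "\<Sum>\<^sub># \<nu>"]]) auto
  have lookup_c: "Poly_Mapping.lookup c \<mu> = (if \<mu> \<in> ?P then X \<mu> else 0)" for \<mu>
    unfolding c_def by (subst lookup_Abs_poly_mapping) (auto intro: finite_subset[OF _ finP])
  have keys_c: "Poly_Mapping.keys c \<subseteq> ?P" by (auto simp: in_keys_iff lookup_c split: if_splits)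
  have "schur \<nu> N = (\<Sum>\<mu>\<in>Poly_Mapping.keys c. Poly_Mapping.single 0 (Poly_Mapping.lookup c \<mu>) * power_sum \<mu> N)" (is "_ = ?E") for N
  proof -
    have E: "Poly_Mapping.lookup ?E \<alpha>
        = (\<Sum>\<mu>\<in>Poly_Mapping.keys c. Poly_Mapping.lookup c \<mu> * Poly_Mapping.lookup (power_sum \<mu> N) \<alpha>)" for \<alpha>
      by (simp add: lookup_sum lookup_const_mult)
    \<comment> \<open>A symmetric polynomial is determined by its dominant coefficients, and these
      agree by the choice of X.\<close>
    have "schur \<nu> N - ?E = 0"
    proof (rule swap_symmetric_eq_0)
      show "Poly_Mapping.lookup (schur \<nu> N - ?E) (swp k \<alpha>) = Poly_Mapping.lookup (schur \<nu> N - ?E) \<alpha>"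
        if "Suc k < N" for k \<alpha>
        using that by (simp add: lookup_minus E lookup_schur_swp lookup_power_sum_swp)
      show "Poly_Mapping.keys \<alpha> \<subseteq> {..<N}" if "Poly_Mapping.lookup (schur \<nu> N - ?E) \<alpha> \<noteq> 0" for \<alpha>
      proof -
        have "Poly_Mapping.lookup (schur \<nu> N) \<alpha> \<noteq> 0 \<or> (\<exists>\<mu>. Poly_Mapping.lookup (power_sum \<mu> N) \<alpha> \<noteq> 0)"
          using that by (auto simp: lookup_minus E intro: ccontr)
        then show ?thesis using schur_support(1) power_sum_support(1) by blast
      qed
      fix \<kappa> assume \<kappa>: "is_partition \<kappa>" "size \<kappa> \<le> N"
      have "Poly_Mapping.lookup ?E (rowexp \<kappa>) = (\<Sum>\<mu>\<in>Poly_Mapping.keys c. Poly_Mapping.lookup c \<mu> * pcoeff \<mu> \<kappa>)"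
        unfolding E using keys_c \<kappa> by (intro sum.cong refl) (auto simp: lookup_power_sum_rowexp)
      also have "\<dots> = (\<Sum>\<mu>\<in>?P. X \<mu> * pcoeff \<mu> \<kappa>)"
        using keys_c finP by (intro sum.mono_neutral_cong_left) (auto simp: lookup_c in_keys_iff)
      also have "\<dots> = kostka \<nu> \<kappa>"
      proof (cases "\<Sum>\<^sub># \<kappa> = \<Sum>\<^sub># \<nu>")
        case True
        have "(\<Sum>\<mu>\<in>?P. X \<mu> * pcoeff \<mu> \<kappa>) = (\<Sum>\<mu> | is_partition \<mu> \<and> pcoeff \<mu> \<kappa> \<noteq> 0. pcoeff \<mu> \<kappa> *\<^sub>Q X \<mu>)"
          unfolding qscale_rat_def
          by (rule sum.mono_neutral_cong_right) (use finP pcoeff_sum[OF \<kappa>(1)] True in auto)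
        then show ?thesis using X[OF \<kappa>(1)] by simp
      next
        case False
        then have "pcoeff \<mu> \<kappa> = 0" if "\<mu> \<in> ?P" for \<mu> using pcoeff_sum[OF \<kappa>(1), of \<mu>] that by auto
        moreover have "kostka \<nu> \<kappa> = 0" using kostka_sum[OF \<kappa>(1), of \<nu>] False by metis
        ultimately show ?thesis by simp
      qed
      finally show "Poly_Mapping.lookup (schur \<nu> N - ?E) (rowexp \<kappa>) = 0"
        using \<kappa> by (simp add: lookup_minus lookup_schur_rowexp)
    qed
    then show ?thesis by simp
  qed
  then have "is_expansion \<nu> c" using keys_c by (auto simp: is_expansion_def)
  then show ?thesis using keys_c by auto
qed

lemma schur_expansion:
  shows is_expansion_schur: "is_expansion \<nu> (schur_expansion \<nu>)"
    and schur_expansion_sum: "\<mu> \<in> Poly_Mapping.keys (schur_expansion \<nu>) \<Longrightarrow> \<Sum>\<^sub># \<mu> = \<Sum>\<^sub># \<nu>"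
    and schur_expansion_partition: "\<mu> \<in> Poly_Mapping.keys (schur_expansion \<nu>) \<Longrightarrow> is_partition \<mu>"
proof -
  obtain c where c: "is_expansion \<nu> c" "\<forall>\<mu>\<in>Poly_Mapping.keys c. \<Sum>\<^sub># \<mu> = \<Sum>\<^sub># \<nu>"
    using expansion_exists by blast
  have "schur_expansion \<nu> = (THE c. is_expansion \<nu> c)"
    by (simp add: schur_expansion_def is_expansion_def)
  also have "\<dots> = c" using c(1) expansion_unique by blast
  finally show 1: "is_expansion \<nu> (schur_expansion \<nu>)"
    "\<mu> \<in> Poly_Mapping.keys (schur_expansion \<nu>) \<Longrightarrow> \<Sum>\<^sub># \<mu> = \<Sum>\<^sub># \<nu>" using c by auto
  from 1(1) show "\<mu> \<in> Poly_Mapping.keys (schur_expansion \<nu>) \<Longrightarrow> is_partition \<mu>"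
    by (simp add: is_expansion_def)
qed

lemma kostka_expansion:
  "kostka \<nu> \<kappa> = (\<Sum>\<mu>\<in>Poly_Mapping.keys (schur_expansion \<nu>). Poly_Mapping.lookup (schur_expansion \<nu>) \<mu> * pcoeff \<mu> \<kappa>)"
  using is_expansion_schur[of \<nu>]
  by (simp add: is_expansion_def kostka_def pcoeff_def lookup_sum lookup_const_mult)


subsection \<open>Triangularity of the Kostka numbers\<close>

text \<open>The statistic n(\<nu>), the sum of i \<nu>_i with rows counted from 0. It is the least
  possible sum of entries of a semistandard tableau of shape \<nu>.\<close>

definition row_rank :: "partition \<Rightarrow> nat" where
  "row_rank \<nu> = (\<Sum>c\<in>diagram \<nu>. fst c)"

lemma ssyt_ge_row: "t \<in> ssyt \<nu> N \<Longrightarrow> (i, j) \<in> diagram \<nu> \<Longrightarrow> i \<le> t (i, j)"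
proof (induction i)
  case (Suc i)
  have "(i, j) \<in> diagram \<nu>"
    using Suc.prems(2) rows_antimono[of i "Suc i" \<nu>] by (simp add: diagram_eq)
  moreover have "t (i, j) < t (Suc i, j)" using Suc.prems by (auto simp: ssyt_def)
  ultimately show ?case using Suc by simp
qed simp

lemma content_row: "content fst (diagram \<nu>) = rowexp \<nu>"
proof (rule poly_mapping_eqI)
  fix i
  have "{c \<in> diagram \<nu>. fst c = i} = Pair i ` {..<rows \<nu> i}" by (auto simp: diagram_eq)
  then show "Poly_Mapping.lookup (content fst (diagram \<nu>)) i = Poly_Mapping.lookup (rowexp \<nu>) i"
    by (simp add: lookup_content card_image inj_on_def)
qed

lemma sum_content:
  assumes "finite D"
  shows "(\<Sum>c\<in>D. t c) = (\<Sum>i\<in>Poly_Mapping.keys (content t D). Poly_Mapping.lookup (content t D) i * (i::nat))"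
proof -
  have "(\<Sum>c\<in>D. t c) = (\<Sum>i\<in>t ` D. \<Sum>c | c \<in> D \<and> t c = i. t c)"
    using assms by (intro sum.group[symmetric]) auto
  then show ?thesis using assms by (simp add: keys_content lookup_content)
qed

lemma content_rowexp_rank: "content t (diagram \<nu>) = rowexp \<kappa> \<Longrightarrow> (\<Sum>c\<in>diagram \<nu>. t c) = row_rank \<kappa>"
  using sum_content[of "diagram \<nu>" t] sum_content[of "diagram \<kappa>" fst]
  by (simp add: content_row row_rank_def)

lemma ssyt_minimal_rank:
  assumes "t \<in> ssyt \<nu> N"
  shows "row_rank \<nu> \<le> (\<Sum>c\<in>diagram \<nu>. t c)"
    and "(\<Sum>c\<in>diagram \<nu>. t c) = row_rank \<nu> \<Longrightarrow> c \<in> diagram \<nu> \<Longrightarrow> t c = fst c"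
proof -
  have ge: "fst c \<le> t c" if "c \<in> diagram \<nu>" for c using ssyt_ge_row[OF assms] that by (cases c) auto
  then show "row_rank \<nu> \<le> (\<Sum>c\<in>diagram \<nu>. t c)" by (simp add: row_rank_def sum_mono)
  assume eq: "(\<Sum>c\<in>diagram \<nu>. t c) = row_rank \<nu>" and c: "c \<in> diagram \<nu>"
  show "t c = fst c"
  proof (rule ccontr)
    assume "t c \<noteq> fst c"
    then have "fst c < t c" using ge[OF c] by simp
    then have "(\<Sum>c\<in>diagram \<nu>. fst c) < (\<Sum>c\<in>diagram \<nu>. t c)"
      using ge c by (intro sum_strict_mono_ex1) auto
    then show False using eq by (simp add: row_rank_def)
  qed
qed

text \<open>The entries of a tableau of content \<kappa> sum to n(\<kappa>), and those in row i are
  at least i. So n(\<nu>) \<le> n(\<kappa>); in case of equality every entry is its row index, and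
  the content is that of \<nu>. This numerical rank takes the place of the dominance order.\<close>

lemma kostka_triangular:
  assumes "is_partition \<nu>" "is_partition \<kappa>" "kostka \<nu> \<kappa> \<noteq> 0"
  shows "\<nu> = \<kappa> \<or> row_rank \<nu> < row_rank \<kappa>"
proof -
  obtain t where t: "t \<in> ssyt \<nu> (size \<kappa>)" "content t (diagram \<nu>) = rowexp \<kappa>"
    using assms(3) unfolding kostka_def lookup_schur
    by (metis (mono_tags, lifting) card.empty empty_Collect_eq of_nat_0)
  note eq = content_rowexp_rank[OF t(2)]
  show ?thesis
  proof (cases "row_rank \<nu> = row_rank \<kappa>")
    case True
    then have "t c = fst c" if "c \<in> diagram \<nu>" for c
      using ssyt_minimal_rank(2)[OF t(1)] that eq by simp
    then have "content t (diagram \<nu>) = content fst (diagram \<nu>)" by (simp add: content_def)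
    then show ?thesis using t(2) assms(1,2) by (auto simp: content_row intro: rowexp_inj)
  qed (use ssyt_minimal_rank(1)[OF t(1)] eq in auto)
qed

lemma kostka_diagonal:
  assumes "is_partition \<nu>"
  shows "kostka \<nu> \<nu> = 1"
proof -
  let ?f = "restrict fst (diagram \<nu>)"
  have "{t \<in> ssyt \<nu> (size \<nu>). content t (diagram \<nu>) = rowexp \<nu>} = {?f}"
  proof safe
    have "i < size \<nu>" if "j < rows \<nu> i" for i j using that by (auto simp: rows_def split: if_splits)
    then show f: "?f \<in> ssyt \<nu> (size \<nu>)"
      by (auto simp: ssyt_eq tabs_def diagram_eq intro: less_le_trans[OF _ rows_antimono])
    show "content ?f (diagram \<nu>) = rowexp \<nu>"
      using content_row[of \<nu>] by (simp add: content_def)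
    fix t assume t: "t \<in> ssyt \<nu> (size \<nu>)" "content t (diagram \<nu>) = rowexp \<nu>"
    have "t c = fst c" if "c \<in> diagram \<nu>" for c
      using ssyt_minimal_rank(2)[OF t(1) content_rowexp_rank[OF t(2)] that] .
    then show "t = ?f" using t(1) by (auto simp: ssyt_def PiE_iff extensional_def fun_eq_iff)
  qed
  then show ?thesis by (simp add: kostka_def lookup_schur)
qed

lemma kostka_Ints: "kostka \<nu> \<kappa> \<in> \<int>"
  by (simp add: kostka_def lookup_schur)


subsection \<open>Evaluation of the expansion at series\<close>

text \<open>The value of s_\<nu> under p_n \<mapsto> a n. The a n need not be power sums of actual
  letters, which admits virtual alphabets.\<close>

definition schur_at :: "partition \<Rightarrow> (nat \<Rightarrow> 'c::{rat_algebra, comm_ring_1}) \<Rightarrow> 'c" where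
  "schur_at \<nu> a = (\<Sum>\<mu>\<in>Poly_Mapping.keys (schur_expansion \<nu>).
     Poly_Mapping.lookup (schur_expansion \<nu>) \<mu> *\<^sub>Q (\<Prod>n\<in>#\<mu>. a n))"

lemma ord_ge_prod:
  fixes f :: "'i \<Rightarrow> ('m::graded_cmonoid, rat) mseries"
  assumes "\<And>i. i \<in> A \<Longrightarrow> ord_ge (d i) (f i)"
  shows "ord_ge (sum d A) (prod f A)"
  using assms by (induction A rule: infinite_finite_induct) (auto intro: ord_ge_mult)

lemma msubst_letters:
  fixes y :: "nat \<Rightarrow> ('m::graded_cmonoid, rat) mseries"
  assumes y: "\<And>i. no_const (y i)" and fin: "\<And>i. N \<le> i \<Longrightarrow> y i = 0"
  shows "msubst (\<lambda>\<alpha>::nat \<Rightarrow>\<^sub>0 nat. \<Prod>i\<in>Poly_Mapping.keys \<alpha>. y i ^ Poly_Mapping.lookup \<alpha> i)"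
    (is "msubst ?\<phi>")
proof
  have sup: "?\<phi> \<alpha> = (\<Prod>i\<in>S. y i ^ Poly_Mapping.lookup \<alpha> i)" if "finite S" "Poly_Mapping.keys \<alpha> \<subseteq> S" for \<alpha> S
    using that by (intro prod.mono_neutral_left) (auto simp: in_keys_iff)
  show "?\<phi> 0 = 1" by simp
  show "?\<phi> (\<alpha> + \<beta>) = ?\<phi> \<alpha> * ?\<phi> \<beta>" for \<alpha> \<beta>
  proof -
    let ?S = "Poly_Mapping.keys \<alpha> \<union> Poly_Mapping.keys \<beta>"
    show ?thesis
      unfolding sup[of ?S \<alpha>, OF _ Un_upper1, simplified] sup[of ?S \<beta>, OF _ Un_upper2, simplified]
        sup[of ?S "\<alpha> + \<beta>", OF _ keys_add, simplified]
      by (simp add: lookup_add power_add prod.distrib)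
  qed
  have "ord_ge (deg \<alpha>) (?\<phi> \<alpha>)" for \<alpha>
    unfolding deg_poly_mapping_def deg_nat_def by (rule ord_ge_prod) (rule ord_ge_power[OF y])
  then show deg: "deg \<alpha> \<le> deg m" if "mcoef (?\<phi> \<alpha>) m \<noteq> 0" for \<alpha> m
    using that by (meson ord_ge_def not_le)
  have keys: "Poly_Mapping.keys \<alpha> \<subseteq> {..<N}" if "mcoef (?\<phi> \<alpha>) m \<noteq> 0" for \<alpha> m
  proof
    fix i assume i: "i \<in> Poly_Mapping.keys \<alpha>"
    show "i \<in> {..<N}"
    proof (rule ccontr)
      assume "i \<notin> {..<N}"
      then have "y i ^ Poly_Mapping.lookup \<alpha> i = 0" using fin i by (simp add: in_keys_iff zero_power)
      then have "?\<phi> \<alpha> = 0" using i by (metis finite_keys prod_zero)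
      then show False using that by simp
    qed
  qed
  show "finite {\<alpha>. mcoef (?\<phi> \<alpha>) m \<noteq> 0}" for m
  proof (rule finite_subset)
    \<comment> \<open>Exponent vectors visible at m lie in a box with N sides of length deg m. The
      box is a rectangular shape, so finiteness of the functions below a shape applies.\<close>
    let ?B = "{f. \<forall>i. f i \<le> (if i < N then deg m else 0)}"
    have lookup_le: "Poly_Mapping.lookup \<alpha> i \<le> deg \<alpha>" for \<alpha> :: "nat \<Rightarrow>\<^sub>0 nat" and i
      by (cases "i \<in> Poly_Mapping.keys \<alpha>")
        (auto simp: deg_poly_mapping_def deg_nat_def in_keys_iff intro!: member_le_sum[of i _ "Poly_Mapping.lookup \<alpha>"])
    show "{\<alpha>. mcoef (?\<phi> \<alpha>) m \<noteq> 0} \<subseteq> Abs_poly_mapping ` ?B"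
    proof clarify
      fix \<alpha> assume nz: "mcoef (?\<phi> \<alpha>) m \<noteq> 0"
      have "Poly_Mapping.lookup \<alpha> i \<le> (if i < N then deg m else 0)" for i
        using keys[OF nz] deg[OF nz] lookup_le[of \<alpha> i] by (auto simp: in_keys_iff subset_iff intro: ccontr)
      then show "\<alpha> \<in> Abs_poly_mapping ` ?B"
        by (intro image_eqI[of _ _ "Poly_Mapping.lookup \<alpha>"]) auto
    qed
    have "{i. (if i < N then deg m else 0) \<noteq> 0} \<subseteq> {..<N}" by (auto split: if_splits)
    then have "finite {i. (if i < N then deg m else 0) \<noteq> 0}" by (rule finite_subset) simp
    then have "shape (\<lambda>i. if i < N then deg m else 0)" by (simp add: shape_def)
    then show "finite (Abs_poly_mapping ` ?B)" by (intro finite_imageI finite_le_fun)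
  qed
qed

text \<open>Substituting letters for the variables is a ring homomorphism, so it turns the power sum
  expansion of the Schur polynomial into an identity between values.\<close>

lemma schur_at_letters:
  fixes y :: "nat \<Rightarrow> ('m::graded_cmonoid, rat) mseries"
  assumes y: "\<And>i. i < N \<Longrightarrow> no_const (y i)"
  shows "schur_at \<nu> (\<lambda>n. \<Sum>i<N. y i ^ n) = tab_gf (rows \<nu>) y N"
proof -
  \<comment> \<open>Substitution assigns a series to every variable, so the letters are padded by 0;
    \<open>tab_gf\<close> looks at the first N only.\<close>
  define z where "z i = (if i < N then y i else 0)" for i
  define \<phi> where "\<phi> = (\<lambda>\<alpha>::nat \<Rightarrow>\<^sub>0 nat. \<Prod>i\<in>Poly_Mapping.keys \<alpha>. z i ^ Poly_Mapping.lookup \<alpha> i)"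
  have z: "no_const (z i)" for i using y by (simp add: z_def no_const_def)
  interpret msubst \<phi>
    unfolding \<phi>_def using z by (rule msubst_letters[of _ N]) (simp add: z_def)
  have mono: "sub (mmono \<alpha> c) = c *\<^sub>Q \<phi> \<alpha>" for \<alpha> and c :: rat
  proof (rule mseries_eqI)
    fix m
    have "mcoef (sub (mmono \<alpha> c)) m = (\<Sum>\<mu>\<in>insert \<alpha> (supp m). mcoef (\<phi> \<mu>) m *\<^sub>Q mcoef (mmono \<alpha> c) \<mu>)"
      by (rule mcoef_sub) auto
    also have "\<dots> = (\<Sum>\<mu>\<in>insert \<alpha> (supp m). if \<mu> = \<alpha> then c * mcoef (\<phi> \<mu>) m else 0)"
      by (intro sum.cong) (auto simp: mcoef_mono qscale_rat_def)
    finally show "mcoef (sub (mmono \<alpha> c)) m = mcoef (c *\<^sub>Q \<phi> \<alpha>) m" by (simp add: qscale_rat_def)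
  qed
  have indet: "sub (pser (indet i)) = z i" for i
    by (simp add: indet_def pser_single mono qscale_one) (simp add: \<phi>_def)
  have sub_0: "sub 0 = (0 :: ('m, rat) mseries)" using sub_lin(2)[of 0 0] by simp
  have sum: "sub (sum f A) = (\<Sum>x\<in>A. sub (f x))" for f :: "'i \<Rightarrow> (nat \<Rightarrow>\<^sub>0 nat, rat) mseries" and A
    by (induction A rule: infinite_finite_induct) (auto simp: sub_0 sub_lin)
  have prod: "sub (prod f A) = (\<Prod>x\<in>A. sub (f x))" for f :: "'i \<Rightarrow> (nat \<Rightarrow>\<^sub>0 nat, rat) mseries" and A
    by (induction A rule: infinite_finite_induct) (auto simp: sub_1 sub_mult)
  have pow: "pser (indet i ^ n) = pser (indet i) ^ n" for i n
    by (induction n) (auto simp: pser_1 pser_mult)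
  have ps: "sub (pser (power_sum \<mu> N)) = (\<Prod>n\<in>#\<mu>. \<Sum>i<N. y i ^ n)" for \<mu>
  proof (induction \<mu>)
    case (add n \<mu>)
    have "power_sum (add_mset n \<mu>) N = (\<Sum>i<N. indet i ^ n) * power_sum \<mu> N" by (simp add: power_sum_def)
    moreover have "(\<Sum>i<N. z i ^ n) = (\<Sum>i<N. y i ^ n)" by (simp add: z_def)
    ultimately show ?case using add
      by (simp add: pser_mult sub_mult pser_sum sum pow sub_power indet)
  qed (simp add: power_sum_def pser_1 sub_1)
  have "tab_gf (rows \<nu>) y N = tab_gf (rows \<nu>) z N" by (rule tab_gf_cong) (simp add: z_def)
  also have "\<dots> = sub (pser (schur \<nu> N))"
    by (simp add: tab_gf_def schur_eq pser_sum pser_prod sum prod indet)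
  also have "schur \<nu> N = (\<Sum>\<mu>\<in>Poly_Mapping.keys (schur_expansion \<nu>).
      Poly_Mapping.single 0 (Poly_Mapping.lookup (schur_expansion \<nu>) \<mu>) * power_sum \<mu> N)"
    using is_expansion_schur[of \<nu>] unfolding is_expansion_def by blast
  also have "sub (pser \<dots>) = schur_at \<nu> (\<lambda>n. \<Sum>i<N. y i ^ n)"
    by (simp add: pser_sum pser_mult pser_single sum sub_mult mono phi_0 ps schur_at_def qscale_mult_left)
  finally show ?thesis ..
qed

subsection \<open>Integrality at virtual alphabets\<close>

text \<open>Polynomial functions of degree at most \<open>d\<close>, described without reference to coefficients.\<close>

primrec polylike :: "nat \<Rightarrow> (int \<Rightarrow> 'c::ab_group_add) \<Rightarrow> bool" where
  "polylike 0 f \<longleftrightarrow> (\<forall>k. f k = f 0)"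
| "polylike (Suc d) f \<longleftrightarrow> polylike d (\<lambda>k. f (k + 1) - f k)"

lemma polylike_0: "polylike d (\<lambda>_. 0)"
  by (induction d) auto

lemma polylike_Suc: "polylike d f \<Longrightarrow> polylike (Suc d) f"
proof (induction d arbitrary: f)
  case 0
  then have "f (k + 1) - f k = 0" for k
    using polylike.simps(1)[of f] by (metis diff_self)
  then show ?case by simp
next
  case (Suc d)
  have "polylike (Suc d) (\<lambda>k. f (k + 1) - f k)"
    by (rule Suc.IH) (use Suc.prems in \<open>simp only: polylike.simps(2)\<close>)
  then show ?case by (simp only: polylike.simps(2)[of "Suc d" f])
qed

lemma polylike_mono: "polylike d f \<Longrightarrow> d \<le> e \<Longrightarrow> polylike e f"
proof -
  assume f: "polylike d f" and "d \<le> e"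
  have "polylike (d + j) f" for j
    by (induction j) (simp_all add: f polylike_Suc del: polylike.simps(2))
  from this[of "e - d"] have "polylike (d + (e - d)) f" .
  with \<open>d \<le> e\<close> show ?thesis by simp
qed

lemma polylike_const: "polylike 0 f \<Longrightarrow> f k = f 0"
  by simp

declare polylike.simps [simp del]

lemma polylike_0I: "(\<And>k. f k = f 0) \<Longrightarrow> polylike 0 f"
  by (simp add: polylike.simps)

lemma polylike_SucI: "polylike d (\<lambda>k. f (k + 1) - f k) \<Longrightarrow> polylike (Suc d) f"
  and polylike_SucD: "polylike (Suc d) f \<Longrightarrow> polylike d (\<lambda>k. f (k + 1) - f k)"
  by (simp_all add: polylike.simps)

lemma polylike_add: "polylike d f \<Longrightarrow> polylike d g \<Longrightarrow> polylike d (\<lambda>k. f k + g k)"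
proof (induction d arbitrary: f g)
  case 0
  show ?case using polylike_const[OF 0(1)] polylike_const[OF 0(2)] by (intro polylike_0I) metis
next
  case (Suc d)
  have "polylike d (\<lambda>k. (f (k + 1) - f k) + (g (k + 1) - g k))"
    by (intro Suc.IH polylike_SucD Suc.prems)
  then show ?case by (intro polylike_SucI) (simp add: algebra_simps)
qed

lemma polylike_linear:
  assumes "\<And>x y. h (x - y) = h x - h y"
  shows "polylike d f \<Longrightarrow> polylike d (\<lambda>k. h (f k))"
proof (induction d arbitrary: f)
  case 0
  show ?case using polylike_const[OF 0] by (intro polylike_0I) metis
next
  case (Suc d)
  have "polylike d (\<lambda>k. h (f (k + 1) - f k))"
    by (intro Suc.IH polylike_SucD Suc.prems)
  then show ?case by (intro polylike_SucI) (simp add: assms)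
qed

lemma polylike_shift: "polylike d f \<Longrightarrow> polylike d (\<lambda>k. f (k + 1))"
proof (induction d arbitrary: f)
  case 0
  show ?case using polylike_const[OF 0] by (intro polylike_0I) metis
next
  case (Suc d)
  show ?case by (intro polylike_SucI Suc.IH[OF polylike_SucD[OF Suc.prems]])
qed

lemma polylike_diff: "polylike d f \<Longrightarrow> polylike d g \<Longrightarrow> polylike d (\<lambda>k. f k - g k)"
  using polylike_add[of d f "\<lambda>k. - g k"] polylike_linear[of uminus d g] by simp

lemma polylike_sum: "(\<And>i. i \<in> A \<Longrightarrow> polylike d (f i)) \<Longrightarrow> polylike d (\<lambda>k. \<Sum>i\<in>A. f i k)"
  by (induction A rule: infinite_finite_induct) (auto intro: polylike_0 polylike_add)

text \<open>Discrete Leibniz rule: the difference of (k b + a) f(k) is (k b + a) times the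
  difference of f, plus b f(k + 1).\<close>

lemma polylike_mult_linear:
  fixes f :: "int \<Rightarrow> 'c::{rat_algebra, comm_ring_1}"
  shows "polylike d f \<Longrightarrow> polylike (Suc d) (\<lambda>k. (of_int k *\<^sub>Q b + a) * f k)"
proof (induction d arbitrary: f)
  case 0
  have f: "f k = f 0" for k by (rule polylike_const[OF 0])
  have E: "((of_int (k + 1) *\<^sub>Q b + a) * f (k + 1) - (of_int k *\<^sub>Q b + a) * f k) = b * f 0" for k
    unfolding f[of "k + 1"] f[of k] by (simp add: algebra_simps qscale_add_left qscale_one)
  then show ?case by (intro polylike_SucI polylike_0I) (simp only: E)
next
  case (Suc d)
  have "polylike (Suc d) (\<lambda>k. (of_int k *\<^sub>Q b + a) * (f (k + 1) - f k) + b * f (k + 1))"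
    using Suc.IH[OF polylike_SucD[OF Suc.prems]] polylike_linear[of "(*) b", OF _ polylike_shift[OF Suc.prems]]
    by (intro polylike_add) (auto simp: right_diff_distrib)
  moreover have "(of_int k *\<^sub>Q b + a) * (f (k + 1) - f k) + b * f (k + 1)
      = (of_int (k + 1) *\<^sub>Q b + a) * f (k + 1) - (of_int k *\<^sub>Q b + a) * f k" for k
    by (simp add: algebra_simps qscale_add_left qscale_one)
  ultimately show ?case by (intro polylike_SucI[of "Suc d"]) simp
qed

text \<open>By induction all differences f(k + 1) - f(k) lie in L, also at negative k, so one can
  step down from f(0).\<close>

lemma polylike_subgroup:
  assumes L: "zsubgroup L"
  shows "polylike d f \<Longrightarrow> (\<And>k. 0 \<le> k \<Longrightarrow> f k \<in> L) \<Longrightarrow> f k \<in> L"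
proof (induction d arbitrary: f k)
  case 0
  then show ?case using polylike_const[OF 0(1), of k] by simp
next
  case (Suc d)
  have diff: "f (k + 1) - f k \<in> L" for k
    by (rule Suc.IH[OF polylike_SucD[OF Suc.prems(1)]])
      (intro zsubgroup_closed(2)[OF L] Suc.prems(2), auto)
  show ?case
  proof (cases "0 \<le> k")
    case False
    then have "k \<le> 0" by simp
    then show ?thesis
    proof (induction k rule: int_le_induct)
      case base
      show ?case using Suc.prems(2) by simp
    next
      case (step k)
      then show ?case using zsubgroup_closed(2)[OF L step.IH diff[of "k - 1"]] by simp
    qed
  qed (rule Suc.prems(2))
qed

definition int_series :: "('m, rat) mseries \<Rightarrow> bool" where
  "int_series f \<longleftrightarrow> (\<forall>m. mcoef f m \<in> \<int>)"

lemma int_series_closed: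
  fixes f g :: "('m::graded_cmonoid, rat) mseries"
  shows "int_series 0" "int_series 1" "int_series f \<Longrightarrow> int_series g \<Longrightarrow> int_series (f + g)"
    "int_series f \<Longrightarrow> int_series g \<Longrightarrow> int_series (f - g)"
    "int_series f \<Longrightarrow> int_series (- f)"
    "int_series f \<Longrightarrow> int_series g \<Longrightarrow> int_series (f * g)"
  by (auto simp: int_series_def mcoef_one mcoef_times intro!: Ints_sum)

lemma int_series_mono: "int_series (mmono m 1)"
  by (simp add: int_series_def mcoef_mono)

lemma int_series_sum: "(\<And>i. i \<in> A \<Longrightarrow> int_series (f i)) \<Longrightarrow> int_series (sum f A)"
  for f :: "'i \<Rightarrow> ('m::graded_cmonoid, rat) mseries"
  by (induction A rule: infinite_finite_induct) (auto intro: int_series_closed)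

lemma int_series_prod: "(\<And>i. i \<in> A \<Longrightarrow> int_series (f i)) \<Longrightarrow> int_series (prod f A)"
  for f :: "'i \<Rightarrow> ('m::graded_cmonoid, rat) mseries"
  by (induction A rule: infinite_finite_induct) (auto intro: int_series_closed)

lemma zsubgroup_int_series: "zsubgroup (Collect (int_series :: ('m::graded_cmonoid, rat) mseries \<Rightarrow> bool))"
  by (auto simp: zsubgroup_def intro: int_series_closed)

text \<open>Each part contributes one factor linear in k, and a partition has at most as many parts
  as their sum.\<close>

lemma polylike_schur_at:
  fixes b :: "nat \<Rightarrow> 'c::{rat_algebra, comm_ring_1}"
  shows "polylike (\<Sum>\<^sub># \<nu>) (\<lambda>k. schur_at \<nu> (\<lambda>n. of_int k *\<^sub>Q y n + b n))"
  unfolding schur_at_def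
proof (rule polylike_sum)
  fix \<mu> assume \<mu>: "\<mu> \<in> Poly_Mapping.keys (schur_expansion \<nu>)"
  have "polylike (size \<mu>) (\<lambda>k. \<Prod>n\<in>#\<mu>. of_int k *\<^sub>Q y n + b n)" for \<mu>
    by (induction \<mu>) (simp_all add: polylike_0I polylike_mult_linear)
  moreover have "size \<mu> \<le> \<Sum>\<^sub># \<nu>"
    using schur_expansion_sum[OF \<mu>] size_le_sum[OF schur_expansion_partition[OF \<mu>]] by simp
  ultimately have "polylike (\<Sum>\<^sub># \<nu>) (\<lambda>k. \<Prod>n\<in>#\<mu>. of_int k *\<^sub>Q y n + b n)"
    by (rule polylike_mono)
  then show "polylike (\<Sum>\<^sub># \<nu>) (\<lambda>k. Poly_Mapping.lookup (schur_expansion \<nu>) \<mu> *\<^sub>Q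
      (\<Prod>n\<in>#\<mu>. of_int k *\<^sub>Q y n + b n))"
    by (rule polylike_linear[rotated]) (rule qs.scale_right_diff_distrib)
qed

lemma int_series_tab_gf:
  fixes y :: "nat \<Rightarrow> ('m::graded_cmonoid, rat) mseries"
  shows "(\<And>i. i < N \<Longrightarrow> int_series (y i)) \<Longrightarrow> int_series (tab_gf f y N)"
  unfolding tab_gf_def
  by (intro int_series_sum int_series_prod) (auto simp: tabs_def PiE_iff)

definition virtual :: "(int \<times> ('m::graded_cmonoid, rat) mseries) list \<Rightarrow> nat \<Rightarrow> ('m, rat) mseries" where
  "virtual xs n = (\<Sum>(c, y)\<leftarrow>xs. of_int c *\<^sub>Q y ^ n)"

text \<open>Virtual letters are converted one at a time. With multiplicity k \<ge> 0 a letter is k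
  actual copies, which join \<open>zs\<close>; the value is polynomial in k, so integrality extends
  to negative k. For actual letters alone it is a tableau sum.\<close>

lemma int_series_schur_at_aux:
  fixes xs :: "(int \<times> ('m::graded_cmonoid, rat) mseries) list"
  assumes "\<And>c y. (c, y) \<in> set xs \<Longrightarrow> int_series y \<and> no_const y"
    and "\<And>z. z \<in> set zs \<Longrightarrow> int_series z \<and> no_const z"
  shows "int_series (schur_at \<nu> (\<lambda>n. virtual xs n + (\<Sum>z\<leftarrow>zs. z ^ n)))"
  using assms
proof (induction xs arbitrary: zs)
  case Nil
  have "(\<Sum>z\<leftarrow>zs. z ^ n) = (\<Sum>i<length zs. (zs ! i) ^ n)" for n
    by (simp add: sum_list_sum_nth atLeast0LessThan)
  then have "schur_at \<nu> (\<lambda>n. virtual [] n + (\<Sum>z\<leftarrow>zs. z ^ n)) = tab_gf (rows \<nu>) ((!) zs) (length zs)"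
    using schur_at_letters[of "length zs" "(!) zs" \<nu>] Nil by (simp add: virtual_def)
  then show ?case using Nil by (auto intro: int_series_tab_gf)
next
  case (Cons cy xs)
  obtain c y where cy: "cy = (c, y)" by (cases cy)
  let ?F = "\<lambda>k. schur_at \<nu> (\<lambda>n. of_int k *\<^sub>Q y ^ n + (virtual xs n + (\<Sum>z\<leftarrow>zs. z ^ n)))"
  have "?F c \<in> Collect int_series"
  proof (rule polylike_subgroup[OF zsubgroup_int_series polylike_schur_at])
    fix k :: int assume "0 \<le> k"
    have "(\<Sum>z\<leftarrow>replicate (nat k) y. z ^ n) = of_int k *\<^sub>Q y ^ n" for n
    proof -
      have "(\<Sum>z\<leftarrow>replicate j y. z ^ n) = of_nat j *\<^sub>Q y ^ n" for j
        by (induction j) (simp_all add: qscale_add_left qscale_one)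
      from this[of "nat k"] show ?thesis using \<open>0 \<le> k\<close> by simp
    qed
    then have "?F k = schur_at \<nu> (\<lambda>n. virtual xs n + (\<Sum>z\<leftarrow>replicate (nat k) y @ zs. z ^ n))"
      by (simp add: algebra_simps)
    also have "int_series \<dots>"
      by (rule Cons.IH) (use Cons.prems cy in auto)
    finally show "?F k \<in> Collect int_series" by simp
  qed
  then show ?case by (simp add: virtual_def cy add.assoc)
qed

lemma int_series_schur_at:
  assumes "\<And>c y. (c, y) \<in> set xs \<Longrightarrow> int_series y \<and> no_const y"
  shows "int_series (schur_at \<nu> (virtual xs))"
  using int_series_schur_at_aux[of xs "[]" \<nu>] assms by simp


subsection \<open>Alphabets with a single letter of multiplicity minus one\<close>

definition column :: "nat \<Rightarrow> nat \<Rightarrow> nat" where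
  "column r i = (if i < r then 1 else 0)"

lemma shape_column: "shape (column r)"
proof -
  have "{i. column r i \<noteq> 0} = {..<r}" by (auto simp: column_def)
  then show ?thesis by (auto simp: shape_def column_def)
qed

lemma dg_empty_iff: "dg f = {} \<longleftrightarrow> f = (\<lambda>_. 0)"
  by (auto simp: dg_def fun_eq_iff)

lemma tab_gf_0: "tab_gf f y 0 = (if f = (\<lambda>_. 0) then 1 else 0)"
proof (cases "f = (\<lambda>_. 0)")
  case True
  then have "dg f = {}" by (simp add: dg_empty_iff)
  moreover from True this have "tabs f 0 = {\<lambda>_. undefined}" by (auto simp: tabs_def)
  ultimately show ?thesis using True by (simp add: tab_gf_def)
next
  case False
  then have "dg f \<noteq> {}" by (simp add: dg_empty_iff)
  then have "tabs f 0 = {}" by (auto simp: tabs_def PiE_iff)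
  with False show ?thesis by (simp add: tab_gf_def)
qed

lemma schur_at_zero: "is_partition \<nu> \<Longrightarrow>
    schur_at \<nu> (\<lambda>_. 0 :: ('m::graded_cmonoid, rat) mseries) = (if \<nu> = {#} then 1 else 0)"
proof -
  assume \<nu>: "is_partition \<nu>"
  have "rows \<nu> = (\<lambda>_. 0) \<longleftrightarrow> \<nu> = {#}"
  proof
    assume "rows \<nu> = (\<lambda>_. 0)"
    then have "{..<size \<nu>} = {}" unfolding rows_support[OF \<nu>, symmetric] by simp
    then show "\<nu> = {#}" by (simp add: lessThan_empty_iff)
  qed (simp add: rows_def fun_eq_iff)
  then show ?thesis
    using schur_at_letters[of 0 "\<lambda>_. 0 :: ('m, rat) mseries" \<nu>] by (simp add: tab_gf_0)
qed

lemma hstrip_refl: "shape f \<Longrightarrow> f \<in> hstrips f"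
  by (simp add: hstrips_def shape_def)

lemma card_dg_hstrip_less:
  assumes "shape f" "g \<in> hstrips f" "g \<noteq> f"
  shows "card (dg g) < card (dg f)"
proof (rule psubset_card_mono[OF finite_dg[OF assms(1)]])
  have "dg g = dg f \<Longrightarrow> g = f"
  proof
    fix i assume "dg g = dg f"
    then have "{j. (i, j) \<in> dg g} = {j. (i, j) \<in> dg f}" by simp
    then have "{..<g i} = {..<f i}" by (simp add: lessThan_def)
    then show "g i = f i" by simp
  qed
  then show "dg g \<subset> dg f" using dg_hstrip[OF assms(2)] assms(3) by blast
qed

lemma card_dg_column: "card (dg (column r)) = r"
  by (subst card_dg[of r]) (auto simp: column_def)

text \<open>Removing a horizontal strip from l + 1 rows leaves l or l + 1 rows, and a single column
  can remain only if the second row has length at most 1.\<close>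

lemma column_hstrips:
  assumes f: "shape f" and S: "{i. f i \<noteq> 0} = {..<Suc l}"
  shows "column r \<in> hstrips f \<longleftrightarrow> f 1 \<le> 1 \<and> (r = l \<or> r = Suc l)"
proof
  have S': "0 < f i \<longleftrightarrow> i < Suc l" for i
    using S[unfolded set_eq_iff, rule_format, of i] by simp
  assume c: "column r \<in> hstrips f"
  then have c': "f (Suc i) \<le> column r i" "column r i \<le> f i" for i by (auto simp: hstrips_def)
  have "f 1 \<le> 1" using c'(1)[of 0] by (auto simp: column_def split: if_splits)
  moreover have "l \<le> r"
  proof (rule ccontr)
    assume "\<not> l \<le> r"
    then have "0 < f (Suc r)" using S'[of "Suc r"] by simp
    then show False using c'(1)[of r] by (simp add: column_def)
  qed
  moreover have "r \<le> Suc l"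
  proof (rule ccontr)
    assume "\<not> r \<le> Suc l"
    then show False using c'(2)[of "Suc l"] S'[of "Suc l"] by (simp add: column_def)
  qed
  ultimately show "f 1 \<le> 1 \<and> (r = l \<or> r = Suc l)" by auto
next
  have S': "0 < f i \<longleftrightarrow> i < Suc l" for i
    using S[unfolded set_eq_iff, rule_format, of i] by simp
  assume r: "f 1 \<le> 1 \<and> (r = l \<or> r = Suc l)"
  have "f (Suc i) \<le> column r i \<and> column r i \<le> f i" for i
    using r S'[of i] S'[of "Suc i"] shape_antimono[OF f, of 1 "Suc i"] by (auto simp: column_def)
  then show "column r \<in> hstrips f" by (simp add: hstrips_def)
qed

text \<open>The branching rule for k copies of y is polynomial in k, so it extends to k = -1, where
  its left side is the value at the empty alphabet. Solving for the term g = f gives a recursion on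
  the number of boxes.\<close>

lemma schur_at_minus_one_aux:
  fixes y :: "('m::graded_cmonoid, rat) mseries"
  assumes y: "no_const y" and f: "shape f"
  shows "schur_at (of_shape f) (\<lambda>n. - (y ^ n)) = (if \<exists>r. f = column r then (- y) ^ card (dg f) else 0)"
  using f
proof (induction "card (dg f)" arbitrary: f rule: less_induct)
  case (less f)
  let ?F = "\<lambda>f k. schur_at (of_shape f) (\<lambda>n. of_int k *\<^sub>Q y ^ n)"
  have nat: "?F g (int k) = tab_gf g (\<lambda>_. y) k" if "shape g" for g k
    using schur_at_letters[of k "\<lambda>_. y" "of_shape g"] y
    by (simp add: rows_of_shape[OF that] qs.scale_sum_left[of "\<lambda>_. 1" "{..<k}", simplified] qscale_one)
  \<comment> \<open>The branching rule holds for k \<ge> 0; the trivial subgroup in the role of L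
    extends the polynomial identity to all integers k.\<close>
  have "?F f (k + 1) - (\<Sum>g\<in>hstrips f. ?F g k * y ^ (card (dg f) - card (dg g))) \<in> {0}" for k
  proof (rule polylike_subgroup)
    have "polylike (card (dg f)) (\<lambda>k. ?F g k)" if "g \<in> hstrips f" for g
    proof -
      have g: "shape g" using that less.prems by (rule shape_hstrip[rotated])
      have "\<Sum>\<^sub># (of_shape g) = card (dg g)"
        using card_diagram[of "of_shape g"] by (simp add: diagram_eq rows_of_shape[OF g])
      then show ?thesis
        using polylike_schur_at[of "of_shape g" "\<lambda>n. y ^ n" "\<lambda>_. 0"] card_dg_hstrip[OF less.prems that]
        by (auto intro: polylike_mono)
    qed
    then show "polylike (card (dg f)) (\<lambda>k. ?F f (k + 1) - (\<Sum>g\<in>hstrips f. ?F g k * y ^ (card (dg f) - card (dg g))))"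
      using hstrip_refl[OF less.prems]
      by (intro polylike_diff polylike_shift polylike_sum polylike_linear[where h = "\<lambda>x. x * _"])
        (auto simp: left_diff_distrib)
    fix k :: int assume "0 \<le> k"
    then obtain j where k: "k = int j" by (metis nonneg_int_cases)
    have "?F f (int (Suc j)) = (\<Sum>g\<in>hstrips f. ?F g (int j) * y ^ (card (dg f) - card (dg g)))"
      unfolding nat[OF less.prems] tab_gf_Suc[OF less.prems]
      by (intro sum.cong refl) (simp only: nat[OF shape_hstrip[OF less.prems]])
    then show "?F f (k + 1) - (\<Sum>g\<in>hstrips f. ?F g k * y ^ (card (dg f) - card (dg g))) \<in> {0}"
      unfolding k by (simp add: add.commute)
  qed (simp add: zsubgroup_def)
  from this[of "-1"] have "?F f 0 = (\<Sum>g\<in>hstrips f. ?F g (- 1) * y ^ (card (dg f) - card (dg g)))"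
    by simp
  also have "\<dots> = ?F f (- 1) + (\<Sum>g\<in>hstrips f - {f}. ?F g (- 1) * y ^ (card (dg f) - card (dg g)))"
    by (subst sum.remove[OF finite_hstrips hstrip_refl]) (simp_all add: less.prems)
  also have "?F f 0 = (if f = (\<lambda>_. 0) then 1 else 0)"
    using nat[OF less.prems, of 0] by (simp add: tab_gf_0)
  finally have rec: "?F f (- 1) = (if f = (\<lambda>_. 0) then 1 else 0)
      - (\<Sum>g\<in>hstrips f - {f}. ?F g (- 1) * y ^ (card (dg f) - card (dg g)))"
    by (simp add: algebra_simps)
  have IH: "?F g (- 1) = (if \<exists>r. g = column r then (- y) ^ card (dg g) else 0)" if "g \<in> hstrips f - {f}" for g
    using less.hyps[of g] that card_dg_hstrip_less[OF less.prems, of g] shape_hstrip[OF less.prems, of g]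
    by (simp add: qscale_one)
  have "?F f (- 1) = (if \<exists>r. f = column r then (- y) ^ card (dg f) else 0)"
  proof (cases "f = (\<lambda>_. 0)")
    case True
    have "hstrips f = {f}" using True by (auto simp: hstrips_def fun_eq_iff)
    moreover have "f = column 0" by (simp add: True column_def fun_eq_iff)
    moreover have "card (dg f) = 0" using True dg_empty_iff[of f] by simp
    ultimately show ?thesis using rec True by auto
  next
    case False
    have "card {i. f i \<noteq> 0} \<noteq> 0"
    proof
      assume "card {i. f i \<noteq> 0} = 0"
      then have "{i. f i \<noteq> 0} = {}" using less.prems by (simp add: shape_def)
      then have "f = (\<lambda>_. 0)" unfolding fun_eq_iff by blast
      with False show False ..
    qed
    then obtain l where l: "card {i. f i \<noteq> 0} = Suc l" by (metis not0_implies_Suc)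
    have S: "{i. f i \<noteq> 0} = {..<Suc l}" using shape_support[OF less.prems] unfolding l .
    note ch = column_hstrips[OF less.prems S]
    define c where "c = card (dg f)"
    have cl: "Suc l \<le> c" if "f 1 \<le> 1"
      using card_dg_hstrip[OF less.prems, of "column (Suc l)"] ch that by (simp add: card_dg_column c_def)
    have sum: "(\<Sum>g\<in>hstrips f - {f}. ?F g (- 1) * y ^ (c - card (dg g)))
        = (\<Sum>r | column r \<in> hstrips f \<and> column r \<noteq> f. (- y) ^ r * y ^ (c - r))"
    proof -
      have inj: "inj_on column X" for X by (rule inj_on_inverseI[of _ "\<lambda>f. card (dg f)"]) (rule card_dg_column)
      have "(\<Sum>g\<in>hstrips f - {f}. ?F g (- 1) * y ^ (c - card (dg g)))
          = (\<Sum>g\<in>hstrips f - {f}. (if \<exists>r. g = column r then (- y) ^ card (dg g) else 0) * y ^ (c - card (dg g)))"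
        by (intro sum.cong refl) (simp only: IH)
      also have "\<dots> = (\<Sum>g\<in>column ` {r. column r \<in> hstrips f \<and> column r \<noteq> f}. (- y) ^ card (dg g) * y ^ (c - card (dg g)))"
        using finite_hstrips[OF less.prems]
        by (intro sum.mono_neutral_cong_right) auto
      finally show ?thesis by (simp add: sum.reindex[OF inj] card_dg_column)
    qed
    show ?thesis
    proof (cases "f 1 \<le> 1")
      case False
      then have "{r. column r \<in> hstrips f \<and> column r \<noteq> f} = {}" using ch by auto
      then have "(\<Sum>r | column r \<in> hstrips f \<and> column r \<noteq> f. (- y) ^ r * y ^ (c - r)) = 0"
        by (simp only: sum.empty)
      moreover have "f \<noteq> column r" for r using False by (auto simp: column_def split: if_splits)
      ultimately show ?thesis using rec sum \<open>f \<noteq> (\<lambda>_. 0)\<close> by (simp add: c_def)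
    next
      case True
      show ?thesis
      proof (cases "\<exists>r. f = column r")
        case col: True
        then obtain r where r: "f = column r" by blast
        have "r = Suc l"
        proof -
          have "{i. f i \<noteq> 0} = {..<r}" by (auto simp: r column_def)
          then show ?thesis using S by simp
        qed
        then have f_eq: "f = column (Suc l)" using r by simp
        have "column s = f \<longleftrightarrow> s = Suc l" for s
        proof
          assume "column s = f"
          then have "card (dg (column s)) = card (dg (column (Suc l)))" by (simp only: f_eq)
          then show "s = Suc l" by (simp only: card_dg_column)
        qed (simp only: f_eq)
        then have "{r. column r \<in> hstrips f \<and> column r \<noteq> f} = {l}" using ch True by auto
        moreover have "c = Suc l" by (simp add: c_def f_eq card_dg_column)
        ultimately show ?thesis using rec sum \<open>f \<noteq> (\<lambda>_. 0)\<close> col by (simp add: c_def[symmetric])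
      next
        \<comment> \<open>The columns of lengths l and l + 1 now both contribute, with opposite
          signs, and cancel.\<close>
        case ncol: False
        then have "{r. column r \<in> hstrips f \<and> column r \<noteq> f} = {l, Suc l}" using ch True by auto
        moreover have "c - l = Suc (c - Suc l)" using cl[OF True] by simp
        ultimately show ?thesis using rec sum \<open>f \<noteq> (\<lambda>_. 0)\<close> ncol
          by (simp add: c_def[symmetric] mult_ac)
      qed
    qed
  qed
  then show ?case by (simp add: qscale_one)
qed

lemma schur_at_minus_one:
  fixes y :: "('m::graded_cmonoid, rat) mseries"
  assumes "no_const y" "is_partition \<nu>"
  shows "schur_at \<nu> (\<lambda>n. - (y ^ n)) = (if \<nu> = replicate_mset (size \<nu>) 1 then (- y) ^ size \<nu> else 0)"
proof -
  have col: "of_shape (column r) = replicate_mset r 1" for r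
  proof -
    have "{i. column r i \<noteq> 0} = {..<r}" by (auto simp: column_def)
    moreover have "image_mset (column r) (mset_set {..<r}) = image_mset (\<lambda>_. 1) (mset_set {..<r})"
      by (rule image_mset_cong) (simp add: column_def)
    ultimately show ?thesis by (simp add: of_shape_def image_mset_const_eq)
  qed
  have "(\<exists>r. rows \<nu> = column r) \<longleftrightarrow> \<nu> = replicate_mset (size \<nu>) 1"
    by (metis col of_shape_rows[OF assms(2)] rows_of_shape(1)[OF shape_column] size_replicate_mset)
  moreover have "card (dg (rows \<nu>)) = \<Sum>\<^sub># \<nu>" using card_diagram[of \<nu>] by (simp add: diagram_eq)
  moreover have "\<Sum>\<^sub># \<nu> = size \<nu>" if "\<nu> = replicate_mset (size \<nu>) 1"
    by (subst that) simp
  ultimately show ?thesis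
    using schur_at_minus_one_aux[OF assms(1) shape_rows, of \<nu>] by (simp add: of_shape_rows[OF assms(2)])
qed

section \<open>Families of partitions\<close>

abbreviation entry :: "'r family \<Rightarrow> 'r \<Rightarrow> partition" where
  "entry \<equiv> Poly_Mapping.lookup"

abbreviation mat :: "partition \<Rightarrow> partition \<Rightarrow> rat" where
  "mat \<nu> \<mu> \<equiv> Poly_Mapping.lookup (schur_expansion \<nu>) \<mu>"

lemma family_partition: "\<mu> \<in> partition_families I \<Longrightarrow> is_partition (entry \<mu> U)"
proof (cases "U \<in> I")
  case False
  assume "\<mu> \<in> partition_families I"
  then have "U \<notin> Poly_Mapping.keys \<mu>" using False by (auto simp: partition_families_def)
  then show ?thesis by (simp add: in_keys_iff is_partition_def)
qed (simp add: partition_families_def)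

lemma family_keys: "\<mu> \<in> partition_families I \<Longrightarrow> Poly_Mapping.keys \<mu> \<subseteq> I"
  by (simp add: partition_families_def)

lemma familyI: "Poly_Mapping.keys \<mu> \<subseteq> I \<Longrightarrow> (\<And>U. is_partition (entry \<mu> U)) \<Longrightarrow> \<mu> \<in> partition_families I"
  by (simp add: partition_families_def)

lemma is_partition_empty [simp]: "is_partition {#}"
  by (simp add: is_partition_def)

lemma sum_eq_0_partition: "is_partition \<mu> \<Longrightarrow> \<Sum>\<^sub># \<mu> = 0 \<longleftrightarrow> \<mu> = {#}"
  using size_le_sum[of \<mu>] by (metis le_zero_eq size_eq_0_iff_empty sum_mset.empty)

lemma finite_families:
  assumes "finite S"
  shows "finite {\<nu> \<in> partition_families I. Poly_Mapping.keys \<nu> \<subseteq> S \<and> weight \<nu> \<le> d}" (is "finite ?A")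
proof -
  let ?r = "\<lambda>\<nu>. \<lambda>U\<in>S. entry \<nu> U"
  have "inj_on ?r ?A"
  proof (rule inj_onI, rule poly_mapping_eqI)
    fix \<nu> \<nu>' U assume *: "\<nu> \<in> ?A" "\<nu>' \<in> ?A" "?r \<nu> = ?r \<nu>'"
    show "entry \<nu> U = entry \<nu>' U"
    proof (cases "U \<in> S")
      case True
      then show ?thesis using fun_cong[OF *(3), of U] by simp
    next
      case False
      then have "U \<notin> Poly_Mapping.keys \<nu>" "U \<notin> Poly_Mapping.keys \<nu>'" using *(1,2) by auto
      then show ?thesis by (simp add: in_keys_iff)
    qed
  qed
  moreover have "?r ` ?A \<subseteq> PiE S (\<lambda>_. {\<mu>. is_partition \<mu> \<and> \<Sum>\<^sub># \<mu> \<le> d})"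
  proof (rule image_subsetI)
    fix \<nu> assume \<nu>: "\<nu> \<in> ?A"
    have "\<Sum>\<^sub># (entry \<nu> U) \<le> d" if "U \<in> S" for U
    proof -
      have "\<Sum>\<^sub># (entry \<nu> U) \<le> (\<Sum>U\<in>S. \<Sum>\<^sub># (entry \<nu> U))" using assms that by (intro member_le_sum) auto
      also have "\<dots> = weight \<nu>" using \<nu> assms by (intro weight_superset[symmetric]) auto
      finally show ?thesis using \<nu> by simp
    qed
    then show "?r \<nu> \<in> PiE S (\<lambda>_. {\<mu>. is_partition \<mu> \<and> \<Sum>\<^sub># \<mu> \<le> d})"
      using \<nu> family_partition by auto
  qed
  moreover have "finite (PiE S (\<lambda>_. {\<mu>. is_partition \<mu> \<and> \<Sum>\<^sub># \<mu> \<le> d}))"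
    using assms by (intro finite_PiE finite_partitions)
  ultimately show ?thesis by (meson inj_on_finite)
qed

subsection \<open>Products of matrices over the index set\<close>

definition fprod :: "(partition \<Rightarrow> partition \<Rightarrow> rat) \<Rightarrow> 'r family \<Rightarrow> 'r family \<Rightarrow> rat" where
  "fprod h \<nu> \<mu> = (\<Prod>U\<in>Poly_Mapping.keys \<nu> \<union> Poly_Mapping.keys \<mu>. h (entry \<nu> U) (entry \<mu> U))"

text \<open>These conditions make the infinite tensor power of h meaningful: away from both supports
  all factors are 1, and nonzero entries keep the degree at every U.\<close>

definition graded_matrix :: "(partition \<Rightarrow> partition \<Rightarrow> rat) \<Rightarrow> bool" where
  "graded_matrix h \<longleftrightarrow> h {#} {#} = 1 \<and>
     (\<forall>\<nu> \<mu>. is_partition \<nu> \<longrightarrow> is_partition \<mu> \<longrightarrow> h \<nu> \<mu> \<noteq> 0 \<longrightarrow> \<Sum>\<^sub># \<nu> = \<Sum>\<^sub># \<mu>)"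

lemma fprod_superset:
  assumes "graded_matrix h" "finite S" "Poly_Mapping.keys \<nu> \<subseteq> S" "Poly_Mapping.keys \<mu> \<subseteq> S"
  shows "fprod h \<nu> \<mu> = (\<Prod>U\<in>S. h (entry \<nu> U) (entry \<mu> U))"
  unfolding fprod_def using assms
  by (intro prod.mono_neutral_left) (auto simp: in_keys_iff graded_matrix_def)

lemma fprod_nonzero:
  assumes "graded_matrix h" "fprod h \<nu> \<mu> \<noteq> 0"
  shows "h (entry \<nu> U) (entry \<mu> U) \<noteq> 0"
proof (cases "U \<in> Poly_Mapping.keys \<nu> \<union> Poly_Mapping.keys \<mu>")
  case True
  then show ?thesis using assms(2) by (auto simp: fprod_def)
next
  case False
  then show ?thesis using assms(1) by (auto simp: in_keys_iff graded_matrix_def)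
qed

text \<open>A finite block, the same for all graded matrices, outside of which the row and the
  column of \<alpha> vanish. Summing over it rather than over nonzero entries lets sums for
  different matrices be combined.\<close>

definition fclass :: "'r set \<Rightarrow> 'r family \<Rightarrow> 'r family set" where
  "fclass I \<alpha> = {\<nu> \<in> partition_families I. Poly_Mapping.keys \<nu> = Poly_Mapping.keys \<alpha> \<and> weight \<nu> = weight \<alpha>}"

lemma finite_fclass [simp]: "finite (fclass I \<alpha>)"
  by (rule finite_subset[OF _ finite_families[of "Poly_Mapping.keys \<alpha>" I "weight \<alpha>"]]) (auto simp: fclass_def)

lemma fclass_eq: "\<mu> \<in> fclass I \<alpha> \<Longrightarrow> fclass I \<mu> = fclass I \<alpha>"
  by (auto simp: fclass_def)

lemma fprod_fclass:
  assumes h: "graded_matrix h" and \<nu>: "\<nu> \<in> partition_families I" and \<mu>: "\<mu> \<in> partition_families I"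
    and nz: "fprod h \<nu> \<mu> \<noteq> 0"
  shows "\<nu> \<in> fclass I \<mu>" "\<mu> \<in> fclass I \<nu>"
proof -
  have sum: "\<Sum>\<^sub># (entry \<nu> U) = \<Sum>\<^sub># (entry \<mu> U)" for U
    using fprod_nonzero[OF h nz, of U] h family_partition[OF \<nu>] family_partition[OF \<mu>]
    by (simp add: graded_matrix_def)
  have "entry \<nu> U = {#} \<longleftrightarrow> entry \<mu> U = {#}" for U
    using sum[of U] sum_eq_0_partition[OF family_partition[OF \<nu>, of U]]
      sum_eq_0_partition[OF family_partition[OF \<mu>, of U]] by simp
  then have keys: "Poly_Mapping.keys \<nu> = Poly_Mapping.keys \<mu>" by (simp add: set_eq_iff in_keys_iff)
  moreover have "weight \<nu> = weight \<mu>" by (simp add: weight_def keys sum)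
  ultimately show "\<nu> \<in> fclass I \<mu>" "\<mu> \<in> fclass I \<nu>" using \<nu> \<mu> by (auto simp: fclass_def)
qed

lemma sum_fclass_left:
  assumes "graded_matrix h" "\<mu> \<in> partition_families I" "finite Y" "fclass I \<mu> \<subseteq> Y" "Y \<subseteq> partition_families I"
  shows "(\<Sum>\<nu> | \<nu> \<in> partition_families I \<and> fprod h \<nu> \<mu> \<noteq> 0. fprod h \<nu> \<mu> *\<^sub>Q X \<nu>)
    = (\<Sum>\<nu>\<in>Y. fprod h \<nu> \<mu> *\<^sub>Q (X \<nu> :: 'v::rat_algebra))"
  by (rule sum.mono_neutral_left[OF assms(3)])
    (use assms(4,5) fprod_fclass(1)[OF assms(1) _ assms(2)] in auto)

text \<open>At every U the partitions agree or the rank drops, so the total rank drops unless all of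
  them agree.\<close>

lemma fprod_triangular:
  assumes h: "graded_matrix h" and \<nu>: "\<nu> \<in> partition_families I" and \<mu>: "\<mu> \<in> partition_families I"
    and nz: "fprod h \<nu> \<mu> \<noteq> 0" and rk: "rk {#} = 0"
    and tri: "\<And>\<nu> \<mu>. is_partition \<nu> \<Longrightarrow> is_partition \<mu> \<Longrightarrow> h \<nu> \<mu> \<noteq> 0 \<Longrightarrow> \<nu> = \<mu> \<or> rk \<nu> < (rk \<mu> :: nat)"
  shows "\<nu> = \<mu> \<or> (\<Sum>U\<in>Poly_Mapping.keys \<nu>. rk (entry \<nu> U)) < (\<Sum>U\<in>Poly_Mapping.keys \<mu>. rk (entry \<mu> U))"
proof (cases "\<nu> = \<mu>")
  case False
  have keys: "Poly_Mapping.keys \<nu> = Poly_Mapping.keys \<mu>"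
    using fprod_fclass(1)[OF h \<nu> \<mu> nz] by (simp add: fclass_def)
  have t: "entry \<nu> U = entry \<mu> U \<or> rk (entry \<nu> U) < rk (entry \<mu> U)" for U
    by (intro tri family_partition[OF \<nu>] family_partition[OF \<mu>] fprod_nonzero[OF h nz])
  obtain U where U: "entry \<nu> U \<noteq> entry \<mu> U" using False by (metis poly_mapping_eqI)
  then have "U \<in> Poly_Mapping.keys \<mu>" using keys by (metis in_keys_iff)
  then have "(\<Sum>U\<in>Poly_Mapping.keys \<mu>. rk (entry \<nu> U)) < (\<Sum>U\<in>Poly_Mapping.keys \<mu>. rk (entry \<mu> U))"
  proof (intro sum_strict_mono_ex1 ballI)
    show "rk (entry \<nu> V) \<le> rk (entry \<mu> V)" for V using t[of V] by auto
    show "\<exists>V\<in>Poly_Mapping.keys \<mu>. rk (entry \<nu> V) < rk (entry \<mu> V)"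
      using t[of U] U \<open>U \<in> Poly_Mapping.keys \<mu>\<close> by blast
  qed simp
  then show ?thesis by (simp add: keys)
qed simp

lemma fprod_diag: "graded_matrix h \<Longrightarrow> (\<And>\<nu>. is_partition \<nu> \<Longrightarrow> h \<nu> \<nu> \<noteq> 0) \<Longrightarrow>
    \<nu> \<in> partition_families I \<Longrightarrow> fprod h \<nu> \<nu> \<noteq> 0"
  by (auto simp: fprod_def family_partition)

lemma graded_pcoeff: "graded_matrix pcoeff"
proof -
  have "rowexp {#} = 0" by (rule poly_mapping_eqI) (simp add: rows_def)
  then have "pcoeff {#} {#} = 1" by (simp add: pcoeff_def lookup_power_sum_empty)
  then show ?thesis using pcoeff_sum unfolding graded_matrix_def by blast
qed

lemma graded_kostka: "graded_matrix kostka"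
  using kostka_sum kostka_diagonal[OF is_partition_empty] unfolding graded_matrix_def by blast

text \<open>Read off at the zero alphabet, where s of the empty partition is 1 and only the constant
  power sum term can occur.\<close>

lemma mat_empty: "mat {#} {#} = 1"
proof -
  have "Poly_Mapping.keys (schur_expansion {#}) \<subseteq> {{#}}"
    using schur_expansion_sum[of _ "{#}"] schur_expansion_partition[of _ "{#}"] sum_eq_0_partition by auto
  then have "schur_at {#} (\<lambda>_. 0 :: (nat, rat) mseries)
      = (\<Sum>\<mu>\<in>{{#}}. mat {#} \<mu> *\<^sub>Q (\<Prod>n\<in>#\<mu>. 0 :: (nat, rat) mseries))"
    unfolding schur_at_def by (intro sum.mono_neutral_left) (auto simp: in_keys_iff)
  then have "mat {#} {#} *\<^sub>Q (1 :: (nat, rat) mseries) = 1" by (simp add: schur_at_zero)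
  then have "mcoef (mat {#} {#} *\<^sub>Q (1 :: (nat, rat) mseries)) 0 = mcoef 1 (0::nat)" by simp
  then show ?thesis by (simp add: mcoef_one qscale_rat_def)
qed

lemma graded_mat: "graded_matrix mat"
  using schur_expansion_sum mat_empty unfolding graded_matrix_def in_keys_iff by metis

lemma schur_coeff_eq: "schur_coeff = fprod mat"
  by (intro ext) (simp add: schur_coeff_def fprod_def)

lemma prod_qscale:
  fixes x :: "'i \<Rightarrow> 'c::{rat_algebra, comm_ring_1}"
  shows "(\<Prod>i\<in>A. q i *\<^sub>Q x i) = (\<Prod>i\<in>A. q i) *\<^sub>Q (\<Prod>i\<in>A. x i)"
  by (induction A rule: infinite_finite_induct)
    (simp_all add: qscale_one qscale_mult_left qscale_mult_right qscale_qscale mult.commute)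

text \<open>The distributive law: families supported in S are choices of a partition for every U in
  S. It is applied to values of Schur products at alphabets and to Kostka numbers of
  families.\<close>

lemma sum_families_prod:
  fixes h :: "'r \<Rightarrow> partition \<Rightarrow> 'c::{rat_algebra, comm_ring_1}"
  assumes \<nu>: "\<nu> \<in> partition_families I" and S: "finite S" "Poly_Mapping.keys \<nu> \<subseteq> S"
  shows "(\<Sum>\<mu>\<in>fclass I \<nu>. fprod mat \<nu> \<mu> *\<^sub>Q (\<Prod>U\<in>S. h U (entry \<mu> U)))
    = (\<Prod>U\<in>S. \<Sum>\<mu>\<in>Poly_Mapping.keys (schur_expansion (entry \<nu> U)). mat (entry \<nu> U) \<mu> *\<^sub>Q h U \<mu>)"
proof -
  let ?B = "\<lambda>U. Poly_Mapping.keys (schur_expansion (entry \<nu> U))"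
  let ?A = "{\<mu> \<in> partition_families I. fprod mat \<nu> \<mu> \<noteq> 0}"
  let ?g = "\<lambda>\<mu>. \<lambda>U\<in>S. entry \<mu> U"
  let ?fam = "\<lambda>g. Abs_poly_mapping (\<lambda>U. if U \<in> S then g U else {#})"
  have A: "Poly_Mapping.keys \<mu> \<subseteq> S" "\<mu> \<in> partition_families I" "fprod mat \<nu> \<mu> = (\<Prod>U\<in>S. mat (entry \<nu> U) (entry \<mu> U))" if "\<mu> \<in> ?A" for \<mu>
  proof -
    show "\<mu> \<in> partition_families I" using that by simp
    show "Poly_Mapping.keys \<mu> \<subseteq> S"
      using that fprod_fclass(2)[OF graded_mat \<nu>, of \<mu>] S by (auto simp: fclass_def)
    then show "fprod mat \<nu> \<mu> = (\<Prod>U\<in>S. mat (entry \<nu> U) (entry \<mu> U))"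
      using S by (intro fprod_superset graded_mat)
  qed
  have lookup_fam: "entry (?fam g) U = (if U \<in> S then g U else {#})" for g U
    using S(1) by (subst lookup_Abs_poly_mapping) (auto intro: finite_subset[of _ S])
  have "(\<Sum>\<mu>\<in>fclass I \<nu>. fprod mat \<nu> \<mu> *\<^sub>Q (\<Prod>U\<in>S. h U (entry \<mu> U)))
      = (\<Sum>\<mu>\<in>?A. fprod mat \<nu> \<mu> *\<^sub>Q (\<Prod>U\<in>S. h U (entry \<mu> U)))"
    by (rule sum.mono_neutral_right[OF finite_fclass])
      (use fprod_fclass(2)[OF graded_mat \<nu>] in \<open>auto simp: fclass_def\<close>)
  also have "\<dots> = (\<Sum>\<mu>\<in>?A. \<Prod>U\<in>S. mat (entry \<nu> U) (entry \<mu> U) *\<^sub>Q h U (entry \<mu> U))"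
    by (intro sum.cong refl) (simp only: prod_qscale A(3))
  also have "\<dots> = (\<Sum>g\<in>PiE S ?B. \<Prod>U\<in>S. mat (entry \<nu> U) (g U) *\<^sub>Q h U (g U))"
  proof (rule sum.reindex_bij_witness[where j = ?g and i = ?fam])
    fix \<mu> assume \<mu>: "\<mu> \<in> ?A"
    show "?fam (?g \<mu>) = \<mu>"
      using A(1)[OF \<mu>] by (intro poly_mapping_eqI) (auto simp: lookup_fam in_keys_iff)
    have "entry \<mu> U \<in> ?B U" for U
      using \<mu> fprod_nonzero[OF graded_mat, of \<nu> \<mu> U] by (simp add: in_keys_iff)
    then show "?g \<mu> \<in> PiE S ?B" by auto
    show "(\<Prod>U\<in>S. mat (entry \<nu> U) (?g \<mu> U) *\<^sub>Q h U (?g \<mu> U)) = (\<Prod>U\<in>S. mat (entry \<nu> U) (entry \<mu> U) *\<^sub>Q h U (entry \<mu> U))"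
      by (rule prod.cong) auto
  next
    fix g assume g: "g \<in> PiE S ?B"
    then show "?g (?fam g) = g" by (auto simp: lookup_fam fun_eq_iff PiE_iff extensional_def)
    have keysS: "Poly_Mapping.keys (?fam g) \<subseteq> S" by (auto simp: in_keys_iff lookup_fam split: if_splits)
    have part: "is_partition (entry (?fam g) U)" for U
      using g by (auto simp: lookup_fam PiE_iff intro: schur_expansion_partition)
    have "fprod mat \<nu> (?fam g) = (\<Prod>U\<in>S. mat (entry \<nu> U) (entry (?fam g) U))"
      using S keysS by (intro fprod_superset graded_mat)
    then have nz: "fprod mat \<nu> (?fam g) \<noteq> 0" using g S(1) by (simp add: lookup_fam PiE_iff in_keys_iff)
    moreover have "Poly_Mapping.keys (?fam g) \<subseteq> I"
    proof
      fix U assume U: "U \<in> Poly_Mapping.keys (?fam g)"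
      have "\<Sum>\<^sub># (entry \<nu> U) = \<Sum>\<^sub># (entry (?fam g) U)"
        using g U keysS schur_expansion_sum[of "g U" "entry \<nu> U"] by (auto simp: lookup_fam PiE_iff)
      then have "entry \<nu> U \<noteq> {#}"
        using U sum_eq_0_partition[OF part[of U]] by (auto simp: in_keys_iff)
      then show "U \<in> I" using family_keys[OF \<nu>] by (auto simp: in_keys_iff)
    qed
    ultimately show "?fam g \<in> ?A" using part by (auto intro: familyI)
  qed
  also have "\<dots> = (\<Prod>U\<in>S. \<Sum>\<mu>\<in>?B U. mat (entry \<nu> U) \<mu> *\<^sub>Q h U \<mu>)"
    using S(1) by (intro prod_sum_PiE[symmetric]) auto
  finally show ?thesis .
qed

lemma fprod_kostka:
  assumes \<nu>: "\<nu> \<in> partition_families I"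
  shows "fprod kostka \<nu> \<alpha> = (\<Sum>\<mu>\<in>fclass I \<nu>. fprod mat \<nu> \<mu> * fprod pcoeff \<mu> \<alpha>)"
proof -
  let ?S = "Poly_Mapping.keys \<nu> \<union> Poly_Mapping.keys \<alpha>"
  have "fprod kostka \<nu> \<alpha> = (\<Sum>\<mu>\<in>fclass I \<nu>. fprod mat \<nu> \<mu> *\<^sub>Q (\<Prod>U\<in>?S. pcoeff (entry \<mu> U) (entry \<alpha> U)))"
    by (subst sum_families_prod[OF \<nu>]) (simp_all add: fprod_def kostka_expansion qscale_rat_def)
  also have "\<dots> = (\<Sum>\<mu>\<in>fclass I \<nu>. fprod mat \<nu> \<mu> * fprod pcoeff \<mu> \<alpha>)"
    by (intro sum.cong refl) (auto simp: qscale_rat_def fclass_def fprod_superset[OF graded_pcoeff, of ?S])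
  finally show ?thesis .
qed


subsection \<open>The elements \<open>Z\<close> for an arbitrary coefficient family\<close>

text \<open>The right-hand side \<omega> is arbitrary because the twisted generating product has to
  be expanded in the same way.\<close>

definition is_Z :: "'r set \<Rightarrow> ('r family \<Rightarrow> 'v::rat_algebra) \<Rightarrow> ('r family \<Rightarrow> 'v) \<Rightarrow> bool" where
  "is_Z I \<omega> Z \<longleftrightarrow> (\<forall>\<nu>. \<nu> \<notin> partition_families I \<longrightarrow> Z \<nu> = 0) \<and>
     (\<forall>\<mu>\<in>partition_families I. (\<Sum>\<nu>\<in>fclass I \<mu>. fprod mat \<nu> \<mu> *\<^sub>Q Z \<nu>) = \<omega> \<mu>)"

text \<open>The coefficient of the dominant monomial of \<alpha> in the formal sum with power sum
  coefficients \<omega>.\<close>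

definition Hcoef :: "'r set \<Rightarrow> ('r family \<Rightarrow> 'v::rat_algebra) \<Rightarrow> 'r family \<Rightarrow> 'v" where
  "Hcoef I \<omega> \<alpha> = (\<Sum>\<mu>\<in>fclass I \<alpha>. fprod pcoeff \<mu> \<alpha> *\<^sub>Q \<omega> \<mu>)"

lemma fclass_families: "fclass I \<alpha> \<subseteq> partition_families I"
  by (auto simp: fclass_def)

text \<open>Schur functions written in power sums, and these in monomials, give Kostka
  numbers.\<close>

lemma Hcoef_mat:
  assumes \<alpha>: "\<alpha> \<in> partition_families I"
  shows "Hcoef I (\<lambda>\<mu>. \<Sum>\<nu>\<in>fclass I \<mu>. fprod mat \<nu> \<mu> *\<^sub>Q Z \<nu>) \<alpha>
    = (\<Sum>\<nu>\<in>fclass I \<alpha>. fprod kostka \<nu> \<alpha> *\<^sub>Q Z \<nu>)"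
proof -
  have "Hcoef I (\<lambda>\<mu>. \<Sum>\<nu>\<in>fclass I \<mu>. fprod mat \<nu> \<mu> *\<^sub>Q Z \<nu>) \<alpha>
      = (\<Sum>\<mu>\<in>fclass I \<alpha>. \<Sum>\<nu>\<in>fclass I \<alpha>. (fprod mat \<nu> \<mu> * fprod pcoeff \<mu> \<alpha>) *\<^sub>Q Z \<nu>)"
    unfolding Hcoef_def
    by (intro sum.cong refl) (simp add: fclass_eq qs.scale_sum_right qscale_qscale mult.commute)
  also have "\<dots> = (\<Sum>\<nu>\<in>fclass I \<alpha>. (\<Sum>\<mu>\<in>fclass I \<alpha>. fprod mat \<nu> \<mu> * fprod pcoeff \<mu> \<alpha>) *\<^sub>Q Z \<nu>)"
    by (subst sum.swap) (simp add: qs.scale_sum_left)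
  also have "\<dots> = (\<Sum>\<nu>\<in>fclass I \<alpha>. fprod kostka \<nu> \<alpha> *\<^sub>Q Z \<nu>)"
  proof (intro sum.cong refl)
    fix \<nu> assume \<nu>: "\<nu> \<in> fclass I \<alpha>"
    then have "\<nu> \<in> partition_families I" by (simp add: fclass_def)
    then show "(\<Sum>\<mu>\<in>fclass I \<alpha>. fprod mat \<nu> \<mu> * fprod pcoeff \<mu> \<alpha>) *\<^sub>Q Z \<nu> = fprod kostka \<nu> \<alpha> *\<^sub>Q Z \<nu>"
      by (simp add: fprod_kostka fclass_eq[OF \<nu>])
  qed
  finally show ?thesis .
qed

lemma is_Z_Hcoef:
  assumes Z: "is_Z I \<omega> Z" and \<alpha>: "\<alpha> \<in> partition_families I"
  shows "Hcoef I \<omega> \<alpha> = (\<Sum>\<nu>\<in>fclass I \<alpha>. fprod kostka \<nu> \<alpha> *\<^sub>Q Z \<nu>)"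
proof -
  have "Hcoef I \<omega> \<alpha> = Hcoef I (\<lambda>\<mu>. \<Sum>\<nu>\<in>fclass I \<mu>. fprod mat \<nu> \<mu> *\<^sub>Q Z \<nu>) \<alpha>"
    unfolding Hcoef_def using Z by (intro sum.cong refl) (auto simp: is_Z_def fclass_def)
  then show ?thesis using Hcoef_mat[OF \<alpha>] by simp
qed

lemma finite_row:
  assumes "graded_matrix h" "\<alpha> \<in> partition_families I"
  shows "finite {\<nu> \<in> partition_families I. fprod h \<nu> \<alpha> \<noteq> 0}"
  by (rule finite_subset[OF _ finite_fclass[of I \<alpha>]]) (use fprod_fclass(1)[OF assms(1) _ assms(2)] in auto)

lemma sum_row:
  assumes "graded_matrix h" "\<alpha> \<in> partition_families I"
  shows "(\<Sum>\<nu> | \<nu> \<in> partition_families I \<and> fprod h \<nu> \<alpha> \<noteq> 0. fprod h \<nu> \<alpha> *\<^sub>Q X \<nu>)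
    = (\<Sum>\<nu>\<in>fclass I \<alpha>. fprod h \<nu> \<alpha> *\<^sub>Q (X \<nu> :: 'v::rat_algebra))"
  by (rule sum_fclass_left[OF assms]) (auto simp: fclass_families)

definition krank :: "'r family \<Rightarrow> nat" where
  "krank \<nu> = (\<Sum>U\<in>Poly_Mapping.keys \<nu>. row_rank (entry \<nu> U))"

definition prank :: "'r family \<Rightarrow> nat" where
  "prank \<nu> = (\<Sum>U\<in>Poly_Mapping.keys \<nu>. \<Sum>\<^sub># (entry \<nu> U) - size (entry \<nu> U))"

lemma row_rank_empty: "row_rank {#} = 0"
proof -
  have "diagram {#} = {}" by (simp add: diagram_def)
  then show ?thesis by (simp add: row_rank_def)
qed

lemma kostka_family_triangular:
  "\<nu> \<in> partition_families I \<Longrightarrow> \<mu> \<in> partition_families I \<Longrightarrow> fprod kostka \<nu> \<mu> \<noteq> 0 \<Longrightarrow>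
    \<nu> = \<mu> \<or> krank \<nu> < krank \<mu>"
  unfolding krank_def by (rule fprod_triangular[OF graded_kostka _ _ _ row_rank_empty kostka_triangular])

lemma kostka_family_diag: "\<nu> \<in> partition_families I \<Longrightarrow> fprod kostka \<nu> \<nu> = 1"
  by (simp add: fprod_def kostka_diagonal family_partition)

lemma pcoeff_family_triangular:
  "\<nu> \<in> partition_families I \<Longrightarrow> \<mu> \<in> partition_families I \<Longrightarrow> fprod pcoeff \<nu> \<mu> \<noteq> 0 \<Longrightarrow>
    \<nu> = \<mu> \<or> prank \<nu> < prank \<mu>"
  unfolding prank_def
  by (rule fprod_triangular[OF graded_pcoeff, where rk = "\<lambda>\<mu>. \<Sum>\<^sub># \<mu> - size \<mu>"]) (auto dest: pcoeff_rank)

lemma Hcoef_eq_0: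
  assumes "\<And>\<alpha>. \<alpha> \<in> partition_families I \<Longrightarrow> Hcoef I D \<alpha> = 0" and "\<mu> \<in> partition_families I"
  shows "D \<mu> = 0"
proof (rule triangular_unique[where P = "partition_families I" and A = "fprod pcoeff" and rk = prank])
  show "(\<Sum>\<mu> | \<mu> \<in> partition_families I \<and> fprod pcoeff \<mu> \<alpha> \<noteq> 0. fprod pcoeff \<mu> \<alpha> *\<^sub>Q D \<mu>) = 0"
    if "\<alpha> \<in> partition_families I" for \<alpha>
    using assms(1)[OF that] by (simp add: sum_row[OF graded_pcoeff that] Hcoef_def)
  show "finite {\<mu> \<in> partition_families I. fprod pcoeff \<mu> \<alpha> \<noteq> 0}" if "\<alpha> \<in> partition_families I" for \<alpha>
    by (rule finite_row[OF graded_pcoeff that])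
  show "\<mu> = \<alpha> \<or> prank \<mu> < prank \<alpha>"
    if "\<mu> \<in> partition_families I" "\<alpha> \<in> partition_families I" "fprod pcoeff \<mu> \<alpha> \<noteq> 0" for \<mu> \<alpha>
    by (rule pcoeff_family_triangular[OF that])
  show "fprod pcoeff \<alpha> \<alpha> \<noteq> 0" if "\<alpha> \<in> partition_families I" for \<alpha>
    by (rule fprod_diag[OF graded_pcoeff pcoeff_diagonal that])
qed (rule assms(2))

text \<open>\<open>mat\<close> is not triangular: already in degree 2 all its entries are nonzero.
  Its product with \<open>pcoeff\<close> is the Kostka matrix, which is triangular; so the system is
  solved for the dominant coefficients, and these determine the power sum coefficients.\<close>

lemma is_Z_exists: "\<exists>Z. is_Z I \<omega> (Z :: 'r family \<Rightarrow> 'v::rat_algebra)"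
proof -
  let ?P = "partition_families I"
  have "\<exists>X. \<forall>\<alpha>\<in>?P. (\<Sum>\<nu> | \<nu> \<in> ?P \<and> fprod kostka \<nu> \<alpha> \<noteq> 0. fprod kostka \<nu> \<alpha> *\<^sub>Q X \<nu>) = Hcoef I \<omega> \<alpha>"
  proof (rule triangular_solve[where rk = krank])
    show "finite {\<mu> \<in> ?P. fprod kostka \<mu> \<alpha> \<noteq> 0}" if "\<alpha> \<in> ?P" for \<alpha>
      by (rule finite_row[OF graded_kostka that])
    show "\<mu> = \<alpha> \<or> krank \<mu> < krank \<alpha>" if "\<mu> \<in> ?P" "\<alpha> \<in> ?P" "fprod kostka \<mu> \<alpha> \<noteq> 0" for \<mu> \<alpha>
      by (rule kostka_family_triangular[OF that])
  qed (simp add: kostka_family_diag)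
  then obtain X where X: "\<And>\<alpha>. \<alpha> \<in> ?P \<Longrightarrow> (\<Sum>\<nu>\<in>fclass I \<alpha>. fprod kostka \<nu> \<alpha> *\<^sub>Q X \<nu>) = Hcoef I \<omega> \<alpha>"
    by (auto simp: sum_row[OF graded_kostka])
  define Z where "Z \<nu> = (if \<nu> \<in> ?P then X \<nu> else 0)" for \<nu>
  let ?Y = "\<lambda>\<mu>. \<Sum>\<nu>\<in>fclass I \<mu>. fprod mat \<nu> \<mu> *\<^sub>Q Z \<nu>"
  have "\<omega> \<mu> - ?Y \<mu> = 0" if "\<mu> \<in> ?P" for \<mu>
  proof (rule Hcoef_eq_0[OF _ that])
    fix \<alpha> assume \<alpha>: "\<alpha> \<in> ?P"
    have "Hcoef I ?Y \<alpha> = (\<Sum>\<nu>\<in>fclass I \<alpha>. fprod kostka \<nu> \<alpha> *\<^sub>Q X \<nu>)"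
      unfolding Hcoef_mat[OF \<alpha>] by (intro sum.cong refl) (auto simp: Z_def fclass_def)
    then show "Hcoef I (\<lambda>\<mu>. \<omega> \<mu> - ?Y \<mu>) \<alpha> = 0"
      using X[OF \<alpha>] by (simp add: Hcoef_def qs.scale_right_diff_distrib sum_subtractf)
  qed
  then have "is_Z I \<omega> Z" by (simp add: is_Z_def Z_def)
  then show ?thesis by blast
qed

lemma is_Z_unique:
  assumes "is_Z I \<omega> Z" "is_Z I \<omega> Z'"
  shows "Z = Z'"
proof
  fix \<nu>
  show "Z \<nu> = Z' \<nu>"
  proof (cases "\<nu> \<in> partition_families I")
    case True
    have "Z \<nu> - Z' \<nu> = 0"
    proof (rule triangular_unique[where P = "partition_families I" and A = "fprod kostka" and rk = krank])
      show "(\<Sum>\<nu> | \<nu> \<in> partition_families I \<and> fprod kostka \<nu> \<alpha> \<noteq> 0. fprod kostka \<nu> \<alpha> *\<^sub>Q (Z \<nu> - Z' \<nu>)) = 0"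
        if "\<alpha> \<in> partition_families I" for \<alpha>
        using is_Z_Hcoef[OF assms(1) that] is_Z_Hcoef[OF assms(2) that]
        by (simp add: sum_row[OF graded_kostka that] qs.scale_right_diff_distrib sum_subtractf)
      show "finite {\<mu> \<in> partition_families I. fprod kostka \<mu> \<alpha> \<noteq> 0}" if "\<alpha> \<in> partition_families I" for \<alpha>
        by (rule finite_row[OF graded_kostka that])
      show "\<mu> = \<alpha> \<or> krank \<mu> < krank \<alpha>"
        if "\<mu> \<in> partition_families I" "\<alpha> \<in> partition_families I" "fprod kostka \<mu> \<alpha> \<noteq> 0" for \<mu> \<alpha>
        by (rule kostka_family_triangular[OF that])
    qed (simp_all add: kostka_family_diag True)
    then show ?thesis by simp
  next
    case False
    then show ?thesis using assms by (simp add: is_Z_def)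
  qed
qed

text \<open>The Kostka matrix is integral and unitriangular and preserves weights, so its inversion
  stays within L and within one weight.\<close>

lemma is_Z_integral:
  assumes Z: "is_Z I \<omega> Z" and L: "zsubgroup L"
    and H: "\<And>\<alpha>. \<alpha> \<in> partition_families I \<Longrightarrow> weight \<alpha> = weight \<nu> \<Longrightarrow> Hcoef I \<omega> \<alpha> \<in> L"
    and \<nu>: "\<nu> \<in> partition_families I"
  shows "Z \<nu> \<in> L"
proof -
  let ?P = "{\<alpha> \<in> partition_families I. weight \<alpha> = weight \<nu>}"
  have set: "{\<mu> \<in> ?P. fprod kostka \<mu> \<alpha> \<noteq> 0} = {\<mu> \<in> partition_families I. fprod kostka \<mu> \<alpha> \<noteq> 0}"
    if "\<alpha> \<in> ?P" for \<alpha>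
    using that fprod_fclass(1)[OF graded_kostka, of _ I \<alpha>] by (auto simp: fclass_def)
  show ?thesis
  proof (rule triangular_integral[where P = ?P and A = "fprod kostka" and rk = krank, OF _ _ _ _ L])
    fix \<alpha> assume \<alpha>: "\<alpha> \<in> ?P"
    show "finite {\<mu> \<in> ?P. fprod kostka \<mu> \<alpha> \<noteq> 0}"
      unfolding set[OF \<alpha>] using \<alpha> by (intro finite_row graded_kostka) simp
    show "fprod kostka \<alpha> \<alpha> = 1" using \<alpha> by (simp add: kostka_family_diag[of _ I])
    have "(\<Sum>\<mu> | \<mu> \<in> partition_families I \<and> fprod kostka \<mu> \<alpha> \<noteq> 0. fprod kostka \<mu> \<alpha> *\<^sub>Q Z \<mu>) \<in> L"
      using \<alpha> H by (simp add: sum_row[OF graded_kostka] is_Z_Hcoef[OF Z, symmetric])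
    then show "(\<Sum>\<mu> | \<mu> \<in> ?P \<and> fprod kostka \<mu> \<alpha> \<noteq> 0. fprod kostka \<mu> \<alpha> *\<^sub>Q Z \<mu>) \<in> L"
      using set[OF \<alpha>] by simp
    show "fprod kostka \<mu> \<alpha> \<in> \<int>" for \<mu>
      unfolding fprod_def by (intro Ints_prod kostka_Ints)
  qed (use \<nu> kostka_family_triangular in auto)
qed

lemma is_Z_Z_elt: "is_Z I (generating_product I) (Z_elt I)"
proof -
  obtain Z where Z: "is_Z I (generating_product I) Z" using is_Z_exists by blast
  have "Z_elt I = (THE Z. is_Z I (generating_product I) Z)"
    unfolding Z_elt_def is_Z_def schur_coeff_eq
    by (rule arg_cong[where f = The]) (auto simp: fun_eq_iff sum_row[OF graded_mat])
  also have "\<dots> = Z" using Z is_Z_unique by blast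
  finally show ?thesis using Z by simp
qed

section \<open>Evaluation of the generating product at finite alphabets\<close>

text \<open>A letter \<open>(U, c, y)\<close> stands for \<open>c\<close> copies of the variable \<open>y\<close> in the alphabet of \<open>U\<close>: it
  contributes \<open>c y\<^sup>n\<close> to the power sum \<open>p\<^sub>n\<close> of that alphabet.\<close>

type_synonym ('r, 'm) letters = "('r \<times> int \<times> ('m, rat) mseries) list"

definition alph :: "('r, 'm::graded_cmonoid) letters \<Rightarrow> 'r \<Rightarrow> nat \<Rightarrow> ('m, rat) mseries" where
  "alph L U = virtual (map snd (filter (\<lambda>x. fst x = U) L))"

definition good :: "'r set \<Rightarrow> ('r, 'm::graded_cmonoid) letters \<Rightarrow> bool" where
  "good I L \<longleftrightarrow> (\<forall>(W, c, y)\<in>set L. W \<in> I \<and> int_series y \<and> no_const y)"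

text \<open>Since \<open>c y\<^sup>0\<close> need not vanish, parts equal to \<open>0\<close> are excluded explicitly.\<close>

definition feval :: "('r, 'm::graded_cmonoid) letters \<Rightarrow> 'r family \<Rightarrow> ('m, rat) mseries" where
  "feval L \<mu> = (\<Prod>U\<in>Poly_Mapping.keys \<mu>. \<Prod>n\<in>#entry \<mu> U. if n = 0 then 0 else alph L U n)"

lemma alph_Nil [simp]: "alph [] U n = 0"
  by (simp add: alph_def virtual_def)

lemma alph_Cons: "alph ((W, c, y) # L) U n = (if W = U then of_int c *\<^sub>Q y ^ n else 0) + alph L U n"
  by (simp add: alph_def virtual_def)

lemma alph_append: "alph (L @ L') U n = alph L U n + alph L' U n"
  by (simp add: alph_def virtual_def)

lemma alph_eq_0: "U \<notin> fst ` set L \<Longrightarrow> alph L U n = 0"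
  by (induction L) (auto simp: alph_Cons)

lemma good_fst: "good I L \<Longrightarrow> fst ` set L \<subseteq> I"
  by (force simp: good_def)

lemma ord_ge_alph: "good I L \<Longrightarrow> ord_ge n (alph L U n)"
proof (induction L)
  case Nil
  then show ?case by (simp add: ord_ge_def)
next
  case (Cons x L)
  obtain W c y where x: "x = (W, c, y)" by (cases x)
  have "ord_ge n (y ^ n)" using Cons.prems by (intro ord_ge_power) (auto simp: good_def x)
  then show ?case
    using Cons by (auto simp: x alph_Cons good_def intro!: ord_ge_lin ord_ge_qscale)
qed

lemma feval_superset:
  assumes "finite S" "Poly_Mapping.keys \<mu> \<subseteq> S"
  shows "feval L \<mu> = (\<Prod>U\<in>S. \<Prod>n\<in>#entry \<mu> U. if n = 0 then 0 else alph L U n)"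
  unfolding feval_def using assms by (intro prod.mono_neutral_left) (auto simp: in_keys_iff)

lemma ord_ge_prod_mset:
  fixes g :: "nat \<Rightarrow> ('m::graded_cmonoid, rat) mseries"
  assumes "\<And>n. ord_ge n (g n)"
  shows "ord_ge (\<Sum>\<^sub># M) (\<Prod>n\<in>#M. g n)"
  using assms by (induction M) (auto intro: ord_ge_mult)

lemma ord_ge_feval: "good I L \<Longrightarrow> ord_ge (weight \<mu>) (feval L \<mu>)"
  unfolding feval_def weight_def
  by (intro ord_ge_prod ord_ge_prod_mset) (simp add: ord_ge_alph ord_ge_def[of _ 0])

lemma feval_nonzero:
  assumes L: "good I L" and nz: "mcoef (feval L \<mu>) m \<noteq> 0"
  shows "\<mu> \<in> partition_families I" "Poly_Mapping.keys \<mu> \<subseteq> fst ` set L" "weight \<mu> \<le> deg m"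
proof -
  have 0: "n \<noteq> 0 \<and> U \<in> fst ` set L" if U: "U \<in> Poly_Mapping.keys \<mu>" and n: "n \<in># entry \<mu> U" for U n
  proof (rule ccontr)
    assume "\<not> (n \<noteq> 0 \<and> U \<in> fst ` set L)"
    then have "(if n = 0 then 0 else alph L U n) = 0" using alph_eq_0[of U L n] by auto
    moreover obtain M where "entry \<mu> U = add_mset n M" using n by (metis multi_member_split)
    ultimately have "(\<Prod>n\<in>#entry \<mu> U. if n = 0 then 0 else alph L U n) = 0" by simp
    then have "feval L \<mu> = 0"
      unfolding feval_def by (intro prod_zero[OF finite_keys] bexI[OF _ U])
    then show False using nz by simp
  qed
  have ex: "\<exists>n. n \<in># entry \<mu> U" if "U \<in> Poly_Mapping.keys \<mu>" for U
    using that by (auto simp: in_keys_iff multiset_nonemptyE)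
  show keys: "Poly_Mapping.keys \<mu> \<subseteq> fst ` set L" using 0 ex by blast
  show "\<mu> \<in> partition_families I"
  proof (rule familyI)
    show "Poly_Mapping.keys \<mu> \<subseteq> I" using keys good_fst[OF L] by blast
    show "is_partition (entry \<mu> U)" for U
      using 0[of U 0] by (cases "U \<in> Poly_Mapping.keys \<mu>") (auto simp: is_partition_def in_keys_iff)
  qed
  show "weight \<mu> \<le> deg m" using ord_ge_feval[OF L, of \<mu>] nz by (meson ord_ge_def not_le)
qed

lemma feval_support:
  "good I L \<Longrightarrow> fst ` set L \<subseteq> S \<Longrightarrow> {\<mu>. mcoef (feval L \<mu>) m \<noteq> 0}
    \<subseteq> {\<nu> \<in> partition_families I. Poly_Mapping.keys \<nu> \<subseteq> S \<and> weight \<nu> \<le> deg m}"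
  using feval_nonzero[of I L _ m] by blast

lemma deg_le_weight: "\<mu> \<in> partition_families I \<Longrightarrow> deg \<mu> \<le> weight \<mu>"
  unfolding deg_poly_mapping_def weight_def deg_multiset_def
  by (intro sum_mono size_le_sum family_partition)

lemma msubst_feval:
  assumes L: "good I L"
  shows "msubst (feval L)"
proof
  show "feval L 0 = 1" by (simp add: feval_def)
  show "feval L (\<mu> + \<nu>) = feval L \<mu> * feval L \<nu>" for \<mu> \<nu>
  proof -
    let ?S = "Poly_Mapping.keys \<mu> \<union> Poly_Mapping.keys \<nu>"
    show ?thesis
      unfolding feval_superset[of ?S \<mu>, OF _ Un_upper1, simplified] feval_superset[of ?S \<nu>, OF _ Un_upper2, simplified]
        feval_superset[of ?S "\<mu> + \<nu>", OF _ keys_add, simplified]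
      by (simp add: lookup_add prod.distrib)
  qed
  show "finite {\<mu>. mcoef (feval L \<mu>) m \<noteq> 0}" for m
    by (rule finite_subset[OF feval_support[OF L order_refl] finite_families]) simp
  show "deg \<mu> \<le> deg m" if "mcoef (feval L \<mu>) m \<noteq> 0" for \<mu> m
    using deg_le_weight[OF feval_nonzero(1)[OF L that]] feval_nonzero(3)[OF L that] by simp
qed

definition tens :: "('m, rat) mseries \<Rightarrow> 'r::{ring, monoid_mult} \<Rightarrow> ('m, 'r qtensor) mseries" where
  "tens f r = MSeries (\<lambda>m. mcoef f m *\<^sub>Q (1 \<otimes>\<^sub>Q r))"

lemma mcoef_tens: "mcoef (tens f r) m = mcoef f m *\<^sub>Q (1 \<otimes>\<^sub>Q r)"
  by (simp add: tens_def)

lemma tens_add: "tens (f + g) r = tens f r + tens g r"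
  by (rule mseries_eqI) (simp add: mcoef_tens qscale_add_left)

lemma tens_0: "tens 0 r = 0"
  by (rule mseries_eqI) (simp add: mcoef_tens)

lemma tens_mult: "tens f r * tens g s = tens (f * g) (r * s)"
  by (rule mseries_eqI)
    (simp add: mcoef_times mcoef_tens qscale_mult_left qscale_mult_right qscale_qscale qtens_mult
      qs.scale_sum_left split_def mult.commute)

text \<open>The sum over U of p_l(x_U) U at the alphabet L. The list form, with letters not
  collected by U, is what multiplying out produces.\<close>

definition cser :: "('r::{ring, monoid_mult}, 'm::graded_cmonoid) letters \<Rightarrow> nat \<Rightarrow> ('m, 'r qtensor) mseries" where
  "cser L l = (\<Sum>(W, c, y)\<leftarrow>L. tens (of_int c *\<^sub>Q y ^ l) W)"

lemma cser_simps: "cser [] l = 0" "cser ((W, c, y) # L) l = tens (of_int c *\<^sub>Q y ^ l) W + cser L l"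
  "cser (L @ L') l = cser L l + cser L' l"
  by (simp_all add: cser_def)

lemma cser_alph: "finite F \<Longrightarrow> fst ` set L \<subseteq> F \<Longrightarrow> cser L l = (\<Sum>U\<in>F. tens (alph L U l) U)"
proof (induction L)
  case (Cons x L)
  obtain W c y where x: "x = (W, c, y)" by (cases x)
  have "(\<Sum>U\<in>F. tens (if W = U then of_int c *\<^sub>Q y ^ l else 0) U) = tens (of_int c *\<^sub>Q y ^ l) W"
    using Cons.prems by (subst sum.remove[of F W]) (auto simp: x tens_0 intro!: sum.neutral split: if_splits)
  then show ?case using Cons by (simp add: x cser_simps alph_Cons tens_add sum.distrib)
qed (simp add: cser_simps tens_0)

lemma no_const_cser: "good I L \<Longrightarrow> 1 \<le> l \<Longrightarrow> no_const (cser L l)"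
proof -
  assume L: "good I L" and l: "1 \<le> l"
  have "mcoef (alph L U l) 0 = 0" for U
    using ord_ge_alph[OF L, of l U] l by (simp add: ord_ge_def)
  then show ?thesis
    by (simp add: no_const_def cser_alph[OF _ order_refl] mcoef_tens)
qed

lemma sub_generators:
  assumes L: "good I L" and l: "1 \<le> l"
  shows "msubst.sub (feval L) (lin I l) = cser L l"
proof -
  interpret msubst "feval L" using L by (rule msubst_feval)
  let ?F = "fst ` set L" and ?s = "\<lambda>U. Poly_Mapping.single U {#l#}"
  have FI: "?F \<subseteq> I" by (rule good_fst[OF L])
  have inj: "?s U = ?s V \<longleftrightarrow> U = V" for U V
  proof
    assume "?s U = ?s V"
    then have "Poly_Mapping.keys (?s U) = Poly_Mapping.keys (?s V)" by simp
    then show "U = V" by simp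
  qed simp
  have lin: "mcoef (lin I l) (?s U) = 1 \<otimes>\<^sub>Q U" if "U \<in> I" for U
  proof -
    have "{V. V \<in> I \<and> ?s U = ?s V} = {U}" using that by (auto simp: inj)
    then show ?thesis by (simp add: lin_def linear_sum_def)
  qed
  have lin0: "mcoef (lin I l) \<mu> = 0" if "\<And>U. U \<in> I \<Longrightarrow> \<mu> \<noteq> ?s U" for \<mu>
  proof -
    have "{V. V \<in> I \<and> \<mu> = ?s V} = {}" using that by blast
    then show ?thesis by (simp only: lin_def linear_sum_def mcoef_MSeries sum.empty)
  qed
  have ev: "feval L (?s U) = alph L U l" for U
    using l by (simp add: feval_def)
  show ?thesis
  proof (rule mseries_eqI)
    fix m
    have "mcoef (sub (lin I l)) m
        = (\<Sum>\<mu>\<in>supp m \<union> ?s ` ?F. mcoef (feval L \<mu>) m *\<^sub>Q mcoef (lin I l) \<mu>)"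
      by (rule mcoef_sub) auto
    also have "\<dots> = (\<Sum>\<mu>\<in>?s ` ?F. mcoef (feval L \<mu>) m *\<^sub>Q mcoef (lin I l) \<mu>)"
    proof (rule sum.mono_neutral_right)
      show "\<forall>\<mu>\<in>supp m \<union> ?s ` ?F - ?s ` ?F. mcoef (feval L \<mu>) m *\<^sub>Q mcoef (lin I l) \<mu> = 0"
      proof
        fix \<mu> assume \<mu>: "\<mu> \<in> supp m \<union> ?s ` ?F - ?s ` ?F"
        show "mcoef (feval L \<mu>) m *\<^sub>Q mcoef (lin I l) \<mu> = 0"
        proof (cases "\<exists>U\<in>I. \<mu> = ?s U")
          case True
          then obtain U where "\<mu> = ?s U" by blast
          then have "U \<notin> ?F" using \<mu> by auto
          then show ?thesis using alph_eq_0[of U L l] by (simp add: \<open>\<mu> = ?s U\<close> ev)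
        next
          case False
          then show ?thesis using lin0[of \<mu>] by simp
        qed
      qed
    qed auto
    also have "\<dots> = (\<Sum>U\<in>?F. mcoef (alph L U l) m *\<^sub>Q (1 \<otimes>\<^sub>Q U))"
      using FI by (subst sum.reindex) (auto simp: inj_on_def inj ev lin intro!: sum.cong)
    also have "\<dots> = mcoef (cser L l) m"
      by (simp add: cser_alph[OF _ order_refl] mcoef_tens)
    finally show "mcoef (sub (lin I l)) m = mcoef (cser L l) m" .
  qed
qed

text \<open>The coefficient at m of the value at L of the formal sum with coefficients
  \<omega>.\<close>

definition Ev :: "('r, 'm::graded_cmonoid) letters \<Rightarrow> ('r family \<Rightarrow> 'v::rat_algebra) \<Rightarrow> 'm \<Rightarrow> 'v" where
  "Ev L \<omega> m = (\<Sum>\<mu> | mcoef (feval L \<mu>) m \<noteq> 0. mcoef (feval L \<mu>) m *\<^sub>Q \<omega> \<mu>)"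

text \<open>Substitution commutes with exp, log and T_l, so it carries partial products over. Only
  families of weight at most deg m contribute, and for these n factors already give the
  limit.\<close>

lemma Ev_gprod:
  assumes L: "good I L" and n: "deg m \<le> n"
  shows "mcoef (gprod (cser L) n) m = Ev L (generating_product I) m"
proof -
  interpret msubst "feval L" using L by (rule msubst_feval)
  have "sub (gprod (lin I) k) = gprod (cser L) k" for k
    by (induction k) (simp_all add: sub_1 sub_mult sub_gexp lie_map_T no_const_lin sub_generators[OF L])
  then have "mcoef (gprod (cser L) n) m = mcoef (sub (gprod (lin I) n)) m" by simp
  also have "\<dots> = (\<Sum>\<mu>\<in>supp m. mcoef (feval L \<mu>) m *\<^sub>Q generating_product I \<mu>)"
    unfolding sub_def mcoef_MSeries
  proof (rule sum.cong[OF refl])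
    fix \<mu> assume "\<mu> \<in> supp m"
    then have "weight \<mu> \<le> n" using feval_nonzero(3)[OF L, of \<mu> m] n by (simp add: supp_def)
    then show "mcoef (feval L \<mu>) m *\<^sub>Q mcoef (gprod (lin I) n) \<mu> = mcoef (feval L \<mu>) m *\<^sub>Q generating_product I \<mu>"
      by (simp add: generating_product_eq)
  qed
  finally show ?thesis by (simp add: Ev_def supp_def)
qed

definition sfam :: "('r, 'm::graded_cmonoid) letters \<Rightarrow> 'r family \<Rightarrow> ('m, rat) mseries" where
  "sfam L \<nu> = (\<Prod>U\<in>Poly_Mapping.keys \<nu>. schur_at (entry \<nu> U) (alph L U))"

lemma int_series_sfam: "good I L \<Longrightarrow> int_series (sfam L \<nu>)"
  unfolding sfam_def alph_def
  by (intro int_series_prod int_series_schur_at) (auto simp: good_def)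

lemma sfam_feval:
  assumes "\<nu> \<in> partition_families I"
  shows "sfam L \<nu> = (\<Sum>\<mu>\<in>fclass I \<nu>. fprod mat \<nu> \<mu> *\<^sub>Q feval L \<mu>)"
proof -
  have "sfam L \<nu> = (\<Sum>\<mu>\<in>fclass I \<nu>. fprod mat \<nu> \<mu> *\<^sub>Q (\<Prod>U\<in>Poly_Mapping.keys \<nu>. \<Prod>n\<in>#entry \<mu> U. alph L U n))"
    using sum_families_prod[OF assms, of "Poly_Mapping.keys \<nu>" "\<lambda>U \<mu>. \<Prod>n\<in>#\<mu>. alph L U n"]
    by (simp add: sfam_def schur_at_def)
  also have "\<dots> = (\<Sum>\<mu>\<in>fclass I \<nu>. fprod mat \<nu> \<mu> *\<^sub>Q feval L \<mu>)"
  proof (intro sum.cong refl)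
    fix \<mu> assume \<mu>: "\<mu> \<in> fclass I \<nu>"
    have "0 \<notin># entry \<mu> U" for U
      using \<mu> family_partition[of \<mu> I U] by (simp add: fclass_def is_partition_def)
    then have "image_mset (alph L U) (entry \<mu> U) = image_mset (\<lambda>n. if n = 0 then 0 else alph L U n) (entry \<mu> U)" for U
      by (intro image_mset_cong) (metis)
    then show "fprod mat \<nu> \<mu> *\<^sub>Q (\<Prod>U\<in>Poly_Mapping.keys \<nu>. \<Prod>n\<in>#entry \<mu> U. alph L U n) = fprod mat \<nu> \<mu> *\<^sub>Q feval L \<mu>"
      using \<mu> by (simp add: feval_def fclass_def)
  qed
  finally show ?thesis .
qed

definition bounded_families :: "'r set \<Rightarrow> 'r set \<Rightarrow> nat \<Rightarrow> 'r family set" where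
  "bounded_families I S d = {\<nu> \<in> partition_families I. Poly_Mapping.keys \<nu> \<subseteq> S \<and> weight \<nu> \<le> d}"

text \<open>This is the defining identity of the Z evaluated at L. Its point is that the scalars
  become coefficients of Schur functions at virtual alphabets, which are integers.\<close>

lemma Ev_sfam:
  assumes L: "good I L" and Z: "is_Z I \<omega> Z" and S: "finite S" "fst ` set L \<subseteq> S"
  shows "Ev L \<omega> m = (\<Sum>\<nu>\<in>bounded_families I S (deg m). mcoef (sfam L \<nu>) m *\<^sub>Q Z \<nu>)"
proof -
  let ?Y = "bounded_families I S (deg m)"
  have fin: "finite ?Y" unfolding bounded_families_def using S by (intro finite_families) auto
  have cls: "fclass I \<mu> \<subseteq> ?Y" if "\<mu> \<in> ?Y" for \<mu>
    using that by (auto simp: fclass_def bounded_families_def)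
  have PF: "\<mu> \<in> partition_families I" if "\<mu> \<in> ?Y" for \<mu> using that by (simp add: bounded_families_def)
  have "Ev L \<omega> m = (\<Sum>\<mu>\<in>?Y. mcoef (feval L \<mu>) m *\<^sub>Q \<omega> \<mu>)"
    unfolding Ev_def
    by (rule sum.mono_neutral_left[OF fin feval_support[OF L S(2), folded bounded_families_def]]) auto
  also have "\<dots> = (\<Sum>\<mu>\<in>?Y. \<Sum>\<nu>\<in>?Y. (fprod mat \<nu> \<mu> * mcoef (feval L \<mu>) m) *\<^sub>Q Z \<nu>)"
  proof (rule sum.cong[OF refl])
    fix \<mu> assume \<mu>: "\<mu> \<in> ?Y"
    have "\<omega> \<mu> = (\<Sum>\<nu>\<in>fclass I \<mu>. fprod mat \<nu> \<mu> *\<^sub>Q Z \<nu>)" using Z PF[OF \<mu>] by (simp add: is_Z_def)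
    also have "\<dots> = (\<Sum>\<nu>\<in>?Y. fprod mat \<nu> \<mu> *\<^sub>Q Z \<nu>)"
      by (rule sum.mono_neutral_left[OF fin cls[OF \<mu>]])
        (use fprod_fclass(1)[OF graded_mat _ PF[OF \<mu>]] PF in auto)
    finally show "mcoef (feval L \<mu>) m *\<^sub>Q \<omega> \<mu> = (\<Sum>\<nu>\<in>?Y. (fprod mat \<nu> \<mu> * mcoef (feval L \<mu>) m) *\<^sub>Q Z \<nu>)"
      by (simp add: qs.scale_sum_right qscale_qscale mult.commute)
  qed
  also have "\<dots> = (\<Sum>\<nu>\<in>?Y. (\<Sum>\<mu>\<in>?Y. fprod mat \<nu> \<mu> * mcoef (feval L \<mu>) m) *\<^sub>Q Z \<nu>)"
    by (subst sum.swap) (simp add: qs.scale_sum_left)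
  also have "\<dots> = (\<Sum>\<nu>\<in>?Y. mcoef (sfam L \<nu>) m *\<^sub>Q Z \<nu>)"
  proof (rule sum.cong[OF refl])
    fix \<nu> assume \<nu>: "\<nu> \<in> ?Y"
    have "(\<Sum>\<mu>\<in>?Y. fprod mat \<nu> \<mu> * mcoef (feval L \<mu>) m) = (\<Sum>\<mu>\<in>fclass I \<nu>. fprod mat \<nu> \<mu> * mcoef (feval L \<mu>) m)"
      by (rule sum.mono_neutral_right[OF fin cls[OF \<nu>]])
        (use fprod_fclass(2)[OF graded_mat PF[OF \<nu>]] PF in auto)
    then show "(\<Sum>\<mu>\<in>?Y. fprod mat \<nu> \<mu> * mcoef (feval L \<mu>) m) *\<^sub>Q Z \<nu> = mcoef (sfam L \<nu>) m *\<^sub>Q Z \<nu>"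
      by (simp add: sfam_feval[OF PF[OF \<nu>]] qscale_rat_def)
  qed
  finally show ?thesis .
qed

lemma Ev_in_subgroup:
  assumes L: "good I L" and Z: "is_Z I \<omega> Z" and G: "zsubgroup G"
    and mem: "\<And>\<nu>. \<nu> \<in> partition_families I \<Longrightarrow> weight \<nu> \<le> deg m \<Longrightarrow> Z \<nu> \<in> G"
  shows "Ev L \<omega> m \<in> G"
  unfolding Ev_sfam[OF L Z finite_imageI[OF finite_set] order_refl]
  by (intro zsubgroup_closed(4)[OF G] zsubgroup_scale[OF G] mem)
    (use int_series_sfam[OF L] in \<open>auto simp: int_series_def bounded_families_def\<close>)


subsection \<open>Letters of higher order\<close>

definition higher :: "('r, 'm::graded_cmonoid) letters \<Rightarrow> bool" where
  "higher L \<longleftrightarrow> (\<forall>(W, c, y)\<in>set L. ord_ge 2 y)"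

lemma ord_ge_power2: "ord_ge 2 y \<Longrightarrow> ord_ge (2 * n) (y ^ n)"
  for y :: "('m::graded_cmonoid, rat) mseries"
proof (induction n)
  case (Suc n)
  then show ?case using ord_ge_mult[of 2 y "2 * n" "y ^ n"] by simp
qed simp

lemma ord_ge_alph_higher: "higher L \<Longrightarrow> n \<noteq> 0 \<Longrightarrow> ord_ge (Suc n) (alph L U n)"
proof (induction L)
  case Nil
  then show ?case by (simp add: ord_ge_def)
next
  case (Cons x L)
  obtain W c y where x: "x = (W, c, y)" by (cases x)
  have "ord_ge (2 * n) (y ^ n)" using Cons.prems by (intro ord_ge_power2) (auto simp: higher_def x)
  then have "ord_ge (Suc n) (y ^ n)" using Cons.prems(2) by (auto intro: ord_ge_mono)
  then show ?case
    using Cons by (auto simp: x alph_Cons higher_def intro!: ord_ge_lin ord_ge_qscale)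
qed

text \<open>Equality of the homogeneous parts of degree k for two series of order at least k; unlike
  a bound on f - g alone, it is compatible with products.\<close>

definition ord_close :: "nat \<Rightarrow> ('m::graded_cmonoid, rat) mseries \<Rightarrow> ('m, rat) mseries \<Rightarrow> bool" where
  "ord_close k f g \<longleftrightarrow> ord_ge k f \<and> ord_ge k g \<and> ord_ge (Suc k) (f - g)"

lemma ord_close_mult:
  assumes "ord_close j f f'" "ord_close k g g'"
  shows "ord_close (j + k) (f * g) (f' * g')"
proof -
  have "f * g - f' * g' = (f - f') * g + f' * (g - g')" by (simp add: algebra_simps)
  moreover have "ord_ge (Suc j + k) ((f - f') * g)" "ord_ge (j + Suc k) (f' * (g - g'))"
    using assms ord_ge_mult[of "Suc j" "f - f'" k g] ord_ge_mult[of j f' "Suc k" "g - g'"]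
    by (auto simp: ord_close_def)
  ultimately show ?thesis using assms by (auto simp: ord_close_def intro: ord_ge_mult ord_ge_lin)
qed

lemma ord_close_1: "ord_close 0 1 1"
  by (simp add: ord_close_def) (simp add: ord_ge_def)

lemma ord_close_prod_mset:
  "(\<And>n. ord_close n (f n) (g n)) \<Longrightarrow> ord_close (\<Sum>\<^sub># M) (\<Prod>n\<in>#M. f n) (\<Prod>n\<in>#M. g n)"
  by (induction M) (simp_all add: ord_close_1 ord_close_mult)

lemma ord_close_prod:
  "(\<And>i. ord_close (d i) (f i) (g i)) \<Longrightarrow> ord_close (sum d A) (prod f A) (prod g A)"
  by (induction A rule: infinite_finite_induct) (simp_all add: ord_close_1 ord_close_mult)

lemma feval_higher:
  assumes L: "good I L" "good I L'" "higher L'"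
  shows "ord_close (weight \<mu>) (feval (L @ L') \<mu>) (feval L \<mu>)"
proof -
  have LL: "good I (L @ L')" using L by (auto simp: good_def)
  let ?g = "\<lambda>L U n. if n = 0 then 0 else alph L U n"
  have "ord_close n (?g (L @ L') U n) (?g L U n)" for U n
    using ord_ge_alph[OF LL, of n U] ord_ge_alph[OF L(1), of n U] ord_ge_alph_higher[OF L(3), of n U]
    by (auto simp: ord_close_def alph_append) (simp add: ord_ge_def)
  then show ?thesis
    unfolding weight_def feval_def by (intro ord_close_prod ord_close_prod_mset)
qed

lemma sfam_higher:
  assumes L: "good I L" "good I L'" "higher L'" and \<nu>: "\<nu> \<in> partition_families I" "weight \<nu> = deg m"
  shows "mcoef (sfam (L @ L') \<nu>) m = mcoef (sfam L \<nu>) m"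
proof -
  have "mcoef (feval (L @ L') \<mu>) m = mcoef (feval L \<mu>) m" if "\<mu> \<in> fclass I \<nu>" for \<mu>
  proof -
    have "ord_ge (Suc (deg m)) (feval (L @ L') \<mu> - feval L \<mu>)"
      using feval_higher[OF L, of \<mu>] that \<nu>(2) by (simp add: ord_close_def fclass_def)
    then show ?thesis by (simp add: ord_ge_def)
  qed
  then show ?thesis by (simp add: sfam_feval[OF \<nu>(1)])
qed

text \<open>Letters of order at least 2 do not change the part of a Schur product whose degree is
  its weight. So the two values differ by an integral combination of Z of weight below deg
  m.\<close>

lemma Ev_higher:
  assumes L: "good I L" "good I L'" "higher L'" and Z: "is_Z I \<omega> Z" and G: "zsubgroup G"
    and mem: "\<And>\<nu>. \<nu> \<in> partition_families I \<Longrightarrow> weight \<nu> < deg m \<Longrightarrow> Z \<nu> \<in> G"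
    and Ev: "Ev (L @ L') \<omega> m \<in> G"
  shows "Ev L \<omega> m \<in> G"
proof -
  have LL: "good I (L @ L')" using L by (auto simp: good_def)
  let ?S = "fst ` set (L @ L')"
  let ?Y = "bounded_families I ?S (deg m)"
  have "Ev (L @ L') \<omega> m - Ev L \<omega> m
      = (\<Sum>\<nu>\<in>?Y. (mcoef (sfam (L @ L') \<nu>) m - mcoef (sfam L \<nu>) m) *\<^sub>Q Z \<nu>)"
  proof -
    have "fst ` set L \<subseteq> ?S" by auto
    then show ?thesis
      using Ev_sfam[OF LL Z, of ?S m] Ev_sfam[OF L(1) Z, of ?S m]
      by (simp add: sum_subtractf qs.scale_left_diff_distrib)
  qed
  also have "\<dots> \<in> G"
  proof (rule zsubgroup_closed(4)[OF G])
    fix \<nu> assume \<nu>: "\<nu> \<in> ?Y"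
    show "(mcoef (sfam (L @ L') \<nu>) m - mcoef (sfam L \<nu>) m) *\<^sub>Q Z \<nu> \<in> G"
    proof (cases "weight \<nu> = deg m")
      case True
      then show ?thesis
        using \<nu> sfam_higher[OF L, of \<nu> m] zsubgroup_closed(1)[OF G] by (simp add: bounded_families_def)
    next
      case False
      have "mcoef (sfam (L @ L') \<nu>) m - mcoef (sfam L \<nu>) m \<in> \<int>"
        using int_series_sfam[OF LL, of \<nu>] int_series_sfam[OF L(1), of \<nu>] by (simp add: int_series_def)
      then show ?thesis
        using \<nu> False by (intro zsubgroup_scale[OF G] mem) (auto simp: bounded_families_def)
    qed
  qed
  finally show ?thesis
    using zsubgroup_closed(2)[OF G Ev, of "Ev (L @ L') \<omega> m - Ev L \<omega> m"] by simp
qed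

lemma keys_subset_singleton_iff:
  "Poly_Mapping.keys m \<subseteq> {U} \<longleftrightarrow> m = Poly_Mapping.single U (Poly_Mapping.lookup m U)"
proof
  assume k: "Poly_Mapping.keys m \<subseteq> {U}"
  show "m = Poly_Mapping.single U (Poly_Mapping.lookup m U)"
  proof (rule poly_mapping_eqI)
    fix V
    have "V \<notin> Poly_Mapping.keys m" if "V \<noteq> U" using k that by auto
    then show "Poly_Mapping.lookup m V
        = Poly_Mapping.lookup (Poly_Mapping.single U (Poly_Mapping.lookup m U)) V"
      by (cases "V = U") (auto simp: lookup_single in_keys_iff)
  qed
next
  assume "m = Poly_Mapping.single U (Poly_Mapping.lookup m U)"
  then have "Poly_Mapping.keys m = Poly_Mapping.keys (Poly_Mapping.single U (Poly_Mapping.lookup m U))"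
    by simp
  then show "Poly_Mapping.keys m \<subseteq> {U}" by (simp split: if_splits)
qed

section \<open>Products of the elements \<open>e\<^sub>r(U)\<close>\<close>

type_synonym 'r monom = "'r \<Rightarrow>\<^sub>0 nat \<Rightarrow>\<^sub>0 nat"

text \<open>Monomials in variables \<open>x\<^bsub>U,i\<^esub>\<close>; a variable is represented by the pair of its indices.\<close>

definition vpow :: "'r \<times> nat \<Rightarrow> nat \<Rightarrow> 'r monom" where
  "vpow v r = Poly_Mapping.single (fst v) (Poly_Mapping.single (snd v) r)"

definition vexp :: "'r \<times> nat \<Rightarrow> 'r monom \<Rightarrow> nat" where
  "vexp v m = Poly_Mapping.lookup (Poly_Mapping.lookup m (fst v)) (snd v)"

definition vser :: "'r \<times> nat \<Rightarrow> ('r monom, rat) mseries" where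
  "vser v = mmono (vpow v 1) 1"

lemma vexp_add: "vexp v (m + n) = vexp v m + vexp v n"
  by (simp add: vexp_def lookup_add)

lemma vexp_0 [simp]: "vexp v 0 = 0"
  by (simp add: vexp_def)

lemma vexp_vpow: "vexp w (vpow v r) = (if w = v then r else 0)"
  by (cases v; cases w) (auto simp: vexp_def vpow_def lookup_single when_def)

lemma monom_eqI: "(\<And>v. vexp v m = vexp v n) \<Longrightarrow> m = n"
  by (intro poly_mapping_eqI) (metis vexp_def fst_conv snd_conv)

lemma vser_power: "vser v ^ n = mmono (vpow v n) 1"
proof (induction n)
  case 0
  have "vpow v 0 = 0" by (rule monom_eqI) (simp add: vexp_vpow)
  then show ?case by (simp add: mono_0_1)
next
  case (Suc n)
  have "vpow v 1 + vpow v n = vpow v (Suc n)" by (rule monom_eqI) (simp add: vexp_vpow vexp_add)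
  then show ?case using Suc by (simp add: vser_def mono_mult)
qed

lemma no_const_vser: "no_const (vser v)"
proof -
  have "vpow v 1 \<noteq> 0" using vexp_vpow[of v v 1] by auto
  then show ?thesis by (simp add: no_const_def vser_def mcoef_mono)
qed

lemma no_const_uminus: "no_const f \<Longrightarrow> no_const (- f)"
  for f :: "('m::graded_cmonoid, 'a::ab_group_add) mseries"
  by (simp add: no_const_def)

section \<open>Series free of a given variable\<close>

definition avoids :: "'r \<times> nat \<Rightarrow> ('r monom, 'a::zero) mseries \<Rightarrow> bool" where
  "avoids v f \<longleftrightarrow> (\<forall>m. vexp v m \<noteq> 0 \<longrightarrow> mcoef f m = 0)"

lemma avoids_iff: "avoids v f \<longleftrightarrow> mrestrict {m. vexp v m = 0} f = f"
proof
  assume "avoids v f"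
  then show "mrestrict {m. vexp v m = 0} f = f"
    by (intro mseries_eqI) (simp add: avoids_def mcoef_mrestrict)
next
  assume r: "mrestrict {m. vexp v m = 0} f = f"
  show "avoids v f" unfolding avoids_def
  proof (intro allI impI)
    fix m assume "vexp v m \<noteq> 0"
    then have "mcoef (mrestrict {m. vexp v m = 0} f) m = 0" by (simp add: mcoef_mrestrict)
    then show "mcoef f m = 0" by (simp only: r)
  qed
qed

lemma face_vexp: "face {m. vexp v m = 0}"
  by (simp add: face_def vexp_add)

lemma avoids_1: "avoids v (1 :: ('r monom, 'a::{ring, monoid_mult}) mseries)"
  by (auto simp: avoids_def mcoef_one)

lemma avoids_mult: "avoids v f \<Longrightarrow> avoids v g \<Longrightarrow> avoids v (f * (g :: ('r monom, 'a::ring) mseries))"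
  by (simp add: avoids_iff mrestrict_mult[OF face_vexp])

lemma avoids_power: "avoids v f \<Longrightarrow> avoids v (f ^ n)"
  for f :: "('r monom, 'a::{ring, monoid_mult}) mseries"
  by (induction n) (auto intro: avoids_1 avoids_mult)

lemma avoids_add: "avoids v f \<Longrightarrow> avoids v g \<Longrightarrow> avoids v (f + g)"
  for f :: "('r monom, 'a::ab_group_add) mseries"
  by (simp add: avoids_def)

lemma avoids_uminus: "avoids v f \<Longrightarrow> avoids v (- f)"
  for f :: "('r monom, 'a::ab_group_add) mseries"
  by (simp add: avoids_def)

lemma avoids_vser: "v \<noteq> w \<Longrightarrow> avoids v (vser w)"
  by (auto simp: avoids_def vser_def mcoef_mono vexp_vpow)

lemma avoids_gprod:
  assumes "\<And>l. 1 \<le> l \<Longrightarrow> avoids v (c l)"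
  shows "avoids v (gprod c n)"
proof (induction n)
  case (Suc n)
  have "avoids v (gexp (T (Suc n)) (c (Suc n)))"
    using assms[of "Suc n"] by (simp add: avoids_iff mrestrict_gexp[OF face_vexp lie_map_T])
  then show ?case using Suc by (simp add: avoids_mult)
qed (simp add: avoids_1)

lemma avoids_cser: "(\<And>W c y. (W, c, y) \<in> set L \<Longrightarrow> avoids v y) \<Longrightarrow> avoids v (cser L l)"
proof (induction L)
  case (Cons x L)
  obtain W c y where x: "x = (W, c, y)" by (cases x)
  have "avoids v y" by (rule Cons.prems[of W c]) (simp add: x)
  then have "avoids v (y ^ l)" by (rule avoids_power)
  then have "avoids v (tens (of_int c *\<^sub>Q y ^ l) W)" by (simp add: avoids_def mcoef_tens)
  moreover have "avoids v (cser L l)"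
  proof (rule Cons.IH)
    fix W c y assume "(W, c, y) \<in> set L"
    then show "avoids v y" by (intro Cons.prems[of W c y]) simp
  qed
  ultimately show ?case by (simp add: x cser_simps avoids_add)
qed (simp add: cser_simps avoids_def)

text \<open>Multiplicity -1 singles out columns, and the second sign makes the coefficient of x^r
  come out without a sign. In all, p_n becomes (-1)^(n-1) x^n, as under the involution.\<close>

definition neg_letter :: "'r \<times> nat \<Rightarrow> 'r \<times> int \<times> ('r monom, rat) mseries" where
  "neg_letter v = (fst v, - 1, - vser v)"

lemma good_append: "good I (L @ L') \<longleftrightarrow> good I L \<and> good I L'"
  by (simp only: good_def set_append ball_Un)

lemma good_neg: "fst ` set vs \<subseteq> I \<Longrightarrow> good I (map neg_letter vs)"
  by (auto simp: good_def neg_letter_def vser_def[symmetric] int_series_closed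
      no_const_uminus no_const_vser) (simp add: vser_def int_series_mono int_series_closed)

text \<open>This is where integrality of multiplication in the basis I enters: products of basis
  elements are integral combinations of basis elements, so new letters again have integer
  multiplicities.\<close>

lemma basis_expansion:
  assumes "is_Z_basis I"
  shows "\<exists>ts. (\<forall>(N, V)\<in>set ts. V \<in> I) \<and> (1 :: rat) \<otimes>\<^sub>Q r = (\<Sum>(N, V)\<leftarrow>ts. of_int N *\<^sub>Q (1 \<otimes>\<^sub>Q V))"
proof -
  have "r \<in> zmod.span I" using assms by (simp add: is_Z_basis_def)
  then show ?thesis
  proof (induction rule: zmod.span_induct_alt)
    case base
    have "(1 :: rat) \<otimes>\<^sub>Q (0 :: 'a) = 0" using qtens_zscale[of 0 "0 :: 'a"] by (simp add: zscale_0)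
    then show ?case by (intro exI[of _ "[]"]) simp
  next
    case (step N V y)
    then obtain ts where ts: "\<forall>(N, V)\<in>set ts. V \<in> I" "(1 :: rat) \<otimes>\<^sub>Q y = (\<Sum>(N, V)\<leftarrow>ts. of_int N *\<^sub>Q (1 \<otimes>\<^sub>Q V))"
      by blast
    show ?case
      using step ts by (intro exI[of _ "(N, V) # ts"]) (simp add: qtens_add_right qtens_zscale)
  qed
qed

lemma tens_expand:
  assumes "(1 :: rat) \<otimes>\<^sub>Q r = (\<Sum>(N, V)\<leftarrow>ts. of_int N *\<^sub>Q (1 \<otimes>\<^sub>Q V))"
  shows "tens f r = (\<Sum>(N, V)\<leftarrow>ts. tens (of_int N *\<^sub>Q f) V)"
proof (rule mseries_eqI)
  fix m
  have "q *\<^sub>Q (\<Sum>(N, V)\<leftarrow>ts. of_int N *\<^sub>Q (1 \<otimes>\<^sub>Q V)) = mcoef (\<Sum>(N, V)\<leftarrow>ts. tens (of_int N *\<^sub>Q f) V) m"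
    if "q = mcoef f m" for q
    using that by (induction ts) (auto simp: mcoef_tens qscale_add_right qscale_qscale qscale_rat_def mult.commute)
  then show "mcoef (tens f r) m = mcoef (\<Sum>(N, V)\<leftarrow>ts. tens (of_int N *\<^sub>Q f) V) m"
    by (simp add: mcoef_tens assms)
qed

text \<open>The letters produced by multiplying out \<open>(1 - x U) (1 + \<Sum> c y W)\<close> (up to signs).\<close>

lemma cser_product:
  assumes bx: "\<And>r. (1 :: rat) \<otimes>\<^sub>Q r = (\<Sum>(N, V)\<leftarrow>bx r. of_int N *\<^sub>Q (1 \<otimes>\<^sub>Q V))"
  shows "cser [neg_letter v] l * cser K l
    = cser (concat (map (\<lambda>(W, c, y). map (\<lambda>(N, V). (V, - (c * N), - vser v * y)) (bx (fst v * W))) K)) l"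
proof (induction K)
  case Nil
  show ?case by (simp add: cser_simps)
next
  case (Cons k K)
  obtain W c y where k: "k = (W, c, y)" by (cases k)
  let ?x = "- vser v"
  \<comment> \<open>Since x^l y^l = (x y)^l, two letters multiply to the l-th power of a letter
    independent of l; only the product in R remains to be expanded in I.\<close>
  have "tens (of_int (- 1) *\<^sub>Q ?x ^ l) (fst v) * tens (of_int c *\<^sub>Q y ^ l) W
      = tens (of_int (- c) *\<^sub>Q (?x * y) ^ l) (fst v * W)"
    by (simp only: tens_mult qscale_mult_left qscale_mult_right qscale_qscale power_mult_distrib) simp
  also have "\<dots> = (\<Sum>(N, V)\<leftarrow>bx (fst v * W). tens (of_int N *\<^sub>Q of_int (- c) *\<^sub>Q (?x * y) ^ l) V)"
    by (rule tens_expand[OF bx])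
  also have "\<dots> = cser (map (\<lambda>(N, V). (V, - (c * N), ?x * y)) (bx (fst v * W))) l"
    by (simp add: cser_def o_def split_def qscale_qscale mult.commute)
  finally show ?case
    using Cons by (simp add: k cser_simps distrib_left neg_letter_def)
qed

text \<open>Factors are added one at a time. The letters collected so far avoid the new variable, as
  the product rule demands; the cross terms are products of two letters without constant term, hence
  of order at least 2.\<close>

lemma product_letters:
  assumes I: "is_Z_basis I" and vs: "distinct vs" "fst ` set vs \<subseteq> I"
  shows "\<exists>L'. good I L' \<and> higher L' \<and> (\<forall>W c y v. (W, c, y) \<in> set L' \<longrightarrow> v \<notin> set vs \<longrightarrow> avoids v y) \<and>
    (\<forall>n. gprod (cser (map neg_letter vs @ L')) n = prod_list (map (\<lambda>v. gprod (cser [neg_letter v]) n) vs))"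
  using vs
proof (induction vs)
  case Nil
  have "gprod (cser ([] :: ('a, 'a monom) letters)) n = 1" for n
    by (induction n) (simp_all add: cser_simps gexp_0 lie_map_T)
  then show ?case by (intro exI[of _ "[]"]) (simp add: good_def higher_def)
next
  case (Cons v vs)
  obtain L' where L': "good I L'" "higher L'" "\<And>W c y v. (W, c, y) \<in> set L' \<Longrightarrow> v \<notin> set vs \<Longrightarrow> avoids v y"
    "\<And>n. gprod (cser (map neg_letter vs @ L')) n = prod_list (map (\<lambda>v. gprod (cser [neg_letter v]) n) vs)"
    using Cons by auto
  obtain bx where bx: "\<And>r. \<forall>(N, V)\<in>set (bx r). V \<in> I"
      "\<And>r. (1 :: rat) \<otimes>\<^sub>Q r = (\<Sum>(N, V)\<leftarrow>bx r. of_int N *\<^sub>Q (1 \<otimes>\<^sub>Q V))"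
    using basis_expansion[OF I] by metis
  let ?K = "map neg_letter vs @ L'"
  let ?new = "concat (map (\<lambda>(W, c, y). map (\<lambda>(N, V). (V, - (c * N), - vser v * y)) (bx (fst v * W))) ?K)"
  have K: "good I ?K" using L'(1) Cons.prems by (simp add: good_append good_neg)
  have v: "good I [neg_letter v]" using Cons.prems good_neg[of "[v]" I] by simp
  have avK: "avoids w y" if K: "(W, c, y) \<in> set ?K" and w: "w \<notin> set vs" for W c y w
  proof (cases "(W, c, y) \<in> set L'")
    case True
    then show ?thesis using w by (rule L'(3))
  next
    case False
    then obtain u where "u \<in> set vs" "y = - vser u" using K by (auto simp: neg_letter_def)
    then show ?thesis using w by (auto intro!: avoids_uminus avoids_vser)
  qed
  have Ky: "int_series y \<and> no_const y" if "(W, c, y) \<in> set ?K" for W c y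
    using K that by (auto simp only: good_def)
  have new: "V \<in> I \<and> (\<exists>W c y. (W, c, y) \<in> set ?K \<and> z = - vser v * y)" if "(V, k, z) \<in> set ?new" for V k z
    using that bx(1) by (auto simp only: set_concat set_map) (auto split: prod.splits)
  have good_new: "good I ?new"
    unfolding good_def
  proof clarify
    fix V k z assume "(V, k, z) \<in> set ?new"
    from new[OF this] obtain W c y where *: "V \<in> I" "(W, c, y) \<in> set ?K" "z = - vser v * y" by blast
    have "int_series z"
      unfolding *(3) using Ky[OF *(2)] by (intro int_series_closed) (auto simp: vser_def int_series_mono)
    moreover have "no_const z"
      unfolding *(3) no_const_def mcoef_times decomp_0 using Ky[OF *(2)] by (simp add: no_const_def)
    ultimately show "V \<in> I \<and> int_series z \<and> no_const z" using *(1) by blast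
  qed
  have higher_new: "higher ?new"
    unfolding higher_def
  proof clarify
    fix V k z assume "(V, k, z) \<in> set ?new"
    from new[OF this] obtain W c y where *: "(W, c, y) \<in> set ?K" "z = - vser v * y" by blast
    have "ord_ge (1 + 1) (- vser v * y)"
      using Ky[OF *(1)] no_const_uminus[OF no_const_vser[of v]]
      by (intro ord_ge_mult) (simp_all only: no_const_iff_ord_ge[symmetric])
    then show "ord_ge 2 z" unfolding *(2) one_add_one .
  qed
  have av_new: "avoids w z" if "(V, k, z) \<in> set ?new" "w \<notin> set (v # vs)" for V k z w
  proof -
    from new[OF that(1)] obtain W c y where *: "(W, c, y) \<in> set ?K" "z = - vser v * y" by blast
    show ?thesis
      unfolding *(2) using that(2) avK[OF *(1), of w]
      by (intro avoids_mult avoids_uminus avoids_vser) auto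
  qed
  have "gprod (cser [neg_letter v]) n * gprod (cser ?K) n = gprod (cser (map neg_letter (v # vs) @ (L' @ ?new))) n" for n
  proof (rule gprod_mult)
    fix l :: nat assume l: "1 \<le> l"
    show "no_const (cser [neg_letter v] l)" "no_const (cser ?K l)"
      using l v K by (simp_all only: no_const_cser)
    have "gexp (T l) (cser [neg_letter v] l) * gexp (T l) (cser ?K l)
        = gexp (T l) (cser [neg_letter v] l + cser ?K l + cser [neg_letter v] l * cser ?K l)"
    \<comment> \<open>The exponent of v separates the factors: every term of the first contains v,
      no term of the second does.\<close>
    proof (rule gexp_mult[where \<chi> = "vexp v"])
      show "lie_map (T l)" using l by (rule lie_map_T)
      show "no_const (cser ?K l)" using K l by (rule no_const_cser)
      have pow: "mcoef ((- vser v) ^ l) m = 0" if "m \<noteq> vpow v l" for m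
      proof -
        have "(- vser v) ^ l = vser v ^ l \<or> (- vser v) ^ l = - (vser v ^ l)"
          by (cases "even l") auto
        then show ?thesis using that by (auto simp: vser_power mcoef_mono)
      qed
      show "mcoef (cser [neg_letter v] l) m = 0" if "vexp v m = 0" for m
      proof -
        have "m \<noteq> vpow v l" using that l by (auto simp: vexp_vpow)
        then show ?thesis by (simp add: cser_simps neg_letter_def mcoef_tens pow)
      qed
      have "avoids v (cser ?K l)"
        by (rule avoids_cser) (use avK Cons.prems in auto)
      then show "mcoef (cser ?K l) m = 0" if "vexp v m \<noteq> 0" for m using that by (simp add: avoids_def)
    qed (rule vexp_add)
    also have "cser [neg_letter v] l + cser ?K l + cser [neg_letter v] l * cser ?K l
        = cser (map neg_letter (v # vs) @ (L' @ ?new)) l"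
      unfolding cser_product[OF bx(2)] cser_simps(3)[symmetric] by simp
    finally show "gexp (T l) (cser [neg_letter v] l) * gexp (T l) (cser ?K l)
        = gexp (T l) (cser (map neg_letter (v # vs) @ (L' @ ?new)) l)" .
  qed
  then have "\<forall>n. gprod (cser (map neg_letter (v # vs) @ (L' @ ?new))) n
      = prod_list (map (\<lambda>v. gprod (cser [neg_letter v]) n) (v # vs))"
    by (simp only: L'(4) list.map prod_list.Cons) simp
  moreover have "good I (L' @ ?new)" using L'(1) good_new by (simp only: good_append)
  moreover have "higher (L' @ ?new)" using L'(2) higher_new by (auto simp only: higher_def set_append)
  moreover have "\<forall>W c y w. (W, c, y) \<in> set (L' @ ?new) \<longrightarrow> w \<notin> set (v # vs) \<longrightarrow> avoids w y"
  proof (intro allI impI)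
    fix W c y w assume W: "(W, c, y) \<in> set (L' @ ?new)" and w: "w \<notin> set (v # vs)"
    show "avoids w y"
    proof (cases "(W, c, y) \<in> set L'")
      case True
      then show ?thesis by (rule L'(3)) (use w in simp)
    next
      case False
      with W have "(W, c, y) \<in> set ?new" unfolding set_append Un_iff by blast
      then show ?thesis using w by (rule av_new)
    qed
  qed
  ultimately show ?case by blast
qed

text \<open>Written in Schur functions, the value at this alphabet retains, among the nonempty
  families, only the columns at U, and the column of length r takes the value x^r.\<close>

lemma mcoef_neg_letter:
  assumes v: "fst v \<in> I" and r: "0 < r" and n: "r \<le> n"
  shows "mcoef (gprod (cser [neg_letter v]) n) (vpow v r) = e_elt I r (fst v)"
proof -
  let ?L = "[neg_letter v]" and ?U = "fst v" and ?m = "vpow v r"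
  let ?\<nu> = "Poly_Mapping.single ?U (replicate_mset r (1::nat))"
  have L: "good I ?L" using good_neg[of "[v]" I] v by simp
  have deg: "deg ?m = r" by (simp add: vpow_def deg_single deg_nat_def)
  have alph: "alph ?L V k = (if V = ?U then - ((- vser v) ^ k) else 0)" for V k
    by (simp add: neg_letter_def alph_Cons qscale_one)
  have \<nu>: "?\<nu> \<in> partition_families I" "weight ?\<nu> = r"
  proof -
    have "is_partition (entry ?\<nu> V)" for V by (auto simp: is_partition_def lookup_single when_def)
    then show "?\<nu> \<in> partition_families I" using v by (intro familyI) auto
    show "weight ?\<nu> = r" using r by (simp add: weight_def)
  qed
  have sf: "mcoef (sfam ?L \<nu>) ?m = (if \<nu> = ?\<nu> then 1 else 0)" if PF: "\<nu> \<in> partition_families I" for \<nu>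
  proof (cases "Poly_Mapping.keys \<nu> = {?U}")
    case True
    then have eq: "\<nu> = Poly_Mapping.single ?U (entry \<nu> ?U)"
      by (simp only: keys_subset_singleton_iff[symmetric] order_refl)
    have "alph ?L ?U = (\<lambda>k. - ((- vser v) ^ k))" by (rule ext) (simp add: alph)
    then have "sfam ?L \<nu> = schur_at (entry \<nu> ?U) (\<lambda>k. - ((- vser v) ^ k))"
      by (simp only: sfam_def True) simp
    also have "\<dots> = (if entry \<nu> ?U = replicate_mset (size (entry \<nu> ?U)) 1 then mmono (vpow v (size (entry \<nu> ?U))) 1 else 0)"
      by (subst schur_at_minus_one[OF no_const_uminus[OF no_const_vser] family_partition[OF PF]]) (simp add: vser_power)
    also have "mcoef \<dots> ?m = (if entry \<nu> ?U = replicate_mset r 1 then 1 else 0)"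
    proof -
      have "vpow v r = vpow v k \<longleftrightarrow> r = k" for k by (metis vexp_vpow)
      then show ?thesis by (auto simp: mcoef_mono)
    qed
    finally have "mcoef (sfam ?L \<nu>) ?m = (if entry \<nu> ?U = replicate_mset r 1 then 1 else 0)" .
    moreover have "entry \<nu> ?U = replicate_mset r 1 \<longleftrightarrow> \<nu> = ?\<nu>"
      using eq by (metis lookup_single_eq)
    ultimately show ?thesis by simp
  next
    case False
    have ne: "\<nu> \<noteq> ?\<nu>" using False r by auto
    have "mcoef (sfam ?L \<nu>) ?m = 0"
    proof (cases "\<nu> = 0")
      case True
      have "?m \<noteq> 0" using vexp_vpow[of v v r] r by auto
      then show ?thesis by (simp add: True sfam_def mcoef_one)
    next
      case False
      then obtain V where V: "V \<in> Poly_Mapping.keys \<nu>" "V \<noteq> ?U"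
        using \<open>Poly_Mapping.keys \<nu> \<noteq> {?U}\<close> by (metis keys_eq_empty subset_singleton_iff subsetI singletonI)
      have "schur_at (entry \<nu> V) (alph ?L V) = schur_at (entry \<nu> V) (\<lambda>_. 0)"
        using V(2) by (simp add: alph[abs_def])
      also have "\<dots> = 0"
        using V(1) schur_at_zero[OF family_partition[OF PF, of V]] by (simp add: in_keys_iff)
      finally have "sfam ?L \<nu> = 0"
        unfolding sfam_def by (intro prod_zero[OF finite_keys] bexI[OF _ V(1)])
      then show ?thesis by simp
    qed
    then show ?thesis using ne by simp
  qed
  have "mcoef (gprod (cser ?L) n) ?m = Ev ?L (generating_product I) ?m"
    by (rule Ev_gprod[OF L]) (simp add: deg n)
  also have "\<dots> = (\<Sum>\<nu>\<in>bounded_families I {?U} (deg ?m). mcoef (sfam ?L \<nu>) ?m *\<^sub>Q Z_elt I \<nu>)"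
    by (rule Ev_sfam[OF L is_Z_Z_elt]) (auto simp: neg_letter_def)
  also have "\<dots> = (\<Sum>\<nu>\<in>{?\<nu>}. Z_elt I \<nu>)"
  proof (rule sum.mono_neutral_cong_right)
    show "finite (bounded_families I {?U} (deg ?m))" unfolding bounded_families_def by (intro finite_families) simp
    show "{?\<nu>} \<subseteq> bounded_families I {?U} (deg ?m)" using \<nu> by (auto simp: bounded_families_def deg)
    show "\<forall>\<nu>\<in>bounded_families I {?U} (deg ?m) - {?\<nu>}. mcoef (sfam ?L \<nu>) ?m *\<^sub>Q Z_elt I \<nu> = 0"
    proof
      fix \<mu> assume "\<mu> \<in> bounded_families I {?U} (deg ?m) - {?\<nu>}"
      then have "\<mu> \<in> partition_families I" "\<mu> \<noteq> ?\<nu>" unfolding bounded_families_def by blast+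
      then show "mcoef (sfam ?L \<mu>) ?m *\<^sub>Q Z_elt I \<mu> = 0" by (simp only: sf if_False qs.scale_zero_left)
    qed
    show "mcoef (sfam ?L \<mu>) ?m *\<^sub>Q Z_elt I \<mu> = Z_elt I \<mu>" if "\<mu> \<in> {?\<nu>}" for \<mu>
      using that \<nu>(1) by (simp only: singleton_iff sf if_True qscale_one refl)
  qed
  finally show ?thesis by (simp add: e_elt_def)
qed

text \<open>Terms of f are powers of v and terms of g are free of v, so only one splitting of the
  monomial contributes.\<close>

lemma mcoef_avoiding_mult:
  fixes f g :: "('r monom, 'a::ring) mseries"
  assumes f: "\<And>w. w \<noteq> v \<Longrightarrow> avoids w f" and g: "avoids v g" and m: "vexp v m = 0"
  shows "mcoef (f * g) (vpow v r + m) = mcoef f (vpow v r) * mcoef g m"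
proof -
  have "mcoef (f * g) (vpow v r + m) = (\<Sum>(a, b)\<in>{(vpow v r, m)}. mcoef f a * mcoef g b)"
    unfolding mcoef_times
  proof (rule sum.mono_neutral_right)
    show "{(vpow v r, m)} \<subseteq> decomp (vpow v r + m)" by (simp add: in_decomp_iff)
    show "\<forall>x\<in>decomp (vpow v r + m) - {(vpow v r, m)}. (case x of (a, b) \<Rightarrow> mcoef f a * mcoef g b) = 0"
    proof
      fix x assume x: "x \<in> decomp (vpow v r + m) - {(vpow v r, m)}"
      obtain a b where ab: "x = (a, b)" by (cases x)
      have sum: "a + b = vpow v r + m" using x by (simp add: ab in_decomp_iff)
      have "mcoef f a = 0 \<or> mcoef g b = 0"
      proof (rule ccontr)
        assume nz: "\<not> (mcoef f a = 0 \<or> mcoef g b = 0)"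
        have "vexp w a = 0" if "w \<noteq> v" for w using f[OF that] nz by (auto simp: avoids_def)
        moreover have "vexp v b = 0" using g nz by (auto simp: avoids_def)
        then have "vexp v a = r"
          using arg_cong[OF sum, of "vexp v"] m by (simp add: vexp_add vexp_vpow)
        ultimately have "a = vpow v r" by (intro monom_eqI) (auto simp: vexp_vpow)
        with sum have "b = m" by simp
        with \<open>a = vpow v r\<close> x show False by (simp add: ab)
      qed
      then show "(case x of (a, b) \<Rightarrow> mcoef f a * mcoef g b) = 0" by (auto simp: ab)
    qed
  qed simp
  then show ?thesis by simp
qed

lemma mcoef_prod_neg:
  assumes "distinct vs" "fst ` set vs \<subseteq> I" "\<And>v. v \<in> set vs \<Longrightarrow> 0 < r v"
    "deg (\<Sum>v\<leftarrow>vs. vpow v (r v)) \<le> n"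
  shows "mcoef (prod_list (map (\<lambda>v. gprod (cser [neg_letter v]) n) vs)) (\<Sum>v\<leftarrow>vs. vpow v (r v))
    = prod_list (map (\<lambda>v. e_elt I (r v) (fst v)) vs)"
  using assms
proof (induction vs)
  case Nil
  then show ?case by (simp add: mcoef_one)
next
  case (Cons v vs)
  let ?E = "\<lambda>v. gprod (cser [neg_letter v]) n"
  have av: "avoids w (?E u)" if "w \<noteq> u" for w u
    by (rule avoids_gprod, rule avoids_cser) (use that in \<open>auto simp: neg_letter_def intro!: avoids_uminus avoids_vser\<close>)
  have g: "avoids v (prod_list (map ?E us))" if "v \<notin> set us" for us
    using that by (induction us) (auto intro!: avoids_mult avoids_1 av)
  have m: "vexp v (\<Sum>v\<leftarrow>us. vpow v (r v)) = 0" if "v \<notin> set us" for us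
    using that by (induction us) (auto simp: vexp_add vexp_vpow)
  have d: "r v \<le> n" "deg (\<Sum>v\<leftarrow>vs. vpow v (r v)) \<le> n"
    using Cons.prems(4) by (auto simp: deg_add vpow_def deg_single deg_nat_def)
  have "mcoef (?E v * prod_list (map ?E vs)) (vpow v (r v) + (\<Sum>v\<leftarrow>vs. vpow v (r v)))
      = mcoef (?E v) (vpow v (r v)) * mcoef (prod_list (map ?E vs)) (\<Sum>v\<leftarrow>vs. vpow v (r v))"
  proof (rule mcoef_avoiding_mult)
    show "avoids w (?E v)" if "w \<noteq> v" for w using that by (rule av)
    show "avoids v (prod_list (map ?E vs))" "vexp v (\<Sum>v\<leftarrow>vs. vpow v (r v)) = 0"
      using Cons.prems(1) by (simp_all add: g m)
  qed
  then show ?case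
    using Cons d by (simp add: mcoef_neg_letter[of v I])
qed

lemma prod_e_eq_Ev:
  assumes "is_Z_basis I" "distinct vs" "fst ` set vs \<subseteq> I" "\<And>v. v \<in> set vs \<Longrightarrow> 0 < r v"
  shows "\<exists>L'. good I L' \<and> higher L' \<and> prod_list (map (\<lambda>v. e_elt I (r v) (fst v)) vs)
    = Ev (map neg_letter vs @ L') (generating_product I) (\<Sum>v\<leftarrow>vs. vpow v (r v))"
proof -
  let ?m = "\<Sum>v\<leftarrow>vs. vpow v (r v)"
  obtain L' where L': "good I L'" "higher L'"
    "\<And>n. gprod (cser (map neg_letter vs @ L')) n = prod_list (map (\<lambda>v. gprod (cser [neg_letter v]) n) vs)"
    using product_letters[OF assms(1-3)] by blast
  have "good I (map neg_letter vs @ L')" using L'(1) assms(3) by (simp add: good_append good_neg)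
  then have "Ev (map neg_letter vs @ L') (generating_product I) ?m
      = mcoef (gprod (cser (map neg_letter vs @ L')) (deg ?m)) ?m"
    by (rule Ev_gprod[symmetric]) simp
  also have "\<dots> = prod_list (map (\<lambda>v. e_elt I (r v) (fst v)) vs)"
    unfolding L'(3) using assms by (intro mcoef_prod_neg) auto
  finally have "prod_list (map (\<lambda>v. e_elt I (r v) (fst v)) vs)
    = Ev (map neg_letter vs @ L') (generating_product I) ?m" ..
  with L'(1,2) show ?thesis by blast
qed

section \<open>The generation theorem\<close>

subsection \<open>Coefficients at the generic alphabet\<close>

lemma msubst_single: "msubst (\<lambda>\<beta>. mmono (Poly_Mapping.single U \<beta>) (1::rat) :: ('r monom, rat) mseries)"
proof
  have lookup: "\<beta> = Poly_Mapping.lookup m U" if "mcoef (mmono (Poly_Mapping.single U \<beta>) (1::rat)) m \<noteq> 0"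
    for \<beta> and m :: "'r monom"
    using that by (auto simp: mcoef_mono split: if_splits)
  show "finite {\<beta>. mcoef (mmono (Poly_Mapping.single U \<beta>) (1::rat)) m \<noteq> 0}" for m :: "'r monom"
    by (rule finite_subset[of _ "{Poly_Mapping.lookup m U}"]) (use lookup in auto)
  show "deg \<beta> \<le> deg m" if "mcoef (mmono (Poly_Mapping.single U \<beta>) (1::rat)) m \<noteq> 0" for \<beta> and m :: "'r monom"
    using that by (auto simp: mcoef_mono deg_single split: if_splits)
qed (simp_all add: mono_0_1 mono_mult single_add)

definition embed :: "'r \<Rightarrow> polynomial \<Rightarrow> ('r monom, rat) mseries" where
  "embed U P = msubst.sub (\<lambda>\<beta>. mmono (Poly_Mapping.single U \<beta>) 1) (pser P)"

lemma mcoef_embed: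
  "mcoef (embed U P) m = (if Poly_Mapping.keys m \<subseteq> {U} then Poly_Mapping.lookup P (Poly_Mapping.lookup m U) else 0)"
proof -
  interpret msubst "\<lambda>\<beta>. mmono (Poly_Mapping.single U \<beta>) 1 :: ('a monom, rat) mseries" by (rule msubst_single)
  have "supp m \<subseteq> {Poly_Mapping.lookup m U}" by (auto simp: supp_def mcoef_mono split: if_splits)
  then have "mcoef (sub (pser P)) m = (\<Sum>\<beta>\<in>{Poly_Mapping.lookup m U}.
      mcoef (mmono (Poly_Mapping.single U \<beta>) 1) m *\<^sub>Q mcoef (pser P) \<beta>)"
    by (intro mcoef_sub) auto
  then show ?thesis
    using keys_subset_singleton_iff[of m U] by (auto simp: embed_def mcoef_mono qscale_rat_def)
qed

lemma embed_power_sum: "embed U (power_sum M N) = (\<Prod>n\<in>#M. \<Sum>i<N. vser (U, i) ^ n)"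
proof -
  interpret msubst "\<lambda>\<beta>. mmono (Poly_Mapping.single U \<beta>) 1 :: ('a monom, rat) mseries" by (rule msubst_single)
  have "sub 0 = (0 :: ('a monom, rat) mseries)" using sub_lin(2)[of 0 0] by simp
  then have sum: "sub (sum f A) = (\<Sum>x\<in>A. sub (f x))" for f :: "'i \<Rightarrow> (nat \<Rightarrow>\<^sub>0 nat, rat) mseries" and A
    by (induction A rule: infinite_finite_induct) (auto simp: sub_lin)
  have indet: "embed U (indet i) = vser (U, i)" for i
  proof (rule mseries_eqI)
    fix m
    have "mcoef (vser (U, i)) m = (if m = Poly_Mapping.single U (Poly_Mapping.single i 1) then 1 else 0)"
      by (simp add: vser_def vpow_def mcoef_mono)
    moreover have "m = Poly_Mapping.single U (Poly_Mapping.single i 1) \<longleftrightarrow>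
        Poly_Mapping.keys m \<subseteq> {U} \<and> Poly_Mapping.lookup m U = Poly_Mapping.single i 1"
      using keys_subset_singleton_iff[of m U] by auto
    ultimately show "mcoef (embed U (indet i)) m = mcoef (vser (U, i)) m"
      by (auto simp: mcoef_embed indet_def lookup_single when_def)
  qed
  have pow: "pser (indet i ^ n) = pser (indet i) ^ n" for i n
    by (induction n) (auto simp: pser_1 pser_mult)
  show ?thesis
  proof (induction M)
    case (add n M)
    have "power_sum (add_mset n M) N = (\<Sum>i<N. indet i ^ n) * power_sum M N" by (simp add: power_sum_def)
    then show ?case using add indet
      by (simp add: embed_def pser_mult sub_mult pser_sum sum pow sub_power)
  qed (simp add: power_sum_def embed_def pser_1 sub_1)
qed

text \<open>Different U use disjoint blocks of variables, so a monomial splits uniquely and the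
  coefficients multiply.\<close>

lemma mcoef_prod_embed:
  assumes "finite S"
  shows "mcoef (\<Prod>U\<in>S. embed U (P U)) m
    = (if Poly_Mapping.keys m \<subseteq> S then \<Prod>U\<in>S. Poly_Mapping.lookup (P U) (Poly_Mapping.lookup m U) else 0)"
  using assms
proof (induction S arbitrary: m rule: finite_induct)
  case empty
  then show ?case by (simp add: mcoef_one)
next
  case (insert U S)
  let ?G = "\<Prod>U\<in>S. embed U (P U)"
  let ?a = "Poly_Mapping.single U (Poly_Mapping.lookup m U)"
  have am: "m = ?a + (m - ?a)" "Poly_Mapping.lookup (m - ?a) V = (if V = U then 0 else Poly_Mapping.lookup m V)" for V
    by (auto intro!: poly_mapping_eqI simp: lookup_add lookup_minus lookup_single when_def)
  have "mcoef (embed U (P U) * ?G) m = (\<Sum>(a, b)\<in>{(?a, m - ?a)}. mcoef (embed U (P U)) a * mcoef ?G b)"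
    unfolding mcoef_times
  proof (rule sum.mono_neutral_right)
    show "{(?a, m - ?a)} \<subseteq> decomp m" using am(1) by (simp add: in_decomp_iff)
    show "\<forall>x\<in>decomp m - {(?a, m - ?a)}. (case x of (a, b) \<Rightarrow> mcoef (embed U (P U)) a * mcoef ?G b) = 0"
    proof
      fix x assume x: "x \<in> decomp m - {(?a, m - ?a)}"
      obtain a b where ab: "x = (a, b)" by (cases x)
      have m: "m = a + b" using x by (simp add: ab in_decomp_iff)
      have "\<not> (Poly_Mapping.keys a \<subseteq> {U} \<and> Poly_Mapping.keys b \<subseteq> S)"
      proof
        assume k: "Poly_Mapping.keys a \<subseteq> {U} \<and> Poly_Mapping.keys b \<subseteq> S"
        then have "U \<notin> Poly_Mapping.keys b" using insert by auto
        then have "Poly_Mapping.lookup m U = Poly_Mapping.lookup a U" by (simp add: m lookup_add in_keys_iff)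
        moreover have "a = Poly_Mapping.single U (Poly_Mapping.lookup a U)"
          using k by (simp only: keys_subset_singleton_iff)
        ultimately have "a = ?a" by simp
        then have "b = m - ?a" using m by (metis add_diff_cancel_left')
        with \<open>a = ?a\<close> x show False by (simp add: ab)
      qed
      then show "(case x of (a, b) \<Rightarrow> mcoef (embed U (P U)) a * mcoef ?G b) = 0"
        by (auto simp: ab insert.IH mcoef_embed)
    qed
  qed simp
  also have "\<dots> = (if Poly_Mapping.keys m \<subseteq> insert U S
      then \<Prod>U\<in>insert U S. Poly_Mapping.lookup (P U) (Poly_Mapping.lookup m U) else 0)"
  proof -
    have "Poly_Mapping.keys (m - ?a) = Poly_Mapping.keys m - {U}" by (auto simp: in_keys_iff am(2) split: if_splits)
    moreover have "(\<Prod>V\<in>S. Poly_Mapping.lookup (P V) (Poly_Mapping.lookup (m - ?a) V))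
        = (\<Prod>V\<in>S. Poly_Mapping.lookup (P V) (Poly_Mapping.lookup m V))"
      using insert by (intro prod.cong refl) (auto simp: am(2))
    ultimately show ?thesis
      using insert by (auto simp: insert.IH mcoef_embed)
  qed
  finally show ?case using insert by simp
qed

section \<open>The generic alphabet of a family\<close>

definition variables :: "'r family \<Rightarrow> ('r \<times> nat) set" where
  "variables \<alpha> = {(U, i). U \<in> Poly_Mapping.keys \<alpha> \<and> i < size (entry \<alpha> U)}"

lemma finite_variables: "finite (variables \<alpha>)"
proof -
  have "variables \<alpha> = Sigma (Poly_Mapping.keys \<alpha>) (\<lambda>U. {..<size (entry \<alpha> U)})"
    by (auto simp: variables_def)
  then show ?thesis by simp
qed

definition var_list :: "'r family \<Rightarrow> ('r \<times> nat) list" where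
  "var_list \<alpha> = (SOME vs. set vs = variables \<alpha> \<and> distinct vs)"

lemma var_list: "set (var_list \<alpha>) = variables \<alpha>" "distinct (var_list \<alpha>)"
  using someI_ex[OF finite_distinct_list[OF finite_variables[of \<alpha>]]] by (simp_all add: var_list_def)

text \<open>The dominant monomial of \<alpha>: over each U there are as many variables as
  \<alpha>(U) has parts, with the parts as exponents.\<close>

definition mexp :: "'r family \<Rightarrow> 'r monom" where
  "mexp \<alpha> = (\<Sum>v\<leftarrow>var_list \<alpha>. vpow v (rows (entry \<alpha> (fst v)) (snd v)))"

lemma lookup_mexp: "Poly_Mapping.lookup (mexp \<alpha>) U = rowexp (entry \<alpha> U)"
proof (rule poly_mapping_eqI)
  fix i
  have "vexp (U, i) (\<Sum>v\<leftarrow>vs. vpow v (f v)) = (if (U, i) \<in> set vs then f (U, i) else 0)"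
    if "distinct vs" for vs and f :: "'a \<times> nat \<Rightarrow> nat"
    using that by (induction vs) (auto simp: vexp_add vexp_vpow)
  from this[OF var_list(2)[of \<alpha>], of "\<lambda>v. rows (entry \<alpha> (fst v)) (snd v)"]
  have "vexp (U, i) (mexp \<alpha>) = (if (U, i) \<in> variables \<alpha> then rows (entry \<alpha> U) i else 0)"
    by (simp add: mexp_def var_list)
  also have "\<dots> = rows (entry \<alpha> U) i"
    by (auto simp: variables_def rows_def in_keys_iff)
  finally show "Poly_Mapping.lookup (Poly_Mapping.lookup (mexp \<alpha>) U) i = Poly_Mapping.lookup (rowexp (entry \<alpha> U)) i"
    by (simp add: vexp_def)
qed

lemma rowexp_eq_0: "is_partition \<kappa> \<Longrightarrow> rowexp \<kappa> = 0 \<longleftrightarrow> \<kappa> = {#}"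
  by (metis deg_rowexp deg_zero sum_eq_0_partition lookup_rowexp rowexp_inj is_partition_empty sum_mset.empty deg_eq_0)

lemma keys_mexp:
  assumes "\<alpha> \<in> partition_families I"
  shows "Poly_Mapping.keys (mexp \<alpha>) = Poly_Mapping.keys \<alpha>"
proof -
  have "rowexp (entry \<alpha> U) = 0 \<longleftrightarrow> entry \<alpha> U = {#}" for U
    by (rule rowexp_eq_0[OF family_partition[OF assms]])
  then show ?thesis by (simp add: set_eq_iff in_keys_iff lookup_mexp)
qed

lemma deg_mexp: "\<alpha> \<in> partition_families I \<Longrightarrow> deg (mexp \<alpha>) = weight \<alpha>"
  by (simp add: deg_poly_mapping_def[of "mexp \<alpha>"] keys_mexp lookup_mexp weight_def deg_rowexp family_partition)

definition pos_letter :: "'r \<times> nat \<Rightarrow> 'r \<times> int \<times> ('r monom, rat) mseries" where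
  "pos_letter v = (fst v, 1, vser v)"

lemma good_pos: "fst ` set vs \<subseteq> I \<Longrightarrow> good I (map pos_letter vs)"
  by (auto simp: good_def pos_letter_def no_const_vser) (simp add: vser_def int_series_mono)

lemma alph_letters: "distinct vs \<Longrightarrow> alph (map (\<lambda>v. (fst v, c, y v)) vs) U n
    = (\<Sum>v | v \<in> set vs \<and> fst v = U. of_int c *\<^sub>Q y v ^ n)"
proof (induction vs)
  case (Cons v vs)
  have "{w. w \<in> set (v # vs) \<and> fst w = U}
      = (if fst v = U then insert v {w. w \<in> set vs \<and> fst w = U} else {w. w \<in> set vs \<and> fst w = U})"
    by auto
  then show ?case using Cons by (simp add: alph_Cons)
qed simp

lemma alph_pos:
  "alph (map pos_letter (var_list \<alpha>)) U n = (\<Sum>i<size (entry \<alpha> U). vser (U, i) ^ n)"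
proof -
  have "{v. v \<in> set (var_list \<alpha>) \<and> fst v = U} = Pair U ` {..<size (entry \<alpha> U)}"
    by (auto simp: var_list variables_def in_keys_iff image_iff)
  then show ?thesis
    using alph_letters[OF var_list(2)[of \<alpha>], of 1 vser U n]
    by (simp add: pos_letter_def[abs_def] qscale_one sum.reindex inj_on_def)
qed

lemma mcoef_feval_pos:
  assumes \<mu>: "\<mu> \<in> partition_families I" and \<alpha>: "\<alpha> \<in> partition_families I"
  shows "mcoef (feval (map pos_letter (var_list \<alpha>)) \<mu>) (mexp \<alpha>) = fprod pcoeff \<mu> \<alpha>"
proof -
  let ?S = "Poly_Mapping.keys \<mu> \<union> Poly_Mapping.keys \<alpha>" and ?L = "map pos_letter (var_list \<alpha>)"
  have "(\<Prod>n\<in>#entry \<mu> U. if n = 0 then 0 else alph ?L U n) = embed U (power_sum (entry \<mu> U) (size (entry \<alpha> U)))" for U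
  proof -
    have "0 \<notin># entry \<mu> U" using family_partition[OF \<mu>] by (simp add: is_partition_def)
    then have "image_mset (\<lambda>n. if n = 0 then 0 else alph ?L U n) (entry \<mu> U) = image_mset (alph ?L U) (entry \<mu> U)"
      by (intro image_mset_cong) (metis)
    moreover have "alph ?L U = (\<lambda>n. \<Sum>i<size (entry \<alpha> U). vser (U, i) ^ n)"
      by (rule ext) (rule alph_pos)
    ultimately show ?thesis by (simp only: embed_power_sum)
  qed
  then have "feval ?L \<mu> = (\<Prod>U\<in>?S. embed U (power_sum (entry \<mu> U) (size (entry \<alpha> U))))"
    by (subst feval_superset[of ?S]) auto
  then show ?thesis
    using keys_mexp[OF \<alpha>] by (simp add: mcoef_prod_embed lookup_mexp fprod_def pcoeff_def)
qed

lemma fst_variables: "\<alpha> \<in> partition_families I \<Longrightarrow> fst ` set (var_list \<alpha>) \<subseteq> I"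
  using family_keys[of \<alpha> I] by (auto simp: var_list variables_def)

lemma Ev_pos:
  assumes \<alpha>: "\<alpha> \<in> partition_families I"
  shows "Ev (map pos_letter (var_list \<alpha>)) \<omega> (mexp \<alpha>) = Hcoef I \<omega> \<alpha>"
proof -
  let ?L = "map pos_letter (var_list \<alpha>)"
  have L: "good I ?L" using fst_variables[OF \<alpha>] by (rule good_pos)
  have "{\<mu>. mcoef (feval ?L \<mu>) (mexp \<alpha>) \<noteq> 0} = {\<mu> \<in> partition_families I. fprod pcoeff \<mu> \<alpha> \<noteq> 0}"
    using feval_nonzero(1)[OF L] mcoef_feval_pos[OF _ \<alpha>] by (metis (mono_tags, lifting))
  then have "Ev ?L \<omega> (mexp \<alpha>) = (\<Sum>\<mu> | \<mu> \<in> partition_families I \<and> fprod pcoeff \<mu> \<alpha> \<noteq> 0. fprod pcoeff \<mu> \<alpha> *\<^sub>Q \<omega> \<mu>)"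
    unfolding Ev_def by (intro sum.cong) (auto simp: mcoef_feval_pos[OF _ \<alpha>])
  then show ?thesis by (simp add: Hcoef_def sum_row[OF graded_pcoeff \<alpha>])
qed

text \<open>The involution of the ring of symmetric functions with \<open>p\<^sub>n \<mapsto> (- 1)\<^bsup>n-1\<^esup> p\<^sub>n\<close>.\<close>

definition twist :: "'r family \<Rightarrow> rat" where
  "twist \<mu> = (\<Prod>U\<in>Poly_Mapping.keys \<mu>. \<Prod>n\<in>#entry \<mu> U. - ((- 1) ^ n))"

lemma twist_square: "twist \<mu> * twist \<mu> = 1"
proof -
  have "(\<Prod>n\<in>#M. - ((- 1) ^ n) :: rat) * (\<Prod>n\<in>#M. - ((- 1) ^ n)) = 1" for M
    by (simp flip: prod_mset.distrib power_add)
  then show ?thesis by (simp add: twist_def flip: prod.distrib)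
qed

lemma twist_nonzero: "twist \<mu> \<noteq> 0"
  using twist_square[of \<mu>] by auto

lemma feval_neg:
  "feval (map neg_letter (var_list \<alpha>)) \<mu> = twist \<mu> *\<^sub>Q feval (map pos_letter (var_list \<alpha>)) \<mu>"
proof -
  let ?L = "map neg_letter (var_list \<alpha>)" and ?P = "map pos_letter (var_list \<alpha>)"
  have pow: "of_int (- 1) *\<^sub>Q (- vser v) ^ n = (- ((- 1) ^ n)) *\<^sub>Q (of_int 1 *\<^sub>Q vser v ^ n)" for v :: "'a \<times> nat" and n
    by (cases "even n") (simp_all add: qscale_one)
  have alph: "alph ?L U n = (- ((- 1) ^ n)) *\<^sub>Q alph ?P U n" for U n
    using alph_letters[OF var_list(2)[of \<alpha>], of "- 1" "\<lambda>v. - vser v" U n]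
      alph_letters[OF var_list(2)[of \<alpha>], of 1 vser U n]
    unfolding neg_letter_def[abs_def] pos_letter_def[abs_def]
    by (simp only: pow qs.scale_sum_right)
  have "(\<Prod>n\<in>#M. if n = 0 then 0 else alph ?L U n)
      = (\<Prod>n\<in>#M. - ((- 1) ^ n)) *\<^sub>Q (\<Prod>n\<in>#M. if n = 0 then 0 else alph ?P U n)" for M U
    by (induction M) (simp_all add: alph qscale_one qscale_mult_left qscale_mult_right qscale_qscale mult.commute)
  then show ?thesis by (simp only: feval_def twist_def prod_qscale)
qed

text \<open>Passing to negative letters multiplies p_n by (-1)^(n-1); the sign can be moved to the
  coefficients \<omega>.\<close>

lemma Ev_neg:
  "Ev (map neg_letter (var_list \<alpha>)) \<omega> m = Ev (map pos_letter (var_list \<alpha>)) (\<lambda>\<mu>. twist \<mu> *\<^sub>Q \<omega> \<mu>) m"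
  unfolding Ev_def
  by (rule sum.cong) (auto simp: feval_neg qscale_rat_def twist_nonzero qscale_qscale mult.commute)


subsection \<open>Generation\<close>

lemma is_subring_hull: "is_subring (is_subring hull S)"
  by (rule hull_in) (auto simp: is_subring_def)

lemma subring_closed:
  assumes "is_subring J"
  shows "zsubgroup J" "1 \<in> J" "x \<in> J \<Longrightarrow> y \<in> J \<Longrightarrow> x * y \<in> J"
    "(\<And>x. x \<in> set xs \<Longrightarrow> x \<in> J) \<Longrightarrow> prod_list xs \<in> J"
proof -
  show 1: "1 \<in> J" and mult: "x \<in> J \<Longrightarrow> y \<in> J \<Longrightarrow> x * y \<in> J" for x y
    using assms by (auto simp: is_subring_def)
  have "1 - 1 \<in> J" using assms 1 unfolding is_subring_def by blast
  then show "zsubgroup J" using assms by (auto simp: zsubgroup_def is_subring_def)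
  show "(\<And>x. x \<in> set xs \<Longrightarrow> x \<in> J) \<Longrightarrow> prod_list xs \<in> J"
    by (induction xs) (auto intro: 1 mult)
qed

lemma zscale_eq: "zscale n x = of_int n *\<^sub>Q (x :: 'v::rat_algebra)"
  by (induction n rule: int_induct[where k = 0])
    (simp_all add: zscale_0 zscale_add1 zscale_diff1 qscale_add_left qs.scale_left_diff_distrib qscale_one)

lemma zsubgroup_span: "zsubgroup (zmod.span S)"
  by (auto simp: zsubgroup_def zmod.span_zero zmod.span_diff)

lemma zsubgroup_subspace: "zsubgroup L \<Longrightarrow> zmod.subspace (L :: 'v::rat_algebra set)"
  by (auto simp: zmod.subspace_def zscale_eq zsubgroup_closed intro: zsubgroup_scale)

lemma Z_in_generated_subring:
  assumes I: "is_Z_basis (I :: 'r::{ring, monoid_mult} set)"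
    and J: "is_subring J" "\<And>r U. 0 < r \<Longrightarrow> U \<in> I \<Longrightarrow> e_elt I r U \<in> J"
    and \<nu>: "\<nu> \<in> partition_families I"
  shows "Z_elt I \<nu> \<in> J"
proof -
  let ?\<omega> = "generating_product I"
  let ?\<omega>' = "\<lambda>\<mu>. twist \<mu> *\<^sub>Q ?\<omega> \<mu>"
  obtain Z' where Z': "is_Z I ?\<omega>' Z'" using is_Z_exists by blast
  note Z = is_Z_Z_elt[of I] and sub = subring_closed(1)[OF J(1)]
  have "Z_elt I \<nu> \<in> J \<and> Z' \<nu> \<in> J" using \<nu>
  proof (induction "weight \<nu>" arbitrary: \<nu> rule: less_induct)
    case less
    \<comment> \<open>The product of the e_r(U) with r running through the parts of \<alpha> is a
      value at the negative letters together with letters of higher order; the latter are stripped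
      with the induction hypothesis.\<close>
    have neg: "Ev (map neg_letter (var_list \<alpha>)) ?\<omega> (mexp \<alpha>) \<in> J"
      if \<alpha>: "\<alpha> \<in> partition_families I" "weight \<alpha> = weight \<nu>" for \<alpha>
    proof -
      let ?r = "\<lambda>v. rows (entry \<alpha> (fst v)) (snd v)"
      have r: "0 < ?r v" if v: "v \<in> set (var_list \<alpha>)" for v
      proof -
        have "snd v \<in> {i. rows (entry \<alpha> (fst v)) i \<noteq> 0}"
          unfolding rows_support[OF family_partition[OF \<alpha>(1)]] using v by (auto simp: var_list variables_def)
        then show ?thesis by simp
      qed
      obtain L' where L': "good I L'" "higher L'"
        "prod_list (map (\<lambda>v. e_elt I (?r v) (fst v)) (var_list \<alpha>))
          = Ev (map neg_letter (var_list \<alpha>) @ L') ?\<omega> (mexp \<alpha>)"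
        using prod_e_eq_Ev[OF I var_list(2) fst_variables[OF \<alpha>(1)], of ?r] r unfolding mexp_def by blast
      have "prod_list (map (\<lambda>v. e_elt I (?r v) (fst v)) (var_list \<alpha>)) \<in> J"
        using r fst_variables[OF \<alpha>(1)] by (intro subring_closed(4)[OF J(1)]) (auto intro!: J(2))
      then have "Ev (map neg_letter (var_list \<alpha>) @ L') ?\<omega> (mexp \<alpha>) \<in> J" by (simp only: L'(3))
      then show ?thesis
        using less.hyps by (intro Ev_higher[OF good_neg[OF fst_variables[OF \<alpha>(1)]] L'(1,2) Z sub])
          (auto simp: deg_mexp[OF \<alpha>(1)] \<alpha>(2))
    qed
    \<comment> \<open>The values just obtained are the dominant coefficients of the twisted product,
      so inverting the Kostka matrix yields all Z' of this weight.\<close>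
    have "Hcoef I ?\<omega>' \<alpha> \<in> J" if "\<alpha> \<in> partition_families I" "weight \<alpha> = weight \<nu>" for \<alpha>
      using neg[OF that] by (simp add: Ev_neg Ev_pos[OF that(1)])
    then have Z'J: "Z' \<kappa> \<in> J" if "\<kappa> \<in> partition_families I" "weight \<kappa> = weight \<nu>" for \<kappa>
      using that by (intro is_Z_integral[OF Z' sub]) auto
    \<comment> \<open>The twist squares to 1, so the dominant coefficients of the original product
      are values of the twisted one at negative letters, hence integral combinations of Z' of weight
      at most the current one.\<close>
    have "Hcoef I ?\<omega> \<alpha> \<in> J" if \<alpha>: "\<alpha> \<in> partition_families I" "weight \<alpha> = weight \<nu>" for \<alpha>
    proof -
      have "Ev (map neg_letter (var_list \<alpha>)) ?\<omega>' (mexp \<alpha>) \<in> J"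
      proof (rule Ev_in_subgroup[OF good_neg[OF fst_variables[OF \<alpha>(1)]] Z' sub])
        fix \<kappa> assume "\<kappa> \<in> partition_families I" "weight \<kappa> \<le> deg (mexp \<alpha>)"
        then show "Z' \<kappa> \<in> J"
          using less.hyps[of \<kappa>] Z'J[of \<kappa>] by (cases "weight \<kappa> = weight \<nu>") (auto simp: deg_mexp[OF \<alpha>(1)] \<alpha>(2))
      qed
      then show ?thesis
        by (simp add: Ev_neg Ev_pos[OF \<alpha>(1)] qscale_qscale twist_square qscale_one)
    qed
    then have "Z_elt I \<nu> \<in> J" using less.prems by (intro is_Z_integral[OF Z sub])
    then show ?case using Z'J[OF less.prems] by simp
  qed
  then show ?thesis ..
qed

lemma prod_e_in_G_inf_Z:
  assumes I: "is_Z_basis (I :: 'r::{ring, monoid_mult} set)"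
    and es: "set es \<subseteq> {e_elt I r U | r U. 0 < r \<and> U \<in> I}"
  shows "prod_list es \<in> G_inf_Z I"
proof -
  have "\<forall>x\<in>set es. \<exists>p. x = e_elt I (fst p) (snd p) \<and> 0 < fst p \<and> snd p \<in> I"
    using es by (force simp: subset_iff)
  then obtain p where p: "\<And>x. x \<in> set es \<Longrightarrow> x = e_elt I (fst (p x)) (snd (p x)) \<and> 0 < fst (p x) \<and> snd (p x) \<in> I"
    by metis
  \<comment> \<open>Positions in the list tag the variables, so that repeated factors still get
    different variables.\<close>
  let ?vs = "map (\<lambda>i. (snd (p (es ! i)), i)) [0..<length es]" and ?r = "\<lambda>v. fst (p (es ! snd v))"
  have "distinct ?vs" by (auto simp: distinct_map inj_on_def)
  moreover have vsI: "fst ` set ?vs \<subseteq> I" and "\<And>v. v \<in> set ?vs \<Longrightarrow> 0 < ?r v" using p by (auto simp: nth_mem)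
  ultimately obtain L' where L': "good I L'"
    "prod_list (map (\<lambda>v. e_elt I (?r v) (fst v)) ?vs)
      = Ev (map neg_letter ?vs @ L') (generating_product I) (\<Sum>v\<leftarrow>?vs. vpow v (?r v))"
    using prod_e_eq_Ev[OF I, of ?vs ?r] by blast
  have es_eq: "map (\<lambda>v. e_elt I (?r v) (fst v)) ?vs = es"
    using p by (intro nth_equalityI) (auto simp flip: p)
  have "good I (map neg_letter ?vs @ L')" using L'(1) good_neg[OF vsI] by (simp only: good_append)
  then have "Ev (map neg_letter ?vs @ L') (generating_product I) (\<Sum>v\<leftarrow>?vs. vpow v (?r v)) \<in> G_inf_Z I"
    unfolding G_inf_Z_def by (rule Ev_in_subgroup[OF _ is_Z_Z_elt zsubgroup_span]) (auto intro: zmod.span_base)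
  then show ?thesis using L'(2) unfolding es_eq by simp
qed

text \<open>Concatenation makes the products of elements of E closed under multiplication, and
  multiplication is biadditive, so their integral span is a subring containing E.\<close>

lemma subring_hull_subset_span:
  "is_subring hull E \<subseteq> zmod.span {prod_list es | es. set es \<subseteq> (E :: 'v::rat_algebra set)}" (is "_ \<subseteq> ?P")
proof (rule hull_minimal)
  let ?B = "{prod_list es | es. set es \<subseteq> E}"
  show "E \<subseteq> ?P"
  proof
    fix x assume "x \<in> E"
    then have "prod_list [x] \<in> ?B" by (intro CollectI exI[of _ "[x]"]) auto
    then show "x \<in> ?P" by (simp add: zmod.span_base)
  qed
  have 1: "(1 :: 'v) \<in> ?P" by (rule zmod.span_base) (auto intro!: exI[of _ "[]"])
  have sub: "zmod.subspace {x. x * y \<in> ?P}" "zmod.subspace {x. y * x \<in> ?P}" for y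
    by (auto simp: zmod.subspace_def zscale_eq distrib_left distrib_right qscale_mult_left qscale_mult_right
        zmod.span_zero zmod.span_add intro: zsubgroup_scale[OF zsubgroup_span])
  have "x * y \<in> ?P" if "x \<in> ?P" "y \<in> ?P" for x y
  proof -
    show ?thesis
    proof (rule zmod.span_induct[where P = "\<lambda>x. x * y \<in> ?P", OF that(1) sub(1)])
      fix b assume "b \<in> ?B"
      then obtain es where es: "b = prod_list es" "set es \<subseteq> E" by blast
      show "b * y \<in> ?P"
      proof (rule zmod.span_induct[where P = "\<lambda>y. b * y \<in> ?P", OF that(2) sub(2)])
        fix c assume "c \<in> ?B"
        then obtain fs where fs: "c = prod_list fs" "set fs \<subseteq> E" by blast
        have "b * c \<in> ?B" using es fs by (intro CollectI exI[of _ "es @ fs"]) auto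
        then show "b * c \<in> ?P" by (rule zmod.span_base)
      qed
    qed
  qed
  then show "is_subring ?P" using 1 by (auto simp: is_subring_def zmod.span_diff)
qed

theorem proposition4p19:
  fixes I :: "'r::{ring, monoid_mult} set"
  assumes "is_Z_basis I"
  shows "is_subring hull {e_elt I r U | r U. 0 < r \<and> U \<in> I} = G_inf_Z I"
proof
  let ?E = "{e_elt I r U | r U. 0 < r \<and> U \<in> I}"
  have "zmod.span {prod_list es | es. set es \<subseteq> ?E} \<subseteq> G_inf_Z I"
  proof (rule zmod.span_minimal)
    show "{prod_list es | es. set es \<subseteq> ?E} \<subseteq> G_inf_Z I"
      using prod_e_in_G_inf_Z[OF assms] by blast
    show "zmod.subspace (G_inf_Z I)"
      unfolding G_inf_Z_def by (rule zmod.subspace_span)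
  qed
  then show "is_subring hull ?E \<subseteq> G_inf_Z I"
    using subring_hull_subset_span[of ?E] by (rule order_trans[rotated])
  have "Z_elt I ` partition_families I \<subseteq> is_subring hull ?E"
    by (rule image_subsetI, rule Z_in_generated_subring[OF assms is_subring_hull])
      (auto intro!: hull_inc)
  then show "G_inf_Z I \<subseteq> is_subring hull ?E"
    unfolding G_inf_Z_def
    by (rule zmod.span_minimal[OF _ zsubgroup_subspace[OF subring_closed(1)[OF is_subring_hull]]])
qed

end
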